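(* Let $X_t$ be a Lévy process in $\mathbb{R}^d$ whose Lévy measure is absolutely continuous with respect to Lebesgue measure, and let $X_t^*$ be its symmetrization. Assume further that for all $t>0$ the distributions of $X_t$ and $X_t^*$ are absolutely continuous with respect to Lebesgue measure, that is, for all $t>0$, $P^x\{X_t\in A\}=\int_A p(t,x,y)\,dy$ and $P^x\{X_t^*\in A\}=\int_A p^*(t,x,y)\,dy$ for any Borel set $A\subset\mathbb{R}^d$. Let $f_1,\ldots,f_m$, $m\ge1$, be nonnegative measurable functions on $\mathbb{R}^d$. Then for all $z\in\mathbb{R}^d$, $$E^{z}\left[\prod_{i=1}^{m} f_i(X_{t_i})\right]\le E^{0}\left[\prod_{i=1}^{m} f_i^*(X^*_{t_i})\right]$$ for all $0\le t_1\le\cdots\le t_m$.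
   Context: For a nonnegative measurable function $f$ on $\mathbb{R}^d$, the symmetric decreasing rearrangement $f^*$ is the unique function with $f^*(x)=f^*(y)$ if $|x|=|y|$, $f^*(x)\le f^*(y)$ if $|x|\ge|y|$, $\lim_{|x|\to|y|^+}f^*(x)=f^*(y)$, and $m\{f>t\}=m\{f^*>t\}$ for all $t\ge0$, where $m\{\cdot\}$ denotes Lebesgue measure. A Lévy process $X_t$ (stationary independent increments, stochastically continuous, càdlàg paths) has a characteristic triple $(b,\mathbb{A},\nu)$, with $b\in\mathbb{R}^d$, $\mathbb{A}$ a symmetric nonnegative definite $d\times d$ matrix, and $\nu$ (the Lévy measure) a measure with $\nu(\{0\})=0$ and $\int_{\mathbb{R}^d}\frac{|y|^2}{1+|y|^2}\,d\nu(y)<\infty$, such that $E^x[e^{i\xi\cdot X_t}]=e^{-t\Psi(\xi)+i\xi\cdot x}$, where $$\Psi(\xi)=-i\langle b,\xi\rangle+\tfrac12\langle\mathbb{A}\xi,\xi\rangle+\int_{\mathbb{R}^d}\left[1+i\langle\xi,y\rangle\mathbb{I}_B(y)-e^{i\xi\cdot y}\right]d\nu(y),$$ and $\mathbb{I}_B$ is the indicator of the unit ball $B$ centered at the origin. $P^x,E^x$ refer to the process started at $x$. If $\nu$ has density $\phi$, the symmetrization $X_t^*$ of $X_t$ is the Lévy process with characteristic triple $(0,\mathbb{A}^*,\phi^*(y)\,dy)$, where $\mathbb{A}^*=(\det\mathbb{A})^{1/d}I_d$, $I_d$ is the $d\times d$ identity matrix, and $\phi^*$ is the symmetric decreasing rearrangement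 of $\phi$.
   Formalization: When t_1 = 0 the claim fails (m = 1, f_1 the indicator of {z}: 1 ≤ 0). For times t_i = 0 it is proved for every z with f_i(z) ≤ f_i^*(0) for all such i, and for almost every z without any condition; for t_1 > 0 it is proved for all z as stated. *)

theory Defs
  imports "HOL-Probability.Probability"
begin

text \<open>Values are taken in \<^typ>\<open>ennreal\<close>: the value of the rearrangement at the origin is the
  essential supremum of the function, which may be infinite.\<close>

definition is_symm_decr_rearrangement ::
    "(real ^ 'n \<Rightarrow> ennreal) \<Rightarrow> (real ^ 'n \<Rightarrow> ennreal) \<Rightarrow> bool" where
  "is_symm_decr_rearrangement f g \<longleftrightarrow>
     (\<forall>x y. norm x = norm y \<longrightarrow> g x = g y) \<and>
     (\<forall>x y. norm y \<le> norm x \<longrightarrow> g x \<le> g y) \<and>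
     (\<forall>y. (g \<longlongrightarrow> g y) (filtercomap norm (at_right (norm y)))) \<and>
     (\<forall>t. emeasure lebesgue {x. t < f x} = emeasure lebesgue {x. t < g x})"

definition symm_decr_rearrangement ::
    "(real ^ 'n \<Rightarrow> ennreal) \<Rightarrow> real ^ 'n \<Rightarrow> ennreal" where
  "symm_decr_rearrangement f = (THE g. is_symm_decr_rearrangement f g)"

text \<open>A Levy process started at \<open>x\<close>; the time parameter is restricted to \<open>t \<ge> 0\<close>.\<close>

definition levy_process ::
    "'w measure \<Rightarrow> (real \<Rightarrow> 'w \<Rightarrow> real ^ 'n) \<Rightarrow> real ^ 'n \<Rightarrow> bool" where
  "levy_process M X x \<longleftrightarrow>
     prob_space M \<and>
     (\<forall>t\<ge>0. X t \<in> borel_measurable M) \<and>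
     (AE \<omega> in M. X 0 \<omega> = x) \<and>
     (\<forall>s\<ge>0. \<forall>t\<ge>0. distr M borel (\<lambda>\<omega>. X (s + t) \<omega> - X s \<omega>) = distr M borel (\<lambda>\<omega>. X t \<omega> - X 0 \<omega>)) \<and>
     (\<forall>n. \<forall>t :: nat \<Rightarrow> real. 0 \<le> t 0 \<and> (\<forall>i<n. t i \<le> t (Suc i)) \<longrightarrow>
        prob_space.indep_vars M (\<lambda>_. borel) (\<lambda>i \<omega>. X (t (Suc i)) \<omega> - X (t i) \<omega>) {..<n}) \<and>
     (\<forall>s\<ge>0. \<forall>\<epsilon>>0.
        ((\<lambda>t. measure M {\<omega> \<in> space M. \<epsilon> < dist (X t \<omega>) (X s \<omega>)}) \<longlongrightarrow> 0) (at s within {0..})) \<and>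
     (AE \<omega> in M. \<forall>t\<ge>0. ((\<lambda>s. X s \<omega>) \<longlongrightarrow> X t \<omega>) (at_right t) \<and>
                        (0 < t \<longrightarrow> (\<exists>l. ((\<lambda>s. X s \<omega>) \<longlongrightarrow> l) (at_left t))))"

definition levy_triple ::
    "real ^ 'n \<Rightarrow> real ^ 'n ^ 'n \<Rightarrow> (real ^ 'n) measure \<Rightarrow> bool" where
  "levy_triple b A \<nu> \<longleftrightarrow>
     transpose A = A \<and> (\<forall>\<xi>. 0 \<le> (A *v \<xi>) \<bullet> \<xi>) \<and>
     sets \<nu> = sets borel \<and> emeasure \<nu> {0} = 0 \<and>
     (\<integral>\<^sup>+ y. ennreal ((norm y)\<^sup>2 / (1 + (norm y)\<^sup>2)) \<partial>\<nu>) < \<infinity>"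

definition levy_exponent ::
    "real ^ 'n \<Rightarrow> real ^ 'n ^ 'n \<Rightarrow> (real ^ 'n) measure \<Rightarrow> real ^ 'n \<Rightarrow> complex" where
  "levy_exponent b A \<nu> \<xi> =
     - \<i> * complex_of_real (b \<bullet> \<xi>) + complex_of_real ((A *v \<xi>) \<bullet> \<xi>) / 2 +
     (LINT y|\<nu>. 1 + \<i> * complex_of_real ((\<xi> \<bullet> y) * indicator (ball 0 1) y) - iexp (\<xi> \<bullet> y))"

text \<open>The family \<open>P x\<close> is the family of laws usually written with a superscript \<open>x\<close>: under \<open>P x\<close> the
  process \<open>X\<close> is a Levy process started at \<open>x\<close> with the given triple.\<close>

definition levy_process_with_triple ::
    "(real ^ 'n \<Rightarrow> 'w measure) \<Rightarrow> (real \<Rightarrow> 'w \<Rightarrow> real ^ 'n) \<Rightarrow>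
     real ^ 'n \<Rightarrow> real ^ 'n ^ 'n \<Rightarrow> (real ^ 'n) measure \<Rightarrow> bool" where
  "levy_process_with_triple P X b A \<nu> \<longleftrightarrow>
     levy_triple b A \<nu> \<and>
     (\<forall>x. levy_process (P x) X x \<and>
          (\<forall>t\<ge>0. \<forall>\<xi>. (LINT \<omega>|P x. iexp (\<xi> \<bullet> X t \<omega>)) =
             exp (- complex_of_real t * levy_exponent b A \<nu> \<xi> + \<i> * complex_of_real (\<xi> \<bullet> x))))"

definition symm_matrix :: "real ^ 'n ^ 'n \<Rightarrow> real ^ 'n ^ 'n" where
  "symm_matrix A = root CARD('n) (det A) *\<^sub>R mat 1"

text \<open>For \<open>\<nu>\<close> absolutely continuous, the Radon-Nikodym derivative is its density; the
  rearrangement depends on the density only up to null sets.\<close>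

definition symm_levy_measure :: "(real ^ 'n) measure \<Rightarrow> (real ^ 'n) measure" where
  "symm_levy_measure \<nu> = density lborel (symm_decr_rearrangement (RN_deriv lborel \<nu>))"

definition is_symmetrization ::
    "(real ^ 'n \<Rightarrow> 'v measure) \<Rightarrow> (real \<Rightarrow> 'v \<Rightarrow> real ^ 'n) \<Rightarrow>
     real ^ 'n ^ 'n \<Rightarrow> (real ^ 'n) measure \<Rightarrow> bool" where
  "is_symmetrization Q Y A \<nu> \<longleftrightarrow>
     levy_process_with_triple Q Y 0 (symm_matrix A) (symm_levy_measure \<nu>)"

end

theory Submission
  imports Defs
begin

text \<open>Call a law \<open>\<mu>\<close> dominated by \<open>\<rho>\<close> if replacing \<open>\<mu>\<close> by \<open>\<rho>\<close> and two sets by centred balls of the same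
  volume never decreases the expected overlap of one set with a random translate of the other; a
  function is dominated by another if this holds for its integrals over sets of finite volume. The
  Riesz rearrangement inequality (proved by Steiner symmetrization from the one-dimensional case) says
  that a density is dominated by its symmetric decreasing rearrangement. Domination is preserved by
  convolution and by products with rearranged functions, hence the expectation of the product, written
  as an iterated integral over independent increments, increases as soon as each increment of \<open>X\<close>
  has a law dominated by that of the increment of the symmetrized process. For compound Poisson
  increments this follows from convolution powers, for Gaussian ones because the rearranged density is
  the rotation invariant Gaussian density with the same covariance determinant, and the general case is a limit
  identified by characteristic functions: convolving with a small Gaussian makes the densities, and so
  the overlaps, converge. Times equal to zero only contribute constant factors.\<close>

subsection \<open>The Riesz inequality on the line\<close>

text \<open>Domination is phrased through overlaps with sets of finite volume, not through
  densities, because the laws met on the way have atoms: point masses carry the drift, and a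
  compound Poisson step may stay put with positive probability. An overlap is a bounded continuous
  function of the shift, so it also survives limits. The price is paid at the start: a single point
  z has no volume, so the first increment is treated through densities, and there absolute
  continuity of the symmetrized law is used. Every majorant is required to dominate itself, which
  says in the same language that it is symmetric decreasing; this is what lets convolutions and
  products be iterated. Null sets shape the final statement: a rearrangement ignores the value of
  \<open>f i\<close> at one point, while at time zero the left side contains exactly
  \<open>f i z\<close>. Hence the pointwise inequality asks that \<open>f i z\<close> be at most the
  value of the rearrangement at the origin, a bound valid for almost every z. Comparing volumes in
  \<open>symball\<close> gives the empty set for null sets and the whole space for infinite volume,
  with no radius to choose.\<close>

definition symball :: "'a::euclidean_space set \<Rightarrow> 'a set" where
  "symball A = {x. emeasure lborel (ball (0::'a) (norm x)) < emeasure lborel A}"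

text \<open>Evaluating \<open>C\<close> at x + y instead of a difference makes the functional
  invariant under moving the three sets by p, q and p + q. Up to a reflection of one set, which
  leaves centred balls alone, this is the usual Riesz functional.\<close>

definition riesz :: "'a::euclidean_space set \<Rightarrow> 'a set \<Rightarrow> 'a set \<Rightarrow> ennreal" where
  "riesz A B C = (\<integral>\<^sup>+x. \<integral>\<^sup>+y. indicator A x * indicator B y * indicator C (x + y) \<partial>lborel \<partial>lborel)"

section \<open>Invariance and elementary bounds\<close>

lemma nn_integral_translate:
  fixes h :: "'a::euclidean_space \<Rightarrow> ennreal"
  assumes "h \<in> borel_measurable borel"
  shows "(\<integral>\<^sup>+x. h (c + x) \<partial>lborel) = (\<integral>\<^sup>+x. h x \<partial>lborel)"
proof -
  have "(\<integral>\<^sup>+x. h x \<partial>lborel) = (\<integral>\<^sup>+x. h x \<partial>distr lborel borel ((+) c))"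
    by (simp add: lborel_distr_plus)
  also have "\<dots> = (\<integral>\<^sup>+x. h (c + x) \<partial>lborel)"
    using assms by (subst nn_integral_distr) auto
  finally show ?thesis by simp
qed

lemma nn_integral_reflect:
  fixes h :: "'a::euclidean_space \<Rightarrow> ennreal"
  assumes "h \<in> borel_measurable borel"
  shows "(\<integral>\<^sup>+x. h (- x) \<partial>lborel) = (\<integral>\<^sup>+x. h x \<partial>lborel)"
proof -
  have "(\<integral>\<^sup>+x. h x \<partial>lborel) = (\<integral>\<^sup>+x. h x \<partial>density (distr lborel borel (\<lambda>x. 0 + (-1) *\<^sub>R x)) (\<lambda>_. ennreal (\<bar>-1\<bar> ^ DIM('a))))"
    by (subst lborel_affine[of "-1" 0]) auto
  also have "\<dots> = (\<integral>\<^sup>+x. h (- x) \<partial>lborel)"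
    using assms by (subst nn_integral_density) (auto simp: nn_integral_distr)
  finally show ?thesis by simp
qed

lemma riesz_le:
  fixes A B C :: "'a::euclidean_space set"
  assumes "A \<in> sets borel" "B \<in> sets borel" "C \<in> sets borel"
  shows "riesz A B C \<le> emeasure lborel A * emeasure lborel B"
    and "riesz A B C \<le> emeasure lborel A * emeasure lborel C"
    and "riesz A B C \<le> emeasure lborel B * emeasure lborel C"
proof -
  note [measurable] = assms
  have "riesz A B C \<le> (\<integral>\<^sup>+x. \<integral>\<^sup>+y. indicator A x * indicator B y \<partial>lborel \<partial>lborel)"
    unfolding riesz_def by (intro nn_integral_mono) (auto simp: indicator_def)
  then show "riesz A B C \<le> emeasure lborel A * emeasure lborel B"
    by (simp add: nn_integral_cmult nn_integral_multc)
  have tr: "(\<integral>\<^sup>+y. indicator C (x + y) \<partial>lborel) = emeasure lborel C" for x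
    by (subst nn_integral_translate[where h="indicator C"]) auto
  have "riesz A B C \<le> (\<integral>\<^sup>+x. \<integral>\<^sup>+y. indicator A x * indicator C (x + y) \<partial>lborel \<partial>lborel)"
    unfolding riesz_def by (intro nn_integral_mono) (auto simp: indicator_def)
  then show "riesz A B C \<le> emeasure lborel A * emeasure lborel C"
    by (simp add: nn_integral_cmult nn_integral_multc tr)
  have "riesz A B C = (\<integral>\<^sup>+y. \<integral>\<^sup>+x. indicator A x * indicator B y * indicator C (x + y) \<partial>lborel \<partial>lborel)"
    unfolding riesz_def by (intro lborel_pair.Fubini') simp
  also have "\<dots> \<le> (\<integral>\<^sup>+y. \<integral>\<^sup>+x. indicator B y * indicator C (y + x) \<partial>lborel \<partial>lborel)"
    by (intro nn_integral_mono) (auto simp: indicator_def add.commute)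
  also have "\<dots> = emeasure lborel B * emeasure lborel C"
    by (simp add: nn_integral_cmult nn_integral_multc tr)
  finally show "riesz A B C \<le> emeasure lborel B * emeasure lborel C" .
qed

text \<open>The total is fixed by the volumes of \<open>A\<close> and \<open>B\<close>, so an upper
  bound for \<open>C\<close> amounts to a lower bound for its complement; the proof on the line
  works on the complement side.\<close>

lemma riesz_split:
  fixes A B C :: "'a::euclidean_space set"
  assumes "A \<in> sets borel" "B \<in> sets borel" "C \<in> sets borel"
  shows "riesz A B C + riesz A B (- C) = emeasure lborel A * emeasure lborel B"
proof -
  note [measurable] = assms
  have "riesz A B C + riesz A B (- C) = (\<integral>\<^sup>+x. (\<integral>\<^sup>+y. indicator A x * indicator B y * indicator C (x + y) \<partial>lborel)
     + (\<integral>\<^sup>+y. indicator A x * indicator B y * indicator (- C) (x + y) \<partial>lborel) \<partial>lborel)"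
    unfolding riesz_def by (subst nn_integral_add) auto
  also have "\<dots> = (\<integral>\<^sup>+x. \<integral>\<^sup>+y. indicator A x * indicator B y \<partial>lborel \<partial>lborel)"
    by (intro nn_integral_cong, subst nn_integral_add[symmetric])
       (auto simp: indicator_def intro!: nn_integral_cong)
  finally show ?thesis by (simp add: nn_integral_cmult nn_integral_multc)
qed

text \<open>\<alpha> is the quantile function of the uniform distribution on \<open>A\<close>,
  rescaled from (0, 1) to (0, a). It carries Lebesgue measure on the interval to Lebesgue measure on
  \<open>A\<close> and respects the order of the line, which is all that the hook argument
  needs.\<close>

lemma exists_quantile:
  fixes A :: "real set"
  assumes A[measurable]: "A \<in> sets borel" and m: "emeasure lborel A = ennreal a" and a: "0 < a"
  obtains \<alpha> :: "real \<Rightarrow> real" where "\<alpha> \<in> borel_measurable borel" "mono_on {0<..<a} \<alpha>"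
    "\<And>h. h \<in> borel_measurable borel \<Longrightarrow>
       (\<integral>\<^sup>+x. indicator A x * h x \<partial>lborel) = (\<integral>\<^sup>+i. indicator {0<..<a} i * h (\<alpha> i) \<partial>lborel)"
proof -
  define M where "M = uniform_measure lborel A"
  interpret prob_space M unfolding M_def
    using m a by (intro prob_space_uniform_measure) auto
  interpret cdf_distribution M
    by unfold_locales (auto simp: M_def)
  \<comment> \<open>Outside the levels 0 is a default; the integral identity contains the indicator
    of (0, a) and never sees it.\<close>
  define \<alpha> where "\<alpha> i = (if i \<in> {0<..<a} then I (i / a) else 0)" for i
  have mono: "mono_on {0<..<a} \<alpha>"
    using a by (auto simp: mono_on_def \<alpha>_def intro!: mono_onD[OF mono_I] divide_right_mono)
  have [measurable]: "\<alpha> \<in> borel_measurable borel"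
  proof -
    have "(\<lambda>i. I (i / a)) \<in> borel_measurable (restrict_space borel {0<..<a})"
      by (intro borel_measurable_mono_on_fnc) (use mono in \<open>auto simp: mono_on_def \<alpha>_def\<close>)
    then have "(\<lambda>i. if i \<in> {0<..<a} then I (i / a) else 0) \<in> borel_measurable borel"
      by (subst (asm) measurable_restrict_space_iff[where c=0]) auto
    moreover have "\<alpha> = (\<lambda>i. if i \<in> {0<..<a} then I (i / a) else 0)"
      by (simp add: \<alpha>_def fun_eq_iff)
    ultimately show ?thesis by simp
  qed
  show thesis
  proof (rule that[of \<alpha>])
    fix h :: "real \<Rightarrow> ennreal" assume h[measurable]: "h \<in> borel_measurable borel"
    have "(\<integral>\<^sup>+i. indicator {0<..<a} i * h (\<alpha> i) \<partial>lborel) =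
       ennreal a * (\<integral>\<^sup>+i. indicator {0<..<a} (0 + a * i) * h (\<alpha> (0 + a * i)) \<partial>lborel)"
      using a by (subst nn_integral_real_affine[where c=a and t=0]) auto
    also have "(\<integral>\<^sup>+i. indicator {0<..<a} (0 + a * i) * h (\<alpha> (0 + a * i)) \<partial>lborel) =
        (\<integral>\<^sup>+i. h (I i) * indicator {0<..<1} i \<partial>lborel)"
      using a by (intro nn_integral_cong) (auto simp: indicator_def \<alpha>_def zero_less_mult_iff)
    also have "\<dots> = (\<integral>\<^sup>+i. h (I i) \<partial>restrict_space lborel {0<..<1})"
      by (subst nn_integral_restrict_space) auto
    also have "\<dots> = (\<integral>\<^sup>+i. h i \<partial>distr (restrict_space lborel {0<..<1}) borel I)"
    proof (subst nn_integral_distr)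
      show "I \<in> restrict_space lborel {0<..<1} \<rightarrow>\<^sub>M borel"
        using measurable_CI by (simp add: measurable_def sets_restrict_space space_restrict_space)
    qed auto
    also have "\<dots> = (\<integral>\<^sup>+i. h i \<partial>M)" by (simp only: distr_I_eq_M)
    also have "\<dots> = (\<integral>\<^sup>+x. h x * indicator A x \<partial>lborel) / ennreal a"
      unfolding M_def by (subst nn_integral_uniform_measure) (auto simp: m)
    also have "ennreal a * \<dots> = (\<integral>\<^sup>+x. indicator A x * h x \<partial>lborel)"
      using a by (simp add: ennreal_times_divide mult.commute[of "ennreal a"] mult_divide_eq_ennreal mult.commute[of "indicator A _"])
    finally show "(\<integral>\<^sup>+x. indicator A x * h x \<partial>lborel) = (\<integral>\<^sup>+i. indicator {0<..<a} i * h (\<alpha> i) \<partial>lborel)"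
      by simp
  qed (use mono in auto)
qed

text \<open>By monotonicity the levels below u are sent below \<alpha> u and those above u are sent
  above it. What lands in \<open>C\<close> is thus bounded by the part of \<open>C\<close> on one
  side of a cut.\<close>

lemma quantile_lower_part:
  fixes \<alpha> :: "real \<Rightarrow> real"
  assumes [measurable]: "\<alpha> \<in> borel_measurable borel" "A \<in> sets borel" "C \<in> sets borel"
    and mono: "mono_on {0<..<a} \<alpha>"
    and h: "\<And>h. h \<in> borel_measurable borel \<Longrightarrow>
       (\<integral>\<^sup>+x. indicator A x * h x \<partial>lborel) = (\<integral>\<^sup>+i. indicator {0<..<a} i * h (\<alpha> i) \<partial>lborel)"
    and u: "0 < u" "u < a"
  shows "(\<integral>\<^sup>+i. indicator {0<..<u} i * indicator C (\<alpha> i + y) \<partial>lborel) \<le> emeasure lborel (C \<inter> {..\<alpha> u + y})"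
    and "(\<integral>\<^sup>+i. indicator {u<..<a} i * indicator C (y + \<alpha> i) \<partial>lborel) \<le> emeasure lborel (C \<inter> {\<alpha> u + y..})"
proof -
  have "(\<integral>\<^sup>+i. indicator {0<..<u} i * indicator C (\<alpha> i + y) \<partial>lborel)
     \<le> (\<integral>\<^sup>+i. indicator {0<..<a} i * indicator (C \<inter> {..\<alpha> u + y}) (\<alpha> i + y) \<partial>lborel)"
    using u mono by (intro nn_integral_mono) (auto simp: indicator_def mono_on_def)
  also have "\<dots> = (\<integral>\<^sup>+x. indicator A x * indicator (C \<inter> {..\<alpha> u + y}) (x + y) \<partial>lborel)"
    by (subst h) auto
  also have "\<dots> \<le> (\<integral>\<^sup>+x. indicator (C \<inter> {..\<alpha> u + y}) (y + x) \<partial>lborel)"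
    by (intro nn_integral_mono) (auto simp: indicator_def add.commute)
  also have "\<dots> = emeasure lborel (C \<inter> {..\<alpha> u + y})"
    by (subst nn_integral_translate) auto
  finally show "(\<integral>\<^sup>+i. indicator {0<..<u} i * indicator C (\<alpha> i + y) \<partial>lborel) \<le> emeasure lborel (C \<inter> {..\<alpha> u + y})" .
  have "(\<integral>\<^sup>+i. indicator {u<..<a} i * indicator C (y + \<alpha> i) \<partial>lborel)
     \<le> (\<integral>\<^sup>+i. indicator {0<..<a} i * indicator (C \<inter> {\<alpha> u + y..}) (y + \<alpha> i) \<partial>lborel)"
    using u mono by (intro nn_integral_mono) (auto simp: indicator_def mono_on_def)
  also have "\<dots> = (\<integral>\<^sup>+x. indicator A x * indicator (C \<inter> {\<alpha> u + y..}) (y + x) \<partial>lborel)"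
    by (subst h) auto
  also have "\<dots> \<le> (\<integral>\<^sup>+x. indicator (C \<inter> {\<alpha> u + y..}) (y + x) \<partial>lborel)"
    by (intro nn_integral_mono) (auto simp: indicator_def)
  also have "\<dots> = emeasure lborel (C \<inter> {\<alpha> u + y..})"
    by (subst nn_integral_translate) auto
  finally show "(\<integral>\<^sup>+i. indicator {u<..<a} i * indicator C (y + \<alpha> i) \<partial>lborel) \<le> emeasure lborel (C \<inter> {\<alpha> u + y..})" .
qed

lemma nn_integral_affine_interval:
  fixes t k l :: real
  assumes "0 \<le> t" "0 \<le> l" "l * t \<le> k"
  shows "(\<integral>\<^sup>+s. indicator {0<..<t} s * ennreal (k - l * s) \<partial>lborel) = ennreal (k * t - l * t\<^sup>2 / 2)"
proof -
  have "(\<integral>\<^sup>+s. indicator {0<..<t} s * ennreal (k - l * s) \<partial>lborel) = (\<integral>\<^sup>+s. ennreal (k - l * s) * indicator {0..t} s \<partial>lborel)"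
    by (intro nn_integral_cong_AE, use AE_lborel_singleton[of 0] AE_lborel_singleton[of t] in eventually_elim)
       (auto simp: indicator_def)
  also have "\<dots> = ennreal ((k * t - l * t\<^sup>2 / 2) - (k * 0 - l * 0\<^sup>2 / 2))"
  proof (intro nn_integral_FTC_Icc)
    fix x assume x: "x \<in> {0..t}"
    show "((\<lambda>t. k * t - l * t\<^sup>2 / 2) has_real_derivative k - l * x) (at x)"
      by (auto intro!: derivative_eq_intros simp: field_simps)
    have "l * x \<le> l * t" using assms x by (intro mult_left_mono) auto
    then show "0 \<le> k - l * x" using assms by simp
  qed (use assms in auto)
  finally show ?thesis by simp
qed

text \<open>The square \<open>(0,a) \<times> (0,b)\<close> of quantile levels contains, for each \<open>s < t\<close>, the hook consisting
  of the points \<open>(i, s)\<close> with \<open>i < a - s\<close> and the points \<open>(a - s, j)\<close> with \<open>j > s\<close>. The sum of the two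
  quantiles is monotone along a hook, so at most measure \<open>c\<close> of each hook is mapped into \<open>C\<close>.\<close>

lemma riesz_complement_lower_bound:
  fixes A B C :: "real set"
  assumes [measurable]: "A \<in> sets borel" "B \<in> sets borel" "C \<in> sets borel"
    and a: "emeasure lborel A = ennreal a" and b: "emeasure lborel B = ennreal b"
    and c: "emeasure lborel C = ennreal c" "0 \<le> c"
    and t: "0 < t" "t \<le> a" "t \<le> b" "2 * t = a + b - c"
  shows "ennreal (t\<^sup>2) \<le> riesz A B (- C)"
proof -
  obtain \<alpha> where \<alpha>[measurable]: "\<alpha> \<in> borel_measurable borel" "mono_on {0<..<a} \<alpha>"
    "\<And>h. h \<in> borel_measurable borel \<Longrightarrow>
       (\<integral>\<^sup>+x. indicator A x * h x \<partial>lborel) = (\<integral>\<^sup>+i. indicator {0<..<a} i * h (\<alpha> i) \<partial>lborel)"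
    using exists_quantile[OF assms(1) a] t by auto
  obtain \<beta> where \<beta>[measurable]: "\<beta> \<in> borel_measurable borel" "mono_on {0<..<b} \<beta>"
    "\<And>h. h \<in> borel_measurable borel \<Longrightarrow>
       (\<integral>\<^sup>+x. indicator B x * h x \<partial>lborel) = (\<integral>\<^sup>+i. indicator {0<..<b} i * h (\<beta> i) \<partial>lborel)"
    using exists_quantile[OF assms(2) b] t by auto
  define g :: "real \<Rightarrow> real \<Rightarrow> ennreal" where "g i j = indicator (- C) (\<alpha> i + \<beta> j)" for i j
  have [measurable]: "case_prod g \<in> borel_measurable (borel \<Otimes>\<^sub>M borel)"
    unfolding g_def by measurable
  have [measurable]: "(\<lambda>p. g (f p) (h p)) \<in> borel_measurable M" if [measurable]: "f \<in> borel_measurable M" "h \<in> borel_measurable M" for f h and M :: "'z measure"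
    unfolding g_def by measurable
  have "riesz A B (- C) = (\<integral>\<^sup>+x. indicator A x * (\<integral>\<^sup>+y. indicator B y * indicator (- C) (x + y) \<partial>lborel) \<partial>lborel)"
    unfolding riesz_def by (auto simp: nn_integral_cmult[symmetric] mult.assoc intro!: nn_integral_cong)
  also have "\<dots> = (\<integral>\<^sup>+i. indicator {0<..<a} i * (\<integral>\<^sup>+y. indicator B y * indicator (- C) (\<alpha> i + y) \<partial>lborel) \<partial>lborel)"
    by (subst \<alpha>(3)) auto
  also have "\<dots> = (\<integral>\<^sup>+i. indicator {0<..<a} i * (\<integral>\<^sup>+j. indicator {0<..<b} j * g i j \<partial>lborel) \<partial>lborel)"
    by (subst \<beta>(3)) (auto simp: g_def)
  also have "\<dots> = (\<integral>\<^sup>+i. \<integral>\<^sup>+j. indicator {0<..<a} i * indicator {0<..<b} j * g i j \<partial>lborel \<partial>lborel)"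
    by (auto simp: nn_integral_cmult[symmetric] mult.assoc intro!: nn_integral_cong)
  finally have J: "riesz A B (- C) = \<dots>" .
  \<comment> \<open>\<open>g1\<close> gathers the horizontal arms of all hooks, \<open>g2\<close>
    the vertical ones. They do not meet, since i + j < a on the former and i + j > a on the latter.
    The substitution i = a - s below brings the two arms of one hook together.\<close>
  define g1 where "g1 i j = indicator {0<..<t} j * indicator {0<..<a - j} i * g i j" for i j
  define g2 where "g2 i j = indicator {a - t<..<a} i * indicator {a - i<..<b} j * g i j" for i j
  have [measurable]: "(\<lambda>p. g1 (f p) (h p)) \<in> borel_measurable M" "(\<lambda>p. g2 (f p) (h p)) \<in> borel_measurable M"
    if [measurable]: "f \<in> borel_measurable M" "h \<in> borel_measurable M" for f h and M :: "'z measure"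
    unfolding g1_def g2_def indicator_def greaterThanLessThan_iff by measurable
  have "(\<integral>\<^sup>+j. \<integral>\<^sup>+i. g1 i j \<partial>lborel \<partial>lborel) + (\<integral>\<^sup>+i. \<integral>\<^sup>+j. g2 i j \<partial>lborel \<partial>lborel)
     = (\<integral>\<^sup>+i. \<integral>\<^sup>+j. g1 i j \<partial>lborel \<partial>lborel) + (\<integral>\<^sup>+i. \<integral>\<^sup>+j. g2 i j \<partial>lborel \<partial>lborel)"
    by (subst lborel_pair.Fubini') auto
  also have "\<dots> = (\<integral>\<^sup>+i. \<integral>\<^sup>+j. g1 i j + g2 i j \<partial>lborel \<partial>lborel)"
    by (simp add: nn_integral_add)
  also have "\<dots> \<le> riesz A B (- C)" unfolding J
    using t by (intro nn_integral_mono) (auto simp: g1_def g2_def indicator_def)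
  finally have low: "(\<integral>\<^sup>+j. \<integral>\<^sup>+i. g1 i j \<partial>lborel \<partial>lborel) + (\<integral>\<^sup>+i. \<integral>\<^sup>+j. g2 i j \<partial>lborel \<partial>lborel) \<le> riesz A B (- C)" .
  have "(\<integral>\<^sup>+i. \<integral>\<^sup>+j. g2 i j \<partial>lborel \<partial>lborel) = (\<integral>\<^sup>+s. \<integral>\<^sup>+j. g2 (a + (-1) * s) j \<partial>lborel \<partial>lborel)"
    by (subst nn_integral_real_affine[where c="-1" and t=a]) auto
  then have low: "(\<integral>\<^sup>+s. ((\<integral>\<^sup>+i. g1 i s \<partial>lborel) + (\<integral>\<^sup>+j. g2 (a - s) j \<partial>lborel)) \<partial>lborel) \<le> riesz A B (- C)"
    using low by (subst nn_integral_add) auto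
  \<comment> \<open>The value y at the corner (a - s, s) cuts \<open>C\<close> into two halves, one
    for each arm; the point y belongs to both but is null.\<close>
  have key: "indicator {0<..<t} s * ennreal (a + b - 2 * s) \<le> indicator {0<..<t} s * ennreal c + ((\<integral>\<^sup>+i. g1 i s \<partial>lborel) + (\<integral>\<^sup>+j. g2 (a - s) j \<partial>lborel))" for s
  proof (cases "0 < s \<and> s < t")
    case True
    define y where "y = \<alpha> (a - s) + \<beta> s"
    have h1: "(\<integral>\<^sup>+i. indicator {0<..<a - s} i * indicator C (\<alpha> i + \<beta> s) \<partial>lborel) \<le> emeasure lborel (C \<inter> {..y})"
      unfolding y_def using \<alpha> True t by (intro quantile_lower_part(1)[of _ A]) auto
    have h2: "(\<integral>\<^sup>+j. indicator {s<..<b} j * indicator C (\<alpha> (a - s) + \<beta> j) \<partial>lborel) \<le> emeasure lborel (C \<inter> {y..})"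
      unfolding y_def add.commute[of "\<alpha> (a - s)" "\<beta> s"] using \<beta> True t by (intro quantile_lower_part(2)[of _ B]) auto
    have "emeasure lborel (C \<inter> {..y}) + emeasure lborel (C \<inter> {y..}) = emeasure lborel (C \<inter> {..y}) + emeasure lborel (C \<inter> {y<..})"
      by (intro arg_cong2[where f="(+)"] refl emeasure_eq_AE AE_I[where N="{y}"]) auto
    also have "\<dots> = emeasure lborel C"
      by (subst plus_emeasure) (auto intro!: arg_cong2[where f=emeasure])
    finally have h3: "emeasure lborel (C \<inter> {..y}) + emeasure lborel (C \<inter> {y..}) = ennreal c" using c by simp
    have "ennreal (a - s) = (\<integral>\<^sup>+i. indicator {0<..<a - s} i \<partial>lborel)" using True t by simp
    also have "\<dots> = (\<integral>\<^sup>+i. (indicator {0<..<a - s} i * indicator C (\<alpha> i + \<beta> s) + g1 i s) \<partial>lborel)"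
      using True t by (intro nn_integral_cong) (auto simp: g1_def g_def indicator_def)
    also have "\<dots> = (\<integral>\<^sup>+i. indicator {0<..<a - s} i * indicator C (\<alpha> i + \<beta> s) \<partial>lborel) + (\<integral>\<^sup>+i. g1 i s \<partial>lborel)"
      by (subst nn_integral_add) auto
    finally have h4: "ennreal (a - s) \<le> emeasure lborel (C \<inter> {..y}) + (\<integral>\<^sup>+i. g1 i s \<partial>lborel)" using h1
      by (simp add: add_mono)
    have "ennreal (b - s) = (\<integral>\<^sup>+i. indicator {s<..<b} i \<partial>lborel)" using True t by simp
    also have "\<dots> = (\<integral>\<^sup>+i. (indicator {s<..<b} i * indicator C (\<alpha> (a - s) + \<beta> i) + g2 (a - s) i) \<partial>lborel)"
      using True t by (intro nn_integral_cong) (auto simp: g2_def g_def indicator_def)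
    also have "\<dots> = (\<integral>\<^sup>+i. indicator {s<..<b} i * indicator C (\<alpha> (a - s) + \<beta> i) \<partial>lborel) + (\<integral>\<^sup>+i. g2 (a - s) i \<partial>lborel)"
      by (subst nn_integral_add) auto
    finally have h5: "ennreal (b - s) \<le> emeasure lborel (C \<inter> {y..}) + (\<integral>\<^sup>+i. g2 (a - s) i \<partial>lborel)" using h2
      by (simp add: add_mono)
    have "ennreal (a + b - 2 * s) = ennreal (a - s) + ennreal (b - s)"
      using True t by (simp add: ennreal_plus[symmetric] del: ennreal_plus)
    also have "\<dots> \<le> (emeasure lborel (C \<inter> {..y}) + (\<integral>\<^sup>+i. g1 i s \<partial>lborel)) + (emeasure lborel (C \<inter> {y..}) + (\<integral>\<^sup>+i. g2 (a - s) i \<partial>lborel))"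
      by (intro add_mono h4 h5)
    also have "\<dots> = ennreal c + ((\<integral>\<^sup>+i. g1 i s \<partial>lborel) + (\<integral>\<^sup>+j. g2 (a - s) j \<partial>lborel))"
      unfolding h3[symmetric] by (simp add: ac_simps)
    finally show ?thesis using True by simp
  qed (auto simp: indicator_def)
  have "ennreal ((a + b) * t - 2 * t\<^sup>2 / 2) = (\<integral>\<^sup>+s. indicator {0<..<t} s * ennreal (a + b - 2 * s) \<partial>lborel)"
    using t c by (subst nn_integral_affine_interval) auto
  also have "\<dots> \<le> (\<integral>\<^sup>+s. indicator {0<..<t} s * ennreal c + ((\<integral>\<^sup>+i. g1 i s \<partial>lborel) + (\<integral>\<^sup>+j. g2 (a - s) j \<partial>lborel)) \<partial>lborel)"
    by (intro nn_integral_mono key)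
  also have "\<dots> = ennreal (c * t) + (\<integral>\<^sup>+s. ((\<integral>\<^sup>+i. g1 i s \<partial>lborel) + (\<integral>\<^sup>+j. g2 (a - s) j \<partial>lborel)) \<partial>lborel)"
    using t c by (subst nn_integral_add)
      (auto simp: nn_integral_multc ennreal_mult' mult.commute[of _ "ennreal c"] nn_integral_cmult)
  also have "\<dots> \<le> ennreal (c * t) + riesz A B (- C)" by (intro add_mono low order_refl)
  finally have fin: "ennreal ((a + b) * t - t\<^sup>2) \<le> ennreal (c * t) + riesz A B (- C)" by simp
  \<comment> \<open>Per hook the surplus is a + b - c - 2 s = 2 (t - s), and its integral over (0,
    t) is the square of t.\<close>
  have "(a + b) * t - t\<^sup>2 = c * t + t\<^sup>2"
  proof -
    have "(a + b) * t = (2 * t + c) * t" using t by simp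
    then show ?thesis by (simp add: power2_eq_square algebra_simps)
  qed
  then have "ennreal (c * t) + ennreal (t\<^sup>2) \<le> ennreal (c * t) + riesz A B (- C)"
    using fin c t by simp
  then show ?thesis by (simp add: ennreal_add_left_cancel_le)
qed

text \<open>In these degenerate configurations two memberships force the third, so a bound of
  \<open>riesz_le\<close> is attained.\<close>

lemma riesz_eq_product:
  fixes A B C :: "'a::euclidean_space set"
  assumes [measurable]: "A \<in> sets borel" "B \<in> sets borel" "C \<in> sets borel"
  shows "(\<And>x y. x \<in> A \<Longrightarrow> y \<in> B \<Longrightarrow> x + y \<in> C) \<Longrightarrow> riesz A B C = emeasure lborel A * emeasure lborel B"
    and "(\<And>x z. x \<in> A \<Longrightarrow> z \<in> C \<Longrightarrow> z - x \<in> B) \<Longrightarrow> riesz A B C = emeasure lborel A * emeasure lborel C"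
    and "(\<And>y z. y \<in> B \<Longrightarrow> z \<in> C \<Longrightarrow> z - y \<in> A) \<Longrightarrow> riesz A B C = emeasure lborel B * emeasure lborel C"
proof -
  have tr: "(\<integral>\<^sup>+y. indicator C (x + y) \<partial>lborel) = emeasure lborel C" for x
    by (subst nn_integral_translate[where h="indicator C"]) auto
  have swap: "riesz A B C = (\<integral>\<^sup>+y. \<integral>\<^sup>+x. indicator A x * indicator B y * indicator C (x + y) \<partial>lborel \<partial>lborel)"
    unfolding riesz_def by (intro lborel_pair.Fubini') simp
  {
    assume *: "\<And>x y. x \<in> A \<Longrightarrow> y \<in> B \<Longrightarrow> x + y \<in> C"
    have "riesz A B C = (\<integral>\<^sup>+x. \<integral>\<^sup>+y. indicator A x * indicator B y \<partial>lborel \<partial>lborel)"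
      unfolding riesz_def using * by (intro nn_integral_cong) (auto simp: indicator_def)
    then show "riesz A B C = emeasure lborel A * emeasure lborel B"
      by (simp add: nn_integral_cmult nn_integral_multc)
  next
    assume *: "\<And>x z. x \<in> A \<Longrightarrow> z \<in> C \<Longrightarrow> z - x \<in> B"
    have "riesz A B C = (\<integral>\<^sup>+x. \<integral>\<^sup>+y. indicator A x * indicator C (x + y) \<partial>lborel \<partial>lborel)"
      unfolding riesz_def using *[of x "x + y" for x y] by (intro nn_integral_cong) (auto simp: indicator_def)
    then show "riesz A B C = emeasure lborel A * emeasure lborel C"
      by (simp add: nn_integral_cmult nn_integral_multc tr)
  next
    assume *: "\<And>y z. y \<in> B \<Longrightarrow> z \<in> C \<Longrightarrow> z - y \<in> A"
    have "riesz A B C = (\<integral>\<^sup>+y. \<integral>\<^sup>+x. indicator B y * indicator C (y + x) \<partial>lborel \<partial>lborel)"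
      unfolding swap using *[of y "x + y" for x y] by (intro nn_integral_cong) (auto simp: indicator_def add.commute)
    then show "riesz A B C = emeasure lborel B * emeasure lborel C"
      by (simp add: nn_integral_cmult nn_integral_multc tr)
  }
qed

section \<open>Centred intervals on the line\<close>

lemma ball_0_real: "ball (0::real) r = {-r<..<r}"
  by (simp add: ball_eq_greaterThanLessThan)

lemma emeasure_ball_half: "0 \<le> a \<Longrightarrow> emeasure lborel (ball (0::real) (a / 2)) = ennreal a"
  by (simp add: ball_0_real)

text \<open>In the rectangle of the first two intervals, the set where x + y leaves the third
  consists of two corner triangles exchanged by (x, y) -> (-x, -y). Each is a right triangle with
  both legs equal to (a + b - c) / 2 = t, so the hook bound is sharp for intervals.\<close>

lemma riesz_complement_intervals:
  fixes a b c t :: real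
  assumes t: "0 < t" "t \<le> a" "t \<le> b" "2 * t = a + b - c"
  shows "riesz (ball (0::real) (a / 2)) (ball 0 (b / 2)) (- ball 0 (c / 2)) \<le> ennreal (t\<^sup>2)"
proof -
  define I J :: "real set" where "I = ball 0 (a / 2)" and "J = ball 0 (b / 2)"
  have [measurable]: "I \<in> sets borel" "J \<in> sets borel" by (auto simp: I_def J_def)
  define g where "g x y = (indicator I x * indicator J y * indicator {c / 2..} (x + y) :: ennreal)" for x y
  have [measurable]: "(\<lambda>p. g (f p) (h p)) \<in> borel_measurable M"
    if [measurable]: "f \<in> borel_measurable M" "h \<in> borel_measurable M" for f h and M :: "'z measure"
    unfolding g_def by measurable
  have "riesz I J (- ball 0 (c / 2)) \<le> (\<integral>\<^sup>+x. \<integral>\<^sup>+y. g x y + g (- x) (- y) \<partial>lborel \<partial>lborel)"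
    unfolding riesz_def by (intro nn_integral_mono) (auto simp: g_def indicator_def I_def J_def ball_0_real)
  also have "\<dots> = (\<integral>\<^sup>+x. \<integral>\<^sup>+y. g x y \<partial>lborel \<partial>lborel) + (\<integral>\<^sup>+x. \<integral>\<^sup>+y. g (- x) (- y) \<partial>lborel \<partial>lborel)"
    by (simp add: nn_integral_add)
  also have "(\<integral>\<^sup>+x. \<integral>\<^sup>+y. g (- x) (- y) \<partial>lborel \<partial>lborel) = (\<integral>\<^sup>+x. \<integral>\<^sup>+y. g (- x) y \<partial>lborel \<partial>lborel)"
    by (intro nn_integral_cong nn_integral_reflect) auto
  also have "\<dots> = (\<integral>\<^sup>+x. \<integral>\<^sup>+y. g x y \<partial>lborel \<partial>lborel)"
    by (rule nn_integral_reflect[where h="\<lambda>x. \<integral>\<^sup>+y. g x y \<partial>lborel"]) auto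
  also have "(\<integral>\<^sup>+x. \<integral>\<^sup>+y. g x y \<partial>lborel \<partial>lborel) \<le> (\<integral>\<^sup>+x. indicator I x * ennreal (x + (b - c) / 2) \<partial>lborel)"
  proof (intro nn_integral_mono)
    fix x :: real
    have "(\<integral>\<^sup>+y. g x y \<partial>lborel) \<le> (\<integral>\<^sup>+y. indicator I x * indicator {c / 2 - x..<b / 2} y \<partial>lborel)"
      by (intro nn_integral_mono) (auto simp: g_def indicator_def J_def)
    also have "\<dots> = indicator I x * emeasure lborel {c / 2 - x..<b / 2}"
      by (simp add: nn_integral_cmult)
    also have "emeasure lborel {c / 2 - x..<b / 2} = ennreal (x + (b - c) / 2)"
      by (cases "c / 2 - x \<le> b / 2") (auto simp: field_simps ennreal_neg)
    finally show "(\<integral>\<^sup>+y. g x y \<partial>lborel) \<le> indicator I x * ennreal (x + (b - c) / 2)" .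
  qed
  also have "(\<integral>\<^sup>+x. indicator I x * ennreal (x + (b - c) / 2) \<partial>lborel)
     = (\<integral>\<^sup>+u. indicator I (a / 2 + (-1) * u) * ennreal ((a / 2 + (-1) * u) + (b - c) / 2) \<partial>lborel)"
    by (subst nn_integral_real_affine[where c="-1" and t="a/2"]) auto
  also have "\<dots> \<le> (\<integral>\<^sup>+u. indicator {0<..<t} u * ennreal (t - 1 * u) \<partial>lborel)"
  proof (intro nn_integral_mono)
    fix u
    have "(a / 2 + (-1) * u) + (b - c) / 2 = t - u" using t by (simp add: field_simps)
    then show "indicator I (a / 2 + (-1) * u) * ennreal ((a / 2 + (-1) * u) + (b - c) / 2) \<le> indicator {0<..<t} u * ennreal (t - 1 * u)"
      by (auto simp: indicator_def I_def ball_0_real ennreal_neg)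
  qed
  also have "\<dots> = ennreal (t\<^sup>2 / 2)"
    using t by (subst nn_integral_affine_interval) (auto simp: power2_eq_square)
  finally show ?thesis
    by (simp add: I_def J_def add_mono ennreal_plus[symmetric] del: ennreal_plus)
qed

text \<open>If one length is at least the sum of the other two, the trivial bound is attained by
  intervals. Otherwise the three triangle inequalities put t between 0 and both a and b, and the
  complements compare: at least the square of t for arbitrary sets, at most that for
  intervals.\<close>

theorem riesz_real:
  fixes A B C :: "real set"
  assumes [measurable]: "A \<in> sets borel" "B \<in> sets borel" "C \<in> sets borel"
    and a: "emeasure lborel A = ennreal a" "0 \<le> a" and b: "emeasure lborel B = ennreal b" "0 \<le> b"
    and c: "emeasure lborel C = ennreal c" "0 \<le> c"
  shows "riesz A B C \<le> riesz (ball (0::real) (a / 2)) (ball 0 (b / 2)) (ball 0 (c / 2))"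
proof -
  note e = emeasure_ball_half[OF a(2)] emeasure_ball_half[OF b(2)] emeasure_ball_half[OF c(2)]
  consider "a + b \<le> c" | "b + c \<le> a" | "a + c \<le> b" | "c < a + b" "a < b + c" "b < a + c" by linarith
  then show ?thesis
  proof cases
    case 1
    have "riesz (ball (0::real) (a / 2)) (ball 0 (b / 2)) (ball 0 (c / 2)) = ennreal a * ennreal b"
      unfolding e[symmetric] by (rule riesz_eq_product(1)) (use 1 in \<open>auto simp: ball_0_real\<close>)
    then show ?thesis using riesz_le(1)[OF assms(1-3)] a b by simp
  next
    case 2
    have "riesz (ball (0::real) (a / 2)) (ball 0 (b / 2)) (ball 0 (c / 2)) = ennreal b * ennreal c"
      unfolding e[symmetric] by (rule riesz_eq_product(3)) (use 2 in \<open>auto simp: ball_0_real\<close>)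
    then show ?thesis using riesz_le(3)[OF assms(1-3)] b c by simp
  next
    case 3
    have "riesz (ball (0::real) (a / 2)) (ball 0 (b / 2)) (ball 0 (c / 2)) = ennreal a * ennreal c"
      unfolding e[symmetric] by (rule riesz_eq_product(2)) (use 3 in \<open>auto simp: ball_0_real\<close>)
    then show ?thesis using riesz_le(2)[OF assms(1-3)] a c by simp
  next
    case 4
    define t where "t = (a + b - c) / 2"
    have t: "0 < t" "t \<le> a" "t \<le> b" "2 * t = a + b - c" using 4 by (auto simp: t_def field_simps)
    have "riesz A B C + ennreal (t\<^sup>2) \<le> riesz A B C + riesz A B (- C)"
      using riesz_complement_lower_bound[OF assms(1-3) a(1) b(1) c t] by (intro add_mono) auto
    also have "\<dots> = riesz (ball (0::real) (a / 2)) (ball 0 (b / 2)) (ball 0 (c / 2)) + riesz (ball (0::real) (a / 2)) (ball 0 (b / 2)) (- ball 0 (c / 2))"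
      using a b by (simp add: riesz_split e)
    also have "\<dots> \<le> riesz (ball (0::real) (a / 2)) (ball 0 (b / 2)) (ball 0 (c / 2)) + ennreal (t\<^sup>2)"
      using riesz_complement_intervals[OF t] by (intro add_mono) auto
    finally show ?thesis by (simp add: ennreal_add_left_cancel_le add.commute[of _ "ennreal _"])
  qed
qed

subsection \<open>Steiner symmetrization\<close>

lemma power_less_iff_less:
  fixes a b :: real
  shows "0 \<le> a \<Longrightarrow> 0 \<le> b \<Longrightarrow> 0 < n \<Longrightarrow> a ^ n < b ^ n \<longleftrightarrow> a < b"
  by (metis not_le power_mono_iff)

lemma emeasure_ball_less_iff:
  assumes "0 \<le> r" "0 \<le> s"
  shows "emeasure lborel (ball (0::'a::euclidean_space) r) < emeasure lborel (ball (0::'a) s) \<longleftrightarrow> r < s"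
proof -
  have "unit_ball_vol (real DIM('a)) > 0" by simp
  then have "unit_ball_vol (real DIM('a)) * r ^ DIM('a) < unit_ball_vol (real DIM('a)) * s ^ DIM('a) \<longleftrightarrow> r < s"
    using assms by (simp add: power_less_iff_less)
  then show ?thesis using assms by (simp add: emeasure_ball ennreal_less_iff)
qed

lemma symball_infinite: "emeasure lborel A = \<infinity> \<Longrightarrow> symball A = UNIV"
  by (auto simp: symball_def emeasure_ball)

lemma symball_ball: "0 \<le> r \<Longrightarrow> symball (ball 0 r) = ball 0 r"
  by (auto simp: symball_def emeasure_ball_less_iff)

lemma symball_finite:
  fixes A :: "'a::euclidean_space set"
  assumes "emeasure lborel A < \<infinity>"
  obtains r where "0 \<le> r" "symball A = ball 0 r" "emeasure lborel (ball (0::'a) r) = emeasure lborel A"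
proof -
  define v where "v = unit_ball_vol (real DIM('a))"
  have v: "v > 0" by (simp add: v_def)
  obtain a where a: "emeasure lborel A = ennreal a" "0 \<le> a"
    using assms by (cases "emeasure lborel A") auto
  define r where "r = root DIM('a) (a / v)"
  have r: "0 \<le> r" using a v by (simp add: r_def)
  have "emeasure lborel (ball (0::'a) r) = ennreal (v * r ^ DIM('a))"
    using r by (simp add: emeasure_ball v_def)
  also have "v * r ^ DIM('a) = a" using a v by (simp add: r_def)
  finally have e: "emeasure lborel (ball (0::'a) r) = emeasure lborel A" using a by simp
  have "symball A = ball 0 r" unfolding symball_def e[symmetric] using r by (auto simp: emeasure_ball_less_iff)
  then show thesis using that r e by blast
qed

lemma emeasure_symball [simp]: "emeasure lborel (symball A) = emeasure lborel A"
proof (cases "emeasure lborel A = \<infinity>")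
  case False
  then show ?thesis using symball_finite[of A] by (metis infinity_ennreal_def top.not_eq_extremum)
qed (simp add: symball_infinite)

lemma symball_cong: "emeasure lborel A = emeasure lborel B \<Longrightarrow> symball A = symball B"
  by (simp add: symball_def)

lemma symball_symball [simp]: "symball (symball A) = symball A"
  by (rule symball_cong) simp

lemma symball_mono: "emeasure lborel A \<le> emeasure lborel B \<Longrightarrow> symball A \<subseteq> symball B"
  by (auto simp: symball_def)

lemma open_symball: "open (symball A)"
proof (cases "emeasure lborel A = \<infinity>")
  case False
  then show ?thesis using symball_finite[of A] by (metis infinity_ennreal_def top.not_eq_extremum open_ball)
qed (simp add: symball_infinite)

lemma sets_symball [measurable, simp]: "symball A \<in> sets borel"
  by (intro borel_open open_symball)

text \<open>Fibres through x, y and x + y are centred at different points. The centres add up, so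
  the intervals may be moved to the origin together.\<close>

lemma riesz_translate:
  fixes A B C :: "'a::euclidean_space set"
  assumes [measurable]: "A \<in> sets borel" "B \<in> sets borel" "C \<in> sets borel"
  shows "riesz {x. p + x \<in> A} {x. q + x \<in> B} {x. p + q + x \<in> C} = riesz A B C"
proof -
  have "riesz {x. p + x \<in> A} {x. q + x \<in> B} {x. p + q + x \<in> C} =
    (\<integral>\<^sup>+x. \<integral>\<^sup>+y. indicator A (p + x) * indicator B (q + y) * indicator C ((p + x) + (q + y)) \<partial>lborel \<partial>lborel)"
    unfolding riesz_def by (intro nn_integral_cong) (auto simp: indicator_def algebra_simps)
  also have "\<dots> = (\<integral>\<^sup>+x. \<integral>\<^sup>+y. indicator A (p + x) * indicator B y * indicator C ((p + x) + y) \<partial>lborel \<partial>lborel)"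
  proof (rule nn_integral_cong)
    fix x
    show "(\<integral>\<^sup>+y. indicator A (p + x) * indicator B (q + y) * indicator C ((p + x) + (q + y)) \<partial>lborel)
        = (\<integral>\<^sup>+y. indicator A (p + x) * indicator B y * indicator C ((p + x) + y) \<partial>lborel)"
      by (rule nn_integral_translate[where h="\<lambda>y. indicator A (p + x) * indicator B y * indicator C ((p + x) + y)"]) simp
  qed
  also have "\<dots> = riesz A B C"
    unfolding riesz_def
    by (subst nn_integral_translate[where h="\<lambda>x. (\<integral>\<^sup>+y. indicator A x * indicator B y * indicator C (x + y) \<partial>lborel)"]) auto
  finally show ?thesis .
qed

lemma riesz_mono: "A \<subseteq> A' \<Longrightarrow> B \<subseteq> B' \<Longrightarrow> C \<subseteq> C' \<Longrightarrow> riesz A B C \<le> riesz A' B' C'"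
  unfolding riesz_def by (intro nn_integral_mono) (auto simp: indicator_def)

section \<open>Fibres in a fixed direction\<close>

definition fibre :: "'a::euclidean_space \<Rightarrow> 'a set \<Rightarrow> 'a \<Rightarrow> real set" where
  "fibre e A x = {s. x + s *\<^sub>R e \<in> A}"

text \<open>The base point of a fibre may be any x, not only a point of the hyperplane orthogonal to
  e. Hence an interval symmetric about that hyperplane appears shifted by p = x \<bullet> e, and l
  is its full length.\<close>

definition centred :: "real \<Rightarrow> real \<Rightarrow> real set" where
  "centred p l = {s. \<bar>p + s\<bar> < l / 2}"

lemma emeasure_centred: "0 \<le> l \<Longrightarrow> emeasure lborel (centred p l) = ennreal l"
proof -
  assume "0 \<le> l"
  moreover have "centred p l = {- p - l / 2<..<- p + l / 2}" unfolding centred_def abs_less_iff by auto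
  ultimately show ?thesis by simp
qed

lemma centred_Int: "centred p k \<inter> centred p l = centred p (min k l)"
  by (auto simp: centred_def)

lemma centred_eq: "centred p l = {s. p + s \<in> ball 0 (l / 2)}"
  by (auto simp: centred_def)

text \<open>x is kept when its distance to the hyperplane is less than half the length of its fibre;
  the strict inequality yields open intervals, as in \<open>centred\<close>.\<close>

definition steiner :: "'a::euclidean_space \<Rightarrow> 'a set \<Rightarrow> 'a set" where
  "steiner e A = {x. ennreal (2 * \<bar>x \<bullet> e\<bar>) < emeasure lborel (fibre e A x)}"

context
  fixes e :: "'a::euclidean_space"
  assumes e: "norm e = 1"
begin

lemma inner_self_1: "e \<bullet> e = 1"
  using e by (simp add: dot_square_norm)

lemma fibre_sets [measurable, simp]:
  assumes [measurable]: "A \<in> sets borel"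
  shows "fibre e A x \<in> sets borel"
  unfolding fibre_def by measurable

lemma emeasure_fibre: "A \<in> sets borel \<Longrightarrow> emeasure lborel (fibre e A x) = (\<integral>\<^sup>+s. indicator A (x + s *\<^sub>R e) \<partial>lborel)"
  by (subst nn_integral_indicator[symmetric]) (simp, intro nn_integral_cong, simp add: fibre_def indicator_def)

lemma emeasure_fibre_measurable [measurable]:
  assumes [measurable]: "A \<in> sets borel"
  shows "(\<lambda>x. emeasure lborel (fibre e A x)) \<in> borel_measurable borel"
  by (simp add: emeasure_fibre)

lemma steiner_sets [measurable, simp]:
  assumes [measurable]: "A \<in> sets borel"
  shows "steiner e A \<in> sets borel"
  unfolding steiner_def by measurable

text \<open>Averaging over the slab \<open>0 \<le> x \<bullet> e < 1\<close> replaces Fubini for the orthogonal decomposition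
  along \<open>e\<close>.\<close>

lemma nn_integral_fibres:
  fixes h :: "'a \<Rightarrow> ennreal"
  assumes [measurable]: "h \<in> borel_measurable borel"
  shows "(\<integral>\<^sup>+x. h x \<partial>lborel) =
    (\<integral>\<^sup>+x. indicator {x. 0 \<le> x \<bullet> e \<and> x \<bullet> e < 1} x * (\<integral>\<^sup>+s. h (x + s *\<^sub>R e) \<partial>lborel) \<partial>lborel)" (is "_ = (\<integral>\<^sup>+x. indicator ?S x * _ \<partial>lborel)")
proof -
  have [measurable]: "?S \<in> sets borel" by measurable
  have "(\<integral>\<^sup>+x. indicator ?S x * (\<integral>\<^sup>+s. h (x + s *\<^sub>R e) \<partial>lborel) \<partial>lborel)
    = (\<integral>\<^sup>+x. \<integral>\<^sup>+s. indicator ?S x * h (x + s *\<^sub>R e) \<partial>lborel \<partial>lborel)"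
    by (simp add: nn_integral_cmult)
  also have "\<dots> = (\<integral>\<^sup>+s. \<integral>\<^sup>+x. indicator ?S x * h (x + s *\<^sub>R e) \<partial>lborel \<partial>lborel)"
    by (intro lborel_pair.Fubini'[symmetric]) simp
  also have "\<dots> = (\<integral>\<^sup>+s. \<integral>\<^sup>+x. indicator ?S (x - s *\<^sub>R e) * h x \<partial>lborel \<partial>lborel)"
  proof (rule nn_integral_cong)
    fix s :: real
    show "(\<integral>\<^sup>+x. indicator ?S x * h (x + s *\<^sub>R e) \<partial>lborel) = (\<integral>\<^sup>+x. indicator ?S (x - s *\<^sub>R e) * h x \<partial>lborel)"
      using nn_integral_translate[where c="s *\<^sub>R e" and h="\<lambda>x. indicator ?S (x - s *\<^sub>R e) * h x"]
      by (simp add: add.commute)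
  qed
  also have "\<dots> = (\<integral>\<^sup>+x. \<integral>\<^sup>+s. indicator ?S (x - s *\<^sub>R e) * h x \<partial>lborel \<partial>lborel)"
    by (intro lborel_pair.Fubini') simp
  also have "\<dots> = (\<integral>\<^sup>+x. h x \<partial>lborel)"
  proof (rule nn_integral_cong)
    \<comment> \<open>The shifts s that bring x back into the slab form a half-open interval of
      length one, so the averaging contributes the factor one.\<close>
    fix x
    have "(\<integral>\<^sup>+s. indicator ?S (x - s *\<^sub>R e) * h x \<partial>lborel) = (\<integral>\<^sup>+s. indicator {x \<bullet> e - 1<..x \<bullet> e} s * h x \<partial>lborel)"
      by (intro nn_integral_cong) (auto simp: indicator_def inner_diff_left inner_self_1)
    then show "(\<integral>\<^sup>+s. indicator ?S (x - s *\<^sub>R e) * h x \<partial>lborel) = h x"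
      by (simp add: nn_integral_multc)
  qed
  finally show ?thesis by simp
qed

lemma emeasure_fibres:
  assumes [measurable]: "A \<in> sets borel"
  shows "emeasure lborel A =
    (\<integral>\<^sup>+x. indicator {x. 0 \<le> x \<bullet> e \<and> x \<bullet> e < 1} x * emeasure lborel (fibre e A x) \<partial>lborel)"
  using nn_integral_fibres[of "indicator A"] by (simp add: emeasure_fibre)

text \<open>Since (x + s e) + (y + r e) = (x + y) + (s + r) e, the inner double integral is again a
  Riesz functional, now of three fibres on the line. The slab weight depends on the base points
  only, hence survives a fibrewise comparison.\<close>

lemma riesz_fibres:
  assumes [measurable]: "A \<in> sets borel" "B \<in> sets borel" "C \<in> sets borel"
  defines "S \<equiv> {x. 0 \<le> x \<bullet> e \<and> x \<bullet> e < 1}"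
  shows "riesz A B C = (\<integral>\<^sup>+x. \<integral>\<^sup>+y. indicator S x * (indicator S y * riesz (fibre e A x) (fibre e B y) (fibre e C (x + y))) \<partial>lborel \<partial>lborel)"
proof -
  have [measurable]: "S \<in> sets borel" unfolding S_def by measurable
  define F where "F x y = (indicator A x * indicator B y * indicator C (x + y) :: ennreal)" for x y
  have [measurable]: "(\<lambda>p. F (f p) (h p)) \<in> borel_measurable M"
    if [measurable]: "f \<in> borel_measurable M" "h \<in> borel_measurable M" for f h and M :: "'z measure"
    unfolding F_def by measurable
  have "riesz A B C = (\<integral>\<^sup>+x. \<integral>\<^sup>+y. F x y \<partial>lborel \<partial>lborel)" by (simp add: riesz_def F_def)
  also have "\<dots> = (\<integral>\<^sup>+x. indicator S x * (\<integral>\<^sup>+s. \<integral>\<^sup>+y. F (x + s *\<^sub>R e) y \<partial>lborel \<partial>lborel) \<partial>lborel)"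
    unfolding S_def by (subst nn_integral_fibres) auto
  also have "\<dots> = (\<integral>\<^sup>+x. indicator S x * (\<integral>\<^sup>+s. \<integral>\<^sup>+y. indicator S y * (\<integral>\<^sup>+r. F (x + s *\<^sub>R e) (y + r *\<^sub>R e) \<partial>lborel) \<partial>lborel \<partial>lborel) \<partial>lborel)"
    by (subst nn_integral_fibres[of "\<lambda>y. F z y" for z]) (auto simp: S_def)
  also have "\<dots> = (\<integral>\<^sup>+x. indicator S x * (\<integral>\<^sup>+y. \<integral>\<^sup>+s. indicator S y * (\<integral>\<^sup>+r. F (x + s *\<^sub>R e) (y + r *\<^sub>R e) \<partial>lborel) \<partial>lborel \<partial>lborel) \<partial>lborel)"
    by (intro nn_integral_cong arg_cong2[where f="(*)"] refl lborel_pair.Fubini') simp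
  also have "\<dots> = (\<integral>\<^sup>+x. indicator S x * (\<integral>\<^sup>+y. indicator S y * (\<integral>\<^sup>+s. \<integral>\<^sup>+r. F (x + s *\<^sub>R e) (y + r *\<^sub>R e) \<partial>lborel \<partial>lborel) \<partial>lborel) \<partial>lborel)"
    by (simp add: nn_integral_cmult)
  also have "\<dots> = (\<integral>\<^sup>+x. \<integral>\<^sup>+y. indicator S x * (indicator S y * (\<integral>\<^sup>+s. \<integral>\<^sup>+r. F (x + s *\<^sub>R e) (y + r *\<^sub>R e) \<partial>lborel \<partial>lborel)) \<partial>lborel \<partial>lborel)"
    by (simp add: nn_integral_cmult)
  also have "\<dots> = (\<integral>\<^sup>+x. \<integral>\<^sup>+y. indicator S x * (indicator S y * riesz (fibre e A x) (fibre e B y) (fibre e C (x + y))) \<partial>lborel \<partial>lborel)"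
    unfolding riesz_def by (intro nn_integral_cong arg_cong2[where f="(*)"] refl) (auto simp: F_def indicator_def fibre_def algebra_simps)
  finally show ?thesis .
qed

lemma fibre_translate: "fibre e A (x + s *\<^sub>R e) = {r. s + r \<in> fibre e A x}"
  by (auto simp: fibre_def algebra_simps)

lemma emeasure_fibre_translate:
  assumes [measurable]: "A \<in> sets borel"
  shows "emeasure lborel (fibre e A (x + s *\<^sub>R e)) = emeasure lborel (fibre e A x)"
proof -
  have "emeasure lborel (fibre e A (x + s *\<^sub>R e)) = (\<integral>\<^sup>+r. indicator (fibre e A x) (s + r) \<partial>lborel)"
    by (subst nn_integral_indicator[symmetric]) (simp, intro nn_integral_cong, simp add: fibre_translate indicator_def)
  also have "\<dots> = emeasure lborel (fibre e A x)" by (subst nn_integral_translate) auto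
  finally show ?thesis .
qed

lemma fibre_steiner:
  assumes "A \<in> sets borel" "emeasure lborel (fibre e A x) = ennreal l" "0 \<le> l"
  shows "fibre e (steiner e A) x = centred (x \<bullet> e) (l)"
proof -
  have "fibre e (steiner e A) x = {s. ennreal (2 * \<bar>x \<bullet> e + s\<bar>) < emeasure lborel (fibre e A x)}"
    by (subst fibre_def) (simp add: steiner_def emeasure_fibre_translate[OF assms(1)] inner_add_left inner_self_1)
  also have "\<dots> = centred (x \<bullet> e) (l)"
    using assms by (auto simp: ennreal_less_iff centred_def)
  finally show ?thesis .
qed

lemma fibre_ball:
  obtains l where "0 \<le> l" "fibre e (ball 0 R) x = centred (x \<bullet> e) (l)"
    "l / 2 = sqrt (max 0 (R\<^sup>2 - (norm x)\<^sup>2 + (x \<bullet> e)\<^sup>2)) \<or> R \<le> 0"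
proof (cases "R \<le> 0")
  case True
  then show thesis by (intro that[of 0]) (auto simp: fibre_def centred_def ball_empty)
next
  case False
  define l where "l = 2 * sqrt (max 0 (R\<^sup>2 - (norm x)\<^sup>2 + (x \<bullet> e)\<^sup>2))"
  have "x + s *\<^sub>R e \<in> ball 0 R \<longleftrightarrow> x \<bullet> e + s \<in> ball 0 (l / 2)" for s
  proof -
    have n: "(norm (x + s *\<^sub>R e))\<^sup>2 = (norm x)\<^sup>2 - (x \<bullet> e)\<^sup>2 + (x \<bullet> e + s)\<^sup>2"
      unfolding power2_norm_eq_inner by (simp add: inner_add_left inner_add_right inner_self_1 inner_commute power2_eq_square algebra_simps)
    have "x + s *\<^sub>R e \<in> ball 0 R \<longleftrightarrow> (norm (x + s *\<^sub>R e))\<^sup>2 < R\<^sup>2"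
      using False by (simp add: power_less_iff_less)
    also have "\<dots> \<longleftrightarrow> \<bar>x \<bullet> e + s\<bar>\<^sup>2 < max 0 (R\<^sup>2 - (norm x)\<^sup>2 + (x \<bullet> e)\<^sup>2)"
      unfolding n power2_abs using zero_le_power2[of "x \<bullet> e + s"] by (intro iffI; linarith)
    also have "\<dots> \<longleftrightarrow> \<bar>x \<bullet> e + s\<bar> < l / 2"
      unfolding l_def by (simp add: real_less_rsqrt real_sqrt_less_iff flip: real_sqrt_abs)
    finally show ?thesis by simp
  qed
  then show thesis by (intro that[of l]) (auto simp: fibre_def l_def centred_eq)
qed

text \<open>Boundedness keeps fibre lengths real, the form in which \<open>riesz_real\<close> takes
  them.\<close>

lemma emeasure_fibre_bounded:
  assumes "A \<subseteq> ball 0 R" "A \<in> sets borel"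
  obtains l where "0 \<le> l" "emeasure lborel (fibre e A x) = ennreal l"
proof -
  obtain k where "0 \<le> k" "fibre e (ball 0 R) x = centred (x \<bullet> e) (k)" using fibre_ball .
  then have "emeasure lborel (fibre e (ball 0 R) x) = ennreal k" by (simp add: emeasure_centred)
  moreover have "emeasure lborel (fibre e A x) \<le> emeasure lborel (fibre e (ball 0 R) x)"
    using assms by (intro emeasure_mono) (auto simp: fibre_def)
  ultimately show thesis using that by (metis ennreal_cases ennreal_neq_top neq_top_trans)
qed

lemma emeasure_steiner:
  assumes A[measurable]: "A \<in> sets borel" "A \<subseteq> ball 0 R"
  shows "emeasure lborel (steiner e A) = emeasure lborel A"
proof -
  have "emeasure lborel (fibre e (steiner e A) x) = emeasure lborel (fibre e A x)" for x
  proof -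
    obtain l where "0 \<le> l" "emeasure lborel (fibre e A x) = ennreal l" using emeasure_fibre_bounded[OF A(2,1)] .
    then show ?thesis by (simp add: fibre_steiner emeasure_centred)
  qed
  then show ?thesis using A by (simp add: emeasure_fibres)
qed

text \<open>The fibre of the ball is already centred and at least as long as that of
  \<open>A\<close>, so the centred interval replacing the latter stays inside it.\<close>

lemma steiner_subset_ball:
  assumes A: "A \<in> sets borel" "A \<subseteq> ball 0 R"
  shows "steiner e A \<subseteq> ball 0 R"
proof
  fix x assume "x \<in> steiner e A"
  then have "ennreal (2 * \<bar>x \<bullet> e\<bar>) < emeasure lborel (fibre e A x)" by (simp add: steiner_def)
  also have "\<dots> \<le> emeasure lborel (fibre e (ball 0 R) x)"
    using assms by (intro emeasure_mono) (auto simp: fibre_def)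
  finally have *: "ennreal (2 * \<bar>x \<bullet> e\<bar>) < emeasure lborel (fibre e (ball 0 R) x)" .
  show "x \<in> ball 0 R"
  proof (cases "R \<le> 0")
    case True
    then have "fibre e (ball 0 R) x = {}" by (auto simp: fibre_def ball_empty)
    with * show ?thesis by simp
  next
    case False
    then obtain l where l: "0 \<le> l" "fibre e (ball 0 R) x = centred (x \<bullet> e) (l)"
      "l / 2 = sqrt (max 0 (R\<^sup>2 - (norm x)\<^sup>2 + (x \<bullet> e)\<^sup>2))" using fibre_ball[of R x] by metis
    then have "\<bar>x \<bullet> e\<bar> < l / 2" using * by (simp add: emeasure_centred ennreal_less_iff)
    then have "\<bar>x \<bullet> e\<bar>\<^sup>2 < (l / 2)\<^sup>2" by (intro power_strict_mono) auto
    then have "(norm x)\<^sup>2 < R\<^sup>2" unfolding l by (auto simp: max_def split: if_splits)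
    then show ?thesis using False by (simp add: power_less_iff_less)
  qed
qed

lemma riesz_steiner:
  assumes A[measurable]: "A \<in> sets borel" "A \<subseteq> ball 0 R" and B[measurable]: "B \<in> sets borel" "B \<subseteq> ball 0 R"
    and C[measurable]: "C \<in> sets borel" "C \<subseteq> ball 0 R"
  shows "riesz A B C \<le> riesz (steiner e A) (steiner e B) (steiner e C)"
proof -
  have "riesz (fibre e A x) (fibre e B y) (fibre e C (x + y)) \<le>
    riesz (fibre e (steiner e A) x) (fibre e (steiner e B) y) (fibre e (steiner e C) (x + y))" for x y
  proof -
    obtain a where a: "0 \<le> a" "emeasure lborel (fibre e A x) = ennreal a" using emeasure_fibre_bounded[OF A(2,1)] .
    obtain b where b: "0 \<le> b" "emeasure lborel (fibre e B y) = ennreal b" using emeasure_fibre_bounded[OF B(2,1)] .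
    obtain c where c: "0 \<le> c" "emeasure lborel (fibre e C (x + y)) = ennreal c" using emeasure_fibre_bounded[OF C(2,1)] .
    have "riesz (fibre e A x) (fibre e B y) (fibre e C (x + y)) \<le> riesz (ball (0::real) (a / 2)) (ball 0 (b / 2)) (ball 0 (c / 2))"
      using a b c by (intro riesz_real) auto
    also have "\<dots> = riesz {s. x \<bullet> e + s \<in> ball 0 (a / 2)} {s. y \<bullet> e + s \<in> ball 0 (b / 2)} {s. x \<bullet> e + y \<bullet> e + s \<in> ball 0 (c / 2)}"
      by (subst riesz_translate) auto
    also have "\<dots> = riesz (fibre e (steiner e A) x) (fibre e (steiner e B) y) (fibre e (steiner e C) (x + y))"
      using a b c by (simp add: fibre_steiner inner_add_left centred_eq)
    finally show ?thesis .
  qed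
  then show ?thesis
    by (subst (1 2) riesz_fibres) (auto intro!: nn_integral_mono mult_left_mono)
qed

text \<open>After symmetrization the fibres of \<open>A\<close> and of the ball \<open>K\<close> are
  concentric, hence nested, and their overlap is the shorter of the two. Before, each of the two
  fibres contained the overlap and, in addition, a disjoint piece as long as the fibre of the
  exchanged set. That piece is the gain.\<close>

lemma steiner_overlap:
  assumes A[measurable]: "A \<in> sets borel" "A \<subseteq> ball 0 R" and K: "K = ball 0 \<rho>" and "0 \<le> k"
  shows "emeasure lborel (A \<inter> K) + emeasure lborel {x \<in> A - K. x + k *\<^sub>R e \<in> K - A} \<le> emeasure lborel (steiner e A \<inter> K)"
proof -
  have [measurable]: "K \<in> sets borel" by (simp add: K)
  define D where "D = {x \<in> A - K. x + k *\<^sub>R e \<in> K - A}"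
  have [measurable]: "D \<in> sets borel" unfolding D_def by measurable
  define S where "S = {x. 0 \<le> x \<bullet> e \<and> x \<bullet> e < 1}"
  have [measurable]: "S \<in> sets borel" unfolding S_def by measurable
  have *: "emeasure lborel (fibre e (A \<inter> K) x) + emeasure lborel (fibre e D x) \<le> emeasure lborel (fibre e (steiner e A \<inter> K) x)" for x
  proof -
    have le: "emeasure lborel (fibre e D x) \<le> emeasure lborel (fibre e (A - K) x)"
      by (intro emeasure_mono) (auto simp: fibre_def D_def)
    \<comment> \<open>Moving by k e stays on the same line, so the fibre based at the shifted point
      has the length of the fibre at x.\<close>
    have "emeasure lborel (fibre e D x) \<le> emeasure lborel (fibre e (K - A) (x + k *\<^sub>R e))"
      by (intro emeasure_mono) (auto simp: fibre_def D_def algebra_simps)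
    then have le': "emeasure lborel (fibre e D x) \<le> emeasure lborel (fibre e (K - A) x)"
      by (simp add: emeasure_fibre_translate)
    obtain a where a: "0 \<le> a" "emeasure lborel (fibre e A x) = ennreal a" using emeasure_fibre_bounded[OF A(2,1)] .
    obtain l where l: "0 \<le> l" "fibre e K x = centred (x \<bullet> e) (l)" using fibre_ball unfolding K .
    have "fibre e (A \<inter> K) x \<union> fibre e (A - K) x = fibre e A x" by (auto simp: fibre_def)
    then have "emeasure lborel (fibre e (A \<inter> K) x) + emeasure lborel (fibre e (A - K) x) = ennreal a"
      unfolding a(2)[symmetric] by (subst plus_emeasure) (auto simp: fibre_def)
    then have 1: "emeasure lborel (fibre e (A \<inter> K) x) + emeasure lborel (fibre e D x) \<le> ennreal a"
      using le by (metis add_left_mono)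
    have "fibre e (A \<inter> K) x \<union> fibre e (K - A) x = fibre e K x" by (auto simp: fibre_def)
    then have "emeasure lborel (fibre e (A \<inter> K) x) + emeasure lborel (fibre e (K - A) x) = ennreal l"
      unfolding emeasure_centred[OF l(1), of "x \<bullet> e", symmetric] l(2)[symmetric]
      by (subst plus_emeasure) (auto simp: fibre_def)
    then have 2: "emeasure lborel (fibre e (A \<inter> K) x) + emeasure lborel (fibre e D x) \<le> ennreal l"
      using le' by (metis add_left_mono)
    have "fibre e (steiner e A \<inter> K) x = fibre e (steiner e A) x \<inter> fibre e K x" by (auto simp: fibre_def)
    also have "\<dots> = centred (x \<bullet> e) (min a l)"
      using a l by (simp add: fibre_steiner centred_Int)
    finally have "emeasure lborel (fibre e (steiner e A \<inter> K) x) = ennreal (min a l)"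
      using a l by (simp add: emeasure_centred)
    then show ?thesis using 1 2 by (simp add: min_def)
  qed
  have "emeasure lborel (A \<inter> K) + emeasure lborel D =
    (\<integral>\<^sup>+x. indicator S x * (emeasure lborel (fibre e (A \<inter> K) x) + emeasure lborel (fibre e D x)) \<partial>lborel)"
    unfolding S_def by (subst (1 2) emeasure_fibres) (auto simp: nn_integral_add[symmetric] distrib_left)
  also have "\<dots> \<le> (\<integral>\<^sup>+x. indicator S x * emeasure lborel (fibre e (steiner e A \<inter> K) x) \<partial>lborel)"
    by (intro nn_integral_mono mult_left_mono *) auto
  also have "\<dots> = emeasure lborel (steiner e A \<inter> K)"
    unfolding S_def by (subst emeasure_fibres[of "steiner e A \<inter> K"]) auto
  finally show ?thesis unfolding D_def .
qed

end

section \<open>Approaching the centred ball\<close>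

lemma exists_overlapping_shift:
  fixes P Q :: "'a::euclidean_space set"
  assumes [measurable]: "P \<in> sets borel" "Q \<in> sets borel" and sub: "P \<subseteq> ball 0 R" "Q \<subseteq> ball 0 R"
    and c: "emeasure lborel P * emeasure lborel Q > ennreal c * emeasure lborel (ball (0::'a) (2 * R))"
  obtains v where "emeasure lborel {x \<in> P. x + v \<in> Q} > ennreal c"
proof (rule ccontr)
  assume no: "\<not> thesis"
  have le: "emeasure lborel {x \<in> P. x + v \<in> Q} \<le> ennreal c" for v
    using no that[of v] by (meson not_le)
  \<comment> \<open>The product of the volumes is the integral of the overlap over all shifts v, and
    shifts of length at least 2 R contribute nothing; if no overlap exceeded c, the integral would
    be too small.\<close>
  have "emeasure lborel P * emeasure lborel Q = (\<integral>\<^sup>+x. indicator P x * (\<integral>\<^sup>+v. indicator Q (x + v) \<partial>lborel) \<partial>lborel)"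
    by (subst nn_integral_translate) (auto simp: nn_integral_multc)
  also have "\<dots> = (\<integral>\<^sup>+x. \<integral>\<^sup>+v. indicator P x * indicator Q (x + v) \<partial>lborel \<partial>lborel)"
    by (simp add: nn_integral_cmult)
  also have "\<dots> = (\<integral>\<^sup>+v. \<integral>\<^sup>+x. indicator P x * indicator Q (x + v) \<partial>lborel \<partial>lborel)"
    by (intro lborel_pair.Fubini'[symmetric]) simp
  also have "\<dots> \<le> (\<integral>\<^sup>+v. indicator (ball (0::'a) (2 * R)) v * ennreal c \<partial>lborel)"
  proof (rule nn_integral_mono)
    fix v :: 'a
    have "(\<integral>\<^sup>+x. indicator P x * indicator Q (x + v) \<partial>lborel) = (\<integral>\<^sup>+x. indicator {x \<in> P. x + v \<in> Q} x \<partial>lborel)"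
      by (intro nn_integral_cong) (simp add: indicator_def)
    also have "\<dots> = emeasure lborel {x \<in> P. x + v \<in> Q}"
      by (rule nn_integral_indicator) measurable
    finally have *: "(\<integral>\<^sup>+x. indicator P x * indicator Q (x + v) \<partial>lborel) = emeasure lborel {x \<in> P. x + v \<in> Q}" .
    show "(\<integral>\<^sup>+x. indicator P x * indicator Q (x + v) \<partial>lborel) \<le> indicator (ball 0 (2 * R)) v * ennreal c"
    proof (cases "v \<in> ball 0 (2 * R)")
      case True
      then show ?thesis unfolding * using le[of v] by simp
    next
      case False
      have "{x \<in> P. x + v \<in> Q} = {}"
      proof safe
        fix x assume "x \<in> P" "x + v \<in> Q"
        then have "norm x < R" "norm (x + v) < R" using sub by auto
        then have "norm v < 2 * R" using norm_triangle_ineq4[of "x + v" x] by simp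
        then show "x \<in> {}" using False by simp
      qed
      then show ?thesis unfolding * by (simp only: emeasure_empty) simp
    qed
  qed
  also have "\<dots> = ennreal c * emeasure lborel (ball (0::'a) (2 * R))"
    by (subst nn_integral_multc) (auto simp: mult.commute intro!: borel_measurable_indicator)
  finally show False using c by simp
qed

text \<open>For a set of finite volume this is half the volume of the symmetric difference with the
  ball of equal volume, since both one-sided differences have the same size.\<close>

definition deficit :: "'a::euclidean_space set \<Rightarrow> real" where
  "deficit A = measure lborel (symball A - A)"

context
  fixes R :: real and V :: real
  assumes R: "0 < R"
  defines "V \<equiv> 2 * measure lborel (ball (0::'a::euclidean_space) (2 * R))"
begin

lemma emeasure_subset_ball_finite:
  assumes "A \<subseteq> ball (0::'a) R"
  shows "emeasure lborel A < \<top>"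
  using emeasure_bounded_finite[of A] assms bounded_subset[OF bounded_ball] by auto

lemma symball_subset_ball:
  assumes "A \<subseteq> ball (0::'a) R"
  shows "symball A \<subseteq> ball 0 R"
proof -
  have "emeasure lborel A \<le> emeasure lborel (ball (0::'a) R)" using assms by (intro emeasure_mono) auto
  then have "symball A \<subseteq> symball (ball 0 R)" by (rule symball_mono)
  then show ?thesis using R by (simp add: symball_ball)
qed

lemma emeasure_diff_symball:
  assumes [measurable]: "A \<in> sets borel" and A: "A \<subseteq> ball (0::'a) R"
  shows "emeasure lborel (A - symball A) = ennreal (deficit A)" "emeasure lborel (symball A - A) = ennreal (deficit A)"
proof -
  have f: "emeasure lborel A < \<top>" "emeasure lborel (symball A - A) < \<top>" "emeasure lborel (symball A \<inter> A) < \<top>"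
    using A symball_subset_ball[OF A] by (auto intro!: emeasure_subset_ball_finite)
  show 1: "emeasure lborel (symball A - A) = ennreal (deficit A)"
    using f by (simp add: deficit_def emeasure_eq_ennreal_measure less_top)
  have "emeasure lborel (symball A \<inter> A) + emeasure lborel (A - symball A) = emeasure lborel A"
    by (subst plus_emeasure) (auto simp del: emeasure_symball intro!: arg_cong2[where f=emeasure])
  also have "\<dots> = emeasure lborel (symball A)" by simp
  also have "\<dots> = emeasure lborel (symball A \<inter> A) + emeasure lborel (symball A - A)"
    by (subst plus_emeasure) (auto simp del: emeasure_symball intro!: arg_cong2[where f=emeasure])
  finally have "emeasure lborel (A - symball A) = emeasure lborel (symball A - A)"
    using f(3) by (auto simp: ennreal_add_left_cancel)
  then show "emeasure lborel (A - symball A) = ennreal (deficit A)" using 1 by simp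
qed

text \<open>Symmetrization keeps the volume and therefore the ball \<open>K\<close>, so every gain
  of overlap with \<open>K\<close> is a loss of deficit.\<close>

lemma deficit_steiner:
  assumes [measurable]: "A \<in> sets borel" and A: "A \<subseteq> ball (0::'a) R" and e: "norm e = 1" "0 \<le> k"
  shows "ennreal (deficit (steiner e A)) + emeasure lborel {x \<in> A - symball A. x + k *\<^sub>R e \<in> symball A - A} \<le> ennreal (deficit A)"
proof -
  define K where "K = symball A"
  have [measurable]: "K \<in> sets borel" by (simp add: K_def)
  define D where "D = {x \<in> A - K. x + k *\<^sub>R e \<in> K - A}"
  obtain r where r: "K = ball 0 r"
    using symball_finite[of A] emeasure_subset_ball_finite[OF A] unfolding K_def by (metis infinity_ennreal_def)
  note S = steiner_sets[OF e(1) assms(1)] steiner_subset_ball[OF e(1) assms(1) A]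
  have KS: "symball (steiner e A) = K"
    unfolding K_def using e A by (intro symball_cong emeasure_steiner) auto
  have [measurable]: "steiner e A \<in> sets borel" by (rule S)
  have f: "emeasure lborel (A \<inter> K) < \<top>" using A by (intro emeasure_subset_ball_finite) auto
  have "emeasure lborel (A \<inter> K) + (ennreal (deficit (steiner e A)) + emeasure lborel D)
    = (emeasure lborel (A \<inter> K) + emeasure lborel D) + emeasure lborel (K - steiner e A)"
    using emeasure_diff_symball(2)[OF S] by (simp add: KS ac_simps)
  also have "\<dots> \<le> emeasure lborel (steiner e A \<inter> K) + emeasure lborel (K - steiner e A)"
    unfolding D_def using steiner_overlap[OF e(1) assms(1) A r e(2)] by (intro add_mono) auto
  also have "\<dots> = emeasure lborel K"
    by (subst plus_emeasure) (auto simp del: emeasure_symball intro!: arg_cong2[where f=emeasure])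
  also have "\<dots> = emeasure lborel (A \<inter> K) + emeasure lborel (K - A)"
    by (subst plus_emeasure) (auto simp del: emeasure_symball intro!: arg_cong2[where f=emeasure])
  also have "\<dots> = emeasure lborel (A \<inter> K) + ennreal (deficit A)"
    using emeasure_diff_symball(2)[OF assms(1) A] by (simp add: K_def)
  finally have "ennreal (deficit (steiner e A)) + emeasure lborel D \<le> ennreal (deficit A)"
    using f by (metis ennreal_add_left_cancel_le infinity_ennreal_def less_irrefl)
  then show ?thesis unfolding D_def K_def .
qed

lemma deficit_nonneg: "0 \<le> deficit A"
  by (simp add: deficit_def)

lemma V_pos: "0 < V"
  using R by (simp add: V_def content_ball)

text \<open>The direction is that of a shift carrying much of the excess
  \<open>A - symball A\<close> onto the gap \<open>symball A - A\<close>. Both have volume equal to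
  the deficit, so averaging over shifts gives an overlap quadratic in it.\<close>

lemma deficit_decrease:
  assumes [measurable]: "A \<in> sets borel" and A: "A \<subseteq> ball (0::'a) R" and pos: "0 < deficit A"
  obtains e :: 'a where "norm e = 1" "deficit (steiner e A) \<le> deficit A - (deficit A)\<^sup>2 / V"
proof -
  have [measurable]: "symball A \<in> sets borel" by simp
  have Vb: "emeasure lborel (ball (0::'a) (2 * R)) = ennreal (V / 2)"
    unfolding V_def by (subst emeasure_eq_ennreal_measure) (auto simp: emeasure_ball R less_imp_le)
  \<comment> \<open>The factor two inside \<open>V\<close> leaves the room for the strict inequality
    that the averaging argument asks for.\<close>
  have "(deficit A)\<^sup>2 / V * (V / 2) < (deficit A)\<^sup>2"
    using V_pos pos by simp
  then have "emeasure lborel (A - symball A) * emeasure lborel (symball A - A) > ennreal ((deficit A)\<^sup>2 / V) * emeasure lborel (ball (0::'a) (2 * R))"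
    unfolding emeasure_diff_symball[OF assms(1) A] Vb using pos V_pos
    by (simp add: ennreal_mult[symmetric] ennreal_less_iff power2_eq_square)
  then obtain v where v: "emeasure lborel {x \<in> A - symball A. x + v \<in> symball A - A} > ennreal ((deficit A)\<^sup>2 / V)"
    using A symball_subset_ball[OF A] by (elim exists_overlapping_shift[rotated 4]) auto
  \<comment> \<open>The excess and the gap are disjoint, so the zero shift produces no overlap and v
    has a direction.\<close>
  have "v \<noteq> 0"
  proof
    assume "v = 0"
    then have "{x \<in> A - symball A. x + v \<in> symball A - A} = {}" by auto
    then show False using v by (simp only: emeasure_empty) simp
  qed
  define e where "e = v /\<^sub>R norm v"
  have e: "norm e = 1" "v = norm v *\<^sub>R e" using \<open>v \<noteq> 0\<close> by (auto simp: e_def)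
  have "ennreal (deficit (steiner e A)) + ennreal ((deficit A)\<^sup>2 / V) \<le> ennreal (deficit A)"
    using deficit_steiner[OF assms(1) A e(1), of "norm v"] v unfolding e(2)[symmetric]
    by (meson add_left_mono less_imp_le norm_ge_zero order_trans)
  then have "deficit (steiner e A) + (deficit A)\<^sup>2 / V \<le> deficit A"
    using V_pos by (simp add: ennreal_plus[symmetric] deficit_nonneg del: ennreal_plus)
  then show thesis using e(1) that by (simp add: field_simps)
qed

lemma deficit_steiner_le:
  assumes "A \<in> sets borel" "A \<subseteq> ball (0::'a) R" "norm e = 1"
  shows "deficit (steiner e A) \<le> deficit A"
proof -
  have "ennreal (deficit (steiner e A)) \<le> ennreal (deficit A)"
    using deficit_steiner[OF assms, of 0] by (meson add_increasing2 order_trans zero_le order_refl)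
  then show ?thesis by (simp add: deficit_nonneg)
qed

text \<open>The triples obtained from \<open>(A, B, C)\<close> without decreasing the Riesz functional; their total deficit
  has infimum zero, as a further Steiner symmetrization decreases it by a definite amount.\<close>

definition improvements :: "'a set \<Rightarrow> 'a set \<Rightarrow> 'a set \<Rightarrow> ('a set \<times> 'a set \<times> 'a set) set" where
  "improvements A B C = {(A', B', C'). (\<forall>X\<in>{A', B', C'}. X \<in> sets borel \<and> X \<subseteq> ball 0 R) \<and>
     emeasure lborel A' = emeasure lborel A \<and> emeasure lborel B' = emeasure lborel B \<and>
     emeasure lborel C' = emeasure lborel C \<and> riesz A B C \<le> riesz A' B' C'}"

lemma improvements_steiner:
  assumes "(A', B', C') \<in> improvements A B C" "norm e = 1"
  shows "(steiner e A', steiner e B', steiner e C') \<in> improvements A B C"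
  using assms riesz_steiner[OF assms(2), of A' R B' C'] emeasure_steiner[OF assms(2), of _ R] steiner_subset_ball[OF assms(2), of _ R]
  by (auto simp: improvements_def intro: order_trans)

lemma exists_improvement:
  assumes "A \<in> sets borel" "A \<subseteq> ball (0::'a) R" "B \<in> sets borel" "B \<subseteq> ball 0 R" "C \<in> sets borel" "C \<subseteq> ball 0 R"
    and eps: "0 < \<epsilon>"
  obtains A' B' C' where "(A', B', C') \<in> improvements A B C" "deficit A' + deficit B' + deficit C' < \<epsilon>"
proof (rule ccontr)
  note obt = that
  assume no: "\<not> thesis"
  define T where "T = (\<lambda>(A' :: 'a set, B' :: 'a set, C' :: 'a set). deficit A' + deficit B' + deficit C')"
  define X where "X = improvements A B C"
  have T: "\<epsilon> \<le> T p" if "p \<in> X" for p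
  proof -
    obtain a b c where p: "p = (a, b, c)" by (cases p)
    show ?thesis
    proof (rule ccontr)
      assume "\<not> \<epsilon> \<le> T p"
      then have small: "deficit a + deficit b + deficit c < \<epsilon>" by (simp add: T_def p)
      have "(a, b, c) \<in> improvements A B C" using that by (simp add: X_def p)
      from no obt[OF this small] show False by (rule notE)
    qed
  qed
  have ne: "T ` X \<noteq> {}" using assms by (auto simp: X_def improvements_def)
  have bdd: "bdd_below (T ` X)" using T by (auto intro!: bdd_belowI)
  \<comment> \<open>With total deficit at least \<epsilon>, one of the three sets has deficit at
    least \<epsilon> / 3, and \<open>deficit_decrease\<close> lowers it by \<delta> or more. This
    contradicts a triple chosen within \<delta> of the infimum.\<close>
  define \<delta> where "\<delta> = (\<epsilon> / 3)\<^sup>2 / V"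
  have \<delta>: "\<delta> > 0" using eps V_pos by (simp add: \<delta>_def)
  obtain p where p: "p \<in> X" "T p < Inf (T ` X) + \<delta>"
    using cInf_lessD[OF ne, of "Inf (T ` X) + \<delta>"] \<delta> by auto
  obtain A' B' C' where p': "p = (A', B', C')" by (cases p)
  have inX: "(A', B', C') \<in> improvements A B C" using p p' by (simp add: X_def)
  have s: "\<And>Z. Z \<in> {A', B', C'} \<Longrightarrow> Z \<in> sets borel \<and> Z \<subseteq> ball 0 R"
    using inX by (auto simp: improvements_def)
  have "\<exists>Z\<in>{A', B', C'}. \<epsilon> / 3 \<le> deficit Z" using T[OF p(1)] by (auto simp: p' T_def)
  then obtain Z where Z: "Z \<in> {A', B', C'}" "\<epsilon> / 3 \<le> deficit Z" by blast
  then obtain e where e: "norm e = 1" "deficit (steiner e Z) \<le> deficit Z - (deficit Z)\<^sup>2 / V"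
    using deficit_decrease[of Z] s[of Z] eps by (metis divide_pos_pos less_le_trans zero_less_numeral)
  have "\<delta> \<le> (deficit Z)\<^sup>2 / V"
    unfolding \<delta>_def using Z eps V_pos by (intro divide_right_mono power_mono) auto
  with e have d: "deficit (steiner e Z) \<le> deficit Z - \<delta>" by simp
  have le: "deficit (steiner e Y) \<le> deficit Y" if "Y \<in> {A', B', C'}" for Y
    using s[OF that] e(1) by (intro deficit_steiner_le) auto
  have "T (steiner e A', steiner e B', steiner e C') \<le> T p - \<delta>"
    using Z(1) d le[of A'] le[of B'] le[of C'] by (auto simp: T_def p')
  moreover have "(steiner e A', steiner e B', steiner e C') \<in> X"
    using improvements_steiner[OF inX e(1)] by (simp add: X_def)
  then have "Inf (T ` X) \<le> T (steiner e A', steiner e B', steiner e C')"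
    by (intro cInf_lower bdd) auto
  ultimately show False using p(2) by simp
qed

text \<open>Exchanging one set costs at most the functional of the part removed; with
  \<open>riesz_le\<close> a small deficit becomes a small error.\<close>

lemma riesz_Un:
  fixes A A' B B' C C' :: "'a set"
  assumes [measurable]: "A \<in> sets borel" "A' \<in> sets borel" "B \<in> sets borel" "B' \<in> sets borel" "C \<in> sets borel" "C' \<in> sets borel"
  shows "riesz A B C \<le> riesz A' B C + riesz (A - A') B C"
    "riesz A B C \<le> riesz A B' C + riesz A (B - B') C"
    "riesz A B C \<le> riesz A B C' + riesz A B (C - C')"
  unfolding riesz_def
  by (subst nn_integral_add[symmetric]; (measurable; fail)?;
      intro nn_integral_mono; subst nn_integral_add[symmetric]; (measurable; fail)?; intro nn_integral_mono; auto simp: indicator_def)+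

lemma riesz_bounded:
  assumes A[measurable]: "A \<in> sets borel" "A \<subseteq> ball (0::'a) R"
    and B[measurable]: "B \<in> sets borel" "B \<subseteq> ball 0 R"
    and C[measurable]: "C \<in> sets borel" "C \<subseteq> ball 0 R"
  shows "riesz A B C \<le> riesz (symball A) (symball B) (symball C)"
proof (rule ennreal_le_epsilon)
  fix \<epsilon> :: real assume eps: "0 < \<epsilon>"
  define M where "M = measure lborel (ball (0::'a) R)"
  have M: "emeasure lborel (ball (0::'a) R) = ennreal M" "0 < M"
    unfolding M_def using R by (simp_all add: emeasure_eq_ennreal_measure emeasure_ball content_ball)
  \<comment> \<open>Each of the three replacements by a ball costs at most \<open>M\<close> times a
    deficit, whence the tolerance \<epsilon> / M.\<close>
  obtain A' B' C' where i: "(A', B', C') \<in> improvements A B C" "deficit A' + deficit B' + deficit C' < \<epsilon> / M"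
    using exists_improvement[OF A B C, of "\<epsilon> / M"] eps M by auto
  have [measurable]: "A' \<in> sets borel" "B' \<in> sets borel" "C' \<in> sets borel" and sub: "A' \<subseteq> ball 0 R" "B' \<subseteq> ball 0 R" "C' \<subseteq> ball 0 R"
    and eq: "symball A = symball A'" "symball B = symball B'" "symball C = symball C'" and le: "riesz A B C \<le> riesz A' B' C'"
    using i(1) by (auto simp: improvements_def intro!: symball_cong)
  have m: "emeasure lborel X \<le> ennreal M" if "X \<subseteq> ball (0::'a) R" for X
    unfolding M(1)[symmetric] using that by (intro emeasure_mono) auto
  note sb = symball_subset_ball[OF sub(1)] symball_subset_ball[OF sub(2)]
  have "riesz A' B' C' \<le> riesz (symball A') B' C' + riesz (A' - symball A') B' C'"
    by (intro riesz_Un) auto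
  also have "riesz (A' - symball A') B' C' \<le> ennreal (deficit A') * ennreal M"
    using emeasure_diff_symball(1)[OF \<open>A' \<in> sets borel\<close> sub(1)] m[OF sub(2)]
    by (intro order_trans[OF riesz_le(1)] mult_mono) auto
  also have "riesz (symball A') B' C' \<le> riesz (symball A') (symball B') C' + riesz (symball A') (B' - symball B') C'"
    by (intro riesz_Un) auto
  also have "riesz (symball A') (B' - symball B') C' \<le> ennreal M * ennreal (deficit B')"
    using emeasure_diff_symball(1)[OF \<open>B' \<in> sets borel\<close> sub(2)] m[OF sb(1)]
    by (intro order_trans[OF riesz_le(1)] mult_mono) auto
  also have "riesz (symball A') (symball B') C' \<le> riesz (symball A') (symball B') (symball C') + riesz (symball A') (symball B') (C' - symball C')"
    by (intro riesz_Un) auto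
  also have "riesz (symball A') (symball B') (C' - symball C') \<le> ennreal M * ennreal (deficit C')"
    using emeasure_diff_symball(1)[OF \<open>C' \<in> sets borel\<close> sub(3)] m[OF sb(1)]
    by (intro order_trans[OF riesz_le(2)] mult_mono) auto
  finally have "riesz A' B' C' \<le> riesz (symball A') (symball B') (symball C') + ennreal M * ennreal (deficit C') + ennreal M * ennreal (deficit B') + ennreal (deficit A') * ennreal M"
    by (simp add: add_mono)
  also have "\<dots> = riesz (symball A') (symball B') (symball C') + ennreal (M * (deficit A' + deficit B' + deficit C'))"
    using M by (simp add: ennreal_mult deficit_nonneg distrib_left ac_simps)
  also have "M * (deficit A' + deficit B' + deficit C') \<le> \<epsilon>"
    using i(2) M by (simp add: field_simps less_imp_le)
  finally show "riesz A B C \<le> riesz (symball A) (symball B) (symball C) + ennreal \<epsilon>"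
    using le by (simp add: eq add_mono ennreal_leI order_trans)
qed

end

theorem riesz_rearrangement:
  fixes A B C :: "'a::euclidean_space set"
  assumes [measurable]: "A \<in> sets borel" "B \<in> sets borel" "C \<in> sets borel"
  shows "riesz A B C \<le> riesz (symball A) (symball B) (symball C)"
proof -
  define F where "F n x y = (indicator (A \<inter> ball 0 (real n)) x * indicator (B \<inter> ball 0 (real n)) y * indicator (C \<inter> ball 0 (real n)) (x + y) :: ennreal)" for n x y
  have [measurable]: "ball (0::'a) r \<in> sets borel" for r by simp
  have [measurable]: "(\<lambda>p. F n (f p) (h p)) \<in> borel_measurable M"
    if [measurable]: "f \<in> borel_measurable M" "h \<in> borel_measurable M" for n f h and M :: "'z measure"
    unfolding F_def by measurable
  have mono: "F n x y \<le> F m x y" if "n \<le> m" for n m x y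
    using that by (auto simp: F_def indicator_def)
  have sup: "(SUP n. F n x y) = indicator A x * indicator B y * indicator C (x + y)" for x y
  proof (rule antisym)
    obtain n where n: "norm x + norm y < real n" using reals_Archimedean2 by blast
    have "norm x < real n" "norm y < real n" "norm (x + y) < real n"
      using n norm_triangle_ineq[of x y] norm_ge_zero[of x] norm_ge_zero[of y] by linarith+
    then have "F n x y = indicator A x * indicator B y * indicator C (x + y)"
      by (auto simp: F_def indicator_def)
    then show "indicator A x * indicator B y * indicator C (x + y) \<le> (SUP n. F n x y)"
      by (metis SUP_upper UNIV_I)
  qed (auto intro!: SUP_least simp: F_def indicator_def)
  have "riesz A B C = (\<integral>\<^sup>+x. \<integral>\<^sup>+y. (SUP n. F n x y) \<partial>lborel \<partial>lborel)"
    by (simp add: riesz_def sup)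
  also have "\<dots> = (\<integral>\<^sup>+x. (SUP n. \<integral>\<^sup>+y. F n x y \<partial>lborel) \<partial>lborel)"
    by (intro nn_integral_cong nn_integral_monotone_convergence_SUP) (auto simp: incseq_def le_fun_def mono)
  also have "\<dots> = (SUP n. \<integral>\<^sup>+x. \<integral>\<^sup>+y. F n x y \<partial>lborel \<partial>lborel)"
    by (intro nn_integral_monotone_convergence_SUP) (auto simp: incseq_def le_fun_def intro!: nn_integral_mono mono)
  also have "\<dots> \<le> riesz (symball A) (symball B) (symball C)"
  proof (rule SUP_least)
    fix n
    have "(\<integral>\<^sup>+x. \<integral>\<^sup>+y. F n x y \<partial>lborel \<partial>lborel) = riesz (A \<inter> ball 0 (real n)) (B \<inter> ball 0 (real n)) (C \<inter> ball 0 (real n))"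
      by (simp add: F_def riesz_def)
    \<comment> \<open>The index n may be 0 while \<open>riesz_bounded\<close> needs a positive
      radius.\<close>
    also have "\<dots> \<le> riesz (A \<inter> ball 0 (real n + 1)) (B \<inter> ball 0 (real n + 1)) (C \<inter> ball 0 (real n + 1))"
      by (intro riesz_mono) auto
    also have "\<dots> \<le> riesz (symball (A \<inter> ball 0 (real n + 1))) (symball (B \<inter> ball 0 (real n + 1))) (symball (C \<inter> ball 0 (real n + 1)))"
      by (rule riesz_bounded[where R="real n + 1"]) auto
    also have "\<dots> \<le> riesz (symball A) (symball B) (symball C)"
      by (intro riesz_mono symball_mono emeasure_mono) auto
    finally show "(\<integral>\<^sup>+x. \<integral>\<^sup>+y. F n x y \<partial>lborel \<partial>lborel) \<le> riesz (symball A) (symball B) (symball C)" .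
  qed
  finally show ?thesis .
qed

subsection \<open>Domination of functions\<close>

lemma ennreal_minus_eq_0: "(a::ennreal) \<le> ennreal c \<Longrightarrow> a - ennreal c = 0"
  by (auto simp: diff_eq_0_iff_ennreal intro: le_less_trans)

lemma ennreal_minus_add: "0 \<le> c \<Longrightarrow> ennreal c \<le> a \<Longrightarrow> (a - ennreal c) + ennreal c = a"
  by (cases a) (auto simp: ennreal_minus ennreal_plus[symmetric] simp del: ennreal_plus)

lemma ennreal_le_minus_add: "0 \<le> c \<Longrightarrow> a \<le> (a - ennreal c) + ennreal c"
  by (cases "ennreal c \<le> a") (auto simp: ennreal_minus_add ennreal_minus_eq_0)

lemma ennreal_less_minus_iff: "0 \<le> c \<Longrightarrow> 0 < s \<Longrightarrow> ennreal s < a - ennreal c \<longleftrightarrow> ennreal (c + s) < a"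
  by (cases a) (auto simp: ennreal_minus ennreal_less_iff ennreal_top_minus simp del: ennreal_plus)

section \<open>Level sets and layer-cake integrals\<close>

definition level :: "('a \<Rightarrow> ennreal) \<Rightarrow> real \<Rightarrow> 'a set" where
  "level u t = {x. ennreal t < u x}"

lemma level_sets [measurable, simp]:
  fixes u :: "'a::topological_space \<Rightarrow> ennreal"
  assumes [measurable]: "u \<in> borel_measurable borel"
  shows "level u t \<in> sets borel"
  unfolding level_def by measurable

lemma level_antimono: "s \<le> t \<Longrightarrow> level u t \<subseteq> level u s"
  by (auto simp: level_def intro: le_less_trans ennreal_leI)

lemma layer_cake: "(c::ennreal) = (\<integral>\<^sup>+t. indicator {0<..} t * of_bool (ennreal t < c) \<partial>lborel)"
proof (cases c)
  case (real r)
  have "(\<integral>\<^sup>+t. indicator {0<..} t * of_bool (ennreal t < c) \<partial>lborel) = (\<integral>\<^sup>+t. indicator {0<..<r} t \<partial>lborel)"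
    using real by (intro nn_integral_cong) (auto simp: indicator_def ennreal_less_iff)
  then show ?thesis using real by simp
next
  case top
  have "(\<integral>\<^sup>+t. indicator {0<..} t * of_bool (ennreal t < c) \<partial>lborel) = (\<integral>\<^sup>+t. indicator {0::real<..} t \<partial>lborel)"
    using top by (intro nn_integral_cong) (auto simp: indicator_def)
  moreover have "emeasure lborel {0::real<..} = \<top>"
  proof (cases "emeasure lborel {0::real<..}")
    case (real r)
    have "emeasure lborel {0<..<r + 1} \<le> emeasure lborel {0::real<..}" by (intro emeasure_mono) auto
    then show ?thesis using real by simp
  qed
  ultimately show ?thesis using top by simp
qed

text \<open>Only the second factor is cut into layers; the first stays whole, so that a bound for
  its integrals over sets applies layer by layer.\<close>

lemma nn_integral_layer_cake:
  fixes u w :: "'a::euclidean_space \<Rightarrow> ennreal"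
  assumes [measurable]: "u \<in> borel_measurable borel" "w \<in> borel_measurable borel"
  shows "(\<integral>\<^sup>+x. u x * w x \<partial>lborel) =
    (\<integral>\<^sup>+t. indicator {0<..} t * (\<integral>\<^sup>+x. indicator (level w t) x * u x \<partial>lborel) \<partial>lborel)"
proof -
  have "(\<integral>\<^sup>+x. u x * w x \<partial>lborel) = (\<integral>\<^sup>+x. u x * (\<integral>\<^sup>+t. indicator {0<..} t * of_bool (ennreal t < w x) \<partial>lborel) \<partial>lborel)"
    by (subst layer_cake[symmetric]) simp
  also have "\<dots> = (\<integral>\<^sup>+x. (\<integral>\<^sup>+t. u x * (indicator {0<..} t * of_bool (ennreal t < w x)) \<partial>lborel) \<partial>lborel)"
    by (simp add: nn_integral_cmult)
  also have "\<dots> = (\<integral>\<^sup>+t. (\<integral>\<^sup>+x. u x * (indicator {0<..} t * of_bool (ennreal t < w x)) \<partial>lborel) \<partial>lborel)"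
    by (intro lborel_pair.Fubini'[symmetric]) simp
  also have "\<dots> = (\<integral>\<^sup>+t. (\<integral>\<^sup>+x. indicator {0<..} t * (indicator (level w t) x * u x) \<partial>lborel) \<partial>lborel)"
    by (intro nn_integral_cong) (auto simp: level_def indicator_def)
  also have "\<dots> = (\<integral>\<^sup>+t. indicator {0<..} t * (\<integral>\<^sup>+x. indicator (level w t) x * u x \<partial>lborel) \<partial>lborel)"
    by (simp add: nn_integral_cmult)
  finally show ?thesis .
qed

lemma measurable_level_indicator [measurable]:
  fixes w :: "'a::euclidean_space \<Rightarrow> ennreal"
  assumes [measurable]: "w \<in> borel_measurable borel" "f \<in> borel_measurable M" "g \<in> borel_measurable M"
  shows "(\<lambda>p. indicator (level w (f p)) (g p) :: ennreal) \<in> borel_measurable M"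
proof -
  have "(\<lambda>p. indicator (level w (f p)) (g p) :: ennreal) = (\<lambda>p. of_bool (ennreal (f p) < w (g p)))"
    by (auto simp: level_def indicator_def)
  also have "\<dots> \<in> borel_measurable M" by measurable
  finally show ?thesis .
qed

lemma measurable_emeasure_level [measurable]:
  fixes w :: "'a::euclidean_space \<Rightarrow> ennreal"
  assumes [measurable]: "w \<in> borel_measurable borel" "f \<in> borel_measurable M"
  shows "(\<lambda>p. emeasure lborel (level w (f p))) \<in> borel_measurable M"
proof -
  have "(\<lambda>t. \<integral>\<^sup>+x. indicator (level w t) x \<partial>lborel) \<in> borel_measurable borel"
    by measurable
  then have [measurable]: "(\<lambda>t. emeasure lborel (level w t)) \<in> borel_measurable borel" by simp
  show ?thesis by measurable
qed

lemma measurable_emeasure_ball [measurable]: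
  assumes [measurable]: "g \<in> borel_measurable M"
  shows "(\<lambda>p. emeasure lborel (ball (0::'a::euclidean_space) (norm (g p :: 'a)))) \<in> borel_measurable M"
  by (simp add: emeasure_ball)

lemma measurable_symball_level_indicator [measurable]:
  fixes w :: "'a::euclidean_space \<Rightarrow> ennreal"
  assumes [measurable]: "w \<in> borel_measurable borel" "f \<in> borel_measurable M" "g \<in> borel_measurable M"
  shows "(\<lambda>p. indicator (symball (level w (f p))) (g p) :: ennreal) \<in> borel_measurable M"
proof -
  have "(\<lambda>p. indicator (symball (level w (f p))) (g p) :: ennreal) =
    (\<lambda>p. of_bool (emeasure lborel (ball (0::'a) (norm (g p))) < emeasure lborel (level w (f p))))"
    by (auto simp: symball_def indicator_def)
  also have "\<dots> \<in> borel_measurable M" by measurable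
  finally show ?thesis .
qed

text \<open>For symmetric decreasing v this is weak majorization in the sense of Hardy and
  Littlewood: the mass of u on any set is at most the mass of v on the centred ball of the same
  volume.\<close>

definition prec :: "('a::euclidean_space \<Rightarrow> ennreal) \<Rightarrow> ('a \<Rightarrow> ennreal) \<Rightarrow> bool" where
  "prec u v \<longleftrightarrow> (\<forall>E\<in>sets borel. emeasure lborel E < \<top> \<longrightarrow>
     (\<integral>\<^sup>+x. indicator E x * u x \<partial>lborel) \<le> (\<integral>\<^sup>+x. indicator (symball E) x * v x \<partial>lborel))"

text \<open>The majorant \<open>v\<close> of a dominated pair agrees almost everywhere with a symmetric decreasing
  function; this is what \<open>prec v v\<close> expresses.\<close>

definition dominated :: "('a::euclidean_space \<Rightarrow> ennreal) \<Rightarrow> ('a \<Rightarrow> ennreal) \<Rightarrow> bool" where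
  "dominated u v \<longleftrightarrow> u \<in> borel_measurable borel \<and> v \<in> borel_measurable borel \<and>
     prec u v \<and> prec v v \<and> (\<integral>\<^sup>+x. v x \<partial>lborel) < \<top>"

lemma dominated_refl: "dominated u v \<Longrightarrow> dominated v v"
  by (simp add: dominated_def)

lemma precD: "prec u v \<Longrightarrow> E \<in> sets borel \<Longrightarrow> emeasure lborel E < \<top> \<Longrightarrow>
   (\<integral>\<^sup>+x. indicator E x * u x \<partial>lborel) \<le> (\<integral>\<^sup>+x. indicator (symball E) x * v x \<partial>lborel)"
  by (simp add: prec_def)

lemma nn_integral_split_set:
  fixes v :: "'a::euclidean_space \<Rightarrow> ennreal"
  assumes [measurable]: "v \<in> borel_measurable borel" "G \<in> sets borel" "H \<in> sets borel"
  shows "(\<integral>\<^sup>+x. indicator G x * v x \<partial>lborel) = (\<integral>\<^sup>+x. indicator (G \<inter> H) x * v x \<partial>lborel) + (\<integral>\<^sup>+x. indicator (G - H) x * v x \<partial>lborel)"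
  by (subst nn_integral_add[symmetric]) (auto intro!: nn_integral_cong simp: indicator_def)

lemma emeasure_level_finite:
  fixes v :: "'a::euclidean_space \<Rightarrow> ennreal"
  assumes [measurable]: "v \<in> borel_measurable borel" and "(\<integral>\<^sup>+x. v x \<partial>lborel) < \<top>" "0 < t"
  shows "ennreal t * emeasure lborel (level v t) \<le> (\<integral>\<^sup>+x. v x \<partial>lborel)" "emeasure lborel (level v t) < \<top>"
proof -
  have "ennreal t * emeasure lborel (level v t) = (\<integral>\<^sup>+x. ennreal t * indicator (level v t) x \<partial>lborel)"
    by (simp add: nn_integral_cmult)
  also have "\<dots> \<le> (\<integral>\<^sup>+x. v x \<partial>lborel)"
    by (intro nn_integral_mono) (auto simp: indicator_def level_def less_imp_le)
  finally show *: "ennreal t * emeasure lborel (level v t) \<le> (\<integral>\<^sup>+x. v x \<partial>lborel)" .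
  show "emeasure lborel (level v t) < \<top>"
  proof (rule ccontr)
    assume "\<not> ?thesis"
    then have "emeasure lborel (level v t) = \<top>" by (simp add: less_top[symmetric])
    with * assms show False by (simp add: ennreal_mult_top)
  qed
qed

text \<open>Testing \<open>prec v v\<close> with the level set G compares the mass on G - G* with
  that on G* - G, where G* is the ball. These differences have equal finite volume, but v > c on the
  first and v \<le> c on the second, so both must be null.\<close>

lemma level_AE_symball:
  fixes v :: "'a::euclidean_space \<Rightarrow> ennreal"
  assumes v[measurable]: "v \<in> borel_measurable borel" and "prec v v" and fin: "(\<integral>\<^sup>+x. v x \<partial>lborel) < \<top>"
    and lev: "emeasure lborel (level v c) < \<top>" and c: "0 \<le> c"
  shows "AE x in lborel. x \<in> level v c \<longleftrightarrow> x \<in> symball (level v c)"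
proof -
  define G where "G = level v c"
  have [measurable]: "G \<in> sets borel" "symball G \<in> sets borel" by (simp_all add: G_def)
  have fG: "emeasure lborel G < \<top>" using lev by (simp add: G_def)
  have fI: "emeasure lborel (G \<inter> symball G) < \<top>"
    by (rule le_less_trans[OF emeasure_mono fG]) auto
  have fD: "emeasure lborel (G - symball G) < \<top>"
    by (rule le_less_trans[OF emeasure_mono fG]) auto
  have "emeasure lborel (G \<inter> symball G) + emeasure lborel (G - symball G) = emeasure lborel G"
    by (subst plus_emeasure) (auto intro!: arg_cong2[where f=emeasure])
  also have "\<dots> = emeasure lborel (symball G)" by simp
  also have "\<dots> = emeasure lborel (G \<inter> symball G) + emeasure lborel (symball G - G)"
    by (subst plus_emeasure) (auto simp del: emeasure_symball intro!: arg_cong2[where f=emeasure])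
  finally have eq: "emeasure lborel (G - symball G) = emeasure lborel (symball G - G)"
    using fI by (auto simp: ennreal_add_left_cancel)
  define I where "I = (\<integral>\<^sup>+x. indicator (G \<inter> symball G) x * v x \<partial>lborel)"
  have "I \<le> (\<integral>\<^sup>+x. v x \<partial>lborel)" unfolding I_def by (intro nn_integral_mono) (auto simp: indicator_def)
  then have I: "I < \<top>" using fin by (rule le_less_trans)
  have "I + (\<integral>\<^sup>+x. indicator (G - symball G) x * v x \<partial>lborel) \<le> I + (\<integral>\<^sup>+x. indicator (symball G - G) x * v x \<partial>lborel)"
    using precD[OF assms(2) _ fG] nn_integral_split_set[of v G "symball G"] nn_integral_split_set[of v "symball G" G]
    by (simp add: I_def Int_commute)
  then have "(\<integral>\<^sup>+x. indicator (G - symball G) x * v x \<partial>lborel) \<le> (\<integral>\<^sup>+x. indicator (symball G - G) x * v x \<partial>lborel)"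
    using I by (auto simp: ennreal_add_left_cancel_le)
  also have "\<dots> \<le> (\<integral>\<^sup>+x. ennreal c * indicator (symball G - G) x \<partial>lborel)"
    by (intro nn_integral_mono) (auto simp: indicator_def G_def level_def not_less)
  also have "\<dots> = ennreal c * emeasure lborel (G - symball G)"
    by (simp add: nn_integral_cmult eq)
  finally have le: "(\<integral>\<^sup>+x. indicator (G - symball G) x * v x \<partial>lborel) \<le> ennreal c * emeasure lborel (G - symball G)" .
  have "(\<integral>\<^sup>+x. indicator (G - symball G) x * v x \<partial>lborel) =
     (\<integral>\<^sup>+x. indicator (G - symball G) x * (v x - ennreal c) + ennreal c * indicator (G - symball G) x \<partial>lborel)"
    by (intro nn_integral_cong) (auto simp: indicator_def G_def level_def less_imp_le ennreal_minus_add c)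
  also have "\<dots> = (\<integral>\<^sup>+x. indicator (G - symball G) x * (v x - ennreal c) \<partial>lborel) + ennreal c * emeasure lborel (G - symball G)"
    by (subst nn_integral_add) (auto simp: nn_integral_cmult)
  finally have "ennreal c * emeasure lborel (G - symball G) + (\<integral>\<^sup>+x. indicator (G - symball G) x * (v x - ennreal c) \<partial>lborel) \<le> ennreal c * emeasure lborel (G - symball G) + 0"
    using le by (simp add: add.commute)
  then have "(\<integral>\<^sup>+x. indicator (G - symball G) x * (v x - ennreal c) \<partial>lborel) = 0"
    using fD by (subst (asm) ennreal_add_left_cancel_le) (auto simp: ennreal_mult_eq_top_iff)
  then have "AE x in lborel. indicator (G - symball G) x * (v x - ennreal c) = 0"
    by (subst (asm) nn_integral_0_iff_AE) auto
  then have 1: "AE x in lborel. x \<notin> G - symball G"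
  proof eventually_elim
    case (elim x)
    then show ?case by (auto simp: G_def level_def diff_eq_0_iff_ennreal indicator_def split: if_splits)
  qed
  then have "emeasure lborel (G - symball G) = 0"
    by (subst (asm) AE_iff_measurable[of "G - symball G"]) auto
  then have "emeasure lborel (symball G - G) = 0" using eq by simp
  then have "AE x in lborel. x \<notin> symball G - G"
    by (subst AE_iff_measurable[of "symball G - G"]) auto
  with 1 show ?thesis unfolding G_def[symmetric] by eventually_elim auto
qed

text \<open>Subtraction truncates at 0, so these are the integrals of positive parts, the convex
  test functions of majorization. The test set is {u > c}, cut off by balls to have finite volume:
  on it u - c is the excess itself, while on any set v - c is at most its positive part.\<close>

lemma prec_excess:
  fixes u v :: "'a::euclidean_space \<Rightarrow> ennreal"
  assumes [measurable]: "u \<in> borel_measurable borel" "v \<in> borel_measurable borel" and "prec u v" and c: "0 \<le> c"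
  shows "(\<integral>\<^sup>+x. u x - ennreal c \<partial>lborel) \<le> (\<integral>\<^sup>+x. v x - ennreal c \<partial>lborel)"
proof -
  define E where "E k = level u c \<inter> ball 0 (real k)" for k
  have [measurable]: "E k \<in> sets borel" for k by (simp add: E_def)
  have fE: "emeasure lborel (E k) < \<top>" for k
    using emeasure_bounded_finite[of "E k"] bounded_subset[OF bounded_ball, of "E k" 0 "real k"] by (auto simp: E_def)
  have sup: "(SUP k. indicator (E k) x * (u x - ennreal c)) = u x - ennreal c" for x
  proof (rule antisym)
    obtain k where "norm x < real k" using reals_Archimedean2 by blast
    then have "u x - ennreal c = indicator (E k) x * (u x - ennreal c)"
      by (auto simp: indicator_def E_def level_def not_less ennreal_minus_eq_0)
    then show "u x - ennreal c \<le> (SUP k. indicator (E k) x * (u x - ennreal c))"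
      by (metis SUP_upper UNIV_I)
  qed (auto intro!: SUP_least simp: indicator_def)
  have "(\<integral>\<^sup>+x. u x - ennreal c \<partial>lborel) = (\<integral>\<^sup>+x. (SUP k. indicator (E k) x * (u x - ennreal c)) \<partial>lborel)"
    by (simp add: sup)
  also have "\<dots> = (SUP k. \<integral>\<^sup>+x. indicator (E k) x * (u x - ennreal c) \<partial>lborel)"
    by (intro nn_integral_monotone_convergence_SUP) (auto simp: incseq_def le_fun_def indicator_def E_def)
  also have "\<dots> \<le> (\<integral>\<^sup>+x. v x - ennreal c \<partial>lborel)"
  proof (rule SUP_least)
    fix k
    have "(\<integral>\<^sup>+x. indicator (E k) x * (u x - ennreal c) \<partial>lborel) + ennreal c * emeasure lborel (E k) =
      (\<integral>\<^sup>+x. indicator (E k) x * (u x - ennreal c) + ennreal c * indicator (E k) x \<partial>lborel)"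
      by (subst nn_integral_add) (auto simp: nn_integral_cmult)
    also have "\<dots> = (\<integral>\<^sup>+x. indicator (E k) x * u x \<partial>lborel)"
      by (intro nn_integral_cong) (auto simp: indicator_def E_def level_def less_imp_le ennreal_minus_add c)
    also have "\<dots> \<le> (\<integral>\<^sup>+x. indicator (symball (E k)) x * v x \<partial>lborel)"
      using precD[OF assms(3) _ fE] by simp
    also have "\<dots> \<le> (\<integral>\<^sup>+x. (v x - ennreal c) + ennreal c * indicator (symball (E k)) x \<partial>lborel)"
    proof (rule nn_integral_mono)
      fix x
      have "v x \<le> (v x - ennreal c) + ennreal c" using c by (rule ennreal_le_minus_add)
      then show "indicator (symball (E k)) x * v x \<le> (v x - ennreal c) + ennreal c * indicator (symball (E k)) x"
        by (auto simp: indicator_def)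
    qed
    also have "\<dots> = (\<integral>\<^sup>+x. v x - ennreal c \<partial>lborel) + ennreal c * emeasure lborel (E k)"
      by (subst nn_integral_add) (auto simp: nn_integral_cmult)
    finally have "ennreal c * emeasure lborel (E k) + (\<integral>\<^sup>+x. indicator (E k) x * (u x - ennreal c) \<partial>lborel)
      \<le> ennreal c * emeasure lborel (E k) + (\<integral>\<^sup>+x. v x - ennreal c \<partial>lborel)" by (simp add: add.commute)
    then show "(\<integral>\<^sup>+x. indicator (E k) x * (u x - ennreal c) \<partial>lborel) \<le> (\<integral>\<^sup>+x. v x - ennreal c \<partial>lborel)"
      using fE[of k] by (subst (asm) ennreal_add_left_cancel_le) (auto simp: ennreal_mult_eq_top_iff)
  qed
  finally show ?thesis .
qed

lemma nn_integral_levels_above: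
  fixes w :: "'a::euclidean_space \<Rightarrow> ennreal"
  assumes [measurable]: "w \<in> borel_measurable borel" and c: "0 \<le> c"
  shows "(\<integral>\<^sup>+t. indicator {c<..} t * emeasure lborel (level w t) \<partial>lborel) = (\<integral>\<^sup>+x. w x - ennreal c \<partial>lborel)"
proof -
  have lev: "level (\<lambda>x. w x - ennreal c) s = level w (c + s)" if "0 < s" for s
  proof -
    have "ennreal s < w x - ennreal c \<longleftrightarrow> ennreal (c + s) < w x" for x
      using c that by (rule ennreal_less_minus_iff)
    then show ?thesis by (auto simp: level_def)
  qed
  have "(\<integral>\<^sup>+x. w x - ennreal c \<partial>lborel) = (\<integral>\<^sup>+x. 1 * (w x - ennreal c) \<partial>lborel)" by simp
  also have "\<dots> = (\<integral>\<^sup>+s. indicator {0<..} s * emeasure lborel (level (\<lambda>x. w x - ennreal c) s) \<partial>lborel)"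
    by (subst nn_integral_layer_cake) auto
  also have "\<dots> = (\<integral>\<^sup>+s. indicator {c<..} (c + s) * emeasure lborel (level w (c + s)) \<partial>lborel)"
    using lev by (intro nn_integral_cong) (auto simp: indicator_def)
  also have "\<dots> = (\<integral>\<^sup>+t. indicator {c<..} t * emeasure lborel (level w t) \<partial>lborel)"
    by (rule nn_integral_translate) simp
  finally show ?thesis by simp
qed

text \<open>As balls are nested, the overlap is at most the smaller of the two volumes. With c the
  height at which {w' > c} shrinks to the size of \<open>V\<close>, the bound by \<open>V\<close> is
  used below c and the level volume above it. This gives c times the volume of \<open>V\<close> plus
  an excess integral, which \<open>prec_excess\<close> moves from w to w'; for w' the sum is exactly
  the mass on \<open>V\<close>.\<close>

lemma prec_symball_levels:
  fixes w w' :: "'a::euclidean_space \<Rightarrow> ennreal"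
  assumes "dominated w w'" and V[measurable]: "V \<in> sets borel" "symball V = V" "emeasure lborel V < \<top>"
  shows "(\<integral>\<^sup>+t. indicator {0<..} t * emeasure lborel (symball (level w t) \<inter> V) \<partial>lborel)
    \<le> (\<integral>\<^sup>+x. indicator V x * w' x \<partial>lborel)"
proof (cases "emeasure lborel V = 0")
  case True
  have "emeasure lborel (symball (level w t) \<inter> V) = 0" for t
    using emeasure_mono[of "symball (level w t) \<inter> V" V lborel] True by (simp del: emeasure_symball)
  then show ?thesis by simp
next
  case False
  have [measurable]: "w \<in> borel_measurable borel" "w' \<in> borel_measurable borel" and p: "prec w w'" "prec w' w'"
    and fin: "(\<integral>\<^sup>+x. w' x \<partial>lborel) < \<top>" using assms(1) by (auto simp: dominated_def)
  \<comment> \<open>The infimum of these heights is the critical one, since the volume of a level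
    set decreases with the height.\<close>
  define S where "S = {t. 0 \<le> t \<and> emeasure lborel (level w' t) \<le> emeasure lborel V}"
  have "S \<noteq> {}"
  proof -
    obtain r where r: "(\<integral>\<^sup>+x. w' x \<partial>lborel) = ennreal r" "0 \<le> r" using fin by (cases "\<integral>\<^sup>+x. w' x \<partial>lborel") auto
    obtain q where q: "emeasure lborel V = ennreal q" "0 < q" using False V(3) by (cases "emeasure lborel V") (auto simp: less_le)
    define t where "t = (r + 1) / q"
    have t: "0 < t" using r q by (simp add: t_def)
    obtain l where l: "emeasure lborel (level w' t) = ennreal l" "0 \<le> l"
      using emeasure_level_finite(2)[of w' t] fin t by (cases "emeasure lborel (level w' t)") auto
    have "t * l \<le> r" using emeasure_level_finite(1)[of w' t] fin t r l by (simp add: ennreal_mult[symmetric])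
    then have "(r + 1) * l \<le> r * q" using q by (simp add: t_def field_simps)
    also have "\<dots> \<le> (r + 1) * q" using q by simp
    finally have "l \<le> q" using r by simp
    then show ?thesis using t l q by (auto simp: S_def intro!: exI[of _ t])
  qed
  define c where "c = Inf S"
  have bdd: "bdd_below S" by (auto simp: S_def intro!: bdd_belowI)
  have c: "0 \<le> c" unfolding c_def using \<open>S \<noteq> {}\<close> by (intro cInf_greatest) (auto simp: S_def)
  have levc: "emeasure lborel (level w' c) \<le> emeasure lborel V"
  proof -
    define L where "L n = level w' (c + 1 / Suc n)" for n
    have "level w' c = (\<Union>n. L n)"
    proof (intro equalityI subsetI)
      fix x assume x: "x \<in> level w' c"
      then obtain d where d: "ennreal c < d" "d < w' x" by (auto simp: level_def dest: dense)
      then obtain e where e: "d = ennreal e" "c < e" using c by (cases d) (auto simp: ennreal_less_iff)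
      obtain n where "1 / real (Suc n) < e - c" using e(2) nat_approx_posE[of "e - c"] by auto
      then have "ennreal (c + 1 / Suc n) \<le> d" using e by (auto intro!: ennreal_leI)
      then have "x \<in> L n" using d by (auto simp: L_def level_def)
      then show "x \<in> (\<Union>n. L n)" by blast
    next
      fix x assume "x \<in> (\<Union>n. L n)"
      then obtain n where "x \<in> L n" by blast
      then show "x \<in> level w' c" using level_antimono[of c "c + 1 / Suc n" w'] by (auto simp: L_def)
    qed
    moreover have "emeasure lborel (\<Union>n. L n) = (SUP n. emeasure lborel (L n))"
    proof (rule SUP_emeasure_incseq[symmetric])
      show "incseq L" unfolding incseq_def L_def by (auto intro!: level_antimono simp: field_simps)
    qed (auto simp: L_def)
    moreover have "emeasure lborel (L n) \<le> emeasure lborel V" for n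
    proof -
      obtain s where s: "s \<in> S" "s < c + 1 / Suc n" using cInf_lessD[OF \<open>S \<noteq> {}\<close>, of "c + 1 / Suc n"] by (auto simp: c_def)
      have "emeasure lborel (L n) \<le> emeasure lborel (level w' s)"
        unfolding L_def using s by (intro emeasure_mono level_antimono) auto
      then show ?thesis using s by (auto simp: S_def)
    qed
    ultimately show ?thesis by (simp add: SUP_least)
  qed
  \<comment> \<open>Above height c the function w' lives in \<open>V\<close>, because its level set
    is almost everywhere a ball that is no larger.\<close>
  have out: "AE x in lborel. w' x - ennreal c = indicator V x * (w' x - ennreal c)"
  proof -
    have "AE x in lborel. x \<in> level w' c \<longleftrightarrow> x \<in> symball (level w' c)"
      using p fin c V(3) levc by (intro level_AE_symball) (auto intro: le_less_trans)
    moreover have "symball (level w' c) \<subseteq> V" using symball_mono[OF levc] V(2) by simp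
    ultimately show ?thesis
      by (auto elim!: eventually_mono simp: indicator_def level_def not_less ennreal_minus_eq_0)
  qed
  \<comment> \<open>For each positive height below c the level set contains \<open>V\<close> up to a
    null set that depends on the height. Rational heights leave only countably many of these null
    sets.\<close>
  have inn: "AE x in lborel. x \<in> V \<longrightarrow> ennreal c \<le> w' x"
  proof -
    have less: "AE x in lborel. x \<in> V \<longrightarrow> ennreal t < w' x" if t: "0 < t" "t < c" for t
    proof -
      have "t \<notin> S" using t cInf_lower[OF _ bdd, of t] by (auto simp: c_def)
      then have "emeasure lborel V \<le> emeasure lborel (level w' t)" using t by (auto simp: S_def)
      then have "V \<subseteq> symball (level w' t)" using symball_mono[of V "level w' t"] V(2) by simp
      moreover have "AE x in lborel. x \<in> level w' t \<longleftrightarrow> x \<in> symball (level w' t)"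
        using p fin t emeasure_level_finite(2)[of w' t] by (intro level_AE_symball) auto
      ultimately show ?thesis by (auto elim!: eventually_mono simp: level_def)
    qed
    have "\<forall>q::rat. AE x in lborel. 0 < real_of_rat q \<and> real_of_rat q < c \<longrightarrow> x \<in> V \<longrightarrow> ennreal (real_of_rat q) < w' x"
    proof (intro allI)
      fix q :: rat
      show "AE x in lborel. 0 < real_of_rat q \<and> real_of_rat q < c \<longrightarrow> x \<in> V \<longrightarrow> ennreal (real_of_rat q) < w' x"
      proof (cases "0 < real_of_rat q \<and> real_of_rat q < c")
        case True
        then have "AE x in lborel. x \<in> V \<longrightarrow> ennreal (real_of_rat q) < w' x" by (intro less) auto
        then show ?thesis by eventually_elim simp
      next
        case False
        then show ?thesis by (intro AE_I2) blast
      qed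
    qed
    then have "AE x in lborel. \<forall>q::rat. 0 < real_of_rat q \<and> real_of_rat q < c \<longrightarrow> x \<in> V \<longrightarrow> ennreal (real_of_rat q) < w' x"
      by (subst AE_all_countable) auto
    then show ?thesis
    proof eventually_elim
      case (elim x)
      show ?case
      proof (rule ccontr)
        assume a: "\<not> ?case"
        then obtain r where r: "w' x = ennreal r" "0 \<le> r" "r < c"
          by (cases "w' x") (auto simp: not_le ennreal_less_iff)
        obtain q where q: "r < real_of_rat q" "real_of_rat q < c" using of_rat_dense[OF r(3)] by blast
        have pos: "0 < real_of_rat q" using q r by linarith
        then have "ennreal (real_of_rat q) < w' x" using elim a q by blast
        then show False using q r pos unfolding r(1) by (subst (asm) ennreal_less_iff) auto
      qed
    qed
  qed
  have "(\<integral>\<^sup>+t. indicator {0<..} t * emeasure lborel (symball (level w t) \<inter> V) \<partial>lborel)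
     \<le> (\<integral>\<^sup>+t. indicator {0<..c} t * emeasure lborel V + indicator {c<..} t * emeasure lborel (level w t) \<partial>lborel)"
  proof (rule nn_integral_mono)
    fix t :: real
    have "emeasure lborel (symball (level w t) \<inter> V) \<le> emeasure lborel V"
      "emeasure lborel (symball (level w t) \<inter> V) \<le> emeasure lborel (symball (level w t))"
      by (intro emeasure_mono; auto)+
    then show "indicator {0<..} t * emeasure lborel (symball (level w t) \<inter> V)
      \<le> indicator {0<..c} t * emeasure lborel V + indicator {c<..} t * emeasure lborel (level w t)"
      using c by (auto simp: indicator_def)
  qed
  also have "\<dots> = ennreal c * emeasure lborel V + (\<integral>\<^sup>+x. w x - ennreal c \<partial>lborel)"
    using c by (subst nn_integral_add) (auto simp: nn_integral_multc nn_integral_levels_above)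
  also have "\<dots> \<le> ennreal c * emeasure lborel V + (\<integral>\<^sup>+x. w' x - ennreal c \<partial>lborel)"
    using p c by (intro add_mono prec_excess) auto
  also have "(\<integral>\<^sup>+x. w' x - ennreal c \<partial>lborel) = (\<integral>\<^sup>+x. indicator V x * (w' x - ennreal c) \<partial>lborel)"
    by (rule nn_integral_cong_AE[OF out])
  also have "ennreal c * emeasure lborel V + \<dots> = (\<integral>\<^sup>+x. ennreal c * indicator V x + indicator V x * (w' x - ennreal c) \<partial>lborel)"
    by (subst nn_integral_add) (auto simp: nn_integral_cmult)
  also have "\<dots> = (\<integral>\<^sup>+x. indicator V x * w' x \<partial>lborel)"
    by (rule nn_integral_cong_AE, use inn in eventually_elim) (auto simp: indicator_def)
  finally show ?thesis .
qed

text \<open>Both functions are cut into layers, but one after the other. Cutting w first lets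
  \<open>prec u v\<close> act on each level set; cutting v afterwards turns its level sets into
  fixed balls, on which \<open>prec_symball_levels\<close> replaces the layers of w by w'.\<close>

theorem dominated_product:
  fixes u v w w' :: "'a::euclidean_space \<Rightarrow> ennreal"
  assumes uv: "dominated u v" and w: "dominated w w'"
  shows "(\<integral>\<^sup>+x. u x * w x \<partial>lborel) \<le> (\<integral>\<^sup>+x. v x * w' x \<partial>lborel)"
proof -
  have [measurable]: "w \<in> borel_measurable borel" "w' \<in> borel_measurable borel" and p: "prec w w'" "prec w' w'"
    and fin: "(\<integral>\<^sup>+x. w' x \<partial>lborel) < \<top>" using w by (auto simp: dominated_def)
  have [measurable]: "u \<in> borel_measurable borel" "v \<in> borel_measurable borel" and p': "prec u v" "prec v v"
    and fin': "(\<integral>\<^sup>+x. v x \<partial>lborel) < \<top>" using uv by (auto simp: dominated_def)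
  have finw: "(\<integral>\<^sup>+x. w x \<partial>lborel) < \<top>"
    using prec_excess[OF _ _ p(1), of 0] fin by (auto simp: le_less_trans)
  have "(\<integral>\<^sup>+x. u x * w x \<partial>lborel) = (\<integral>\<^sup>+t. indicator {0<..} t * (\<integral>\<^sup>+x. indicator (level w t) x * u x \<partial>lborel) \<partial>lborel)"
    by (rule nn_integral_layer_cake) auto
  also have "\<dots> \<le> (\<integral>\<^sup>+t. indicator {0<..} t * (\<integral>\<^sup>+x. indicator (symball (level w t)) x * v x \<partial>lborel) \<partial>lborel)"
    using finw by (intro nn_integral_mono) (auto simp: indicator_def[of "{0<..}"] intro!: precD[OF p'(1)] emeasure_level_finite(2))
  also have "\<dots> = (\<integral>\<^sup>+t. indicator {0<..} t * (\<integral>\<^sup>+s. indicator {0<..} s * emeasure lborel (symball (level w t) \<inter> level v s) \<partial>lborel) \<partial>lborel)"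
  proof (rule nn_integral_cong)
    fix t :: real
    have "(\<integral>\<^sup>+x. indicator (symball (level w t)) x * v x \<partial>lborel) =
      (\<integral>\<^sup>+s. indicator {0<..} s * (\<integral>\<^sup>+x. indicator (level v s) x * indicator (symball (level w t)) x \<partial>lborel) \<partial>lborel)"
      by (rule nn_integral_layer_cake) auto
    also have "\<dots> = (\<integral>\<^sup>+s. indicator {0<..} s * emeasure lborel (symball (level w t) \<inter> level v s) \<partial>lborel)"
      by (simp add: indicator_inter_arith[symmetric] Int_commute)
    finally show "indicator {0<..} t * (\<integral>\<^sup>+x. indicator (symball (level w t)) x * v x \<partial>lborel) =
      indicator {0<..} t * (\<integral>\<^sup>+s. indicator {0<..} s * emeasure lborel (symball (level w t) \<inter> level v s) \<partial>lborel)" by simp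
  qed
  also have "\<dots> = (\<integral>\<^sup>+s. indicator {0<..} s * (\<integral>\<^sup>+t. indicator {0<..} t * emeasure lborel (symball (level w t) \<inter> level v s) \<partial>lborel) \<partial>lborel)"
  proof -
    define F where "F s t = emeasure lborel (symball (level w t) \<inter> level v s)" for s t
    have F: "F s t = (\<integral>\<^sup>+x. indicator (symball (level w t)) x * indicator (level v s) x \<partial>lborel)" for s t
      by (simp add: F_def indicator_inter_arith[symmetric])
    have [measurable]: "(\<lambda>p. F (f p) (g p)) \<in> borel_measurable M" if [measurable]: "f \<in> borel_measurable M" "g \<in> borel_measurable M" for f g and M :: "'z measure"
      unfolding F by measurable
    have "(\<integral>\<^sup>+t. indicator {0<..} t * (\<integral>\<^sup>+s. indicator {0<..} s * F s t \<partial>lborel) \<partial>lborel) = (\<integral>\<^sup>+t. (\<integral>\<^sup>+s. indicator {0<..} t * (indicator {0<..} s * F s t) \<partial>lborel) \<partial>lborel)"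
      by (simp add: nn_integral_cmult)
    also have "\<dots> = (\<integral>\<^sup>+s. (\<integral>\<^sup>+t. indicator {0<..} t * (indicator {0<..} s * F s t) \<partial>lborel) \<partial>lborel)"
      by (rule lborel_pair.Fubini') simp
    also have "\<dots> = (\<integral>\<^sup>+s. (\<integral>\<^sup>+t. indicator {0<..} s * (indicator {0<..} t * F s t) \<partial>lborel) \<partial>lborel)"
      by (simp add: ac_simps)
    also have "\<dots> = (\<integral>\<^sup>+s. indicator {0<..} s * (\<integral>\<^sup>+t. indicator {0<..} t * F s t \<partial>lborel) \<partial>lborel)"
      by (simp add: nn_integral_cmult)
    finally show ?thesis unfolding F_def .
  qed
  also have "\<dots> \<le> (\<integral>\<^sup>+s. indicator {0<..} s * (\<integral>\<^sup>+x. indicator (level v s) x * w' x \<partial>lborel) \<partial>lborel)"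
  proof (rule nn_integral_mono)
    fix s :: real
    show "indicator {0<..} s * (\<integral>\<^sup>+t. indicator {0<..} t * emeasure lborel (symball (level w t) \<inter> level v s) \<partial>lborel)
      \<le> indicator {0<..} s * (\<integral>\<^sup>+x. indicator (level v s) x * w' x \<partial>lborel)"
    proof (cases "0 < s")
      case True
      have fs: "emeasure lborel (level v s) < \<top>" using fin' True by (intro emeasure_level_finite) auto
      \<comment> \<open>This is where self-domination of v enters: its level sets may be exchanged
        for balls without changing overlaps.\<close>
      have ae: "AE x in lborel. x \<in> level v s \<longleftrightarrow> x \<in> symball (level v s)"
        using p' fin' True fs by (intro level_AE_symball) auto
      have "(\<integral>\<^sup>+t. indicator {0<..} t * emeasure lborel (symball (level w t) \<inter> level v s) \<partial>lborel) =
        (\<integral>\<^sup>+t. indicator {0<..} t * emeasure lborel (symball (level w t) \<inter> symball (level v s)) \<partial>lborel)"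
        by (intro nn_integral_cong arg_cong2[where f="(*)"] refl emeasure_eq_AE) (use ae in \<open>auto elim: eventually_mono\<close>)
      also have "\<dots> \<le> (\<integral>\<^sup>+x. indicator (symball (level v s)) x * w' x \<partial>lborel)"
        using w fs by (intro prec_symball_levels) auto
      also have "\<dots> = (\<integral>\<^sup>+x. indicator (level v s) x * w' x \<partial>lborel)"
        by (rule nn_integral_cong_AE, use ae in eventually_elim) (auto simp: indicator_def)
      finally show ?thesis using True by simp
    qed simp
  qed
  also have "\<dots> = (\<integral>\<^sup>+x. w' x * v x \<partial>lborel)"
    by (rule nn_integral_layer_cake[symmetric]) auto
  finally show ?thesis by (simp add: mult.commute)
qed

text \<open>A description by level sets at real heights, which determine a function with values in
  the extended half-line. The agreement with the definition of the rearrangement by norms and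
  one-sided limits is \<open>symm_decr_rearrangement_eq\<close>.\<close>

definition is_rearr :: "('a::euclidean_space \<Rightarrow> ennreal) \<Rightarrow> ('a \<Rightarrow> ennreal) \<Rightarrow> bool" where
  "is_rearr f g \<longleftrightarrow> f \<in> borel_measurable borel \<and> g \<in> borel_measurable borel \<and> (\<forall>t\<ge>0. level g t = symball (level f t))"

lemma is_rearr_refl: "is_rearr f g \<Longrightarrow> is_rearr g g"
  by (simp add: is_rearr_def)

text \<open>Cut f into layers. The ball belonging to the intersection of \<open>E\<close> with {f >
  t} lies in the ball of \<open>E\<close> and in {g > t}, so the product is handled one height at a
  time.\<close>

lemma prec_mult:
  assumes "prec u v" "is_rearr f g" and [measurable]: "u \<in> borel_measurable borel" "v \<in> borel_measurable borel"
  shows "prec (\<lambda>x. f x * u x) (\<lambda>x. g x * v x)"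
  unfolding prec_def
proof safe
  fix E :: "'a set" assume E[measurable]: "E \<in> sets borel" and fE: "emeasure lborel E < \<top>"
  have [measurable]: "f \<in> borel_measurable borel" "g \<in> borel_measurable borel" and lev: "\<And>t. 0 \<le> t \<Longrightarrow> level g t = symball (level f t)"
    using assms(2) by (auto simp: is_rearr_def)
  have "(\<integral>\<^sup>+x. indicator E x * (f x * u x) \<partial>lborel) = (\<integral>\<^sup>+x. (indicator E x * u x) * f x \<partial>lborel)"
    by (simp add: ac_simps)
  also have "\<dots> = (\<integral>\<^sup>+t. indicator {0<..} t * (\<integral>\<^sup>+x. indicator (level f t) x * (indicator E x * u x) \<partial>lborel) \<partial>lborel)"
    by (rule nn_integral_layer_cake) auto
  also have "\<dots> = (\<integral>\<^sup>+t. indicator {0<..} t * (\<integral>\<^sup>+x. indicator (E \<inter> level f t) x * u x \<partial>lborel) \<partial>lborel)"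
    by (simp add: indicator_inter_arith ac_simps)
  also have "\<dots> \<le> (\<integral>\<^sup>+t. indicator {0<..} t * (\<integral>\<^sup>+x. indicator (symball E \<inter> level g t) x * v x \<partial>lborel) \<partial>lborel)"
  proof (rule nn_integral_mono)
    fix t :: real
    show "indicator {0<..} t * (\<integral>\<^sup>+x. indicator (E \<inter> level f t) x * u x \<partial>lborel) \<le> indicator {0<..} t * (\<integral>\<^sup>+x. indicator (symball E \<inter> level g t) x * v x \<partial>lborel)"
    proof (cases "0 < t")
      case True
      have le: "emeasure lborel (E \<inter> level f t) \<le> emeasure lborel E" "emeasure lborel (E \<inter> level f t) \<le> emeasure lborel (level f t)" by (intro emeasure_mono; auto)+
      have "(\<integral>\<^sup>+x. indicator (E \<inter> level f t) x * u x \<partial>lborel) \<le> (\<integral>\<^sup>+x. indicator (symball (E \<inter> level f t)) x * v x \<partial>lborel)"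
        using le(1) fE by (intro precD[OF assms(1)]) (auto intro: le_less_trans)
      also have "\<dots> \<le> (\<integral>\<^sup>+x. indicator (symball E \<inter> level g t) x * v x \<partial>lborel)"
        using symball_mono[OF le(1)] symball_mono[OF le(2)] True lev[of t]
        by (intro nn_integral_mono mult_right_mono) (auto simp: indicator_def)
      finally show ?thesis using True by simp
    qed simp
  qed
  also have "\<dots> = (\<integral>\<^sup>+t. indicator {0<..} t * (\<integral>\<^sup>+x. indicator (level g t) x * (indicator (symball E) x * v x) \<partial>lborel) \<partial>lborel)"
    by (simp add: indicator_inter_arith ac_simps)
  also have "\<dots> = (\<integral>\<^sup>+x. (indicator (symball E) x * v x) * g x \<partial>lborel)"
    by (rule nn_integral_layer_cake[symmetric]) auto
  finally show "(\<integral>\<^sup>+x. indicator E x * (f x * u x) \<partial>lborel) \<le> (\<integral>\<^sup>+x. indicator (symball E) x * (g x * v x) \<partial>lborel)"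
    by (simp add: ac_simps)
qed

lemma is_rearr_bounded:
  assumes "is_rearr f g" "\<And>x. f x \<le> ennreal c" "0 \<le> c"
  shows "g x \<le> ennreal c"
proof -
  have "level f c = {}" using assms(2) by (auto simp: level_def not_less)
  then have "level g c = {}" using assms by (simp add: is_rearr_def symball_def)
  then show ?thesis by (auto simp: level_def not_less)
qed

text \<open>The bound c keeps the integral of the majorant finite, as \<open>dominated\<close>
  demands.\<close>

lemma dominated_mult:
  assumes uv: "dominated u v" and fg: "is_rearr f g" and bd: "\<And>x. f x \<le> ennreal c" "0 \<le> c"
  shows "dominated (\<lambda>x. f x * u x) (\<lambda>x. g x * v x)"
proof -
  have [measurable]: "u \<in> borel_measurable borel" "v \<in> borel_measurable borel" and p': "prec u v" "prec v v"
    and fin': "(\<integral>\<^sup>+x. v x \<partial>lborel) < \<top>" using uv by (auto simp: dominated_def)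
  have [measurable]: "f \<in> borel_measurable borel" "g \<in> borel_measurable borel" using fg by (auto simp: is_rearr_def)
  have "(\<integral>\<^sup>+x. g x * v x \<partial>lborel) \<le> (\<integral>\<^sup>+x. ennreal c * v x \<partial>lborel)"
    using is_rearr_bounded[OF fg bd] by (intro nn_integral_mono mult_right_mono) auto
  also have "\<dots> < \<top>" using fin' by (simp add: nn_integral_cmult ennreal_mult_less_top)
  finally show ?thesis unfolding dominated_def
    using prec_mult[OF p'(1) fg] prec_mult[OF p'(2) is_rearr_refl[OF fg]] by simp
qed

section \<open>Overlaps and convolutions\<close>

definition shifted_overlap :: "'a::euclidean_space set \<Rightarrow> 'a set \<Rightarrow> 'a \<Rightarrow> ennreal" where
  "shifted_overlap F E x = (\<integral>\<^sup>+y. indicator F y * indicator E (x + y) \<partial>lborel)"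

lemma shifted_overlap_measurable [measurable]:
  assumes [measurable]: "F \<in> sets borel" "E \<in> sets borel"
  shows "shifted_overlap F E \<in> borel_measurable borel"
  unfolding shifted_overlap_def[abs_def] by measurable

text \<open>When the densities are the indicators of a set and of its ball, this is the Riesz
  inequality. Integrating the overlap against a law lets an arbitrary measure, atoms included, play
  the part of the third set.\<close>

definition riesz_le_measure :: "'a::euclidean_space measure \<Rightarrow> 'a measure \<Rightarrow> bool" where
  "riesz_le_measure \<mu> \<rho> \<longleftrightarrow> (\<forall>F\<in>sets borel. \<forall>E\<in>sets borel. emeasure lborel F < \<top> \<longrightarrow> emeasure lborel E < \<top> \<longrightarrow>
     (\<integral>\<^sup>+x. shifted_overlap F E x \<partial>\<mu>) \<le> (\<integral>\<^sup>+x. shifted_overlap (symball F) (symball E) x \<partial>\<rho>))"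

text \<open>By Fubini the integral over F of the function on the left is the overlap of E and F
  averaged over \<mu>, so domination of laws turns into domination of functions.\<close>

lemma dominated_reflected_indicator:
  fixes E :: "'a::euclidean_space set"
  assumes "prob_space \<mu>" "prob_space \<rho>" and [measurable_cong]: "sets \<mu> = sets borel" "sets \<rho> = sets borel"
    and le: "riesz_le_measure \<mu> \<rho>" "riesz_le_measure \<rho> \<rho>" and E[measurable]: "E \<in> sets borel" and fE: "emeasure lborel E < \<top>"
  shows "dominated (\<lambda>z. \<integral>\<^sup>+x. indicator E (z - x) \<partial>\<mu>) (\<lambda>z. \<integral>\<^sup>+x. indicator (symball E) (z - x) \<partial>\<rho>)"
proof -
  interpret \<mu>: prob_space \<mu> by fact
  interpret \<rho>: prob_space \<rho> by fact
  have swap: "(\<integral>\<^sup>+z. indicator F z * (\<integral>\<^sup>+x. indicator E (z - x) \<partial>\<mu>) \<partial>lborel) = (\<integral>\<^sup>+x. shifted_overlap E F x \<partial>\<mu>)"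
    if "prob_space \<mu>" and [measurable_cong]: "sets \<mu> = sets borel" and [measurable]: "E \<in> sets borel" "F \<in> sets borel" for E F :: "'a set" and \<mu>
  proof -
    interpret m: prob_space \<mu> by fact
    interpret pair_sigma_finite lborel \<mu> ..
    have "(\<integral>\<^sup>+z. indicator F z * (\<integral>\<^sup>+x. indicator E (z - x) \<partial>\<mu>) \<partial>lborel) = (\<integral>\<^sup>+z. \<integral>\<^sup>+x. indicator F z * indicator E (z - x) \<partial>\<mu> \<partial>lborel)"
      by (simp add: nn_integral_cmult)
    also have "\<dots> = (\<integral>\<^sup>+x. \<integral>\<^sup>+z. indicator F z * indicator E (z - x) \<partial>lborel \<partial>\<mu>)"
      by (rule Fubini'[symmetric]) measurable
    also have "\<dots> = (\<integral>\<^sup>+x. shifted_overlap E F x \<partial>\<mu>)"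
    proof (rule nn_integral_cong)
      fix x
      show "(\<integral>\<^sup>+z. indicator F z * indicator E (z - x) \<partial>lborel) = shifted_overlap E F x"
        unfolding shifted_overlap_def
        by (subst nn_integral_translate[of "\<lambda>z. indicator F z * indicator E (z - x)" x, symmetric])
           (auto simp: mult.commute)
    qed
    finally show ?thesis .
  qed
  have pr: "prec (\<lambda>z. \<integral>\<^sup>+x. indicator E (z - x) \<partial>\<mu>) (\<lambda>z. \<integral>\<^sup>+x. indicator (symball E) (z - x) \<partial>\<rho>)"
    if "prob_space \<mu>" and [measurable_cong]: "sets \<mu> = sets borel" and [measurable]: "E \<in> sets borel" and "emeasure lborel E < \<top>" "riesz_le_measure \<mu> \<rho>" for \<mu> and E :: "'a set"
    unfolding prec_def using that assms(2,4)
    by (auto simp: swap riesz_le_measure_def)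
  interpret pair_sigma_finite lborel \<rho> ..
  have "(\<integral>\<^sup>+z. \<integral>\<^sup>+x. indicator (symball E) (z - x) \<partial>\<rho> \<partial>lborel) = (\<integral>\<^sup>+x. \<integral>\<^sup>+z. indicator (symball E) (z - x) \<partial>lborel \<partial>\<rho>)"
    by (rule Fubini'[symmetric]) measurable
  also have "\<dots> = (\<integral>\<^sup>+x. emeasure lborel E \<partial>\<rho>)"
  proof (rule nn_integral_cong)
    fix x
    have "(\<integral>\<^sup>+z. indicator (symball E) (z - x) \<partial>lborel) = (\<integral>\<^sup>+z. indicator (symball E) z \<partial>lborel)"
      using nn_integral_translate[of "indicator (symball E)" "- x"] by simp
    then show "(\<integral>\<^sup>+z. indicator (symball E) (z - x) \<partial>lborel) = emeasure lborel E" by simp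
  qed
  also have "\<dots> < \<top>" using fE by (simp add: \<rho>.emeasure_space_1)
  finally show ?thesis
    unfolding dominated_def using pr[OF assms(1,3) E fE le(1)] pr[OF assms(2,4) sets_symball[of E], OF _ le(2)] fE
    by simp
qed

text \<open>A substitution moves the convolution from u onto the indicator of the test set. The
  reflected indicator is dominated by the previous lemma, and \<open>dominated_product\<close>
  finishes.\<close>

lemma prec_convolution:
  fixes u v :: "'a::euclidean_space \<Rightarrow> ennreal"
  assumes "prob_space \<mu>" "prob_space \<rho>" and [measurable_cong]: "sets \<mu> = sets borel" "sets \<rho> = sets borel"
    and le: "riesz_le_measure \<mu> \<rho>" "riesz_le_measure \<rho> \<rho>" and uv: "dominated u v"
  shows "prec (\<lambda>y. \<integral>\<^sup>+x. u (y + x) \<partial>\<mu>) (\<lambda>y. \<integral>\<^sup>+x. v (y + x) \<partial>\<rho>)"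
  unfolding prec_def
proof safe
  fix E :: "'a set" assume E[measurable]: "E \<in> sets borel" and fE: "emeasure lborel E < \<top>"
  have [measurable]: "u \<in> borel_measurable borel" "v \<in> borel_measurable borel" using uv by (auto simp: dominated_def)
  have swap: "(\<integral>\<^sup>+y. indicator E y * (\<integral>\<^sup>+x. u (y + x) \<partial>\<mu>) \<partial>lborel) = (\<integral>\<^sup>+z. u z * (\<integral>\<^sup>+x. indicator E (z - x) \<partial>\<mu>) \<partial>lborel)"
    if "prob_space \<mu>" and [measurable_cong]: "sets \<mu> = sets borel" and [measurable]: "E \<in> sets borel" "u \<in> borel_measurable borel" for E :: "'a set" and u and \<mu>
  proof -
    interpret \<mu>: prob_space \<mu> by fact
    interpret pair_sigma_finite lborel \<mu> ..
    have "(\<integral>\<^sup>+y. indicator E y * (\<integral>\<^sup>+x. u (y + x) \<partial>\<mu>) \<partial>lborel) = (\<integral>\<^sup>+y. \<integral>\<^sup>+x. indicator E y * u (y + x) \<partial>\<mu> \<partial>lborel)"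
      by (simp add: nn_integral_cmult)
    also have "\<dots> = (\<integral>\<^sup>+x. \<integral>\<^sup>+y. indicator E y * u (y + x) \<partial>lborel \<partial>\<mu>)"
      by (rule Fubini'[symmetric]) measurable
    also have "\<dots> = (\<integral>\<^sup>+x. \<integral>\<^sup>+z. u z * indicator E (z - x) \<partial>lborel \<partial>\<mu>)"
    proof (rule nn_integral_cong)
      fix x
      show "(\<integral>\<^sup>+y. indicator E y * u (y + x) \<partial>lborel) = (\<integral>\<^sup>+z. u z * indicator E (z - x) \<partial>lborel)"
        by (subst nn_integral_translate[of "\<lambda>z. u z * indicator E (z - x)" x, symmetric])
           (auto simp: mult.commute add.commute)
    qed
    also have "\<dots> = (\<integral>\<^sup>+z. \<integral>\<^sup>+x. u z * indicator E (z - x) \<partial>\<mu> \<partial>lborel)"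
      by (rule Fubini') measurable
    also have "\<dots> = (\<integral>\<^sup>+z. u z * (\<integral>\<^sup>+x. indicator E (z - x) \<partial>\<mu>) \<partial>lborel)"
      by (simp add: nn_integral_cmult)
    finally show ?thesis .
  qed
  show "(\<integral>\<^sup>+y. indicator E y * (\<integral>\<^sup>+x. u (y + x) \<partial>\<mu>) \<partial>lborel) \<le> (\<integral>\<^sup>+y. indicator (symball E) y * (\<integral>\<^sup>+x. v (y + x) \<partial>\<rho>) \<partial>lborel)"
    using dominated_product[OF uv dominated_reflected_indicator[OF assms(1-6) E fE]] assms(1-4)
    by (simp add: swap)
qed

theorem dominated_convolution:
  fixes u v :: "'a::euclidean_space \<Rightarrow> ennreal"
  assumes "prob_space \<mu>" "prob_space \<rho>" and [measurable_cong]: "sets \<mu> = sets borel" "sets \<rho> = sets borel"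
    and le: "riesz_le_measure \<mu> \<rho>" "riesz_le_measure \<rho> \<rho>" and uv: "dominated u v"
  shows "dominated (\<lambda>y. \<integral>\<^sup>+x. u (y + x) \<partial>\<mu>) (\<lambda>y. \<integral>\<^sup>+x. v (y + x) \<partial>\<rho>)"
proof -
  interpret \<mu>: prob_space \<mu> by fact
  interpret \<rho>: prob_space \<rho> by fact
  interpret pair_sigma_finite lborel \<rho> ..
  have [measurable]: "u \<in> borel_measurable borel" "v \<in> borel_measurable borel" and fin: "(\<integral>\<^sup>+x. v x \<partial>lborel) < \<top>"
    using uv by (auto simp: dominated_def)
  have "(\<integral>\<^sup>+y. \<integral>\<^sup>+x. v (y + x) \<partial>\<rho> \<partial>lborel) = (\<integral>\<^sup>+x. \<integral>\<^sup>+y. v (y + x) \<partial>lborel \<partial>\<rho>)"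
    by (rule Fubini'[symmetric]) measurable
  also have "\<dots> = (\<integral>\<^sup>+x. (\<integral>\<^sup>+y. v y \<partial>lborel) \<partial>\<rho>)"
    using nn_integral_translate[of v] by (simp add: add.commute)
  also have "\<dots> < \<top>" using fin by (simp add: \<rho>.emeasure_space_1)
  finally show ?thesis
    unfolding dominated_def using prec_convolution[OF assms(1-6) uv] prec_convolution[OF assms(2,2,4,4) le(2,2) dominated_refl[OF uv]]
    by simp
qed

text \<open>The overlap against a convolution is the integral over F of the indicator of E averaged
  over both laws. Starting from the dominated indicator, each law is one application of
  \<open>dominated_convolution\<close>.\<close>

lemma riesz_le_convolution:
  fixes \<mu>1 \<mu>2 \<rho>1 \<rho>2 :: "'a::euclidean_space measure"
  assumes "prob_space \<mu>1" "prob_space \<rho>1" and [measurable_cong]: "sets \<mu>1 = sets borel" "sets \<rho>1 = sets borel"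
    and le1: "riesz_le_measure \<mu>1 \<rho>1" "riesz_le_measure \<rho>1 \<rho>1"
    and "prob_space \<mu>2" "prob_space \<rho>2" and [measurable_cong]: "sets \<mu>2 = sets borel" "sets \<rho>2 = sets borel"
    and le2: "riesz_le_measure \<mu>2 \<rho>2" "riesz_le_measure \<rho>2 \<rho>2"
  shows "riesz_le_measure (distr (\<mu>1 \<Otimes>\<^sub>M \<mu>2) borel (\<lambda>(x, y). x + y)) (distr (\<rho>1 \<Otimes>\<^sub>M \<rho>2) borel (\<lambda>(x, y). x + y))"
  unfolding riesz_le_measure_def
proof safe
  fix F E :: "'a set" assume [measurable]: "F \<in> sets borel" "E \<in> sets borel" and fin: "emeasure lborel F < \<top>" "emeasure lborel E < \<top>"
  have eq: "(\<integral>\<^sup>+x. shifted_overlap F E x \<partial>distr (\<mu>1 \<Otimes>\<^sub>M \<mu>2) borel (\<lambda>(x, y). x + y)) =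
    (\<integral>\<^sup>+y. indicator F y * (\<integral>\<^sup>+x1. (\<integral>\<^sup>+x2. indicator E ((y + x1) + x2) \<partial>\<mu>2) \<partial>\<mu>1) \<partial>lborel)"
    if "prob_space \<mu>1" "prob_space \<mu>2" and [measurable_cong]: "sets \<mu>1 = sets borel" "sets \<mu>2 = sets borel" and [measurable]: "F \<in> sets borel" "E \<in> sets borel"
    for \<mu>1 \<mu>2 and F E :: "'a set"
  proof -
    interpret m1: prob_space \<mu>1 by fact
    interpret m2: prob_space \<mu>2 by fact
    interpret p1: pair_sigma_finite lborel \<mu>1 ..
    interpret p2: pair_sigma_finite lborel \<mu>2 ..
    have "(\<integral>\<^sup>+x. shifted_overlap F E x \<partial>distr (\<mu>1 \<Otimes>\<^sub>M \<mu>2) borel (\<lambda>(x, y). x + y)) = (\<integral>\<^sup>+x1. \<integral>\<^sup>+x2. shifted_overlap F E (x1 + x2) \<partial>\<mu>2 \<partial>\<mu>1)"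
      by (subst nn_integral_distr) (auto simp: m2.nn_integral_fst[symmetric])
    also have "\<dots> = (\<integral>\<^sup>+x1. \<integral>\<^sup>+y. \<integral>\<^sup>+x2. indicator F y * indicator E (x1 + x2 + y) \<partial>\<mu>2 \<partial>lborel \<partial>\<mu>1)"
      unfolding shifted_overlap_def by (intro nn_integral_cong p2.Fubini') measurable
    also have "\<dots> = (\<integral>\<^sup>+y. \<integral>\<^sup>+x1. \<integral>\<^sup>+x2. indicator F y * indicator E (x1 + x2 + y) \<partial>\<mu>2 \<partial>\<mu>1 \<partial>lborel)"
      by (rule p1.Fubini') measurable
    also have "\<dots> = (\<integral>\<^sup>+y. indicator F y * (\<integral>\<^sup>+x1. (\<integral>\<^sup>+x2. indicator E ((y + x1) + x2) \<partial>\<mu>2) \<partial>\<mu>1) \<partial>lborel)"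
      by (simp add: nn_integral_cmult ac_simps)
    finally show ?thesis .
  qed
  have "dominated (indicator E) (indicator (symball E))"
  proof -
    have pr: "prec (indicator E) (indicator (symball E))" if [measurable]: "E \<in> sets borel" for E :: "'a set"
      unfolding prec_def
    proof safe
      fix G :: "'a set" assume [measurable]: "G \<in> sets borel"
      \<comment> \<open>Centred balls are nested, so the intersection of two of them is the smaller
        one.\<close>
      have "symball G \<inter> symball E = symball G \<or> symball G \<inter> symball E = symball E"
        using linear[of "emeasure lborel G" "emeasure lborel E"] symball_mono[of G E] symball_mono[of E G] by blast
      moreover have "emeasure lborel (G \<inter> E) \<le> emeasure lborel G" "emeasure lborel (G \<inter> E) \<le> emeasure lborel E"
        by (intro emeasure_mono; auto)+
      ultimately have "emeasure lborel (G \<inter> E) \<le> emeasure lborel (symball G \<inter> symball E)"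
        by (metis emeasure_symball)
      then show "(\<integral>\<^sup>+x. indicator G x * indicator E x \<partial>lborel) \<le> (\<integral>\<^sup>+x. indicator (symball G) x * indicator (symball E) x \<partial>lborel)"
        by (simp add: indicator_inter_arith[symmetric] del: emeasure_symball)
    qed
    show ?thesis unfolding dominated_def using pr[of E] pr[of "symball E"] fin by simp
  qed
  from dominated_convolution[OF assms(7-12) this]
  have "dominated (\<lambda>y. \<integral>\<^sup>+x2. indicator E (y + x2) \<partial>\<mu>2) (\<lambda>y. \<integral>\<^sup>+x2. indicator (symball E) (y + x2) \<partial>\<rho>2)" .
  from dominated_convolution[OF assms(1-6) this]
  have "prec (\<lambda>y. \<integral>\<^sup>+x1. \<integral>\<^sup>+x2. indicator E (y + x1 + x2) \<partial>\<mu>2 \<partial>\<mu>1) (\<lambda>y. \<integral>\<^sup>+x1. \<integral>\<^sup>+x2. indicator (symball E) (y + x1 + x2) \<partial>\<rho>2 \<partial>\<rho>1)"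
    by (simp add: dominated_def)
  from precD[OF this _ fin(1)]
  show "(\<integral>\<^sup>+x. shifted_overlap F E x \<partial>distr (\<mu>1 \<Otimes>\<^sub>M \<mu>2) borel (\<lambda>(x, y). x + y)) \<le>
    (\<integral>\<^sup>+x. shifted_overlap (symball F) (symball E) x \<partial>distr (\<rho>1 \<Otimes>\<^sub>M \<rho>2) borel (\<lambda>(x, y). x + y))"
    using assms by (simp add: eq)
qed

subsection \<open>Domination of probability measures\<close>

definition law_dominated :: "'a::euclidean_space measure \<Rightarrow> 'a measure \<Rightarrow> bool" where
  "law_dominated \<mu> \<rho> \<longleftrightarrow> prob_space \<mu> \<and> prob_space \<rho> \<and> sets \<mu> = sets borel \<and> sets \<rho> = sets borel \<and>
     riesz_le_measure \<mu> \<rho> \<and> riesz_le_measure \<rho> \<rho>"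

definition charf :: "'a::euclidean_space measure \<Rightarrow> 'a \<Rightarrow> complex" where
  "charf \<mu> \<xi> = (LINT x|\<mu>. iexp (\<xi> \<bullet> x))"

definition conv :: "'a::euclidean_space measure \<Rightarrow> 'a measure \<Rightarrow> 'a measure" where
  "conv \<mu> \<nu> = distr (\<mu> \<Otimes>\<^sub>M \<nu>) borel (\<lambda>(x, y). x + y)"

lemma law_dominated_refl: "law_dominated \<mu> \<rho> \<Longrightarrow> law_dominated \<rho> \<rho>"
  by (simp add: law_dominated_def)

lemma sets_conv [simp, measurable_cong]: "sets (conv \<mu> \<nu>) = sets borel"
  by (simp add: conv_def)

lemma prob_space_conv:
  assumes "prob_space \<mu>" "prob_space \<nu>" and [measurable_cong]: "sets \<mu> = sets borel" "sets \<nu> = sets borel"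
  shows "prob_space (conv \<mu> \<nu>)"
proof -
  interpret m: prob_space \<mu> by fact
  interpret n: prob_space \<nu> by fact
  interpret pair_prob_space \<mu> \<nu> ..
  show ?thesis unfolding conv_def by (rule P.prob_space_distr) measurable
qed

lemma law_dominated_conv: "law_dominated \<mu>1 \<rho>1 \<Longrightarrow> law_dominated \<mu>2 \<rho>2 \<Longrightarrow> law_dominated (conv \<mu>1 \<mu>2) (conv \<rho>1 \<rho>2)"
  unfolding law_dominated_def by (auto simp: prob_space_conv) (auto simp: conv_def intro!: riesz_le_convolution)

lemma nn_integral_conv:
  assumes "prob_space \<mu>" "prob_space \<nu>" and [measurable_cong]: "sets \<mu> = sets borel" "sets \<nu> = sets borel"
    and [measurable]: "h \<in> borel_measurable borel"
  shows "(\<integral>\<^sup>+x. h x \<partial>conv \<mu> \<nu>) = (\<integral>\<^sup>+x. \<integral>\<^sup>+y. h (x + y) \<partial>\<nu> \<partial>\<mu>)"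
proof -
  interpret n: prob_space \<nu> by fact
  show ?thesis unfolding conv_def
    by (subst nn_integral_distr) (auto simp: n.nn_integral_fst[symmetric])
qed

lemma charf_le_1:
  assumes "prob_space \<mu>" and [measurable_cong]: "sets \<mu> = sets borel"
  shows "norm (charf \<mu> \<xi>) \<le> 1"
proof -
  interpret prob_space \<mu> by fact
  have "norm (charf \<mu> \<xi>) \<le> (LINT x|\<mu>. norm (iexp (\<xi> \<bullet> x)))" unfolding charf_def by (rule integral_norm_bound)
  also have "\<dots> = 1" by (simp add: prob_space)
  finally show ?thesis .
qed

lemma charf_conv:
  assumes "prob_space \<mu>" "prob_space \<nu>" and [measurable_cong]: "sets \<mu> = sets borel" "sets \<nu> = sets borel"
  shows "charf (conv \<mu> \<nu>) \<xi> = charf \<mu> \<xi> * charf \<nu> \<xi>"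
proof -
  interpret m: prob_space \<mu> by fact
  interpret n: prob_space \<nu> by fact
  interpret pair_prob_space \<mu> \<nu> ..
  have "charf (conv \<mu> \<nu>) \<xi> = (LINT p|(\<mu> \<Otimes>\<^sub>M \<nu>). iexp (\<xi> \<bullet> (fst p + snd p)))"
    unfolding charf_def conv_def by (subst integral_distr) (auto simp: case_prod_beta)
  also have "\<dots> = (LINT x|\<mu>. LINT y|\<nu>. iexp (\<xi> \<bullet> (x + y)))"
    by (subst integral_fst'[symmetric]) (auto intro!: P.integrable_const_bound[where B=1] simp: norm_exp_i_times)
  also have "\<dots> = (LINT x|\<mu>. LINT y|\<nu>. iexp (\<xi> \<bullet> x) * iexp (\<xi> \<bullet> y))"
    by (simp add: inner_add_right distrib_left exp_add)
  finally show ?thesis by (simp add: charf_def)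
qed

lemma charf_measurable [measurable]:
  assumes "prob_space \<mu>" and [measurable_cong]: "sets \<mu> = sets borel"
  shows "charf \<mu> \<in> borel_measurable borel"
proof -
  interpret prob_space \<mu> by fact
  show ?thesis unfolding charf_def[abs_def] by measurable
qed

section \<open>Point masses and densities\<close>

lemma shifted_overlap_le: "F \<in> sets borel \<Longrightarrow> shifted_overlap F E x \<le> emeasure lborel F"
proof -
  assume [measurable]: "F \<in> sets borel"
  have "shifted_overlap F E x \<le> (\<integral>\<^sup>+y. indicator F y \<partial>lborel)"
    unfolding shifted_overlap_def by (intro nn_integral_mono) (auto simp: indicator_def)
  then show ?thesis by simp
qed

text \<open>Overlap is greatest when concentric balls are not moved against each other. This is how
  the drift disappears from the symmetrized process.\<close>

lemma law_dominated_return: "law_dominated (return borel b) (return borel (0::'a::euclidean_space))"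
proof -
  have "riesz_le_measure (return borel b) (return borel (0::'a))" for b
    unfolding riesz_le_measure_def
  proof safe
    fix F E :: "'a set" assume [measurable]: "F \<in> sets borel" "E \<in> sets borel"
    have "shifted_overlap F E b \<le> (\<integral>\<^sup>+y. indicator E (b + y) \<partial>lborel)"
      unfolding shifted_overlap_def by (intro nn_integral_mono) (auto simp: indicator_def)
    also have "\<dots> = emeasure lborel E" by (subst nn_integral_translate) auto
    finally have 1: "shifted_overlap F E b \<le> emeasure lborel E" .
    have 2: "shifted_overlap F E b \<le> emeasure lborel F" by (rule shifted_overlap_le) simp
    have "symball F \<inter> symball E = symball F \<or> symball F \<inter> symball E = symball E"
      using linear[of "emeasure lborel F" "emeasure lborel E"] symball_mono[of F E] symball_mono[of E F] by blast
    then have "shifted_overlap F E b \<le> emeasure lborel (symball F \<inter> symball E)"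
      using 1 2 by (metis emeasure_symball)
    also have "\<dots> = shifted_overlap (symball F) (symball E) 0"
      by (simp add: shifted_overlap_def indicator_inter_arith[symmetric])
    finally show "(\<integral>\<^sup>+x. shifted_overlap F E x \<partial>return borel b) \<le> (\<integral>\<^sup>+x. shifted_overlap (symball F) (symball E) x \<partial>return borel 0)"
      by (simp add: nn_integral_return)
  qed
  then show ?thesis by (simp add: law_dominated_def prob_space_return)
qed

lemma charf_return: "charf (return borel b) \<xi> = iexp (\<xi> \<bullet> b)"
  unfolding charf_def by (subst integral_return) auto

text \<open>Cutting the density into layers leaves one Riesz inequality for each height.\<close>

lemma riesz_le_density:
  assumes "is_rearr \<phi> \<psi>"
  shows "riesz_le_measure (density lborel \<phi>) (density lborel \<psi>)"
  unfolding riesz_le_measure_def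
proof safe
  fix F E :: "'a set" assume [measurable]: "F \<in> sets borel" "E \<in> sets borel"
  have [measurable]: "\<phi> \<in> borel_measurable borel" "\<psi> \<in> borel_measurable borel" and lev: "\<And>t. 0 \<le> t \<Longrightarrow> level \<psi> t = symball (level \<phi> t)"
    using assms by (auto simp: is_rearr_def)
  have eq: "(\<integral>\<^sup>+x. shifted_overlap F E x \<partial>density lborel \<phi>) = (\<integral>\<^sup>+t. indicator {0<..} t * riesz (level \<phi> t) F E \<partial>lborel)"
    if [measurable]: "\<phi> \<in> borel_measurable borel" "F \<in> sets borel" "E \<in> sets borel" for \<phi> and F E :: "'a set"
  proof -
    have "(\<integral>\<^sup>+x. shifted_overlap F E x \<partial>density lborel \<phi>) = (\<integral>\<^sup>+x. shifted_overlap F E x * \<phi> x \<partial>lborel)"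
      by (subst nn_integral_density) (auto simp: mult.commute)
    also have "\<dots> = (\<integral>\<^sup>+t. indicator {0<..} t * (\<integral>\<^sup>+x. indicator (level \<phi> t) x * shifted_overlap F E x \<partial>lborel) \<partial>lborel)"
      by (rule nn_integral_layer_cake) auto
    also have "\<dots> = (\<integral>\<^sup>+t. indicator {0<..} t * riesz (level \<phi> t) F E \<partial>lborel)"
      unfolding riesz_def shifted_overlap_def by (simp add: nn_integral_cmult[symmetric] mult.assoc)
    finally show ?thesis .
  qed
  show "(\<integral>\<^sup>+x. shifted_overlap F E x \<partial>density lborel \<phi>) \<le> (\<integral>\<^sup>+x. shifted_overlap (symball F) (symball E) x \<partial>density lborel \<psi>)"
    using riesz_rearrangement[of "level \<phi> t" F E for t] lev
    by (simp add: eq) (auto intro!: nn_integral_mono simp: indicator_def[of "{0<..}"])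
qed

lemma nn_integral_rearr:
  assumes "is_rearr \<phi> \<psi>"
  shows "(\<integral>\<^sup>+x. \<phi> x \<partial>lborel) = (\<integral>\<^sup>+x. \<psi> x \<partial>lborel)"
proof -
  have [measurable]: "\<phi> \<in> borel_measurable borel" "\<psi> \<in> borel_measurable borel" and lev: "\<And>t. 0 \<le> t \<Longrightarrow> level \<psi> t = symball (level \<phi> t)"
    using assms by (auto simp: is_rearr_def)
  have "(\<integral>\<^sup>+x. \<phi> x - ennreal 0 \<partial>lborel) = (\<integral>\<^sup>+t. indicator {0<..} t * emeasure lborel (level \<phi> t) \<partial>lborel)"
    by (rule nn_integral_levels_above[symmetric]) auto
  also have "\<dots> = (\<integral>\<^sup>+t. indicator {0<..} t * emeasure lborel (level \<psi> t) \<partial>lborel)"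
    by (intro nn_integral_cong) (auto simp: indicator_def lev)
  also have "\<dots> = (\<integral>\<^sup>+x. \<psi> x - ennreal 0 \<partial>lborel)"
    by (rule nn_integral_levels_above) auto
  finally show ?thesis by simp
qed

section \<open>Continuity of the overlap in the shift\<close>

lemma shifted_overlap_liminf_open:
  assumes [measurable]: "F \<in> sets borel" and U: "open U" and x: "x \<longlonglongrightarrow> l"
  shows "shifted_overlap F U l \<le> liminf (\<lambda>k. shifted_overlap F U (x k))"
proof -
  have [measurable]: "U \<in> sets borel" using U by simp
  have "shifted_overlap F U l \<le> (\<integral>\<^sup>+y. liminf (\<lambda>k. indicator F y * indicator U (x k + y)) \<partial>lborel)"
    unfolding shifted_overlap_def
  proof (rule nn_integral_mono)
    fix y
    show "indicator F y * indicator U (l + y) \<le> liminf (\<lambda>k. indicator F y * indicator U (x k + y) :: ennreal)"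
    proof (cases "y \<in> F \<and> l + y \<in> U")
      case True
      have "(\<lambda>k. x k + y) \<longlonglongrightarrow> l + y" using x by (intro tendsto_intros)
      then have "eventually (\<lambda>k. x k + y \<in> U) sequentially" using U True by (auto simp: tendsto_def)
      then have "eventually (\<lambda>k. indicator F y * indicator U (l + y) \<le> (indicator F y * indicator U (x k + y) :: ennreal)) sequentially"
        by eventually_elim (use True in auto)
      then show ?thesis by (rule Liminf_bounded)
    qed (auto simp: indicator_def)
  qed
  also have "\<dots> \<le> liminf (\<lambda>k. shifted_overlap F U (x k))"
    unfolding shifted_overlap_def by (rule nn_integral_liminf) measurable
  finally show ?thesis .
qed

text \<open>Fatou's lemma needs an open set, so E is enlarged to an open U with excess volume below
  \<epsilon>. The error is the same for all shifts by translation invariance.\<close>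

lemma shifted_overlap_liminf:
  assumes [measurable]: "F \<in> sets borel" "E \<in> sets borel" and x: "x \<longlonglongrightarrow> l"
  shows "shifted_overlap F E l \<le> liminf (\<lambda>k. shifted_overlap F E (x k))"
proof (rule ennreal_le_epsilon)
  fix \<epsilon> :: real assume eps: "0 < \<epsilon>"
  obtain U where U: "open U" "E \<subseteq> U" "(U - E) \<in> lmeasurable" "emeasure lebesgue (U - E) < ennreal \<epsilon>"
    using sets_lebesgue_outer_open[of E \<epsilon>] eps by auto
  have [measurable]: "U \<in> sets borel" using U by simp
  have small: "emeasure lborel (U - E) < ennreal \<epsilon>" using U(4) by simp
  have "shifted_overlap F E l \<le> shifted_overlap F U l"
    using U(2) unfolding shifted_overlap_def by (intro nn_integral_mono) (auto simp: indicator_def)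
  also have "\<dots> \<le> liminf (\<lambda>k. shifted_overlap F U (x k))" by (rule shifted_overlap_liminf_open[OF _ U(1) x]) simp
  also have "\<dots> \<le> liminf (\<lambda>k. ennreal \<epsilon> + shifted_overlap F E (x k))"
  proof (intro Liminf_mono always_eventually allI)
    fix k
    have "shifted_overlap F U (x k) \<le> (\<integral>\<^sup>+y. indicator (U - E) (x k + y) + indicator F y * indicator E (x k + y) \<partial>lborel)"
      unfolding shifted_overlap_def by (intro nn_integral_mono) (auto simp: indicator_def)
    also have "\<dots> = (\<integral>\<^sup>+y. indicator (U - E) (x k + y) \<partial>lborel) + shifted_overlap F E (x k)"
      unfolding shifted_overlap_def by (subst nn_integral_add) auto
    also have "(\<integral>\<^sup>+y. indicator (U - E) (x k + y) \<partial>lborel) = emeasure lborel (U - E)"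
      by (subst nn_integral_translate) auto
    finally show "shifted_overlap F U (x k) \<le> ennreal \<epsilon> + shifted_overlap F E (x k)"
      using small by (meson add_right_mono less_imp_le order_trans)
  qed
  also have "\<dots> = ennreal \<epsilon> + liminf (\<lambda>k. shifted_overlap F E (x k))"
    by (intro Liminf_const_add) auto
  finally show "shifted_overlap F E l \<le> liminf (\<lambda>k. shifted_overlap F E (x k)) + ennreal \<epsilon>"
    by (simp add: add.commute)
qed

text \<open>The overlaps with E and with its complement are both lower semicontinuous in the shift
  and add up to the finite constant volume of F, so each is continuous.\<close>

lemma shifted_overlap_tendsto:
  assumes [measurable]: "F \<in> sets borel" "E \<in> sets borel" and fF: "emeasure lborel F < \<top>" and x: "x \<longlonglongrightarrow> l"
  shows "(\<lambda>k. shifted_overlap F E (x k)) \<longlonglongrightarrow> shifted_overlap F E l"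
proof -
  have sum: "shifted_overlap F E z + shifted_overlap F (- E) z = emeasure lborel F" for z
  proof -
    have "shifted_overlap F E z + shifted_overlap F (- E) z = (\<integral>\<^sup>+y. indicator F y * indicator E (z + y) + indicator F y * indicator (- E) (z + y) \<partial>lborel)"
      unfolding shifted_overlap_def by (subst nn_integral_add) auto
    also have "\<dots> = (\<integral>\<^sup>+y. indicator F y \<partial>lborel)" by (intro nn_integral_cong) (auto simp: indicator_def)
    finally show ?thesis by simp
  qed
  show ?thesis
  proof (rule order_tendstoI)
    fix a assume "a < shifted_overlap F E l"
    then have "a < liminf (\<lambda>k. shifted_overlap F E (x k))" using shifted_overlap_liminf[OF assms(1,2) x] by (rule less_le_trans)
    then show "eventually (\<lambda>k. a < shifted_overlap F E (x k)) sequentially" by (rule less_LiminfD)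
  next
    fix a assume a: "shifted_overlap F E l < a"
    show "eventually (\<lambda>k. shifted_overlap F E (x k) < a) sequentially"
    proof (cases "emeasure lborel F < a")
      case True
      then show ?thesis using shifted_overlap_le[of F E] by (auto intro!: always_eventually intro: le_less_trans)
    next
      case False
      obtain f where f: "emeasure lborel F = ennreal f" "0 \<le> f" using fF by (cases "emeasure lborel F") auto
      have fin: "shifted_overlap F X z < \<top>" for X z using shifted_overlap_le[of F X z] fF by (auto intro: le_less_trans)
      have a': "a = ennreal (enn2real a)" using False f by (cases a) (auto simp: not_less top_unique)
      define h where "h X z = enn2real (shifted_overlap F X z)" for X z
      have h: "shifted_overlap F X z = ennreal (h X z)" "0 \<le> h X z" for X z using fin[of X z] by (auto simp: h_def)
      have s: "h E z + h (- E) z = f" for z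
        using sum[of z] h f by (simp add: ennreal_plus[symmetric] del: ennreal_plus)
      have "h E l < enn2real a" using a h by (subst (asm) a', subst (asm) h, subst (asm) ennreal_less_iff) auto
      then have "f - enn2real a < h (- E) l" using s[of l] by simp
      moreover have "0 \<le> f - enn2real a" using False f by (subst (asm) a') (simp add: not_less)
      ultimately have "ennreal (f - enn2real a) < shifted_overlap F (- E) l" by (simp add: h ennreal_less_iff)
      also have "\<dots> \<le> liminf (\<lambda>k. shifted_overlap F (- E) (x k))" by (rule shifted_overlap_liminf[OF _ _ x]) auto
      finally have "eventually (\<lambda>k. ennreal (f - enn2real a) < shifted_overlap F (- E) (x k)) sequentially" by (rule less_LiminfD)
      then show ?thesis
      proof eventually_elim
        case (elim k)
        then have "f - enn2real a < h (- E) (x k)" using \<open>0 \<le> f - enn2real a\<close> by (simp add: h ennreal_less_iff)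
        then have "h E (x k) < enn2real a" using s[of "x k"] by simp
        then show ?case by (subst a', subst h, subst ennreal_less_iff) (auto simp: h)
      qed
    qed
  qed
qed

subsection \<open>Gaussian measures\<close>

definition gauss_density :: "'a::euclidean_space \<Rightarrow> real" where
  "gauss_density x = (1 / sqrt (2 * pi)) ^ DIM('a) * exp (- (norm x)\<^sup>2 / 2)"

definition gauss :: "'a::euclidean_space measure" where
  "gauss = density lborel (\<lambda>x. ennreal (gauss_density x))"

lemma gauss_density_measurable [measurable]: "gauss_density \<in> borel_measurable borel"
  unfolding gauss_density_def[abs_def] by measurable

lemma gauss_density_pos: "0 < gauss_density x"
  by (simp add: gauss_density_def)

lemma sets_gauss [simp, measurable_cong]: "sets gauss = sets borel"
  by (simp add: gauss_def)

lemma norm_power2_sum: "(norm (x::'a::euclidean_space))\<^sup>2 = (\<Sum>b\<in>Basis. (x \<bullet> b)\<^sup>2)"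
  by (subst power2_norm_eq_inner, subst euclidean_inner) (simp add: power2_eq_square)

lemma exp_norm_power2: "exp (- (norm (x::'a::euclidean_space))\<^sup>2 / 2) = (\<Prod>b\<in>Basis. exp (- (x \<bullet> b)\<^sup>2 / 2))"
proof -
  have "- (norm x)\<^sup>2 / 2 = (\<Sum>b\<in>Basis. - (x \<bullet> b)\<^sup>2 / 2)"
    by (simp add: norm_power2_sum sum_negf sum_divide_distrib)
  then show ?thesis by (simp only: exp_sum[OF finite_Basis])
qed

lemma gauss_density_prod: "gauss_density (x::'a::euclidean_space) = (\<Prod>b\<in>Basis. std_normal_density (x \<bullet> b))"
proof -
  have "(\<Prod>b\<in>Basis. std_normal_density (x \<bullet> b)) = (\<Prod>b\<in>(Basis::'a set). 1 / sqrt (2 * pi)) * (\<Prod>b\<in>Basis. exp (- (x \<bullet> b)\<^sup>2 / 2))"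
    unfolding std_normal_density_def by (simp add: prod.distrib del: prod_constant) (simp add: prod_dividef power_divide)
  also have "(\<Prod>b\<in>Basis. exp (- (x \<bullet> b)\<^sup>2 / 2)) = exp (- (norm x)\<^sup>2 / 2)"
    by (simp only: exp_norm_power2)
  finally show ?thesis by (simp add: gauss_density_def)
qed

lemma integral_lborel_prod:
  fixes f :: "'a::euclidean_space \<Rightarrow> real \<Rightarrow> complex"
  assumes int: "\<And>b. b \<in> Basis \<Longrightarrow> integrable lborel (f b)"
  shows "(LINT x|lborel. (\<Prod>b\<in>Basis. f b (x \<bullet> b))) = (\<Prod>b\<in>Basis. LINT t|lborel. f b t)"
proof -
  interpret product_sigma_finite "\<lambda>_::'a. lborel :: real measure" ..
  have [measurable]: "\<And>b. b \<in> Basis \<Longrightarrow> f b \<in> borel_measurable borel" using int by (auto dest!: borel_measurable_integrable)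
  have "(LINT x|lborel. (\<Prod>b\<in>Basis. f b (x \<bullet> b))) =
    (LINT x|distr (\<Pi>\<^sub>M b\<in>Basis. lborel) borel (\<lambda>f. \<Sum>b\<in>Basis. f b *\<^sub>R b). (\<Prod>b\<in>Basis. f b (x \<bullet> b)))"
    by (subst lborel_eq) simp
  also have "\<dots> = (LINT x|(\<Pi>\<^sub>M b\<in>Basis. lborel). (\<Prod>b\<in>Basis. f b ((\<Sum>c\<in>Basis. x c *\<^sub>R c) \<bullet> b)))"
    by (rule integral_distr) measurable
  also have "\<dots> = (LINT x|(\<Pi>\<^sub>M b\<in>(Basis::'a set). lborel). (\<Prod>b\<in>Basis. f b (x b)))"
    by (intro Bochner_Integration.integral_cong refl prod.cong) simp
  also have "\<dots> = (\<Prod>b\<in>Basis. LINT t|lborel. f b t)"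
    by (rule product_integral_prod) (use int in auto)
  finally show ?thesis .
qed

lemma prob_space_gauss: "prob_space (gauss :: 'a::euclidean_space measure)"
proof (rule prob_spaceI)
  have 1: "(\<integral>\<^sup>+t. ennreal (std_normal_density t) \<partial>lborel) = 1"
    using prob_space.emeasure_space_1[OF prob_space_normal_density[of 1 0]] by (simp add: emeasure_density)
  have "emeasure gauss (space (gauss :: 'a measure)) = (\<integral>\<^sup>+x. (\<Prod>b\<in>Basis. ennreal (std_normal_density ((x::'a) \<bullet> b))) \<partial>lborel)"
    by (simp add: gauss_def emeasure_density gauss_density_prod prod_ennreal)
  also have "\<dots> = (\<Prod>b\<in>(Basis::'a set). \<integral>\<^sup>+t. ennreal (std_normal_density t) \<partial>lborel)"
    by (rule nn_integral_lborel_prod) auto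
  finally show "emeasure gauss (space (gauss :: 'a measure)) = 1" by (simp add: 1)
qed

lemma charf_gauss: "charf gauss \<xi> = complex_of_real (exp (- (norm \<xi>)\<^sup>2 / 2))"
proof -
  have one: "(LINT t|lborel. complex_of_real (std_normal_density t) * iexp (s * t)) = complex_of_real (exp (- s\<^sup>2 / 2))" for s
  proof -
    have "char std_normal_distribution s = (LINT t|lborel. std_normal_density t *\<^sub>R iexp (s * t))"
      unfolding char_def by (subst integral_density) auto
    then show ?thesis by (simp add: char_std_normal_distribution scaleR_conv_of_real)
  qed
  have int: "integrable lborel (\<lambda>t. complex_of_real (std_normal_density t) * iexp (s * t))" for s
  proof (rule Bochner_Integration.integrable_bound[OF integrable_normal_density[of 1 0]])
    show "AE t in lborel. norm (complex_of_real (std_normal_density t) * iexp (s * t)) \<le> norm (std_normal_density t)"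
      by (auto simp: norm_mult)
  qed auto
  have "charf gauss \<xi> = (LINT x|lborel. gauss_density x *\<^sub>R iexp (\<xi> \<bullet> x))"
    unfolding charf_def gauss_def by (subst integral_density) (auto intro: less_imp_le gauss_density_pos)
  also have "\<dots> = (LINT x|lborel. (\<Prod>b\<in>Basis. complex_of_real (std_normal_density (x \<bullet> b)) * iexp ((\<xi> \<bullet> b) * (x \<bullet> b))))"
  proof (rule Bochner_Integration.integral_cong[OF refl])
    fix x :: 'a
    have "\<i> * complex_of_real (\<xi> \<bullet> x) = (\<Sum>b\<in>Basis. \<i> * complex_of_real ((\<xi> \<bullet> b) * (x \<bullet> b)))"
      by (subst euclidean_inner) (simp add: sum_distrib_left)
    then have "iexp (\<xi> \<bullet> x) = (\<Prod>b\<in>Basis. iexp ((\<xi> \<bullet> b) * (x \<bullet> b)))"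
      by (simp only: exp_sum[OF finite_Basis])
    then show "gauss_density x *\<^sub>R iexp (\<xi> \<bullet> x) = (\<Prod>b\<in>Basis. complex_of_real (std_normal_density (x \<bullet> b)) * iexp ((\<xi> \<bullet> b) * (x \<bullet> b)))"
      by (simp add: gauss_density_prod scaleR_conv_of_real prod.distrib)
  qed
  also have "\<dots> = (\<Prod>b\<in>Basis. LINT t|lborel. complex_of_real (std_normal_density t) * iexp ((\<xi> \<bullet> b) * t))"
    by (rule integral_lborel_prod) (rule int)
  also have "\<dots> = complex_of_real (\<Prod>b\<in>Basis. exp (- (\<xi> \<bullet> b)\<^sup>2 / 2))"
    unfolding one by simp
  also have "(\<Prod>b\<in>Basis. exp (- (\<xi> \<bullet> b)\<^sup>2 / 2)) = exp (- (norm \<xi>)\<^sup>2 / 2)"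
    by (simp only: exp_norm_power2)
  finally show ?thesis .
qed

definition gauss_scaled :: "real \<Rightarrow> 'a::euclidean_space measure" where
  "gauss_scaled \<sigma> = distr gauss borel (\<lambda>z. \<sigma> *\<^sub>R z)"

lemma sets_gauss_scaled [simp, measurable_cong]: "sets (gauss_scaled \<sigma>) = sets borel"
  by (simp add: gauss_scaled_def)

lemma prob_space_gauss_scaled: "prob_space (gauss_scaled \<sigma> :: 'a::euclidean_space measure)"
proof -
  interpret prob_space "gauss :: 'a measure" by (rule prob_space_gauss)
  show ?thesis unfolding gauss_scaled_def by (rule prob_space_distr) measurable
qed

section \<open>Smoothing by a Gaussian\<close>

lemma nn_integral_shifted_overlap:
  assumes [measurable]: "F \<in> sets borel" "E \<in> sets borel"
  shows "(\<integral>\<^sup>+x. shifted_overlap F E x \<partial>lborel) = emeasure lborel F * emeasure lborel E"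
proof -
  have "(\<integral>\<^sup>+x. shifted_overlap F E x \<partial>lborel) = (\<integral>\<^sup>+y. \<integral>\<^sup>+x. indicator F y * indicator E (y + x) \<partial>lborel \<partial>lborel)"
    unfolding shifted_overlap_def by (subst lborel_pair.Fubini') (auto simp: add.commute)
  also have "\<dots> = (\<integral>\<^sup>+y. indicator F y * emeasure lborel E \<partial>lborel)"
  proof (rule nn_integral_cong)
    fix y
    have "(\<integral>\<^sup>+x. indicator E (y + x) \<partial>lborel) = emeasure lborel E" by (subst nn_integral_translate) auto
    then show "(\<integral>\<^sup>+x. indicator F y * indicator E (y + x) \<partial>lborel) = indicator F y * emeasure lborel E"
      by (subst nn_integral_cmult) auto
  qed
  finally show ?thesis by (simp add: nn_integral_multc)
qed

text \<open>Up to the factor \<sigma> to the power of the dimension this is the density of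
  \<open>conv \<mu> (gauss_scaled \<sigma>)\<close>; the factor is restored in
  \<open>nn_integral_conv_gauss_scaled\<close>.\<close>

definition smooth_density :: "real \<Rightarrow> 'a::euclidean_space measure \<Rightarrow> 'a \<Rightarrow> real" where
  "smooth_density \<sigma> \<mu> w = (LINT x|\<mu>. gauss_density ((w - x) /\<^sub>R \<sigma>))"

lemma gauss_density_le: "gauss_density (x::'a::euclidean_space) \<le> (1 / sqrt (2 * pi)) ^ DIM('a)"
  unfolding gauss_density_def by (rule mult_left_le) auto

lemma integrable_gauss_density:
  fixes \<mu> :: "'a::euclidean_space measure"
  assumes "prob_space \<mu>" and [measurable_cong]: "sets \<mu> = sets borel"
  shows "integrable \<mu> (\<lambda>x. gauss_density ((w - x) /\<^sub>R \<sigma>))"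
proof -
  interpret prob_space \<mu> by fact
  show ?thesis
    by (rule integrable_const_bound[where B="(1 / sqrt (2 * pi)) ^ DIM('a)"])
       (auto simp: abs_of_pos gauss_density_pos gauss_density_le)
qed

text \<open>Up to a factor the Gaussian density is its own Fourier transform, so the density of a smoothed
  measure is an integral of the characteristic function.\<close>

lemma smooth_density_charf:
  fixes \<mu> :: "'a::euclidean_space measure"
  assumes "prob_space \<mu>" and [measurable_cong]: "sets \<mu> = sets borel"
  shows "complex_of_real (smooth_density \<sigma> \<mu> w) =
    complex_of_real ((1 / sqrt (2 * pi)) ^ DIM('a)) * (LINT \<eta>|gauss. iexp (\<eta> \<bullet> (w /\<^sub>R \<sigma>)) * charf \<mu> (- (\<eta> /\<^sub>R \<sigma>)))"
proof -
  interpret m: prob_space \<mu> by fact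
  interpret g: prob_space "gauss :: 'a measure" by (rule prob_space_gauss)
  interpret pair_prob_space \<mu> "gauss :: 'a measure" ..
  define c where "c = complex_of_real ((1 / sqrt (2 * pi)) ^ DIM('a))"
  have "complex_of_real (smooth_density \<sigma> \<mu> w) = (LINT x|\<mu>. complex_of_real (gauss_density ((w - x) /\<^sub>R \<sigma>)))"
    by (simp add: smooth_density_def)
  also have "\<dots> = (LINT x|\<mu>. c * charf gauss ((w - x) /\<^sub>R \<sigma>))"
    unfolding charf_gauss gauss_density_def c_def by simp
  also have "\<dots> = c * (LINT x|\<mu>. LINT \<eta>|gauss. iexp (((w - x) /\<^sub>R \<sigma>) \<bullet> \<eta>))"
    unfolding charf_def by simp
  also have "(LINT x|\<mu>. LINT \<eta>|gauss. iexp (((w - x) /\<^sub>R \<sigma>) \<bullet> \<eta>)) = (LINT \<eta>|gauss. LINT x|\<mu>. iexp (((w - x) /\<^sub>R \<sigma>) \<bullet> \<eta>))"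
    by (rule Fubini_integral[symmetric]) (auto simp: case_prod_beta norm_exp_i_times intro!: P.integrable_const_bound[where B=1])
  also have "\<dots> = (LINT \<eta>|gauss. LINT x|\<mu>. iexp (\<eta> \<bullet> (w /\<^sub>R \<sigma>)) * iexp ((- (\<eta> /\<^sub>R \<sigma>)) \<bullet> x))"
  proof (intro Bochner_Integration.integral_cong refl)
    fix \<eta> x :: 'a
    have "((w - x) /\<^sub>R \<sigma>) \<bullet> \<eta> = \<eta> \<bullet> (w /\<^sub>R \<sigma>) + (- (\<eta> /\<^sub>R \<sigma>)) \<bullet> x"
      by (simp add: inner_diff_left inner_diff_right algebra_simps inner_commute)
    then show "iexp (((w - x) /\<^sub>R \<sigma>) \<bullet> \<eta>) = iexp (\<eta> \<bullet> (w /\<^sub>R \<sigma>)) * iexp ((- (\<eta> /\<^sub>R \<sigma>)) \<bullet> x)"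
      by (simp only: of_real_add distrib_left exp_add)
  qed
  finally show ?thesis by (simp add: c_def charf_def)
qed

lemma smooth_density_bounds:
  fixes \<mu> :: "'a::euclidean_space measure"
  assumes "prob_space \<mu>" and [measurable_cong]: "sets \<mu> = sets borel"
  shows "0 \<le> smooth_density \<sigma> \<mu> w" "smooth_density \<sigma> \<mu> w \<le> (1 / sqrt (2 * pi)) ^ DIM('a)"
proof -
  interpret prob_space \<mu> by fact
  show "0 \<le> smooth_density \<sigma> \<mu> w" unfolding smooth_density_def
    by (rule Bochner_Integration.integral_nonneg) (simp add: gauss_density_pos less_imp_le)
  have "smooth_density \<sigma> \<mu> w \<le> (LINT x|\<mu>. (1 / sqrt (2 * pi)) ^ DIM('a))"
    unfolding smooth_density_def using integrable_gauss_density[OF assms]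
    by (intro integral_mono gauss_density_le) auto
  then show "smooth_density \<sigma> \<mu> w \<le> (1 / sqrt (2 * pi)) ^ DIM('a)" by (simp add: prob_space)
qed

lemma smooth_density_measurable [measurable]:
  fixes \<mu> :: "'a::euclidean_space measure"
  assumes "prob_space \<mu>" and [measurable_cong]: "sets \<mu> = sets borel"
  shows "smooth_density \<sigma> \<mu> \<in> borel_measurable borel"
proof -
  interpret prob_space \<mu> by fact
  show ?thesis unfolding smooth_density_def[abs_def] by measurable
qed

text \<open>In the Fourier formula the measure enters only through its characteristic function,
  bounded by 1, so dominated convergence against the Gaussian suffices. Neither tightness nor a
  continuity theorem is invoked.\<close>

lemma smooth_density_tendsto:
  fixes \<mu> :: "'a::euclidean_space measure"
  assumes \<mu>n: "\<And>n. prob_space (\<mu>n n)" "\<And>n. sets (\<mu>n n) = sets borel" and \<mu>: "prob_space \<mu>" "sets \<mu> = sets borel"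
    and lim: "\<And>\<xi>. (\<lambda>n. charf (\<mu>n n) \<xi>) \<longlonglongrightarrow> charf \<mu> \<xi>"
  shows "(\<lambda>n. smooth_density \<sigma> (\<mu>n n) w) \<longlonglongrightarrow> smooth_density \<sigma> \<mu> w"
proof -
  interpret g: prob_space "gauss :: 'a measure" by (rule prob_space_gauss)
  note [measurable] = charf_measurable[OF \<mu>] charf_measurable[OF \<mu>n]
  have "(\<lambda>n. LINT \<eta>|gauss. iexp (\<eta> \<bullet> (w /\<^sub>R \<sigma>)) * charf (\<mu>n n) (- (\<eta> /\<^sub>R \<sigma>))) \<longlonglongrightarrow>
     (LINT \<eta>|gauss. iexp (\<eta> \<bullet> (w /\<^sub>R \<sigma>)) * charf \<mu> (- (\<eta> /\<^sub>R \<sigma>)))"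
  proof (rule integral_dominated_convergence[where w="\<lambda>_. 1"])
    show "AE \<eta> in gauss. (\<lambda>n. iexp (\<eta> \<bullet> (w /\<^sub>R \<sigma>)) * charf (\<mu>n n) (- (\<eta> /\<^sub>R \<sigma>))) \<longlonglongrightarrow> iexp (\<eta> \<bullet> (w /\<^sub>R \<sigma>)) * charf \<mu> (- (\<eta> /\<^sub>R \<sigma>))"
      by (intro AE_I2 tendsto_intros lim)
    show "AE \<eta> in gauss. norm (iexp (\<eta> \<bullet> (w /\<^sub>R \<sigma>)) * charf (\<mu>n n) (- (\<eta> /\<^sub>R \<sigma>))) \<le> 1" for n
      using charf_le_1[OF \<mu>n] by (simp add: norm_mult norm_exp_i_times)
  qed (simp_all, measurable)
  then have "(\<lambda>n. complex_of_real (smooth_density \<sigma> (\<mu>n n) w)) \<longlonglongrightarrow> complex_of_real (smooth_density \<sigma> \<mu> w)"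
    unfolding smooth_density_charf[OF \<mu>] smooth_density_charf[OF \<mu>n] by (intro tendsto_intros)
  then show ?thesis by (simp only: tendsto_of_real_iff)
qed

lemma nn_integral_affine:
  fixes h :: "'a::euclidean_space \<Rightarrow> ennreal"
  assumes [measurable]: "h \<in> borel_measurable borel" and "0 < \<sigma>"
  shows "(\<integral>\<^sup>+w. h w \<partial>lborel) = ennreal (\<sigma> ^ DIM('a)) * (\<integral>\<^sup>+z. h (x + \<sigma> *\<^sub>R z) \<partial>lborel)"
proof -
  have "(\<integral>\<^sup>+w. h w \<partial>lborel) = (\<integral>\<^sup>+w. h w \<partial>density (distr lborel borel (\<lambda>z. x + \<sigma> *\<^sub>R z)) (\<lambda>_. ennreal (\<bar>\<sigma>\<bar> ^ DIM('a))))"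
    using assms by (subst lborel_affine[of \<sigma> x]) auto
  then show ?thesis
    using assms by (simp add: nn_integral_density nn_integral_distr nn_integral_cmult)
qed

lemma nn_integral_conv_gauss_scaled:
  fixes \<mu> :: "'a::euclidean_space measure"
  assumes \<mu>: "prob_space \<mu>" and [measurable_cong]: "sets \<mu> = sets borel" and \<sigma>: "0 < \<sigma>"
    and h[measurable]: "h \<in> borel_measurable borel"
  shows "ennreal (\<sigma> ^ DIM('a)) * (\<integral>\<^sup>+x. h x \<partial>conv \<mu> (gauss_scaled \<sigma>)) = (\<integral>\<^sup>+w. h w * ennreal (smooth_density \<sigma> \<mu> w) \<partial>lborel)"
proof -
  interpret prob_space \<mu> by fact
  interpret g: prob_space "gauss :: 'a measure" by (rule prob_space_gauss)
  interpret pair_sigma_finite lborel \<mu> ..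
  have "ennreal (\<sigma> ^ DIM('a)) * (\<integral>\<^sup>+x. h x \<partial>conv \<mu> (gauss_scaled \<sigma>)) = (\<integral>\<^sup>+x. ennreal (\<sigma> ^ DIM('a)) * (\<integral>\<^sup>+z. h (x + \<sigma> *\<^sub>R z) \<partial>gauss) \<partial>\<mu>)"
    by (subst nn_integral_conv[OF \<mu> prob_space_gauss_scaled assms(2)])
       (simp_all add: gauss_scaled_def nn_integral_distr nn_integral_cmult)
  also have "\<dots> = (\<integral>\<^sup>+x. ennreal (\<sigma> ^ DIM('a)) * (\<integral>\<^sup>+z. ennreal (gauss_density z) * h (x + \<sigma> *\<^sub>R z) \<partial>lborel) \<partial>\<mu>)"
    unfolding gauss_def by (subst nn_integral_density) auto
  also have "\<dots> = (\<integral>\<^sup>+x. \<integral>\<^sup>+w. ennreal (gauss_density ((w - x) /\<^sub>R \<sigma>)) * h w \<partial>lborel \<partial>\<mu>)"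
  proof (rule nn_integral_cong)
    fix x
    show "ennreal (\<sigma> ^ DIM('a)) * (\<integral>\<^sup>+z. ennreal (gauss_density z) * h (x + \<sigma> *\<^sub>R z) \<partial>lborel) = (\<integral>\<^sup>+w. ennreal (gauss_density ((w - x) /\<^sub>R \<sigma>)) * h w \<partial>lborel)"
      using \<sigma> by (subst nn_integral_affine[where \<sigma>=\<sigma> and x=x]) auto
  qed
  also have "\<dots> = (\<integral>\<^sup>+w. \<integral>\<^sup>+x. ennreal (gauss_density ((w - x) /\<^sub>R \<sigma>)) * h w \<partial>\<mu> \<partial>lborel)"
    by (rule Fubini') measurable
  also have "\<dots> = (\<integral>\<^sup>+w. h w * ennreal (smooth_density \<sigma> \<mu> w) \<partial>lborel)"
  proof (rule nn_integral_cong)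
    fix w
    have "(\<integral>\<^sup>+x. ennreal (gauss_density ((w - x) /\<^sub>R \<sigma>)) \<partial>\<mu>) = ennreal (smooth_density \<sigma> \<mu> w)"
      unfolding smooth_density_def
      by (rule nn_integral_eq_integral) (auto intro!: integrable_gauss_density \<mu> assms simp: gauss_density_pos less_imp_le)
    then show "(\<integral>\<^sup>+x. ennreal (gauss_density ((w - x) /\<^sub>R \<sigma>)) * h w \<partial>\<mu>) = h w * ennreal (smooth_density \<sigma> \<mu> w)"
      by (subst nn_integral_multc) (auto simp: mult.commute)
  qed
  finally show ?thesis .
qed

text \<open>Smoothed densities converge pointwise and are bounded by the peak of the Gaussian
  density. The overlap itself, with total integral the product of the volumes of F and E, supplies
  the integrable bound.\<close>

lemma conv_gauss_tendsto:
  fixes \<mu> :: "'a::euclidean_space measure"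
  assumes \<mu>n: "\<And>n. prob_space (\<mu>n n)" "\<And>n. sets (\<mu>n n) = sets borel" and \<mu>: "prob_space \<mu>" "sets \<mu> = sets borel"
    and lim: "\<And>\<xi>. (\<lambda>n. charf (\<mu>n n) \<xi>) \<longlonglongrightarrow> charf \<mu> \<xi>"
    and [measurable]: "F \<in> sets borel" "E \<in> sets borel" and fin: "emeasure lborel F < \<top>" "emeasure lborel E < \<top>"
    and \<sigma>: "0 < \<sigma>"
  shows "(\<lambda>n. \<integral>\<^sup>+x. shifted_overlap F E x \<partial>conv (\<mu>n n) (gauss_scaled \<sigma>)) \<longlonglongrightarrow> (\<integral>\<^sup>+x. shifted_overlap F E x \<partial>conv \<mu> (gauss_scaled \<sigma>))"
proof -
  note [measurable] = smooth_density_measurable[OF \<mu>] smooth_density_measurable[OF \<mu>n]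
  define c where "c = (1 / sqrt (2 * pi)) ^ DIM('a)"
  have "(\<lambda>n. \<integral>\<^sup>+w. shifted_overlap F E w * ennreal (smooth_density \<sigma> (\<mu>n n) w) \<partial>lborel) \<longlonglongrightarrow>
    (\<integral>\<^sup>+w. shifted_overlap F E w * ennreal (smooth_density \<sigma> \<mu> w) \<partial>lborel)"
  proof (rule nn_integral_dominated_convergence[where w="\<lambda>w. shifted_overlap F E w * ennreal c"])
    show "AE w in lborel. shifted_overlap F E w * ennreal (smooth_density \<sigma> (\<mu>n n) w) \<le> shifted_overlap F E w * ennreal c" for n
      unfolding c_def by (intro AE_I2 mult_left_mono ennreal_leI smooth_density_bounds \<mu>n) auto
    show "(\<integral>\<^sup>+w. shifted_overlap F E w * ennreal c \<partial>lborel) < \<infinity>"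
      using fin by (simp add: nn_integral_multc nn_integral_shifted_overlap ennreal_mult_less_top)
    show "AE w in lborel. (\<lambda>n. shifted_overlap F E w * ennreal (smooth_density \<sigma> (\<mu>n n) w)) \<longlonglongrightarrow> shifted_overlap F E w * ennreal (smooth_density \<sigma> \<mu> w)"
    proof (rule AE_I2)
      fix w
      have "shifted_overlap F E w < \<top>" using shifted_overlap_le[of F E w] fin by (auto intro: le_less_trans)
      then show "(\<lambda>n. shifted_overlap F E w * ennreal (smooth_density \<sigma> (\<mu>n n) w)) \<longlonglongrightarrow> shifted_overlap F E w * ennreal (smooth_density \<sigma> \<mu> w)"
        by (intro ennreal_tendsto_cmult tendsto_ennrealI smooth_density_tendsto assms)
    qed
  qed measurable
  then have "(\<lambda>n. ennreal (\<sigma> ^ DIM('a)) * (\<integral>\<^sup>+x. shifted_overlap F E x \<partial>conv (\<mu>n n) (gauss_scaled \<sigma>))) \<longlonglongrightarrow>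
     ennreal (\<sigma> ^ DIM('a)) * (\<integral>\<^sup>+x. shifted_overlap F E x \<partial>conv \<mu> (gauss_scaled \<sigma>))"
    using \<sigma> assms(1-4) by (simp add: nn_integral_conv_gauss_scaled)
  then have "(\<lambda>n. ennreal (1 / \<sigma> ^ DIM('a)) * (ennreal (\<sigma> ^ DIM('a)) * (\<integral>\<^sup>+x. shifted_overlap F E x \<partial>conv (\<mu>n n) (gauss_scaled \<sigma>)))) \<longlonglongrightarrow>
     ennreal (1 / \<sigma> ^ DIM('a)) * (ennreal (\<sigma> ^ DIM('a)) * (\<integral>\<^sup>+x. shifted_overlap F E x \<partial>conv \<mu> (gauss_scaled \<sigma>)))"
    by (rule ennreal_tendsto_cmult[rotated]) simp
  moreover have "ennreal (1 / \<sigma> ^ DIM('a)) * (ennreal (\<sigma> ^ DIM('a)) * a) = a" for a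
    using \<sigma> by (simp add: mult.assoc[symmetric] ennreal_mult[symmetric])
  ultimately show ?thesis by simp
qed

text \<open>Undoing the smoothing: the overlap is continuous in the shift and bounded by the volume
  of F, so dominated convergence applies to the Gaussian and then to \<mu>.\<close>

lemma conv_gauss_small_tendsto:
  fixes \<mu> :: "'a::euclidean_space measure"
  assumes \<mu>: "prob_space \<mu>" and [measurable_cong]: "sets \<mu> = sets borel"
    and [measurable]: "F \<in> sets borel" "E \<in> sets borel" and fin: "emeasure lborel F < \<top>"
  shows "(\<lambda>n. \<integral>\<^sup>+x. shifted_overlap F E x \<partial>conv \<mu> (gauss_scaled (1 / real (Suc n)))) \<longlonglongrightarrow> (\<integral>\<^sup>+x. shifted_overlap F E x \<partial>\<mu>)"
proof -
  interpret m: prob_space \<mu> by fact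
  interpret g: prob_space "gauss :: 'a measure" by (rule prob_space_gauss)
  have eq: "(\<integral>\<^sup>+x. shifted_overlap F E x \<partial>conv \<mu> (gauss_scaled \<sigma>)) = (\<integral>\<^sup>+x. \<integral>\<^sup>+z. shifted_overlap F E (x + \<sigma> *\<^sub>R z) \<partial>gauss \<partial>\<mu>)" for \<sigma>
    by (subst nn_integral_conv[OF \<mu> prob_space_gauss_scaled assms(2)]) (simp_all add: gauss_scaled_def nn_integral_distr)
  have "(\<lambda>n. \<integral>\<^sup>+x. \<integral>\<^sup>+z. shifted_overlap F E (x + (1 / real (Suc n)) *\<^sub>R z) \<partial>gauss \<partial>\<mu>) \<longlonglongrightarrow> (\<integral>\<^sup>+x. shifted_overlap F E x \<partial>\<mu>)"
  proof (rule nn_integral_dominated_convergence[where w="\<lambda>_. emeasure lborel F"])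
    have le: "(\<integral>\<^sup>+z. shifted_overlap F E (f z) \<partial>gauss) \<le> emeasure lborel F" for f :: "'a \<Rightarrow> 'a"
    proof -
      have "(\<integral>\<^sup>+z. shifted_overlap F E (f z) \<partial>gauss) \<le> (\<integral>\<^sup>+(z::'a). emeasure lborel F \<partial>gauss)"
        by (intro nn_integral_mono shifted_overlap_le) simp
      then show ?thesis by (simp add: g.emeasure_space_1)
    qed
    show "AE x in \<mu>. (\<integral>\<^sup>+z. shifted_overlap F E (x + (1 / real (Suc n)) *\<^sub>R z) \<partial>gauss) \<le> emeasure lborel F" for n
      by (intro AE_I2 le)
    show "AE x in \<mu>. (\<lambda>n. \<integral>\<^sup>+z. shifted_overlap F E (x + (1 / real (Suc n)) *\<^sub>R z) \<partial>gauss) \<longlonglongrightarrow> shifted_overlap F E x"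
    proof (rule AE_I2)
      fix x
      have "(\<lambda>n. \<integral>\<^sup>+z. shifted_overlap F E (x + (1 / real (Suc n)) *\<^sub>R z) \<partial>gauss) \<longlonglongrightarrow> (\<integral>\<^sup>+(z::'a). shifted_overlap F E x \<partial>gauss)"
      proof (rule nn_integral_dominated_convergence[where w="\<lambda>_. emeasure lborel F"])
        show "AE z in gauss. (\<lambda>n. shifted_overlap F E (x + (1 / real (Suc n)) *\<^sub>R z)) \<longlonglongrightarrow> shifted_overlap F E x"
        proof (rule AE_I2)
          fix z :: 'a
          have "(\<lambda>n. x + (1 / real (Suc n)) *\<^sub>R z) \<longlonglongrightarrow> x + 0 *\<^sub>R z"
            by (intro tendsto_intros LIMSEQ_inverse_real_of_nat[unfolded inverse_eq_divide])
          then show "(\<lambda>n. shifted_overlap F E (x + (1 / real (Suc n)) *\<^sub>R z)) \<longlonglongrightarrow> shifted_overlap F E x"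
            using fin by (intro shifted_overlap_tendsto) auto
        qed
        show "AE z in gauss. shifted_overlap F E (x + (1 / real (Suc n)) *\<^sub>R z) \<le> emeasure lborel F" for n
          by (intro AE_I2 shifted_overlap_le) simp
      qed (use fin in \<open>auto simp: g.emeasure_space_1\<close>)
      then show "(\<lambda>n. \<integral>\<^sup>+z. shifted_overlap F E (x + (1 / real (Suc n)) *\<^sub>R z) \<partial>gauss) \<longlonglongrightarrow> shifted_overlap F E x"
        by (simp add: g.emeasure_space_1)
    qed
  qed (use fin in \<open>auto simp: m.emeasure_space_1\<close>)
  then show ?thesis by (simp add: eq)
qed

text \<open>Two limits in a fixed order: first n grows at a fixed width \<sigma>, then \<sigma>
  tends to 0. Smoothing both members of a pair preserves domination because a scaled Gaussian
  dominates itself. This is assumed here and supplied later for \<open>real ^ 'n\<close>, where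
  linear images are available. The second use of \<open>key\<close> shows that \<rho> dominates
  itself.\<close>

theorem law_dominated_limit:
  fixes \<mu> \<rho> :: "'a::euclidean_space measure"
  assumes law_dominated: "\<And>n. law_dominated (\<mu>n n) (\<rho>n n)" and \<mu>: "prob_space \<mu>" "sets \<mu> = sets borel" and \<rho>: "prob_space \<rho>" "sets \<rho> = sets borel"
    and lim\<mu>: "\<And>\<xi>. (\<lambda>n. charf (\<mu>n n) \<xi>) \<longlonglongrightarrow> charf \<mu> \<xi>" and lim\<rho>: "\<And>\<xi>. (\<lambda>n. charf (\<rho>n n) \<xi>) \<longlonglongrightarrow> charf \<rho> \<xi>"
    and gauss: "\<And>\<sigma>. 0 < \<sigma> \<Longrightarrow> law_dominated (gauss_scaled \<sigma> :: 'a measure) (gauss_scaled \<sigma>)"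
  shows "law_dominated \<mu> \<rho>"
proof -
  have key: "riesz_le_measure \<mu> \<rho>"
    if law_dominated: "\<And>n. law_dominated (\<mu>n n) (\<rho>n n)" and \<mu>: "prob_space \<mu>" "sets \<mu> = sets borel"
      and lim\<mu>: "\<And>\<xi>. (\<lambda>n. charf (\<mu>n n) \<xi>) \<longlonglongrightarrow> charf \<mu> \<xi>" for \<mu> :: "'a measure" and \<mu>n
    unfolding riesz_le_measure_def
  proof (intro ballI impI)
    fix F E :: "'a set" assume [measurable]: "F \<in> sets borel" "E \<in> sets borel"
      and fin: "emeasure lborel F < \<top>" "emeasure lborel E < \<top>"
    have smooth: "(\<integral>\<^sup>+x. shifted_overlap F E x \<partial>conv \<mu> (gauss_scaled \<sigma>)) \<le> (\<integral>\<^sup>+x. shifted_overlap (symball F) (symball E) x \<partial>conv \<rho> (gauss_scaled \<sigma>))"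
      if \<sigma>: "0 < \<sigma>" for \<sigma>
    proof (rule LIMSEQ_le)
      show "(\<lambda>n. \<integral>\<^sup>+x. shifted_overlap F E x \<partial>conv (\<mu>n n) (gauss_scaled \<sigma>)) \<longlonglongrightarrow> (\<integral>\<^sup>+x. shifted_overlap F E x \<partial>conv \<mu> (gauss_scaled \<sigma>))"
        using law_dominated by (intro conv_gauss_tendsto \<mu> lim\<mu> \<sigma> fin) (auto simp: law_dominated_def)
      show "(\<lambda>n. \<integral>\<^sup>+x. shifted_overlap (symball F) (symball E) x \<partial>conv (\<rho>n n) (gauss_scaled \<sigma>)) \<longlonglongrightarrow> (\<integral>\<^sup>+x. shifted_overlap (symball F) (symball E) x \<partial>conv \<rho> (gauss_scaled \<sigma>))"
        using law_dominated fin by (intro conv_gauss_tendsto \<rho> lim\<rho> \<sigma>) (auto simp: law_dominated_def)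
      have "law_dominated (conv (\<mu>n n) (gauss_scaled \<sigma>)) (conv (\<rho>n n) (gauss_scaled \<sigma>))" for n
        by (intro law_dominated_conv law_dominated gauss \<sigma>)
      then show "\<exists>N. \<forall>n\<ge>N. (\<integral>\<^sup>+x. shifted_overlap F E x \<partial>conv (\<mu>n n) (gauss_scaled \<sigma>)) \<le> (\<integral>\<^sup>+x. shifted_overlap (symball F) (symball E) x \<partial>conv (\<rho>n n) (gauss_scaled \<sigma>))"
        using fin by (auto simp: law_dominated_def riesz_le_measure_def)
    qed
    show "(\<integral>\<^sup>+x. shifted_overlap F E x \<partial>\<mu>) \<le> (\<integral>\<^sup>+x. shifted_overlap (symball F) (symball E) x \<partial>\<rho>)"
    proof (rule LIMSEQ_le)
      show "(\<lambda>n. \<integral>\<^sup>+x. shifted_overlap F E x \<partial>conv \<mu> (gauss_scaled (1 / real (Suc n)))) \<longlonglongrightarrow> (\<integral>\<^sup>+x. shifted_overlap F E x \<partial>\<mu>)"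
        by (intro conv_gauss_small_tendsto \<mu> fin) auto
      show "(\<lambda>n. \<integral>\<^sup>+x. shifted_overlap (symball F) (symball E) x \<partial>conv \<rho> (gauss_scaled (1 / real (Suc n)))) \<longlonglongrightarrow> (\<integral>\<^sup>+x. shifted_overlap (symball F) (symball E) x \<partial>\<rho>)"
        using fin by (intro conv_gauss_small_tendsto \<rho>) auto
    qed (intro exI[of _ 0] allI impI smooth, simp)
  qed
  show ?thesis
    unfolding law_dominated_def using key[OF law_dominated \<mu> lim\<mu>] key[OF law_dominated_refl[OF law_dominated] \<rho> lim\<rho>] \<mu> \<rho> by simp
qed

section \<open>Convolution powers and lazy steps\<close>

primrec conv_power :: "'a::euclidean_space measure \<Rightarrow> nat \<Rightarrow> 'a measure" where
  "conv_power \<mu> 0 = return borel 0"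
| "conv_power \<mu> (Suc n) = conv \<mu> (conv_power \<mu> n)"

lemma law_dominated_conv_power: "law_dominated \<mu> \<rho> \<Longrightarrow> law_dominated (conv_power \<mu> n) (conv_power \<rho> n)"
  by (induction n) (auto intro: law_dominated_conv law_dominated_return)

lemma charf_conv_power:
  assumes "prob_space \<mu>" "sets \<mu> = sets borel"
  shows "charf (conv_power \<mu> n) \<xi> = charf \<mu> \<xi> ^ n \<and> prob_space (conv_power \<mu> n) \<and> sets (conv_power \<mu> n) = sets borel"
  by (induction n) (auto simp: charf_return charf_conv prob_space_conv prob_space_return assms)

text \<open>A jump with law \<mu> is made with probability p, otherwise the walk stays at 0.
  Convolving N such steps with p of order 1 / N approximates a compound Poisson law.\<close>

definition lazy_step :: "real \<Rightarrow> 'a::euclidean_space measure \<Rightarrow> 'a measure" where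
  "lazy_step p \<mu> = distr (measure_pmf (bernoulli_pmf p) \<Otimes>\<^sub>M \<mu>) borel (\<lambda>(b, x). if b then x else 0)"

lemma lazy_step_props:
  assumes "prob_space \<mu>" and [measurable_cong]: "sets \<mu> = sets borel" and p: "0 \<le> p" "p \<le> 1"
  shows "prob_space (lazy_step p \<mu>)" "sets (lazy_step p \<mu>) = sets borel"
    "charf (lazy_step p \<mu>) \<xi> = complex_of_real p * charf \<mu> \<xi> + complex_of_real (1 - p)"
    "h \<in> borel_measurable borel \<Longrightarrow> (\<integral>\<^sup>+x. h x \<partial>lazy_step p \<mu>) = ennreal p * (\<integral>\<^sup>+x. h x \<partial>\<mu>) + ennreal (1 - p) * h 0"
proof -
  interpret m: prob_space \<mu> by fact
  interpret pair_prob_space "measure_pmf (bernoulli_pmf p)" \<mu> ..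
  have [measurable]: "(\<lambda>(b, x). if b then x else 0) \<in> borel_measurable (measure_pmf (bernoulli_pmf p) \<Otimes>\<^sub>M \<mu>)"
    unfolding case_prod_beta by measurable
  show "prob_space (lazy_step p \<mu>)" unfolding lazy_step_def by (rule P.prob_space_distr) measurable
  show "sets (lazy_step p \<mu>) = sets borel" by (simp add: lazy_step_def)
  have "charf (lazy_step p \<mu>) \<xi> = (LINT q|(measure_pmf (bernoulli_pmf p) \<Otimes>\<^sub>M \<mu>). iexp (\<xi> \<bullet> (if fst q then snd q else 0)))"
    unfolding charf_def lazy_step_def by (subst integral_distr) (auto simp: case_prod_beta)
  also have "\<dots> = (LINT b|measure_pmf (bernoulli_pmf p). LINT x|\<mu>. iexp (\<xi> \<bullet> (if b then x else 0)))"
    by (subst integral_fst'[symmetric]) (auto intro!: P.integrable_const_bound[where B=1] simp: norm_exp_i_times cong: if_cong)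
  also have "\<dots> = (\<Sum>b\<in>UNIV. pmf (bernoulli_pmf p) b *\<^sub>R (LINT x|\<mu>. iexp (\<xi> \<bullet> (if b then x else 0))))"
    by (rule integral_measure_pmf) auto
  also have "\<dots> = complex_of_real p * charf \<mu> \<xi> + complex_of_real (1 - p)"
    using p by (simp add: UNIV_bool charf_def scaleR_conv_of_real m.prob_space)
  finally show "charf (lazy_step p \<mu>) \<xi> = complex_of_real p * charf \<mu> \<xi> + complex_of_real (1 - p)" .
  assume [measurable]: "h \<in> borel_measurable borel"
  have "(\<integral>\<^sup>+x. h x \<partial>lazy_step p \<mu>) = (\<integral>\<^sup>+q. h (if fst q then snd q else 0) \<partial>(measure_pmf (bernoulli_pmf p) \<Otimes>\<^sub>M \<mu>))"
    unfolding lazy_step_def by (subst nn_integral_distr) (auto simp: case_prod_beta)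
  also have "\<dots> = (\<integral>\<^sup>+b. \<integral>\<^sup>+x. h (if b then x else 0) \<partial>\<mu> \<partial>measure_pmf (bernoulli_pmf p))"
    by (subst m.nn_integral_fst[symmetric]) (auto cong: if_cong)
  also have "\<dots> = ennreal p * (\<integral>\<^sup>+x. h x \<partial>\<mu>) + ennreal (1 - p) * h 0"
    using p by (subst nn_integral_measure_pmf_support[of UNIV]) (auto simp: UNIV_bool m.emeasure_space_1 mult.commute add.commute)
  finally show "(\<integral>\<^sup>+x. h x \<partial>lazy_step p \<mu>) = ennreal p * (\<integral>\<^sup>+x. h x \<partial>\<mu>) + ennreal (1 - p) * h 0" .
qed

text \<open>The overlap integral of the mixture is the mixture of the overlap integrals, and the
  atom at 0 is compared with itself.\<close>

lemma law_dominated_lazy_step: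
  assumes d: "law_dominated \<mu> \<rho>" and p: "0 \<le> p" "p \<le> 1"
  shows "law_dominated (lazy_step p \<mu>) (lazy_step p \<rho>)"
proof -
  have "riesz_le_measure (lazy_step p \<mu>) (lazy_step p \<rho>)" if d: "law_dominated \<mu> \<rho>" for \<mu> \<rho> :: "'a measure"
    unfolding riesz_le_measure_def
  proof safe
    fix F E :: "'a set" assume [measurable]: "F \<in> sets borel" "E \<in> sets borel" and fin: "emeasure lborel F < \<top>" "emeasure lborel E < \<top>"
    have 0: "shifted_overlap F E 0 \<le> shifted_overlap (symball F) (symball E) 0"
      using law_dominated_return[of "0::'a"] fin by (auto simp: law_dominated_def riesz_le_measure_def nn_integral_return)
    have "(\<integral>\<^sup>+x. shifted_overlap F E x \<partial>\<mu>) \<le> (\<integral>\<^sup>+x. shifted_overlap (symball F) (symball E) x \<partial>\<rho>)"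
      using d fin by (auto simp: law_dominated_def riesz_le_measure_def)
    then show "(\<integral>\<^sup>+x. shifted_overlap F E x \<partial>lazy_step p \<mu>) \<le> (\<integral>\<^sup>+x. shifted_overlap (symball F) (symball E) x \<partial>lazy_step p \<rho>)"
      using d p 0 by (simp add: lazy_step_props(4) law_dominated_def add_mono mult_left_mono)
  qed
  from this[OF d] this[OF law_dominated_refl[OF d]] show ?thesis
    using d p by (auto simp: law_dominated_def lazy_step_props)
qed

lemma law_dominated_density:
  assumes r: "is_rearr \<phi> \<psi>" and 1: "(\<integral>\<^sup>+x. \<phi> x \<partial>lborel) = 1"
  shows "law_dominated (density lborel \<phi>) (density lborel \<psi>)"
proof -
  have [measurable]: "\<phi> \<in> borel_measurable borel" "\<psi> \<in> borel_measurable borel" using r by (auto simp: is_rearr_def)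
  have "prob_space (density lborel \<phi>)" using 1 by (intro prob_spaceI) (simp add: emeasure_density)
  moreover have "prob_space (density lborel \<psi>)" using 1 nn_integral_rearr[OF r] by (intro prob_spaceI) (simp add: emeasure_density)
  ultimately show ?thesis
    using riesz_le_density[OF r] riesz_le_density[OF is_rearr_refl[OF r]] by (simp add: law_dominated_def)
qed

subsection \<open>Linear images of Gaussian measures\<close>

lemma det_scaled_mat_1: "det (r *\<^sub>R mat 1 :: real ^ 'n ^ 'n) = r ^ CARD('n)"
  by (subst det_diagonal) (auto simp: mat_def)

lemma scaled_mat_1_vec: "(r *\<^sub>R mat 1 :: real ^ 'n ^ 'n) *v x = r *\<^sub>R x"
  by (metis matrix_vector_mul_lid scaleR_matrix_vector_assoc)

lemma scaled_mat_1_fun: "(*v) (r *\<^sub>R mat 1 :: real ^ 'n ^ 'n) = (\<lambda>x. r *\<^sub>R x)"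
  by (rule ext) (rule scaled_mat_1_vec)

lemma matrix_inv_vec:
  fixes T :: "real ^ 'n ^ 'n"
  assumes "det T \<noteq> 0"
  shows "matrix_inv T *v (T *v x) = x"
proof -
  have "\<exists>T'. T ** T' = mat 1 \<and> T' ** T = mat 1"
    using assms by (simp add: invertible_det_nz[symmetric] invertible_def)
  then have "matrix_inv T ** T = mat 1" unfolding matrix_inv_def by (rule someI2_ex) simp
  then show ?thesis by (simp add: matrix_vector_mul_assoc)
qed

text \<open>Along lines in direction m the coordinate n \<noteq> m is constant, so the shear acts on
  each fibre as a translation.\<close>

lemma nn_integral_shear:
  fixes h :: "real ^ 'n \<Rightarrow> ennreal"
  assumes [measurable]: "h \<in> borel_measurable borel" and "m \<noteq> n"
  shows "(\<integral>\<^sup>+x. h (x + (x $ n) *\<^sub>R axis m 1) \<partial>lborel) = (\<integral>\<^sup>+x. h x \<partial>lborel)"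
proof -
  define e :: "real ^ 'n" where "e = axis m 1"
  have e: "norm e = 1" by (simp add: e_def norm_axis_1)
  have en: "e $ n = 0" using assms by (simp add: e_def axis_def)
  have [measurable]: "(\<lambda>x :: real ^ 'n. x $ n) \<in> borel_measurable borel"
    by (intro borel_measurable_continuous_onI continuous_intros)
  define S where "S = {x. 0 \<le> x \<bullet> e \<and> x \<bullet> e < 1}"
  have "(\<integral>\<^sup>+x. h (x + (x $ n) *\<^sub>R e) \<partial>lborel) =
    (\<integral>\<^sup>+x. indicator S x * (\<integral>\<^sup>+s. h ((x + s *\<^sub>R e) + ((x + s *\<^sub>R e) $ n) *\<^sub>R e) \<partial>lborel) \<partial>lborel)"
    unfolding S_def by (rule nn_integral_fibres[OF e]) measurable
  also have "\<dots> = (\<integral>\<^sup>+x. indicator S x * (\<integral>\<^sup>+s. h (x + s *\<^sub>R e) \<partial>lborel) \<partial>lborel)"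
  proof (rule nn_integral_cong)
    fix x
    have "(\<integral>\<^sup>+s. h ((x + s *\<^sub>R e) + ((x + s *\<^sub>R e) $ n) *\<^sub>R e) \<partial>lborel) = (\<integral>\<^sup>+s. h (x + (x $ n + s) *\<^sub>R e) \<partial>lborel)"
      by (intro nn_integral_cong arg_cong[where f=h]) (simp add: en algebra_simps)
    also have "\<dots> = (\<integral>\<^sup>+s. h (x + s *\<^sub>R e) \<partial>lborel)"
      by (rule nn_integral_translate[where h="\<lambda>s. h (x + s *\<^sub>R e)"]) measurable
    finally show "indicator S x * (\<integral>\<^sup>+s. h ((x + s *\<^sub>R e) + ((x + s *\<^sub>R e) $ n) *\<^sub>R e) \<partial>lborel) = indicator S x * (\<integral>\<^sup>+s. h (x + s *\<^sub>R e) \<partial>lborel)"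
      by simp
  qed
  also have "\<dots> = (\<integral>\<^sup>+x. h x \<partial>lborel)"
    unfolding S_def by (rule nn_integral_fibres[OF e, symmetric]) measurable
  finally show ?thesis unfolding e_def .
qed

lemma matrix_vector_measurable [measurable]:
  "(\<lambda>x. (A :: real ^ 'n ^ 'n) *v x) \<in> borel_measurable borel"
  by (intro borel_measurable_continuous_onI matrix_vector_mult_linear_continuous_on)

text \<open>A permutation of coordinates sends boxes to boxes with the same side lengths in another
  order, and boxes determine Lebesgue measure.\<close>

lemma distr_permute_lborel:
  fixes p :: "'n::finite \<Rightarrow> 'n"
  assumes p: "p permutes UNIV"
  shows "distr lborel borel (\<lambda>x :: real ^ 'n. \<chi> i. x $ p i) = lborel"
proof (rule lborel_eqI[symmetric])
  have [measurable]: "(\<lambda>x :: real ^ 'n. \<chi> i. x $ p i) \<in> borel_measurable borel"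
    by (intro borel_measurable_continuous_onI continuous_intros)
  fix l u :: "real ^ 'n" assume lu: "\<And>b. b \<in> Basis \<Longrightarrow> l \<bullet> b \<le> u \<bullet> b"
  then have le: "l $ i \<le> u $ i" for i by (metis cart_eq_inner_axis axis_in_Basis_iff Basis_real_def insertI1)
  have prod: "(\<Prod>b\<in>Basis. (v - w) \<bullet> b) = (\<Prod>i\<in>UNIV. v $ i - w $ i)" for v w :: "real ^ 'n"
    by (simp add: Basis_vec_def prod.UNION_disjoint cart_eq_inner_axis[symmetric] inner_axis UNION_singleton_eq_range prod.reindex inj_on_def axis_eq_axis)
  define q where "q = inv p"
  have q: "p (q i) = i" "q (p i) = i" for i
    using p by (simp_all add: q_def permutes_inverses)
  define l' u' :: "real ^ 'n" where "l' = (\<chi> i. l $ q i)" and "u' = (\<chi> i. u $ q i)"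
  have "(\<lambda>x :: real ^ 'n. \<chi> i. x $ p i) -` box l u \<inter> space lborel = box l' u'"
    unfolding l'_def u'_def by (auto simp: mem_box_cart q) (metis q)+
  then have "emeasure (distr lborel borel (\<lambda>x :: real ^ 'n. \<chi> i. x $ p i)) (box l u) = emeasure lborel (box l' u')"
    by (subst emeasure_distr) auto
  also have "\<dots> = ennreal (\<Prod>b\<in>Basis. (u' - l') \<bullet> b)"
    using le by (intro emeasure_lborel_box) (auto simp: Basis_vec_def cart_eq_inner_axis[symmetric] inner_axis l'_def u'_def)
  also have "(\<Prod>b\<in>Basis. (u' - l') \<bullet> b) = (\<Prod>i\<in>UNIV. u $ q i - l $ q i)"
    unfolding prod by (simp add: l'_def u'_def)
  also have "\<dots> = (\<Prod>i\<in>UNIV. u $ i - l $ i)"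
    by (rule prod.reindex_bij_betw) (use permutes_bij[OF permutes_inv[OF p]] in \<open>simp add: q_def\<close>)
  also have "\<dots> = (\<Prod>b\<in>Basis. (u - l) \<bullet> b)" by (rule prod[symmetric])
  finally show "emeasure (distr lborel borel (\<lambda>x. \<chi> i. x $ p i)) (box l u) = (\<Prod>b\<in>Basis. (u - l) \<bullet> b)" .
qed simp

text \<open>Change of variables by decomposition into elementary matrices: products, diagonal
  matrices, transpositions and shears. A matrix with a zero row is excluded by its
  determinant.\<close>

theorem nn_integral_linear:
  fixes A :: "real ^ 'n ^ 'n"
  assumes "det A \<noteq> 0" "h \<in> borel_measurable borel"
  shows "ennreal \<bar>det A\<bar> * (\<integral>\<^sup>+x. h (A *v x) \<partial>lborel) = (\<integral>\<^sup>+x. h x \<partial>lborel)"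
  using assms
proof (induction A arbitrary: h rule: induct_matrix_elementary_alt)
  case (1 A B)
  note [measurable] = 1(4)
  have d: "det A \<noteq> 0" "det B \<noteq> 0" using 1(3) by (auto simp: det_mul)
  have "ennreal \<bar>det (A ** B)\<bar> * (\<integral>\<^sup>+x. h ((A ** B) *v x) \<partial>lborel) = ennreal \<bar>det A\<bar> * (ennreal \<bar>det B\<bar> * (\<integral>\<^sup>+x. h (A *v (B *v x)) \<partial>lborel))"
    by (simp add: det_mul abs_mult ennreal_mult matrix_vector_mul_assoc mult.assoc)
  also have "ennreal \<bar>det B\<bar> * (\<integral>\<^sup>+x. h (A *v (B *v x)) \<partial>lborel) = (\<integral>\<^sup>+x. h (A *v x) \<partial>lborel)"
    using 1(2)[OF d(2), of "\<lambda>y. h (A *v y)"] by simp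
  also have "ennreal \<bar>det A\<bar> * (\<integral>\<^sup>+x. h (A *v x) \<partial>lborel) = (\<integral>\<^sup>+x. h x \<partial>lborel)"
    using 1(1)[OF d(1)] by simp
  finally show ?case .
next
  case (2 A i)
  then show ?case using det_zero_row(1)[of i A] by simp
next
  case (3 A)
  note [measurable] = 3(3)
  have dA: "det A = (\<Prod>i\<in>UNIV. A $ i $ i)" by (rule det_diagonal) (use 3 in auto)
  then have nz: "A $ i $ i \<noteq> 0" for i using 3(2) by auto
  \<comment> \<open>The scaling formula for \<open>lborel\<close> takes its coefficients indexed by
    basis vectors; at \<open>axis i 1\<close> this sum is the i-th diagonal entry.\<close>
  define c where "c b = (\<Sum>i\<in>UNIV. (A $ i $ i) * (b $ i))" for b :: "real ^ 'n"
  have c: "c (axis i 1) = A $ i $ i" for i unfolding c_def axis_def by (simp add: if_distrib cong: if_cong)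
  have eq: "(\<Sum>b\<in>Basis. (c b * (x \<bullet> b)) *\<^sub>R b) = A *v x" for x :: "real ^ 'n"
  proof -
    have "(\<Sum>b\<in>Basis. (c b * (x \<bullet> b)) *\<^sub>R b) = (\<Sum>i\<in>UNIV. (A $ i $ i * x $ i) *\<^sub>R axis i 1)"
      by (simp add: Basis_vec_def UNION_singleton_eq_range sum.reindex inj_on_def axis_eq_axis c inner_axis)
    also have "\<dots> = A *v x"
    proof (rule vec_eq_iff[THEN iffD2, rule_format])
      fix k
      have "(A *v x) $ k = (\<Sum>j\<in>UNIV. A $ k $ j * x $ j)" by (simp add: matrix_vector_mult_def)
      also have "\<dots> = (\<Sum>j\<in>UNIV. if j = k then A $ k $ k * x $ k else 0)"
        by (rule sum.cong) (use 3(1) in auto)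
      finally have "(A *v x) $ k = (\<Sum>j\<in>UNIV. if j = k then A $ k $ k * x $ k else 0)" .
      then show "(\<Sum>i\<in>UNIV. (A $ i $ i * x $ i) *\<^sub>R axis i 1) $ k = (A *v x) $ k"
        by (simp add: axis_def if_distrib cong: if_cong)
    qed
    finally show ?thesis .
  qed
  have prodc: "(\<Prod>b\<in>Basis. \<bar>c b\<bar>) = \<bar>det A\<bar>"
    unfolding dA by (simp add: Basis_vec_def UNION_singleton_eq_range prod.reindex inj_on_def axis_eq_axis c abs_prod)
  have "lborel = density (distr lborel borel (\<lambda>x. 0 + (\<Sum>j\<in>Basis. (c j * (x \<bullet> j)) *\<^sub>R j))) (\<lambda>_. ennreal (\<Prod>j\<in>Basis. \<bar>c j\<bar>))"
    by (rule lborel_affine_euclidean) (auto simp: Basis_vec_def c nz)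
  then have "lborel = density (distr lborel borel ((*v) A)) (\<lambda>_. ennreal \<bar>det A\<bar>)" by (simp add: eq prodc)
  then have "(\<integral>\<^sup>+x. h x \<partial>lborel) = (\<integral>\<^sup>+x. h x \<partial>density (distr lborel borel ((*v) A)) (\<lambda>_. ennreal \<bar>det A\<bar>))" by simp
  also have "\<dots> = ennreal \<bar>det A\<bar> * (\<integral>\<^sup>+x. h (A *v x) \<partial>lborel)"
    by (simp add: nn_integral_density nn_integral_distr nn_integral_cmult)
  finally show ?case by simp
next
  case (4 m n)
  note [measurable] = 4(3)
  define p where "p = Transposition.transpose m n"
  have p: "p permutes UNIV" unfolding p_def by (rule permutes_swap_id) auto
  have "det (\<chi> i j. (mat 1 :: real ^ 'n ^ 'n) $ i $ p j) = of_int (sign p) * det (mat 1 :: real ^ 'n ^ 'n)"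
    by (rule det_permute_columns[OF p])
  then have d: "\<bar>det (\<chi> i j. (mat 1 :: real ^ 'n ^ 'n) $ i $ p j)\<bar> = 1" by (simp add: sign_def)
  have act: "(\<chi> i j. (mat 1 :: real ^ 'n ^ 'n) $ i $ p j) *v x = (\<chi> i. x $ p i)" for x :: "real ^ 'n"
  proof (rule vec_eq_iff[THEN iffD2, rule_format])
    fix k
    have "k = p j \<longleftrightarrow> j = p k" for j unfolding p_def by (metis transpose_involutory)
    then have "(\<Sum>j\<in>UNIV. (mat 1 :: real ^ 'n ^ 'n) $ k $ p j * x $ j) = (\<Sum>j\<in>UNIV. if j = p k then x $ j else 0)"
      by (intro sum.cong refl) (simp add: mat_def)
    then have "((\<chi> i j. (mat 1 :: real ^ 'n ^ 'n) $ i $ p j) *v x) $ k = (\<Sum>j\<in>UNIV. if j = p k then x $ j else 0)"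
      by (simp add: matrix_vector_mult_def)
    then show "((\<chi> i j. (mat 1 :: real ^ 'n ^ 'n) $ i $ p j) *v x) $ k = (\<chi> i. x $ p i) $ k" by simp
  qed
  have [measurable]: "(\<lambda>x :: real ^ 'n. \<chi> i. x $ p i) \<in> borel_measurable borel"
    by (intro borel_measurable_continuous_onI continuous_intros)
  have "(\<integral>\<^sup>+x. h x \<partial>lborel) = (\<integral>\<^sup>+x. h x \<partial>distr lborel borel (\<lambda>x :: real ^ 'n. \<chi> i. x $ p i))"
    by (simp add: distr_permute_lborel[OF p])
  also have "\<dots> = (\<integral>\<^sup>+x. h (\<chi> i. x $ p i) \<partial>lborel)" by (subst nn_integral_distr) auto
  finally show ?case using d by (simp add: act p_def[symmetric])
next
  case (5 m n)
  note [measurable] = 5(3)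
  define M :: "real ^ 'n ^ 'n" where "M = (\<chi> i j. of_bool (i = m \<and> j = n \<or> i = j))"
  have "M = (\<chi> k. if k = m then row m (mat 1) + 1 *s row n (mat 1) else row k (mat 1))"
    using 5(1) by (auto simp: M_def vec_eq_iff row_def mat_def)
  then have d: "det M = 1" using det_row_operation[OF 5(1), of "mat 1" 1] by simp
  have act: "M *v x = x + (x $ n) *\<^sub>R axis m 1" for x :: "real ^ 'n"
  proof (rule vec_eq_iff[THEN iffD2, rule_format])
    fix k
    have "(M *v x) $ k = (\<Sum>j\<in>UNIV. M $ k $ j * x $ j)" by (simp add: matrix_vector_mult_def)
    also have "\<dots> = (\<Sum>j\<in>UNIV. (if j = k then x $ j else 0) + (if j = n then of_bool (k = m) * x $ n else 0))"
      by (rule sum.cong[OF refl]) (use 5(1) in \<open>auto simp: M_def\<close>)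
    also have "\<dots> = x $ k + of_bool (k = m) * x $ n" by (simp add: sum.distrib)
    finally show "(M *v x) $ k = (x + (x $ n) *\<^sub>R axis m 1) $ k" by (simp add: axis_def)
  qed
  show ?case unfolding M_def[symmetric] d act using nn_integral_shear[of h m n] 5 by simp
qed

section \<open>Balls and ellipsoids as Gaussian level sets\<close>

lemma gauss_level_ball:
  assumes "0 < t"
  obtains k where "0 \<le> k" "level (\<lambda>x. ennreal (gauss_density (x::'a::euclidean_space))) t = ball 0 k"
proof -
  define C where "C = (1 / sqrt (2 * pi)) ^ DIM('a)"
  have C: "0 < C" by (simp add: C_def)
  \<comment> \<open>The squared radius at which the density takes the value t.\<close>
  define q where "q = 2 * ln (C / t)"
  have "exp (- q / 2) = inverse (exp (ln (C / t)))" by (simp add: q_def exp_minus)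
  also have "exp (ln (C / t)) = C / t" by (rule exp_ln) (use C assms in simp)
  finally have t: "t = C * exp (- q / 2)" using C assms by simp
  \<comment> \<open>For t at or above the peak of the density q is not positive; the radius 0 then
    gives the empty ball, as it should.\<close>
  define k where "k = sqrt (max 0 q)"
  have k: "0 \<le> k" by (simp add: k_def)
  have less: "t < gauss_density x \<longleftrightarrow> norm x < k" for x :: 'a
  proof -
    have gd: "gauss_density x = C * exp (- (norm x)\<^sup>2 / 2)" by (simp only: gauss_density_def C_def)
    have "t < gauss_density x \<longleftrightarrow> C * exp (- q / 2) < C * exp (- (norm x)\<^sup>2 / 2)"
      unfolding t[symmetric] gd ..
    also have "\<dots> \<longleftrightarrow> - q / 2 < - (norm x)\<^sup>2 / 2"
      by (simp only: mult_less_cancel_left_pos[OF C] exp_less_cancel_iff)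
    also have "\<dots> \<longleftrightarrow> (norm x)\<^sup>2 < max 0 q"
    proof (rule iffI)
      assume "(norm x)\<^sup>2 < max 0 q"
      then show "- q / 2 < - (norm x)\<^sup>2 / 2" using zero_le_power2[of "norm x"] by linarith
    qed linarith
    also have "\<dots> \<longleftrightarrow> norm x < k"
    proof (rule iffI)
      assume "norm x < k"
      then have "(norm x)\<^sup>2 < k\<^sup>2" by (intro power_strict_mono) auto
      then show "(norm x)\<^sup>2 < max 0 q" by (simp add: k_def)
    qed (simp add: k_def real_less_rsqrt)
    finally show ?thesis .
  qed
  have "level (\<lambda>x. ennreal (gauss_density (x::'a))) t = ball 0 k"
    unfolding level_def using assms by (intro set_eqI) (simp add: ennreal_less_iff less)
  with k show thesis by (rule that)
qed

definition gauss_linear :: "real ^ 'n ^ 'n \<Rightarrow> (real ^ 'n) measure" where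
  "gauss_linear T = distr gauss borel ((*v) T)"

text \<open>Each level set of the first density is an ellipsoid, the image under T of a ball. The
  second has the same ball scaled by r, and the condition on r makes the two volumes equal. Hence
  the level sets on the right are the rearrangements of those on the left, and the Riesz inequality
  applies at each height.\<close>

lemma riesz_le_gauss_linear:
  fixes T :: "real ^ 'n ^ 'n"
  assumes T: "det T \<noteq> 0" and r: "0 < r" "r ^ CARD('n) = \<bar>det T\<bar>"
  shows "riesz_le_measure (gauss_linear T) (gauss_scaled r)"
  unfolding riesz_le_measure_def
proof safe
  fix F E :: "(real ^ 'n) set" assume [measurable]: "F \<in> sets borel" "E \<in> sets borel"
  define g where "g x = ennreal (gauss_density x)" for x :: "real ^ 'n"
  have [measurable]: "g \<in> borel_measurable borel" by (simp add: g_def[abs_def])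
  have dS: "det (r *\<^sub>R mat 1 :: real ^ 'n ^ 'n) = r ^ CARD('n)"
    by (simp add: det_scaled_mat_1)
  note Sv = scaled_mat_1_vec
  have eq: "ennreal \<bar>det T\<bar> * (\<integral>\<^sup>+x. shifted_overlap F E x \<partial>distr gauss borel ((*v) T)) =
     (\<integral>\<^sup>+t. indicator {0<..} t * riesz {x. matrix_inv T *v x \<in> level g t} F E \<partial>lborel)"
    if T: "det T \<noteq> 0" and [measurable]: "F \<in> sets borel" "E \<in> sets borel" for T :: "real ^ 'n ^ 'n" and F E :: "(real ^ 'n) set"
  proof -
    note inv = matrix_inv_vec[OF T]
    have "(\<integral>\<^sup>+x. shifted_overlap F E x \<partial>distr gauss borel ((*v) T)) = (\<integral>\<^sup>+x. shifted_overlap F E (T *v x) * g x \<partial>lborel)"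
      by (simp add: nn_integral_distr gauss_def nn_integral_density g_def mult.commute)
    also have "\<dots> = (\<integral>\<^sup>+x. (\<lambda>y. shifted_overlap F E y * g (matrix_inv T *v y)) (T *v x) \<partial>lborel)"
      by (simp add: inv)
    also have "ennreal \<bar>det T\<bar> * \<dots> = (\<integral>\<^sup>+y. shifted_overlap F E y * g (matrix_inv T *v y) \<partial>lborel)"
      by (rule nn_integral_linear[OF T]) measurable
    also have "\<dots> = (\<integral>\<^sup>+t. indicator {0<..} t * (\<integral>\<^sup>+x. indicator (level (\<lambda>y. g (matrix_inv T *v y)) t) x * shifted_overlap F E x \<partial>lborel) \<partial>lborel)"
      by (rule nn_integral_layer_cake) auto
    also have "\<dots> = (\<integral>\<^sup>+t. indicator {0<..} t * riesz {x. matrix_inv T *v x \<in> level g t} F E \<partial>lborel)"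
      unfolding riesz_def shifted_overlap_def by (simp add: nn_integral_cmult[symmetric] mult.assoc level_def)
    finally show ?thesis .
  qed
  have meas: "emeasure lborel {x. matrix_inv T *v x \<in> B} = ennreal \<bar>det T\<bar> * emeasure lborel B" if T: "det T \<noteq> 0" and [measurable]: "B \<in> sets borel" for T :: "real ^ 'n ^ 'n" and B
  proof -
    note inv = matrix_inv_vec[OF T]
    have "emeasure lborel {x. matrix_inv T *v x \<in> B} = (\<integral>\<^sup>+x. indicator B (matrix_inv T *v x) \<partial>lborel)"
      by (subst nn_integral_indicator[symmetric]) (measurable, intro nn_integral_cong, simp add: indicator_def)
    also have "\<dots> = ennreal \<bar>det T\<bar> * (\<integral>\<^sup>+x. indicator B (matrix_inv T *v (T *v x)) \<partial>lborel)"
      by (rule nn_integral_linear[OF T, symmetric]) measurable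
    finally show ?thesis by (simp add: inv)
  qed
  define S where "S = (r *\<^sub>R mat 1 :: real ^ 'n ^ 'n)"
  have S: "det S \<noteq> 0" "\<bar>det S\<bar> = \<bar>det T\<bar>" using r T by (auto simp: S_def dS)
  have Sinv: "matrix_inv S *v x = x /\<^sub>R r" for x
  proof -
    have "matrix_inv S *v (S *v (x /\<^sub>R r)) = x /\<^sub>R r"
      using S by (simp add: matrix_inv_vec)
    then show ?thesis using r by (simp add: S_def Sv)
  qed
  have gs: "gauss_scaled r = distr gauss borel ((*v) S)"
    unfolding gauss_scaled_def S_def scaled_mat_1_fun by simp
  \<comment> \<open>Multiplying by the common determinant avoids dividing in the change of
    variables; it is nonzero and is cancelled at the end.\<close>
  have "ennreal \<bar>det T\<bar> * (\<integral>\<^sup>+x. shifted_overlap F E x \<partial>gauss_linear T) \<le> ennreal \<bar>det T\<bar> * (\<integral>\<^sup>+x. shifted_overlap (symball F) (symball E) x \<partial>gauss_scaled r)"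
    unfolding gs gauss_linear_def eq[OF T \<open>F \<in> sets borel\<close> \<open>E \<in> sets borel\<close>] eq[OF S(1) sets_symball[of F] sets_symball[of E], unfolded S(2)]
  proof (rule nn_integral_mono)
    fix t :: real
    show "indicator {0<..} t * riesz {x. matrix_inv T *v x \<in> level g t} F E \<le> indicator {0<..} t * riesz {x. matrix_inv S *v x \<in> level g t} (symball F) (symball E)"
    proof (cases "0 < t")
      case True
      obtain k where k: "0 \<le> k" "level g t = ball 0 k" using gauss_level_ball[OF True] unfolding g_def by blast
      have 1: "{x. matrix_inv S *v x \<in> level g t} = ball 0 (r * k)"
        using r by (auto simp: Sinv k field_simps)
      have "symball {x. matrix_inv T *v x \<in> level g t} = symball {x. matrix_inv S *v x \<in> level g t}"
        using S T by (intro symball_cong) (simp add: meas)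
      also have "\<dots> = {x. matrix_inv S *v x \<in> level g t}" using r k unfolding 1 by (simp add: symball_ball)
      finally have 2: "symball {x. matrix_inv T *v x \<in> level g t} = {x. matrix_inv S *v x \<in> level g t}" .
      have [measurable]: "{x. matrix_inv T *v x \<in> level g t} \<in> sets borel" by measurable
      have "riesz {x. matrix_inv T *v x \<in> level g t} F E \<le> riesz {x. matrix_inv S *v x \<in> level g t} (symball F) (symball E)"
        using riesz_rearrangement[of "{x. matrix_inv T *v x \<in> level g t}" F E] unfolding 2 by simp
      then show ?thesis using True by simp
    qed simp
  qed
  then show "(\<integral>\<^sup>+x. shifted_overlap F E x \<partial>gauss_linear T) \<le> (\<integral>\<^sup>+x. shifted_overlap (symball F) (symball E) x \<partial>gauss_scaled r)"
    using T by (simp add: ennreal_mult_le_mult_iff)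
qed

lemma gauss_linear_scaled: "gauss_scaled r = gauss_linear (r *\<^sub>R mat 1)"
  unfolding gauss_scaled_def gauss_linear_def scaled_mat_1_fun ..

lemma prob_space_gauss_linear: "prob_space (gauss_linear T)" "sets (gauss_linear T) = sets borel"
  using prob_space.prob_space_distr[OF prob_space_gauss, of "(*v) T" borel] by (simp_all add: gauss_linear_def)

lemma charf_gauss_linear: "charf (gauss_linear T) \<xi> = complex_of_real (exp (- (norm (transpose T *v \<xi>))\<^sup>2 / 2))"
proof -
  have "charf (gauss_linear T) \<xi> = (LINT x|gauss. iexp (\<xi> \<bullet> (T *v x)))"
    unfolding charf_def gauss_linear_def by (subst integral_distr) auto
  also have "\<dots> = charf gauss (transpose T *v \<xi>)"
    unfolding charf_def by (simp only: dot_lmul_matrix transpose_matrix_vector)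
  finally show ?thesis by (simp add: charf_gauss)
qed

lemma law_dominated_gauss_linear:
  fixes T :: "real ^ 'n ^ 'n"
  assumes T: "det T \<noteq> 0" and r: "0 < r" "r ^ CARD('n) = \<bar>det T\<bar>"
  shows "law_dominated (gauss_linear T) (gauss_scaled r)"
proof -
  have "riesz_le_measure (gauss_linear (r *\<^sub>R mat 1 :: real ^ 'n ^ 'n)) (gauss_scaled r)"
    by (rule riesz_le_gauss_linear) (use r T in \<open>simp_all add: det_scaled_mat_1\<close>)
  then show ?thesis
    unfolding law_dominated_def gauss_linear_scaled[symmetric]
    using riesz_le_gauss_linear[OF assms] prob_space_gauss_linear[of T] by (simp add: prob_space_gauss_scaled)
qed

lemma law_dominated_gauss_scaled:
  assumes "0 < \<sigma>"
  shows "law_dominated (gauss_scaled \<sigma> :: (real ^ 'n) measure) (gauss_scaled \<sigma>)"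
  by (rule law_dominated_refl, rule law_dominated_gauss_linear[of "\<sigma> *\<^sub>R mat 1 :: real ^ 'n ^ 'n"])
     (use assms in \<open>simp_all add: det_scaled_mat_1\<close>)

subsection \<open>The rearrangement of a Borel function\<close>

lemma level_eq_Union:
  fixes w :: "'a \<Rightarrow> ennreal"
  assumes c: "0 \<le> c"
  shows "level w c = (\<Union>n. level w (c + 1 / Suc n))"
proof (intro equalityI subsetI)
  fix x assume x: "x \<in> level w c"
  then obtain d where d: "ennreal c < d" "d < w x" by (auto simp: level_def dest: dense)
  then obtain e where e: "d = ennreal e" "c < e" using c by (cases d) (auto simp: ennreal_less_iff)
  obtain n where "1 / real (Suc n) < e - c" using e(2) nat_approx_posE[of "e - c"] by auto
  then have "ennreal (c + 1 / Suc n) \<le> d" using e by (auto intro!: ennreal_leI)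
  then have "x \<in> level w (c + 1 / Suc n)" using d by (auto simp: level_def)
  then show "x \<in> (\<Union>n. level w (c + 1 / Suc n))" by blast
next
  fix x assume "x \<in> (\<Union>n. level w (c + 1 / Suc n))"
  then obtain n where "x \<in> level w (c + 1 / Suc n)" by blast
  then show "x \<in> level w c" using level_antimono[of c "c + 1 / Suc n" w] by auto
qed

text \<open>Volumes of level sets are continuous from the right in the height, because the strict
  inequality defining a level set holds with some room.\<close>

lemma emeasure_level_SUP:
  fixes w :: "'a::euclidean_space \<Rightarrow> ennreal"
  assumes [measurable]: "w \<in> borel_measurable borel" and c: "0 \<le> c"
  shows "emeasure lborel (level w c) = (SUP n. emeasure lborel (level w (c + 1 / Suc n)))"
  unfolding level_eq_Union[OF c]
  by (rule SUP_emeasure_incseq[symmetric]) (auto simp: incseq_def intro!: level_antimono frac_le)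

lemma symball_mem_SUP:
  assumes "emeasure lborel A = (SUP n. emeasure lborel (B n))"
  shows "symball A = (\<Union>n. symball (B n))"
  unfolding symball_def assms by (auto simp: less_SUP_iff)

definition rearr_fun :: "('a::euclidean_space \<Rightarrow> ennreal) \<Rightarrow> 'a \<Rightarrow> ennreal" where
  "rearr_fun f x = (SUP t\<in>{t. 0 \<le> t \<and> x \<in> symball (level f t)}. ennreal t)"

text \<open>The supremum in \<open>rearr_fun\<close> could lose the strict inequality at the height
  t itself. Right continuity of the volumes prevents this: a point of the ball at height t still
  lies in the ball at a slightly greater height.\<close>

lemma level_rearr_fun:
  fixes f :: "'a::euclidean_space \<Rightarrow> ennreal"
  assumes [measurable]: "f \<in> borel_measurable borel" and t: "0 \<le> t"
  shows "level (rearr_fun f) t = symball (level f t)"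
proof (intro equalityI subsetI)
  fix x assume "x \<in> level (rearr_fun f) t"
  then obtain s where s: "0 \<le> s" "x \<in> symball (level f s)" "ennreal t < ennreal s"
    by (auto simp: level_def rearr_fun_def less_SUP_iff)
  then have "t \<le> s" using t by (simp add: ennreal_less_iff)
  then have "symball (level f s) \<subseteq> symball (level f t)"
    by (intro symball_mono emeasure_mono level_antimono) auto
  then show "x \<in> symball (level f t)" using s by blast
next
  fix x assume "x \<in> symball (level f t)"
  then obtain n where n: "x \<in> symball (level f (t + 1 / Suc n))"
    using symball_mem_SUP[OF emeasure_level_SUP[OF assms]] by blast
  have "ennreal t < ennreal (t + 1 / Suc n)" using t by (simp add: ennreal_less_iff del: ennreal_plus)
  also have "\<dots> \<le> rearr_fun f x"
    unfolding rearr_fun_def using n t by (intro SUP_upper) auto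
  finally show "x \<in> level (rearr_fun f) t" by (simp add: level_def)
qed

lemma rearr_fun_measurable [measurable]:
  fixes f :: "'a::euclidean_space \<Rightarrow> ennreal"
  assumes [measurable]: "f \<in> borel_measurable borel"
  shows "rearr_fun f \<in> borel_measurable borel"
proof (rule borel_measurableI_greater)
  fix y :: ennreal
  show "{x \<in> space borel. y < rearr_fun f x} \<in> sets borel"
  proof (cases y)
    case (real t)
    have "{x \<in> space borel. y < rearr_fun f x} = level (rearr_fun f) t" by (simp add: level_def real)
    then show ?thesis using real by (simp add: level_rearr_fun)
  next
    case top
    then have "{x \<in> space borel. y < rearr_fun f x} = {}" by auto
    then show ?thesis by (simp only: sets.empty_sets)
  qed
qed

lemma is_rearr_rearr_fun: "f \<in> borel_measurable borel \<Longrightarrow> is_rearr f (rearr_fun f)"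
  by (simp add: is_rearr_def level_rearr_fun)

lemma ennreal_le_levels: "(\<And>t. 0 \<le> t \<Longrightarrow> ennreal t < a \<Longrightarrow> ennreal t < b) \<Longrightarrow> a \<le> b"
proof (rule ccontr)
  assume *: "\<And>t. 0 \<le> t \<Longrightarrow> ennreal t < a \<Longrightarrow> ennreal t < b" and "\<not> a \<le> b"
  then have "b < a" by simp
  then show False using *[of "enn2real b"] by (cases b) auto
qed

lemma is_rearr_radial:
  assumes "is_rearr f g" "norm x = norm y"
  shows "g x = g y"
proof -
  have "g x \<le> g y" if "norm x = norm y" for x y
  proof (rule ennreal_le_levels)
    fix t :: real assume t: "0 \<le> t" "ennreal t < g x"
    then have "x \<in> symball (level f t)" using assms(1) by (auto simp: is_rearr_def level_def)
    then have "y \<in> symball (level f t)" using that by (simp add: symball_def)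
    then show "ennreal t < g y" using t assms(1) by (auto simp: is_rearr_def level_def)
  qed
  then show ?thesis using assms(2) by (metis antisym)
qed

lemma is_rearr_mono:
  assumes "is_rearr f g" "is_rearr f' g'" "\<And>x. f x \<le> f' x"
  shows "g x \<le> g' x"
proof (rule ennreal_le_levels)
  fix t :: real assume t: "0 \<le> t" "ennreal t < g x"
  have [measurable]: "f \<in> borel_measurable borel" "f' \<in> borel_measurable borel" using assms by (auto simp: is_rearr_def)
  have "x \<in> symball (level f t)" using assms(1) t by (auto simp: is_rearr_def level_def)
  also have "symball (level f t) \<subseteq> symball (level f' t)"
    using assms(3) by (intro symball_mono emeasure_mono) (auto simp: level_def intro: less_le_trans)
  finally show "ennreal t < g' x" using t assms(2) by (auto simp: is_rearr_def level_def)
qed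

text \<open>Volumes pass to increasing unions and ignore null sets, so the limit of the fn is needed
  only almost everywhere, yet that of the rearrangements holds at every point.\<close>

lemma is_rearr_SUP:
  assumes "\<And>n. is_rearr (fn n) (gn n)" "is_rearr f g" and inc: "incseq fn"
    and sup: "AE x in lborel. f x = (SUP n. fn n x)"
  shows "g x = (SUP n. gn n x)"
proof (rule antisym)
  have [measurable]: "f \<in> borel_measurable borel" "fn n \<in> borel_measurable borel" for n using assms by (auto simp: is_rearr_def)
  show "g x \<le> (SUP n. gn n x)"
  proof (rule ennreal_le_levels)
    fix t :: real assume t: "0 \<le> t" "ennreal t < g x"
    have "emeasure lborel (level f t) = emeasure lborel (\<Union>n. level (fn n) t)"
      by (rule emeasure_eq_AE) (use sup in \<open>auto simp: level_def less_SUP_iff elim: eventually_mono\<close>)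
    also have "\<dots> = (SUP n. emeasure lborel (level (fn n) t))"
      using inc by (intro SUP_emeasure_incseq[symmetric]) (auto simp: incseq_def le_fun_def level_def intro: less_le_trans)
    finally have "symball (level f t) = (\<Union>n. symball (level (fn n) t))" by (rule symball_mem_SUP)
    moreover have "x \<in> symball (level f t)" using assms(2) t by (auto simp: is_rearr_def level_def)
    ultimately obtain n where "x \<in> symball (level (fn n) t)" by blast
    then have "ennreal t < gn n x" using assms(1)[of n] t by (auto simp: is_rearr_def level_def)
    then show "ennreal t < (SUP n. gn n x)" by (auto simp: less_SUP_iff)
  qed
  show "(SUP n. gn n x) \<le> g x"
  proof (rule SUP_least)
    fix n
    show "gn n x \<le> g x"
    proof (rule ennreal_le_levels)
      fix t :: real assume t: "0 \<le> t" "ennreal t < gn n x"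
      have "x \<in> symball (level (fn n) t)" using assms(1)[of n] t by (auto simp: is_rearr_def level_def)
      also have "emeasure lborel (level (fn n) t) \<le> emeasure lborel (level f t)"
        by (rule emeasure_mono_AE) (use sup in \<open>auto simp: level_def less_SUP_iff elim!: eventually_mono\<close>)
      then have "symball (level (fn n) t) \<subseteq> symball (level f t)" by (rule symball_mono)
      finally show "ennreal t < g x" using t assms(2) by (auto simp: is_rearr_def level_def)
    qed
  qed
qed

lemma is_rearr_scale:
  assumes r: "is_rearr f g" and c: "0 < c"
  shows "is_rearr (\<lambda>x. ennreal c * f x) (\<lambda>x. ennreal c * g x)"
proof -
  have [measurable]: "f \<in> borel_measurable borel" "g \<in> borel_measurable borel" using r by (auto simp: is_rearr_def)
  have lev: "level (\<lambda>x. ennreal c * h x) t = level h (t / c)" if "0 \<le> t" for t and h :: "'a \<Rightarrow> ennreal"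
  proof -
    have "ennreal t < ennreal c * a \<longleftrightarrow> ennreal (t / c) < a" for a
    proof (cases a)
      case (real r)
      then show ?thesis using c that by (simp add: ennreal_mult[symmetric] ennreal_less_iff field_simps)
    qed (use c in \<open>simp add: ennreal_mult_top\<close>)
    then show ?thesis by (simp add: level_def)
  qed
  show ?thesis using r c by (auto simp: is_rearr_def lev)
qed

subsection \<open>Approximation of Levy processes by compound Poisson and Gaussian laws\<close>

text \<open>The lazy step jumps with probability c * l according to the normalized density; the
  total mass l cancels and leaves 1 minus c times the unnormalized jump integral. Equal total masses
  give both laws the same jump probability.\<close>

lemma jump_step:
  fixes \<phi> \<psi> :: "'a::euclidean_space \<Rightarrow> ennreal"
  assumes r: "is_rearr \<phi> \<psi>" and l: "(\<integral>\<^sup>+x. \<phi> x \<partial>lborel) = ennreal l" "0 \<le> l" and c: "0 \<le> c" "c * l \<le> 1"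
  obtains \<mu> \<rho> :: "'a measure" where "law_dominated \<mu> \<rho>"
    "\<And>\<xi>. charf \<mu> \<xi> = 1 - complex_of_real c * (LINT y|density lborel \<phi>. 1 - iexp (\<xi> \<bullet> y))"
    "\<And>\<xi>. charf \<rho> \<xi> = 1 - complex_of_real c * (LINT y|density lborel \<psi>. 1 - iexp (\<xi> \<bullet> y))"
proof (cases "l = 0")
  \<comment> \<open>There is nothing to normalize by when the total mass is zero; both laws are then
    the point mass at 0.\<close>
  case True
  have zero: "(LINT y|density lborel \<phi>. 1 - iexp (\<xi> \<bullet> y)) = 0"
    if [measurable]: "\<phi> \<in> borel_measurable borel" and "(\<integral>\<^sup>+x. \<phi> x \<partial>lborel) = 0" for \<phi> :: "'a \<Rightarrow> ennreal" and \<xi>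
  proof -
    have "AE x in lborel. \<phi> x = 0" using that(2) by (subst (asm) nn_integral_0_iff_AE) auto
    then have "AE x in density lborel \<phi>. 1 - iexp (\<xi> \<bullet> x) = 0"
      by (subst AE_density) (auto elim: eventually_mono)
    then show ?thesis by (rule integral_eq_zero_AE)
  qed
  have "\<phi> \<in> borel_measurable borel" "\<psi> \<in> borel_measurable borel" using r by (auto simp: is_rearr_def)
  moreover have z: "(\<integral>\<^sup>+x. \<phi> x \<partial>lborel) = 0" using l(1) True by (simp only: ennreal_0)
  moreover have "(\<integral>\<^sup>+x. \<psi> x \<partial>lborel) = 0" using z by (simp only: nn_integral_rearr[OF r])
  ultimately have "(LINT y|density lborel \<phi>. 1 - iexp (\<xi> \<bullet> y)) = 0" "(LINT y|density lborel \<psi>. 1 - iexp (\<xi> \<bullet> y)) = 0" for \<xi>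
    using zero by blast+
  then show thesis
    by (intro that[of "return borel 0" "return borel 0"]) (simp_all add: law_dominated_return charf_return)
next
  case False
  then have pos: "0 < l" using l by simp
  have meas: "\<phi> \<in> borel_measurable borel" "\<psi> \<in> borel_measurable borel" using r by (auto simp: is_rearr_def)
  have step: "prob_space (density lborel (\<lambda>x. ennreal (1 / l) * \<phi> x))"
     "charf (lazy_step (c * l) (density lborel (\<lambda>x. ennreal (1 / l) * \<phi> x))) \<xi> = 1 - complex_of_real c * (LINT y|density lborel \<phi>. 1 - iexp (\<xi> \<bullet> y))"
    if [measurable]: "\<phi> \<in> borel_measurable borel" and i: "(\<integral>\<^sup>+x. \<phi> x \<partial>lborel) = ennreal l" for \<phi> :: "'a \<Rightarrow> ennreal" and \<xi>
  proof -
    define Q where "Q = density lborel (\<lambda>x. ennreal (1 / l) * \<phi> x)"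
    show p: "prob_space Q" unfolding Q_def
      by (rule prob_spaceI) (simp add: emeasure_density nn_integral_cmult i ennreal_mult[symmetric] l False)
    have s: "sets Q = sets borel" by (simp add: Q_def)
    interpret D: finite_measure "density lborel \<phi>"
      by (rule finite_measureI) (simp add: emeasure_density i)
    have mD: "measure (density lborel \<phi>) UNIV = l"
      by (simp add: measure_def emeasure_density i l)
    have "Q = density (density lborel \<phi>) (\<lambda>_. ennreal (1 / l))"
      unfolding Q_def by (subst density_density_eq) (auto simp: mult.commute)
    then have "charf Q \<xi> = (LINT y|density lborel \<phi>. (1 / l) *\<^sub>R iexp (\<xi> \<bullet> y))"
      unfolding charf_def using pos by (simp only:) (subst integral_density, auto)
    also have "\<dots> = complex_of_real (1 / l) * (LINT y|density lborel \<phi>. iexp (\<xi> \<bullet> y))"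
      by (simp add: scaleR_conv_of_real)
    finally have cQ: "complex_of_real (c * l) * charf Q \<xi> = complex_of_real c * (LINT y|density lborel \<phi>. iexp (\<xi> \<bullet> y))"
      using pos by simp
    have J: "(LINT y|density lborel \<phi>. 1 - iexp (\<xi> \<bullet> y)) = complex_of_real l - (LINT y|density lborel \<phi>. iexp (\<xi> \<bullet> y))"
      by (subst Bochner_Integration.integral_diff)
         (auto intro!: D.integrable_const_bound[where B=1] simp: norm_exp_i_times mD scaleR_conv_of_real)
    have "charf (lazy_step (c * l) Q) \<xi> = complex_of_real (c * l) * charf Q \<xi> + complex_of_real (1 - c * l)"
      using c l by (intro lazy_step_props(3) p s) auto
    then show "charf (lazy_step (c * l) Q) \<xi> = 1 - complex_of_real c * (LINT y|density lborel \<phi>. 1 - iexp (\<xi> \<bullet> y))"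
      unfolding J cQ by (simp add: algebra_simps)
  qed
  have r': "is_rearr (\<lambda>x. ennreal (1 / l) * \<phi> x) (\<lambda>x. ennreal (1 / l) * \<psi> x)"
    using pos by (intro is_rearr_scale[OF r]) simp
  have one: "(\<integral>\<^sup>+x. ennreal (1 / l) * \<phi> x \<partial>lborel) = 1"
    using meas pos by (simp add: nn_integral_cmult l ennreal_mult[symmetric])
  have "law_dominated (lazy_step (c * l) (density lborel (\<lambda>x. ennreal (1 / l) * \<phi> x))) (lazy_step (c * l) (density lborel (\<lambda>x. ennreal (1 / l) * \<psi> x)))"
    using c l by (intro law_dominated_lazy_step law_dominated_density r' one) auto
  then show thesis
    using step(2)[OF meas(1) l(1)] step(2)[OF meas(2)] nn_integral_rearr[OF r] l by (intro that) auto
qed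

text \<open>For numbers of modulus at most one, the distance of N-th powers is at most N times the
  distance of the bases. Each base contributes a quadratic Taylor remainder of order 1 over N
  squared. The nonnegative real part bounds the exponential by one.\<close>

lemma poisson_approx:
  fixes \<Lambda> :: complex
  assumes N: "0 < N" and "norm (\<Lambda> / of_nat N) \<le> 1" and "0 \<le> Re \<Lambda>" and "norm (1 - \<Lambda> / of_nat N) \<le> 1"
  shows "norm ((1 - \<Lambda> / of_nat N) ^ N - exp (- \<Lambda>)) \<le> exp 1 * (norm \<Lambda>)\<^sup>2 / N"
proof -
  define u where "u = \<Lambda> / of_nat N"
  have u: "norm u \<le> 1" "of_nat N * u = \<Lambda>" "norm u = norm \<Lambda> / N" using assms by (auto simp: u_def norm_divide)
  have "exp (- \<Lambda>) = exp (- u) ^ N" using u(2) by (simp add: exp_of_nat_mult[symmetric])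
  then have "norm ((1 - u) ^ N - exp (- \<Lambda>)) = norm ((1 - u) ^ N - exp (- u) ^ N)" by simp
  also have "\<dots> \<le> N * norm ((1 - u) - exp (- u))"
  proof (rule norm_power_diff)
    show "norm (1 - u) \<le> 1" using assms by (simp add: u_def)
    have "0 \<le> Re u" using assms by (simp add: u_def)
    then show "norm (exp (- u)) \<le> 1" by simp
  qed
  also have "norm ((1 - u) - exp (- u)) = norm (exp (- u) - (\<Sum>i\<le>1. (- u) ^ i / fact i))"
    by (simp add: norm_minus_commute)
  also have "\<dots> \<le> exp (norm (- u)) * norm (- u) ^ Suc 1 / fact 1" by (rule Taylor_exp_field)
  also have "\<dots> = exp (norm u) * (norm u)\<^sup>2" by (simp add: power2_eq_square)
  also have "\<dots> \<le> exp 1 * (norm u)\<^sup>2" using u by (intro mult_right_mono) auto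
  also have "real N * (exp 1 * (norm u)\<^sup>2) = exp 1 * (norm \<Lambda>)\<^sup>2 / N"
    using N by (simp add: u(3) power2_eq_square field_simps)
  finally show ?thesis using N by (simp add: u_def mult_left_mono)
qed

text \<open>The compound Poisson law at time s is approximated by N lazy steps of length s / N. The
  jump integral is at most 2 * l in modulus for every frequency, so the error is uniform in
  \<xi>.\<close>

lemma jump_approx:
  fixes \<phi> \<psi> :: "'a::euclidean_space \<Rightarrow> ennreal"
  assumes r: "is_rearr \<phi> \<psi>" and fin: "(\<integral>\<^sup>+x. \<phi> x \<partial>lborel) < \<top>" and s: "0 \<le> s" and eps: "0 < \<epsilon>"
  obtains \<mu> \<rho> :: "'a measure" where "law_dominated \<mu> \<rho>"
    "\<And>\<xi>. norm (charf \<mu> \<xi> - exp (- (complex_of_real s * (LINT y|density lborel \<phi>. 1 - iexp (\<xi> \<bullet> y))))) \<le> \<epsilon>"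
    "\<And>\<xi>. norm (charf \<rho> \<xi> - exp (- (complex_of_real s * (LINT y|density lborel \<psi>. 1 - iexp (\<xi> \<bullet> y))))) \<le> \<epsilon>"
proof -
  have meas: "\<phi> \<in> borel_measurable borel" "\<psi> \<in> borel_measurable borel" using r by (auto simp: is_rearr_def)
  obtain l where l: "(\<integral>\<^sup>+x. \<phi> x \<partial>lborel) = ennreal l" "0 \<le> l" using fin by (cases "\<integral>\<^sup>+x. \<phi> x \<partial>lborel") auto
  have l': "(\<integral>\<^sup>+x. \<psi> x \<partial>lborel) = ennreal l" using nn_integral_rearr[OF r] l by simp
  \<comment> \<open>The first bound keeps the jump probability and the modulus of the exponent per
    step below one; the second makes the error of \<open>poisson_approx\<close> at most
    \<epsilon>.\<close>
  obtain N :: nat where N: "max (1 + 2 * s * l) (exp 1 * (2 * s * l)\<^sup>2 / \<epsilon>) < real N" using reals_Archimedean2 by blast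
  have "0 \<le> s * l" using s l by simp
  then have N0: "0 < N" "1 + 2 * s * l < N" using N by (auto simp: max_def split: if_splits)
  have N1: "exp 1 * (2 * s * l)\<^sup>2 / N \<le> \<epsilon>"
  proof -
    have "exp 1 * (2 * s * l)\<^sup>2 / \<epsilon> < real N" using N by simp
    then show ?thesis using eps N0 by (simp add: field_simps)
  qed
  have "s / N * l \<le> 1" using N0 \<open>0 \<le> s * l\<close> by (simp add: field_simps)
  then obtain \<mu> \<rho> :: "'a measure" where d: "law_dominated \<mu> \<rho>"
    and c\<mu>: "\<And>\<xi>. charf \<mu> \<xi> = 1 - complex_of_real (s / N) * (LINT y|density lborel \<phi>. 1 - iexp (\<xi> \<bullet> y))"
    and c\<rho>: "\<And>\<xi>. charf \<rho> \<xi> = 1 - complex_of_real (s / N) * (LINT y|density lborel \<psi>. 1 - iexp (\<xi> \<bullet> y))"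
    using jump_step[OF r l, of "s / N"] s by auto
  have est: "norm (charf (conv_power \<mu> N) \<xi> - exp (- (complex_of_real s * (LINT y|density lborel \<phi>. 1 - iexp (\<xi> \<bullet> y))))) \<le> \<epsilon>"
    if meas[measurable]: "\<phi> \<in> borel_measurable borel" and i: "(\<integral>\<^sup>+x. \<phi> x \<partial>lborel) = ennreal l" and p: "prob_space \<mu>" "sets \<mu> = sets borel"
    and c\<mu>: "charf \<mu> \<xi> = 1 - complex_of_real (s / N) * (LINT y|density lborel \<phi>. 1 - iexp (\<xi> \<bullet> y))" for \<phi> and \<mu> :: "'a measure" and \<xi>
  proof -
    interpret D: finite_measure "density lborel \<phi>"
      by (rule finite_measureI) (simp add: emeasure_density i)
    have mD: "measure (density lborel \<phi>) UNIV = l"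
      by (simp add: measure_def emeasure_density i l)
    define L where "L = (LINT y|density lborel \<phi>. 1 - iexp (\<xi> \<bullet> y))"
    have bd: "norm (1 - iexp x) \<le> 2" for x :: real
      using norm_triangle_ineq4[of 1 "iexp x"] by (simp add: norm_exp_i_times)
    have int: "integrable (density lborel \<phi>) (\<lambda>y. 1 - iexp (\<xi> \<bullet> y))"
      by (rule D.integrable_const_bound[where B=2]) (auto simp: bd)
    have "norm L \<le> (LINT y|density lborel \<phi>. norm (1 - iexp (\<xi> \<bullet> y)))"
      unfolding L_def by (rule integral_norm_bound)
    also have "\<dots> \<le> (LINT y|density lborel \<phi>. 2)"
      using int bd by (intro integral_mono) auto
    finally have "norm L \<le> (LINT y|density lborel \<phi>. 2)" .
    then have nL: "norm L \<le> 2 * l" by (simp add: mD)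
    have "Re L = (LINT y|density lborel \<phi>. Re (1 - iexp (\<xi> \<bullet> y)))"
      unfolding L_def by (rule integral_Re[OF int, symmetric])
    also have "0 \<le> \<dots>" by (rule Bochner_Integration.integral_nonneg) (simp add: Re_exp)
    finally have ReL: "0 \<le> Re L" .
    define \<Lambda> where "\<Lambda> = complex_of_real s * L"
    have n\<Lambda>: "norm \<Lambda> \<le> 2 * s * l" using mult_left_mono[OF nL s] s by (simp add: \<Lambda>_def norm_mult mult.assoc mult.left_commute)
    have c: "charf \<mu> \<xi> = 1 - \<Lambda> / of_nat N" unfolding c\<mu> L_def[symmetric] \<Lambda>_def by simp
    have "norm (charf (conv_power \<mu> N) \<xi> - exp (- \<Lambda>)) = norm ((1 - \<Lambda> / of_nat N) ^ N - exp (- \<Lambda>))"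
      using charf_conv_power[OF p] by (simp add: c)
    also have "\<dots> \<le> exp 1 * (norm \<Lambda>)\<^sup>2 / N"
    proof (rule poisson_approx[OF N0(1)])
      show "norm (\<Lambda> / of_nat N) \<le> 1" using n\<Lambda> N0 by (simp add: norm_divide)
      show "0 \<le> Re \<Lambda>" using ReL s by (simp add: \<Lambda>_def)
      show "norm (1 - \<Lambda> / of_nat N) \<le> 1" using charf_le_1[OF p, of \<xi>] by (simp add: c)
    qed
    also have "\<dots> \<le> exp 1 * (2 * s * l)\<^sup>2 / N"
      using n\<Lambda> by (intro divide_right_mono mult_left_mono power_mono) auto
    also have "\<dots> \<le> \<epsilon>" by (rule N1)
    finally show ?thesis by (simp add: \<Lambda>_def L_def)
  qed
  show thesis
    by (rule that[OF law_dominated_conv_power[OF d, of N]]; rule est)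
       (use meas l l' d c\<mu> c\<rho> in \<open>auto simp: law_dominated_def\<close>)
qed

lemma ball_measurable_pred [measurable]: "Measurable.pred borel (\<lambda>x. x \<in> ball (a::'a::euclidean_space) r)"
  unfolding pred_def by (simp add: borel_open del: mem_ball)

text \<open>In the unit ball the Taylor remainder is at most half the square of norm \<xi> * norm y,
  and there 1 + (norm y)^2 \<le> 2. Outside, the bound 2 is at most 4 times the weight, because norm
  y \<ge> 1. The constant adds the two coefficients.\<close>

lemma compensator_bound:
  fixes \<xi> y :: "'a::euclidean_space"
  shows "norm (1 + \<i> * complex_of_real ((\<xi> \<bullet> y) * indicator (ball 0 1) y) - iexp (\<xi> \<bullet> y))
    \<le> ((norm \<xi>)\<^sup>2 + 4) * ((norm y)\<^sup>2 / (1 + (norm y)\<^sup>2))"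
proof (cases "norm y < 1")
  case True
  have "norm (iexp (\<xi> \<bullet> y) - (\<Sum>k\<le>1. (\<i> * (\<xi> \<bullet> y)) ^ k / fact k)) \<le> \<bar>\<xi> \<bullet> y\<bar> ^ Suc 1 / fact (Suc 1)"
    by (rule iexp_approx1)
  then have "norm (1 + \<i> * complex_of_real (\<xi> \<bullet> y) - iexp (\<xi> \<bullet> y)) \<le> \<bar>\<xi> \<bullet> y\<bar>\<^sup>2 / 2"
    by (subst norm_minus_commute) (simp add: power2_eq_square)
  also have "\<dots> \<le> (norm \<xi> * norm y)\<^sup>2 / 2"
    using Cauchy_Schwarz_ineq2[of \<xi> y] by (intro divide_right_mono power_mono) auto
  also have "\<dots> \<le> (norm \<xi>)\<^sup>2 * ((norm y)\<^sup>2 / (1 + (norm y)\<^sup>2))"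
  proof -
    have "(norm y)\<^sup>2 \<le> 1" using True by (simp add: power_le_one)
    then have "(norm y)\<^sup>2 / 2 \<le> (norm y)\<^sup>2 / (1 + (norm y)\<^sup>2)"
      by (intro divide_left_mono) (auto intro: add_pos_nonneg)
    then have "(norm \<xi>)\<^sup>2 * ((norm y)\<^sup>2 / 2) \<le> (norm \<xi>)\<^sup>2 * ((norm y)\<^sup>2 / (1 + (norm y)\<^sup>2))"
      by (rule mult_left_mono) simp
    then show ?thesis by (simp add: power_mult_distrib)
  qed
  also have "\<dots> \<le> ((norm \<xi>)\<^sup>2 + 4) * ((norm y)\<^sup>2 / (1 + (norm y)\<^sup>2))"
    by (rule mult_right_mono) (auto intro: add_pos_nonneg)
  finally show ?thesis using True by simp
next
  case False
  have "norm (1 - iexp (\<xi> \<bullet> y)) \<le> 2"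
    using norm_triangle_ineq4[of 1 "iexp (\<xi> \<bullet> y)"] by (simp add: norm_exp_i_times)
  also have "2 \<le> 4 * ((norm y)\<^sup>2 / (1 + (norm y)\<^sup>2))"
  proof -
    have "1 \<le> (norm y)\<^sup>2" using False by simp
    moreover have "0 < 1 + (norm y)\<^sup>2" by (rule add_pos_nonneg) auto
    ultimately show ?thesis by (simp add: field_simps)
  qed
  also have "\<dots> \<le> ((norm \<xi>)\<^sup>2 + 4) * ((norm y)\<^sup>2 / (1 + (norm y)\<^sup>2))"
    by (rule mult_right_mono) (auto intro: add_pos_nonneg)
  finally show ?thesis using False by simp
qed

section \<open>The Levy measure away from the origin\<close>

lemma levy_weight_integrable:
  fixes \<nu> :: "('a::euclidean_space) measure"
  assumes [measurable_cong]: "sets \<nu> = sets borel" and fin: "(\<integral>\<^sup>+ y. ennreal ((norm y)\<^sup>2 / (1 + (norm y)\<^sup>2)) \<partial>\<nu>) < \<infinity>"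
  shows "integrable \<nu> (\<lambda>y. (norm y)\<^sup>2 / (1 + (norm y)\<^sup>2))"
  by (rule integrableI_nonneg) (use fin in \<open>auto intro!: divide_nonneg_nonneg\<close>)

lemma compensator_integrable:
  fixes \<nu> :: "('a::euclidean_space) measure"
  assumes s[measurable_cong]: "sets \<nu> = sets borel" and fin: "(\<integral>\<^sup>+ y. ennreal ((norm y)\<^sup>2 / (1 + (norm y)\<^sup>2)) \<partial>\<nu>) < \<infinity>"
  shows "integrable \<nu> (\<lambda>y. 1 + \<i> * complex_of_real ((\<xi> \<bullet> y) * indicator (ball 0 1) y) - iexp (\<xi> \<bullet> y))"
proof (rule Bochner_Integration.integrable_bound)
  show "integrable \<nu> (\<lambda>y. ((norm \<xi>)\<^sup>2 + 4) * ((norm y)\<^sup>2 / (1 + (norm y)\<^sup>2)))"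
    by (intro integrable_mult_right levy_weight_integrable s fin)
  show "AE y in \<nu>. norm (1 + \<i> * complex_of_real ((\<xi> \<bullet> y) * indicator (ball 0 1) y) - iexp (\<xi> \<bullet> y))
     \<le> norm (((norm \<xi>)\<^sup>2 + 4) * ((norm y)\<^sup>2 / (1 + (norm y)\<^sup>2)))"
    by (intro AE_I2 order_trans[OF compensator_bound]) simp
qed measurable

text \<open>The cutoffs are numbered from radius 1 downwards and exhaust everything but the origin,
  a null set of every Levy measure. Each carries finite Levy mass, as required by the compound
  Poisson approximation.\<close>

definition away :: "nat \<Rightarrow> ('a::euclidean_space) set" where
  "away n = {y. 1 / real (Suc n) \<le> norm y}"

lemma away_sets [measurable, simp]: "away n \<in> sets borel"
  unfolding away_def by measurable

lemma away_Union: "(\<Union>n. away n) = - {0}"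
proof (intro equalityI subsetI)
  fix y :: 'a assume "y \<in> - {0}"
  then obtain n where "1 / real (Suc n) < norm y" using nat_approx_posE[of "norm y"] by auto
  then show "y \<in> (\<Union>n. away n)" by (auto simp: away_def intro!: exI[of _ n])
qed (auto simp: away_def field_simps)

lemma away_mono: "n \<le> m \<Longrightarrow> away n \<subseteq> away m"
  by (auto simp: away_def intro: order_trans[rotated] simp: frac_le)

text \<open>The weight increases with norm y, so it is bounded below by its positive value on the
  inner boundary.\<close>

lemma emeasure_away:
  fixes \<nu> :: "('a::euclidean_space) measure"
  assumes s[measurable_cong]: "sets \<nu> = sets borel" and fin: "(\<integral>\<^sup>+ y. ennreal ((norm y)\<^sup>2 / (1 + (norm y)\<^sup>2)) \<partial>\<nu>) < \<infinity>"
  shows "emeasure \<nu> (away n) < \<top>"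
proof -
  define c where "c = (1 / real (Suc n))\<^sup>2 / (1 + (1 / real (Suc n))\<^sup>2)"
  have c: "0 < c" unfolding c_def by (intro divide_pos_pos add_pos_nonneg) auto
  have "ennreal c * emeasure \<nu> (away n) = (\<integral>\<^sup>+y. ennreal c * indicator (away n) y \<partial>\<nu>)"
    by (subst nn_integral_cmult_indicator) (auto simp: s)
  also have "\<dots> \<le> (\<integral>\<^sup>+ y. ennreal ((norm y)\<^sup>2 / (1 + (norm y)\<^sup>2)) \<partial>\<nu>)"
  proof (rule nn_integral_mono)
    fix y :: 'a
    have "c \<le> (norm y)\<^sup>2 / (1 + (norm y)\<^sup>2)" if "y \<in> away n"
    proof -
      have mono: "a / (1 + a) \<le> b / (1 + b)" if "0 \<le> a" "a \<le> b" for a b :: real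
        using that by (simp add: divide_simps) (simp add: algebra_simps)
      have "(1 / real (Suc n))\<^sup>2 \<le> (norm y)\<^sup>2" using that by (intro power_mono) (auto simp: away_def)
      then show ?thesis unfolding c_def by (intro mono) auto
    qed
    then show "ennreal c * indicator (away n) y \<le> ennreal ((norm y)\<^sup>2 / (1 + (norm y)\<^sup>2))"
      by (auto simp: indicator_def intro: ennreal_leI)
  qed
  also have "\<dots> < \<top>" using fin by simp
  finally show ?thesis using c by (auto simp: ennreal_mult_less_top)
qed

lemma integrable_away:
  fixes \<nu> :: "('a::euclidean_space) measure" and f :: "'a \<Rightarrow> 'b::{banach, second_countable_topology}"
  assumes s[measurable_cong]: "sets \<nu> = sets borel" and fin: "(\<integral>\<^sup>+ y. ennreal ((norm y)\<^sup>2 / (1 + (norm y)\<^sup>2)) \<partial>\<nu>) < \<infinity>"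
    and [measurable]: "f \<in> borel_measurable borel" and bd: "\<And>y. norm (f y) \<le> B"
  shows "integrable \<nu> (\<lambda>y. indicator (away n) y *\<^sub>R f y)"
proof (rule Bochner_Integration.integrable_bound)
  show "integrable \<nu> (\<lambda>y. B * indicator (away n) y)"
    using emeasure_away[OF s fin, of n] by (intro integrable_mult_right integrable_real_indicator) (auto simp: s)
  show "AE y in \<nu>. norm (indicator (away n) y *\<^sub>R f y) \<le> norm (B * indicator (away n) y)"
    using bd by (intro AE_I2) (auto simp: indicator_def intro: order_trans[OF _ abs_ge_self])
qed measurable

text \<open>Truncating the Levy measure to \<open>away n\<close> and moving the compensator of the remaining jumps
  into the drift gives exponents that converge to the jump part of the Levy exponent.\<close>

lemma truncated_exponent:
  fixes \<nu> :: "('a::euclidean_space) measure"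
  assumes s[measurable_cong]: "sets \<nu> = sets borel" and fin: "(\<integral>\<^sup>+ y. ennreal ((norm y)\<^sup>2 / (1 + (norm y)\<^sup>2)) \<partial>\<nu>) < \<infinity>"
    and z: "emeasure \<nu> {0} = 0"
  obtains d :: "nat \<Rightarrow> 'a" where
    "\<And>\<xi>. (\<lambda>n. (LINT y|\<nu>. indicator (away n) y *\<^sub>R (1 - iexp (\<xi> \<bullet> y))) + \<i> * complex_of_real (\<xi> \<bullet> d n)) \<longlonglongrightarrow>
      (LINT y|\<nu>. 1 + \<i> * complex_of_real ((\<xi> \<bullet> y) * indicator (ball 0 1) y) - iexp (\<xi> \<bullet> y))"
proof
  \<comment> \<open>The total compensator of the retained jumps of norm less than one; it may
    diverge as n grows, though its combination with the jump integral converges.\<close>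
  define d where "d n = (LINT y|\<nu>. indicator (away n \<inter> ball 0 1) y *\<^sub>R y)" for n
  fix \<xi> :: 'a
  define G where "G y = 1 + \<i> * complex_of_real ((\<xi> \<bullet> y) * indicator (ball 0 1) y) - iexp (\<xi> \<bullet> y)" for y
  have [measurable]: "G \<in> borel_measurable borel" unfolding G_def by measurable
  have iG: "integrable \<nu> G" unfolding G_def by (rule compensator_integrable[OF s fin])
  have eq: "(LINT y|\<nu>. indicator (away n) y *\<^sub>R (1 - iexp (\<xi> \<bullet> y))) + \<i> * complex_of_real (\<xi> \<bullet> d n) = (LINT y|\<nu>. indicator (away n) y *\<^sub>R G y)" for n
  proof -
    have A: "integrable \<nu> (\<lambda>y. indicator (away n) y *\<^sub>R (1 - iexp (\<xi> \<bullet> y)))"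
      using norm_triangle_ineq4[of 1 "iexp (\<xi> \<bullet> y)" for y] by (intro integrable_away[OF s fin, where B=2]) (auto simp: norm_exp_i_times)
    have "integrable \<nu> (\<lambda>y. indicator (away n) y *\<^sub>R (indicator (ball 0 1) y *\<^sub>R y))"
      by (rule integrable_away[OF s fin, where B=1]) (auto simp: indicator_def)
    then have D: "integrable \<nu> (\<lambda>y. indicator (away n \<inter> ball 0 1) y *\<^sub>R y)"
      by (simp add: indicator_inter_arith)
    have "\<i> * complex_of_real (\<xi> \<bullet> d n) = \<i> * complex_of_real (LINT y|\<nu>. \<xi> \<bullet> (indicator (away n \<inter> ball 0 1) y *\<^sub>R y))"
      unfolding d_def using D by (subst integral_inner_right) auto
    also have "\<dots> = (LINT y|\<nu>. \<i> * complex_of_real (\<xi> \<bullet> (indicator (away n \<inter> ball 0 1) y *\<^sub>R y)))"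
      by (simp only: integral_mult_right_zero integral_complex_of_real)
    finally have e: "\<i> * complex_of_real (\<xi> \<bullet> d n) = \<dots>" .
    have "integrable \<nu> (\<lambda>y. \<i> * complex_of_real (\<xi> \<bullet> (indicator (away n \<inter> ball 0 1) y *\<^sub>R y)))"
      using D by (intro integrable_mult_right integrable_of_real integrable_inner_right)
    from Bochner_Integration.integral_add[OF A this, symmetric] show ?thesis unfolding e
      by (rule trans) (rule Bochner_Integration.integral_cong[OF refl], auto simp: G_def indicator_def)
  qed
  have "(\<lambda>n. LINT y|\<nu>. indicator (away n) y *\<^sub>R G y) \<longlonglongrightarrow> (LINT y|\<nu>. G y)"
  proof (rule integral_dominated_convergence[where w="\<lambda>y. norm (G y)"])
    show "integrable \<nu> (\<lambda>y. norm (G y))" using iG by (rule integrable_norm)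
    have "AE y in \<nu>. y \<noteq> 0" using z by (intro AE_I[where N="{0}"]) (auto simp: s)
    then show "AE y in \<nu>. (\<lambda>n. indicator (away n) y *\<^sub>R G y) \<longlonglongrightarrow> G y"
    proof eventually_elim
      case (elim y)
      then obtain n where n: "y \<in> away n" using away_Union by blast
      then have "eventually (\<lambda>m. indicator (away m) y *\<^sub>R G y = G y) sequentially"
        using away_mono by (intro eventually_sequentiallyI[of n]) (auto simp: indicator_def)
      then show ?case by (rule tendsto_eventually)
    qed
    show "AE y in \<nu>. norm (indicator (away n) y *\<^sub>R G y) \<le> norm (G y)" for n
      by (intro AE_I2) (auto simp: indicator_def)
  qed measurable
  then show "(\<lambda>n. (LINT y|\<nu>. indicator (away n) y *\<^sub>R (1 - iexp (\<xi> \<bullet> y))) + \<i> * complex_of_real (\<xi> \<bullet> d n)) \<longlonglongrightarrow>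
      (LINT y|\<nu>. 1 + \<i> * complex_of_real ((\<xi> \<bullet> y) * indicator (ball 0 1) y) - iexp (\<xi> \<bullet> y))"
    by (simp only: eq) (simp only: G_def)
qed

section \<open>Even densities and real exponents\<close>

lemma distr_uminus_density:
  fixes \<psi> :: "'a::euclidean_space \<Rightarrow> ennreal"
  assumes [measurable]: "\<psi> \<in> borel_measurable borel" and even: "\<And>x. \<psi> (- x) = \<psi> x"
  shows "distr (density lborel \<psi>) borel uminus = density lborel \<psi>"
proof (rule measure_eqI)
  fix A assume "A \<in> sets (distr (density lborel \<psi>) borel uminus)"
  then have [measurable]: "A \<in> sets borel" by simp
  have [measurable]: "uminus -` A \<in> sets borel" by (rule measurable_sets_borel[of _ borel]) auto
  have "emeasure (distr (density lborel \<psi>) borel uminus) A = (\<integral>\<^sup>+x. \<psi> x * indicator (uminus -` A) x \<partial>lborel)"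
    by (simp add: emeasure_distr emeasure_density)
  also have "\<dots> = (\<integral>\<^sup>+x. (\<lambda>y. \<psi> y * indicator A y) (- x) \<partial>lborel)"
    by (intro nn_integral_cong) (simp add: even indicator_def)
  also have "\<dots> = (\<integral>\<^sup>+x. \<psi> x * indicator A x \<partial>lborel)" by (rule nn_integral_reflect) measurable
  finally show "emeasure (distr (density lborel \<psi>) borel uminus) A = emeasure (density lborel \<psi>) A"
    by (simp add: emeasure_density)
qed simp

text \<open>The reflection y -> -y preserves the measure and conjugates the integrand, so the
  integral equals its own conjugate.\<close>

lemma integral_even_density:
  fixes \<psi> :: "'a::euclidean_space \<Rightarrow> ennreal" and h :: "'a \<Rightarrow> complex"
  assumes [measurable]: "\<psi> \<in> borel_measurable borel" and even: "\<And>x. \<psi> (- x) = \<psi> x"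
    and int: "integrable (density lborel \<psi>) h" and h: "\<And>x. h (- x) = cnj (h x)"
  shows "(LINT y|density lborel \<psi>. h y) = complex_of_real (LINT y|density lborel \<psi>. Re (h y))"
proof -
  have [measurable]: "h \<in> borel_measurable borel" using borel_measurable_integrable[OF int] by simp
  have "(LINT y|density lborel \<psi>. h y) = (LINT y|distr (density lborel \<psi>) borel uminus. h y)"
    by (simp add: distr_uminus_density even)
  also have "\<dots> = (LINT y|density lborel \<psi>. cnj (h y))"
    by (subst integral_distr) (auto simp: h)
  also have "\<dots> = cnj (LINT y|density lborel \<psi>. h y)"
    by (rule integral_bounded_linear[OF bounded_linear_cnj int])
  finally have "Im (LINT y|density lborel \<psi>. h y) = 0" by (simp add: complex_eq_iff)
  then show ?thesis using int by (simp add: complex_eq_iff)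
qed

text \<open>The \<psi>n are rearrangements of truncated densities, not truncations of \<psi>, so the
  argument for the original measure does not carry over. Evenness removes the compensator and leaves
  the integral of 1 - cos, a nonnegative function of the frequency and the jump. Increasing
  densities then allow monotone convergence, with no drift correction.\<close>

lemma truncated_exponent_symmetric:
  fixes \<psi> :: "'a::euclidean_space \<Rightarrow> ennreal" and \<psi>n :: "nat \<Rightarrow> 'a \<Rightarrow> ennreal"
  assumes [measurable]: "\<psi> \<in> borel_measurable borel" "\<And>n. \<psi>n n \<in> borel_measurable borel"
    and even: "\<And>x. \<psi> (- x) = \<psi> x" "\<And>n x. \<psi>n n (- x) = \<psi>n n x"
    and inc: "incseq \<psi>n" and sup: "\<And>x. \<psi> x = (SUP n. \<psi>n n x)"
    and fin: "(\<integral>\<^sup>+ y. ennreal ((norm y)\<^sup>2 / (1 + (norm y)\<^sup>2)) \<partial>density lborel \<psi>) < \<infinity>"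
    and finn: "\<And>n. (\<integral>\<^sup>+ y. \<psi>n n y \<partial>lborel) < \<top>"
  shows "(\<lambda>n. LINT y|density lborel (\<psi>n n). 1 - iexp (\<xi> \<bullet> y)) \<longlonglongrightarrow>
      (LINT y|density lborel \<psi>. 1 + \<i> * complex_of_real ((\<xi> \<bullet> y) * indicator (ball 0 1) y) - iexp (\<xi> \<bullet> y))"
proof -
  define G where "G y = 1 + \<i> * complex_of_real ((\<xi> \<bullet> y) * indicator (ball 0 1) y) - iexp (\<xi> \<bullet> y)" for y
  have [measurable]: "G \<in> borel_measurable borel" unfolding G_def by measurable
  have iG: "integrable (density lborel \<psi>) G" unfolding G_def by (rule compensator_integrable) (use fin in auto)
  have ReG: "Re (G y) = 1 - cos (\<xi> \<bullet> y)" for y by (simp add: G_def Re_exp)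
  have L: "(LINT y|density lborel \<psi>. G y) = complex_of_real (LINT y|density lborel \<psi>. 1 - cos (\<xi> \<bullet> y))"
    unfolding ReG[symmetric] by (rule integral_even_density) (auto simp: even iG, auto simp: G_def indicator_def exp_cnj)
  have Ln: "(LINT y|density lborel (\<psi>n n). 1 - iexp (\<xi> \<bullet> y)) = complex_of_real (LINT y|density lborel (\<psi>n n). 1 - cos (\<xi> \<bullet> y))" for n
  proof -
    interpret D: finite_measure "density lborel (\<psi>n n)"
      by (rule finite_measureI) (use finn[of n] in \<open>simp add: emeasure_density less_top[symmetric]\<close>)
    have "integrable (density lborel (\<psi>n n)) (\<lambda>y. 1 - iexp (\<xi> \<bullet> y))"
      using norm_triangle_ineq4[of 1 "iexp (\<xi> \<bullet> y)" for y] by (intro D.integrable_const_bound[where B=2]) (auto simp: norm_exp_i_times)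
    then have "(LINT y|density lborel (\<psi>n n). 1 - iexp (\<xi> \<bullet> y)) = complex_of_real (LINT y|density lborel (\<psi>n n). Re (1 - iexp (\<xi> \<bullet> y)))"
      by (intro integral_even_density) (auto simp: even exp_cnj)
    then show ?thesis by (simp add: Re_exp)
  qed
  define g where "g y = ennreal (1 - cos (\<xi> \<bullet> y))" for y
  have [measurable]: "g \<in> borel_measurable borel" unfolding g_def by measurable
  have R: "(LINT y|density lborel \<psi>. 1 - cos (\<xi> \<bullet> y)) = enn2real (\<integral>\<^sup>+y. \<psi> y * g y \<partial>lborel)"
    if [measurable]: "\<psi> \<in> borel_measurable borel" for \<psi> :: "'a \<Rightarrow> ennreal"
    by (subst integral_eq_nn_integral) (auto simp: nn_integral_density g_def)
  have "(\<integral>\<^sup>+y. \<psi> y * g y \<partial>lborel) = (\<integral>\<^sup>+y. ennreal (Re (G y)) \<partial>density lborel \<psi>)"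
    by (simp add: nn_integral_density g_def ReG)
  also have "\<dots> < \<infinity>"
    using integrable_Re[OF iG] by (auto simp: real_integrable_def less_top)
  finally have fing: "(\<integral>\<^sup>+y. \<psi> y * g y \<partial>lborel) < \<top>" by simp
  have incn: "incseq (\<lambda>n. \<integral>\<^sup>+y. \<psi>n n y * g y \<partial>lborel)"
    using inc by (auto simp: incseq_def le_fun_def intro!: nn_integral_mono mult_right_mono)
  have "(\<integral>\<^sup>+y. \<psi> y * g y \<partial>lborel) = (\<integral>\<^sup>+y. (SUP n. \<psi>n n y * g y) \<partial>lborel)"
    by (simp add: sup SUP_mult_right_ennreal)
  also have "\<dots> = (SUP n. \<integral>\<^sup>+y. \<psi>n n y * g y \<partial>lborel)"
    using inc by (intro nn_integral_monotone_convergence_SUP) (auto simp: incseq_def le_fun_def intro!: mult_right_mono)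
  finally have "(\<lambda>n. \<integral>\<^sup>+y. \<psi>n n y * g y \<partial>lborel) \<longlonglongrightarrow> (\<integral>\<^sup>+y. \<psi> y * g y \<partial>lborel)"
    using LIMSEQ_SUP[OF incn] by simp
  then have "(\<lambda>n. enn2real (\<integral>\<^sup>+y. \<psi>n n y * g y \<partial>lborel)) \<longlonglongrightarrow> enn2real (\<integral>\<^sup>+y. \<psi> y * g y \<partial>lborel)"
    using fing by (intro tendsto_enn2real) auto
  then have "(\<lambda>n. complex_of_real (enn2real (\<integral>\<^sup>+y. \<psi>n n y * g y \<partial>lborel))) \<longlonglongrightarrow> complex_of_real (enn2real (\<integral>\<^sup>+y. \<psi> y * g y \<partial>lborel))"
    by (rule tendsto_of_real)
  then have "(\<lambda>n. LINT y|density lborel (\<psi>n n). 1 - iexp (\<xi> \<bullet> y)) \<longlonglongrightarrow> (LINT y|density lborel \<psi>. G y)"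
    unfolding L Ln by (simp add: R)
  then show ?thesis by (simp only: G_def)
qed

text \<open>Gram-Schmidt for the inner product defined by A gives a basis orthonormal for it. With
  the basis vectors as rows of V this reads V A V^T = 1, and T is the inverse of V.\<close>

lemma pd_factor:
  fixes A :: "real ^ 'n ^ 'n"
  assumes sym: "transpose A = A" and pd: "\<And>x. x \<noteq> 0 \<Longrightarrow> 0 < (A *v x) \<bullet> x"
  obtains T :: "real ^ 'n ^ 'n" where "A = T ** transpose T" "det T \<noteq> 0"
proof -
  have symv: "(A *v x) \<bullet> y = (A *v y) \<bullet> x" for x y
  proof -
    have "(A *v x) \<bullet> y = (transpose A *v x) \<bullet> y" by (simp only: sym)
    also have "\<dots> = x \<bullet> (A *v y)" by (simp only: transpose_matrix_vector dot_lmul_matrix)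
    finally show ?thesis by (simp only: inner_commute[of x])
  qed
  have ex: "\<exists>v :: 'n \<Rightarrow> real ^ 'n. \<forall>i\<in>I. \<forall>j\<in>I. (A *v v i) \<bullet> v j = (if i = j then 1 else 0)" for I :: "'n set"
  proof (induction I rule: finite_induct[OF finite])
    case (2 k I)
    then obtain v where v: "\<And>i j. i \<in> I \<Longrightarrow> j \<in> I \<Longrightarrow> (A *v v i) \<bullet> v j = (if i = j then 1 else 0)" by blast
    \<comment> \<open>The images A v_i of fewer vectors than the dimension span a proper subspace; a
      vector orthogonal to it is orthogonal to all v_i for the form of A.\<close>
    have "dim ((\<lambda>i. A *v v i) ` I) \<le> card ((\<lambda>i. A *v v i) ` I)"
      by (rule dim_le_card) (auto simp: span_superset)
    also have "\<dots> \<le> card I" by (rule card_image_le) simp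
    also have "card I < CARD('n)" using 2 by (intro psubset_card_mono) auto
    finally have "dim ((\<lambda>i. A *v v i) ` I) < DIM(real ^ 'n)" by simp
    then obtain x where x: "x \<noteq> 0" "\<And>y. y \<in> span ((\<lambda>i. A *v v i) ` I) \<Longrightarrow> orthogonal x y"
      using orthogonal_to_subspace_exists by metis
    have o: "(A *v v i) \<bullet> x = 0" if "i \<in> I" for i
      using x(2)[of "A *v v i"] that by (simp add: orthogonal_def inner_commute span_base)
    define q where "q = (A *v x) \<bullet> x"
    have q: "0 < q" using pd x by (simp add: q_def)
    define w where "w = (1 / sqrt q) *\<^sub>R x"
    have ww: "(A *v w) \<bullet> w = 1" using q by (simp add: w_def matrix_vector_mult_scaleR q_def[symmetric])
    have vw: "(A *v v i) \<bullet> w = 0" if "i \<in> I" for i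
      using o[OF that] by (simp add: w_def)
    have wv: "(A *v w) \<bullet> v i = 0" if "i \<in> I" for i
      using vw[OF that] by (subst symv)
    show ?case
    proof (intro exI[of _ "v(k := w)"] ballI)
      fix i j assume "i \<in> insert k I" "j \<in> insert k I"
      then show "(A *v (v(k := w)) i) \<bullet> (v(k := w)) j = (if i = j then 1 else 0)"
        using 2(2) v[of i j] vw[of i] wv[of j] ww by (cases "i = k"; cases "j = k") auto
    qed
  qed simp
  then obtain v :: "'n \<Rightarrow> real ^ 'n" where v: "\<And>i j. (A *v v i) \<bullet> v j = (if i = j then 1 else 0)"
    using ex[of UNIV] by auto
  define V :: "real ^ 'n ^ 'n" where "V = (\<chi> i. v i)"
  have VAV: "V ** A ** transpose V = mat 1"
  proof -
    have "(V ** A ** transpose V) $ i $ j = (A *v v j) \<bullet> v i" for i j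
    proof -
      have "(V ** A ** transpose V) $ i $ j = (\<Sum>k\<in>UNIV. (\<Sum>l\<in>UNIV. v i $ l * A $ l $ k) * v j $ k)"
        by (simp add: matrix_matrix_mult_def V_def transpose_def)
      also have "\<dots> = (\<Sum>k\<in>UNIV. \<Sum>l\<in>UNIV. v i $ l * A $ l $ k * v j $ k)"
        by (simp only: sum_distrib_right)
      also have "\<dots> = (\<Sum>l\<in>UNIV. \<Sum>k\<in>UNIV. v i $ l * A $ l $ k * v j $ k)"
        by (rule sum.swap)
      also have "\<dots> = (\<Sum>l\<in>UNIV. (\<Sum>k\<in>UNIV. A $ l $ k * v j $ k) * v i $ l)"
      proof (rule sum.cong[OF refl])
        fix l
        show "(\<Sum>k\<in>UNIV. v i $ l * A $ l $ k * v j $ k) = (\<Sum>k\<in>UNIV. A $ l $ k * v j $ k) * v i $ l"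
          unfolding sum_distrib_right by (rule sum.cong[OF refl]) (simp only: ac_simps)
      qed
      also have "\<dots> = (A *v v j) \<bullet> v i"
        by (simp add: inner_vec_def matrix_vector_mult_def)
      finally show ?thesis .
    qed
    then show ?thesis by (simp add: vec_eq_iff v mat_def)
  qed
  then have "det (V ** A ** transpose V) = 1" by (simp only: det_I)
  then have "det V \<noteq> 0" by (auto simp: det_mul)
  then obtain T where T: "V ** T = mat 1" "T ** V = mat 1" by (auto simp: invertible_det_nz[symmetric] invertible_def)
  have "transpose V ** transpose T = transpose (T ** V)" by (simp only: matrix_transpose_mul)
  then have tT: "transpose V ** transpose T = mat 1" by (simp only: T(2) transpose_mat)
  have "T ** transpose T = T ** (V ** A ** transpose V) ** transpose T" by (simp add: VAV matrix_mul_rid)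
  also have "\<dots> = (T ** V) ** A ** (transpose V ** transpose T)" by (simp add: matrix_mul_assoc)
  also have "\<dots> = A" by (simp add: T tT)
  finally have "A = T ** transpose T" by simp
  moreover have "det (T ** V) = 1" by (simp only: T(2) det_I)
  then have "det T \<noteq> 0" by (auto simp: det_mul)
  ultimately show thesis by (rule that)
qed

lemma tendsto_det:
  fixes A :: "nat \<Rightarrow> real ^ 'n ^ 'n"
  assumes "\<And>i j. (\<lambda>n. A n $ i $ j) \<longlonglongrightarrow> B $ i $ j"
  shows "(\<lambda>n. det (A n)) \<longlonglongrightarrow> det B"
  unfolding det_def by (intro tendsto_intros assms)

text \<open>A may be singular, whereas the comparison of ellipsoids needs an invertible factor, so a
  vanishing multiple of the identity is added. Continuity of the determinant and of the root then
  carries the symmetrized covariance to the limit, including det A = 0.\<close>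

lemma gauss_approx:
  fixes A :: "real ^ 'n ^ 'n"
  assumes sym: "transpose A = A" and psd: "\<And>x. 0 \<le> (A *v x) \<bullet> x" and s: "0 \<le> s"
  obtains \<mu> \<rho> :: "nat \<Rightarrow> (real ^ 'n) measure" where "\<And>n. law_dominated (\<mu> n) (\<rho> n)"
    "\<And>\<xi>. (\<lambda>n. charf (\<mu> n) \<xi>) \<longlonglongrightarrow> complex_of_real (exp (- s * ((A *v \<xi>) \<bullet> \<xi>) / 2))"
    "\<And>\<xi>. (\<lambda>n. charf (\<rho> n) \<xi>) \<longlonglongrightarrow> complex_of_real (exp (- s * ((symm_matrix A *v \<xi>) \<bullet> \<xi>) / 2))"
proof -
  define N where "N = CARD('n)"
  have N: "0 < N" by (simp add: N_def)
  define B where "B n = s *\<^sub>R A + (1 / real (Suc n)) *\<^sub>R mat 1" for n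
  have Bv: "(B n *v x) \<bullet> x = s * ((A *v x) \<bullet> x) + (1 / real (Suc n)) * (x \<bullet> x)" for n x
    by (simp add: B_def matrix_vector_mult_add_rdistrib inner_add_left scaleR_matrix_vector_assoc[symmetric] scaled_mat_1_vec)
  have "\<exists>T. B n = T ** transpose T \<and> det T \<noteq> 0" for n
  proof -
    have "transpose (B n) = B n"
      using sym by (simp add: B_def vec_eq_iff transpose_def mat_def)
    moreover have "0 < (B n *v x) \<bullet> x" if "x \<noteq> 0" for x
      unfolding Bv using psd[of x] s that by (intro add_nonneg_pos mult_nonneg_nonneg mult_pos_pos) auto
    ultimately obtain T where "B n = T ** transpose T" "det T \<noteq> 0" by (rule pd_factor)
    then show ?thesis by blast
  qed
  then obtain T where T: "\<And>n. B n = T n ** transpose (T n)" "\<And>n. det (T n) \<noteq> 0" by metis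
  \<comment> \<open>The covariance of the scaled Gaussian is r squared times the identity. As
    \<open>B n\<close> is T times its transpose, r squared is the root of det (B n), in agreement
    with \<open>symm_matrix\<close>.\<close>
  define r where "r n = root N \<bar>det (T n)\<bar>" for n
  have r: "0 < r n" "r n ^ N = \<bar>det (T n)\<bar>" for n using T(2)[of n] N by (simp_all add: r_def)
  have r2: "(r n)\<^sup>2 = root N (det (B n))" for n
  proof -
    have "det (B n) = \<bar>det (T n)\<bar>\<^sup>2" by (simp add: T(1) det_mul det_transpose power2_eq_square)
    then show ?thesis unfolding r_def by (simp only: real_root_power[OF N])
  qed
  have "(\<lambda>n. B n $ i $ j) \<longlonglongrightarrow> (s *\<^sub>R A) $ i $ j" for i j
  proof -
    have "(\<lambda>n. s * A $ i $ j + (1 / real (Suc n)) * (mat 1 :: real ^ 'n ^ 'n) $ i $ j) \<longlonglongrightarrow> s * A $ i $ j + 0 * (mat 1 :: real ^ 'n ^ 'n) $ i $ j"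
      by (intro tendsto_intros LIMSEQ_inverse_real_of_nat[unfolded inverse_eq_divide])
    then show ?thesis by (simp add: B_def)
  qed
  then have "(\<lambda>n. det (B n)) \<longlonglongrightarrow> det (s *\<^sub>R A)" by (rule tendsto_det)
  moreover have "det (s *\<^sub>R A) = s ^ N * det A"
  proof -
    have "s *\<^sub>R A = (s *\<^sub>R mat 1) ** A"
      by (metis matrix_mul_lid scalar_matrix_assoc)
    then show ?thesis by (simp add: det_mul det_scaled_mat_1 N_def)
  qed
  ultimately have "(\<lambda>n. root N (det (B n))) \<longlonglongrightarrow> root N (s ^ N * det A)" by (auto intro: tendsto_real_root)
  also have "root N (s ^ N * det A) = s * root N (det A)" using N s by (simp add: real_root_mult real_root_power_cancel)
  finally have rlim: "(\<lambda>n. (r n)\<^sup>2) \<longlonglongrightarrow> s * root N (det A)" by (simp add: r2)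
  show thesis
  proof (rule that[of "\<lambda>n. gauss_linear (T n)" "\<lambda>n. gauss_scaled (r n)"])
    show "law_dominated (gauss_linear (T n)) (gauss_scaled (r n))" for n
      using T(2) r by (intro law_dominated_gauss_linear) (auto simp: N_def)
  next
    fix \<xi> :: "real ^ 'n"
    have c: "charf (gauss_linear (T n)) \<xi> = complex_of_real (exp (- (s * ((A *v \<xi>) \<bullet> \<xi>) + (1 / real (Suc n)) * (\<xi> \<bullet> \<xi>)) / 2))" for n
    proof -
      have "(norm (transpose (T n) *v \<xi>))\<^sup>2 = (B n *v \<xi>) \<bullet> \<xi>"
        unfolding T(1) power2_norm_eq_inner matrix_vector_mul_assoc[symmetric]
        by (metis dot_lmul_matrix inner_commute transpose_matrix_vector)
      then show ?thesis by (simp only: charf_gauss_linear Bv)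
    qed
    have "(\<lambda>n. complex_of_real (exp (- (s * ((A *v \<xi>) \<bullet> \<xi>) + (1 / real (Suc n)) * (\<xi> \<bullet> \<xi>)) / 2))) \<longlonglongrightarrow> complex_of_real (exp (- (s * ((A *v \<xi>) \<bullet> \<xi>) + 0 * (\<xi> \<bullet> \<xi>)) / 2))"
      by (intro tendsto_intros LIMSEQ_inverse_real_of_nat[unfolded inverse_eq_divide]) simp
    then show "(\<lambda>n. charf (gauss_linear (T n)) \<xi>) \<longlonglongrightarrow> complex_of_real (exp (- s * ((A *v \<xi>) \<bullet> \<xi>) / 2))"
      unfolding c by simp
    have c': "charf (gauss_scaled (r n)) \<xi> = complex_of_real (exp (- ((r n)\<^sup>2 * (norm \<xi>)\<^sup>2) / 2))" for n
    proof -
      have "transpose (r n *\<^sub>R mat 1 :: real ^ 'n ^ 'n) = r n *\<^sub>R mat 1" by (simp add: vec_eq_iff transpose_def mat_def)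
      then show ?thesis by (simp add: gauss_linear_scaled charf_gauss_linear scaled_mat_1_vec power_mult_distrib)
    qed
    have e: "(symm_matrix A *v \<xi>) \<bullet> \<xi> = root N (det A) * (norm \<xi>)\<^sup>2"
      by (simp add: symm_matrix_def scaled_mat_1_vec power2_norm_eq_inner N_def)
    have "(\<lambda>n. complex_of_real (exp (- ((r n)\<^sup>2 * (norm \<xi>)\<^sup>2) / 2))) \<longlonglongrightarrow> complex_of_real (exp (- (s * root N (det A) * (norm \<xi>)\<^sup>2) / 2))"
      by (intro tendsto_intros rlim) simp
    then show "(\<lambda>n. charf (gauss_scaled (r n)) \<xi>) \<longlonglongrightarrow> complex_of_real (exp (- s * ((symm_matrix A *v \<xi>) \<bullet> \<xi>) / 2))"
      unfolding c' e by (simp add: mult.assoc)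
  qed
qed

text \<open>The three terms of the exponent become three convolution factors: a point mass for the
  drift, Gaussians, and compound Poisson laws. All are dominated factor by factor, and a single
  limit in n removes the regularization and the truncation together.\<close>

theorem law_dominated_levy:
  fixes \<mu> \<rho> :: "(real ^ 'n) measure"
  assumes t1: "levy_triple b A \<nu>" and t2: "levy_triple 0 (symm_matrix A) \<nu>'"
    and \<nu>: "\<nu> = density lborel \<phi>" "\<nu>' = density lborel \<psi>" and r: "is_rearr \<phi> \<psi>" and s: "0 \<le> s"
    and \<mu>: "prob_space \<mu>" "sets \<mu> = sets borel" and \<rho>: "prob_space \<rho>" "sets \<rho> = sets borel"
    and c\<mu>: "\<And>\<xi>. charf \<mu> \<xi> = exp (- complex_of_real s * levy_exponent b A \<nu> \<xi>)"
    and c\<rho>: "\<And>\<xi>. charf \<rho> \<xi> = exp (- complex_of_real s * levy_exponent 0 (symm_matrix A) \<nu>' \<xi>)"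
  shows "law_dominated \<mu> \<rho>"
proof -
  have [measurable]: "\<phi> \<in> borel_measurable borel" "\<psi> \<in> borel_measurable borel" using r by (auto simp: is_rearr_def)
  have s\<nu>: "sets \<nu> = sets borel" "sets \<nu>' = sets borel" by (simp_all add: \<nu>)
  have f1: "(\<integral>\<^sup>+ y. ennreal ((norm y)\<^sup>2 / (1 + (norm y)\<^sup>2)) \<partial>\<nu>) < \<infinity>" and f2: "(\<integral>\<^sup>+ y. ennreal ((norm y)\<^sup>2 / (1 + (norm y)\<^sup>2)) \<partial>\<nu>') < \<infinity>"
    and z: "emeasure \<nu> {0} = 0" and sym: "transpose A = A" and psd: "\<And>x. 0 \<le> (A *v x) \<bullet> x"
    using t1 t2 by (auto simp: levy_triple_def)
  obtain G\<mu> G\<rho> :: "nat \<Rightarrow> (real ^ 'n) measure" where G: "\<And>n. law_dominated (G\<mu> n) (G\<rho> n)"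
    and G\<mu>: "\<And>\<xi>. (\<lambda>n. charf (G\<mu> n) \<xi>) \<longlonglongrightarrow> complex_of_real (exp (- s * ((A *v \<xi>) \<bullet> \<xi>) / 2))"
    and G\<rho>: "\<And>\<xi>. (\<lambda>n. charf (G\<rho> n) \<xi>) \<longlonglongrightarrow> complex_of_real (exp (- s * ((symm_matrix A *v \<xi>) \<bullet> \<xi>) / 2))"
    by (rule gauss_approx[OF sym psd s]) (rule that)
  define \<phi>n where "\<phi>n n x = \<phi> x * indicator (away n) x" for n x
  \<comment> \<open>A rearranged truncation has the same mass as the truncation, so both sides jump
    at the same rate. Truncating the rearrangement of \<phi> would not give a matching pair.\<close>
  define \<psi>n where "\<psi>n n = rearr_fun (\<phi>n n)" for n
  have [measurable]: "\<phi>n n \<in> borel_measurable borel" for n unfolding \<phi>n_def[abs_def] by measurable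
  have rn: "is_rearr (\<phi>n n) (\<psi>n n)" for n unfolding \<psi>n_def by (rule is_rearr_rearr_fun) simp
  have [measurable]: "\<psi>n n \<in> borel_measurable borel" for n using rn[of n] by (simp add: is_rearr_def)
  have finn: "(\<integral>\<^sup>+x. \<phi>n n x \<partial>lborel) < \<top>" for n
    using emeasure_away[OF s\<nu>(1) f1, of n] by (simp add: \<nu> emeasure_density \<phi>n_def)
  have inc: "incseq \<phi>n"
    using away_mono by (auto simp: incseq_def le_fun_def \<phi>n_def indicator_def)
  have supn: "\<phi> x = (SUP n. \<phi>n n x)" if "x \<noteq> 0" for x
  proof (rule antisym)
    have "x \<in> (\<Union>n. away n)" unfolding away_Union using that by simp
    then obtain n where "x \<in> away n" by (rule UN_E)
    then have "\<phi> x = \<phi>n n x" by (simp add: \<phi>n_def)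
    then show "\<phi> x \<le> (SUP n. \<phi>n n x)" by (rule ord_eq_le_trans) (rule SUP_upper[OF UNIV_I])
  qed (rule SUP_least, simp add: \<phi>n_def indicator_def)
  have incs: "incseq \<psi>n"
    unfolding incseq_def le_fun_def using inc by (auto intro!: is_rearr_mono[OF rn rn] simp: incseq_def le_fun_def)
  \<comment> \<open>The truncations all vanish at the origin, where \<phi> need not; one point does
    not influence the rearrangement.\<close>
  have "AE x in lborel. x \<noteq> (0 :: real ^ 'n)" by (rule AE_lborel_singleton)
  then have "AE x in lborel. \<phi> x = (SUP n. \<phi>n n x)" by eventually_elim (rule supn)
  from is_rearr_SUP[OF rn r inc this] have sups: "\<psi> x = (SUP n. \<psi>n n x)" for x .
  obtain d :: "nat \<Rightarrow> real ^ 'n" where d: "\<And>\<xi>. (\<lambda>n. (LINT y|\<nu>. indicator (away n) y *\<^sub>R (1 - iexp (\<xi> \<bullet> y))) + \<i> * complex_of_real (\<xi> \<bullet> d n)) \<longlonglongrightarrow>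
      (LINT y|\<nu>. 1 + \<i> * complex_of_real ((\<xi> \<bullet> y) * indicator (ball 0 1) y) - iexp (\<xi> \<bullet> y))"
    by (rule truncated_exponent[OF s\<nu>(1) f1 z]) (rule that)
  have dn: "density lborel (\<phi>n n) = density \<nu> (\<lambda>y. ennreal (indicator (away n) y))" for n
    unfolding \<nu> by (subst density_density_eq) (auto simp: \<phi>n_def[abs_def] ennreal_indicator)
  have trunc: "(LINT y|density lborel (\<phi>n n). 1 - iexp (\<xi> \<bullet> y)) = (LINT y|\<nu>. indicator (away n) y *\<^sub>R (1 - iexp (\<xi> \<bullet> y)))" for n \<xi>
    unfolding dn by (subst integral_density) (auto simp: \<nu>)
  have even: "\<psi> (- x) = \<psi> x" "\<psi>n n (- x) = \<psi>n n x" for n x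
    using is_rearr_radial[OF r, of "- x" x] is_rearr_radial[OF rn, of "- x" x] by simp_all
  have d': "(\<lambda>n. LINT y|density lborel (\<psi>n n). 1 - iexp (\<xi> \<bullet> y)) \<longlonglongrightarrow>
      (LINT y|\<nu>'. 1 + \<i> * complex_of_real ((\<xi> \<bullet> y) * indicator (ball 0 1) y) - iexp (\<xi> \<bullet> y))" for \<xi>
    unfolding \<nu>(2)
    by (rule truncated_exponent_symmetric) (use even incs sups f2 finn nn_integral_rearr[OF rn] in \<open>auto simp: \<nu>\<close>)
  define L where "L n \<xi> = complex_of_real s * (LINT y|density lborel (\<phi>n n). 1 - iexp (\<xi> \<bullet> y))" for n \<xi>
  define L' where "L' n \<xi> = complex_of_real s * (LINT y|density lborel (\<psi>n n). 1 - iexp (\<xi> \<bullet> y))" for n \<xi>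
  \<comment> \<open>The error 1 / (n + 1) is uniform in the frequency, so approximation and
    truncation can share the index n.\<close>
  define approx where "approx n q \<longleftrightarrow> law_dominated (fst q) (snd q) \<and> (\<forall>\<xi>. norm (charf (fst q) \<xi> - exp (- L n \<xi>)) \<le> 1 / Suc n)
     \<and> (\<forall>\<xi>. norm (charf (snd q) \<xi> - exp (- L' n \<xi>)) \<le> 1 / Suc n)" for n :: nat and q :: "(real ^ 'n) measure \<times> (real ^ 'n) measure"
  have "\<exists>q. approx n q" for n
  proof (rule jump_approx[OF rn[of n] finn[of n] s, of "1 / Suc n"])
    fix \<mu> \<rho> :: "(real ^ 'n) measure"
    assume "law_dominated \<mu> \<rho>"
      "\<And>\<xi>. norm (charf \<mu> \<xi> - exp (- (complex_of_real s * (LINT y|density lborel (\<phi>n n). 1 - iexp (\<xi> \<bullet> y))))) \<le> 1 / Suc n"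
      "\<And>\<xi>. norm (charf \<rho> \<xi> - exp (- (complex_of_real s * (LINT y|density lborel (\<psi>n n). 1 - iexp (\<xi> \<bullet> y))))) \<le> 1 / Suc n"
    then have "approx n (\<mu>, \<rho>)" unfolding approx_def L_def L'_def fst_conv snd_conv by (intro conjI allI)
    then show ?thesis by (rule exI)
  qed simp
  then have "\<forall>n. \<exists>q. approx n q" by (rule allI)
  from choice[OF this] obtain J where J0: "\<forall>n. approx n (J n)" by (rule exE)
  define J\<mu> J\<rho> where "J\<mu> n = fst (J n)" and "J\<rho> n = snd (J n)" for n
  have J: "law_dominated (J\<mu> n) (J\<rho> n)" and J\<mu>: "norm (charf (J\<mu> n) \<xi> - exp (- L n \<xi>)) \<le> 1 / Suc n"
    and J\<rho>: "norm (charf (J\<rho> n) \<xi> - exp (- L' n \<xi>)) \<le> 1 / Suc n" for n \<xi>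
    using J0[rule_format, of n] unfolding approx_def J\<mu>_def J\<rho>_def by simp_all
  have vanish: "(\<lambda>n. a n - c n) \<longlonglongrightarrow> 0" if "\<And>n. norm (a n - c n) \<le> 1 / Suc n" for a c :: "nat \<Rightarrow> complex"
    by (rule Lim_null_comparison[OF _ LIMSEQ_inverse_real_of_nat[unfolded inverse_eq_divide]]) (use that in auto)
  \<comment> \<open>The drift that remains once the compensator of the truncated jumps has been
    moved into it. It may diverge, but on the side of the majorant every translation is replaced by
    0.\<close>
  define x where "x n = s *\<^sub>R (b - d n)" for n
  define M where "M n = conv (return borel (x n)) (conv (G\<mu> n) (J\<mu> n))" for n
  define R where "R n = conv (return borel 0) (conv (G\<rho> n) (J\<rho> n))" for n
  have p: "prob_space (G\<mu> n)" "sets (G\<mu> n) = sets borel" "prob_space (J\<mu> n)" "sets (J\<mu> n) = sets borel"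
     "prob_space (G\<rho> n)" "sets (G\<rho> n) = sets borel" "prob_space (J\<rho> n)" "sets (J\<rho> n) = sets borel" for n
    using G[of n] J[of n] by (auto simp: law_dominated_def)
  have cM: "charf (M n) \<xi> = iexp (\<xi> \<bullet> x n) * (charf (G\<mu> n) \<xi> * charf (J\<mu> n) \<xi>)" for n \<xi>
    unfolding M_def by (simp add: charf_conv prob_space_conv prob_space_return p charf_return)
  have cR: "charf (R n) \<xi> = charf (G\<rho> n) \<xi> * charf (J\<rho> n) \<xi>" for n \<xi>
    unfolding R_def by (simp add: charf_conv prob_space_conv prob_space_return p charf_return)
  show ?thesis
  proof (rule law_dominated_limit[of M R])
    show "law_dominated (M n) (R n)" for n unfolding M_def R_def by (intro law_dominated_conv law_dominated_return G J)
    show "law_dominated (gauss_scaled \<sigma> :: (real ^ 'n) measure) (gauss_scaled \<sigma>)" if "0 < \<sigma>" for \<sigma> using that by (rule law_dominated_gauss_scaled)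
    fix \<xi> :: "real ^ 'n"
    define D where "D = (LINT y|\<nu>. 1 + \<i> * complex_of_real ((\<xi> \<bullet> y) * indicator (ball 0 1) y) - iexp (\<xi> \<bullet> y))"
    define D' where "D' = (LINT y|\<nu>'. 1 + \<i> * complex_of_real ((\<xi> \<bullet> y) * indicator (ball 0 1) y) - iexp (\<xi> \<bullet> y))"
    have "(\<lambda>n. charf (J\<rho> n) \<xi> - exp (- L' n \<xi>) + exp (- L' n \<xi>)) \<longlonglongrightarrow> 0 + exp (- (complex_of_real s * D'))"
      unfolding L'_def by (intro tendsto_intros vanish J\<rho>[unfolded L'_def] d'[of \<xi>, folded D'_def])
    then have "(\<lambda>n. charf (G\<rho> n) \<xi> * charf (J\<rho> n) \<xi>) \<longlonglongrightarrow> complex_of_real (exp (- s * ((symm_matrix A *v \<xi>) \<bullet> \<xi>) / 2)) * exp (- (complex_of_real s * D'))"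
      by (intro tendsto_intros G\<rho>) simp
    also have "complex_of_real (exp (- s * ((symm_matrix A *v \<xi>) \<bullet> \<xi>) / 2)) * exp (- (complex_of_real s * D')) = charf \<rho> \<xi>"
      unfolding c\<rho> levy_exponent_def D'_def[symmetric] exp_of_real[symmetric] mult_exp_exp
      by (rule arg_cong[where f=exp]) (simp add: algebra_simps)
    finally show "(\<lambda>n. charf (R n) \<xi>) \<longlonglongrightarrow> charf \<rho> \<xi>" by (simp only: cR)
    \<comment> \<open>The phase alone need not converge. The approximation error tends to 0 whatever
      the phase is, and in the product of the phase with the exact exponential the drift
      \<open>d n\<close> joins the truncated jump integral, whose sum with it converges.\<close>
    have "(\<lambda>n. iexp (\<xi> \<bullet> x n) * (charf (J\<mu> n) \<xi> - exp (- L n \<xi>))) \<longlonglongrightarrow> 0"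
      by (rule Lim_null_comparison[OF _ LIMSEQ_inverse_real_of_nat[unfolded inverse_eq_divide]])
         (use J\<mu> in \<open>auto simp: norm_mult norm_exp_i_times\<close>)
    moreover have "(\<lambda>n. iexp (\<xi> \<bullet> x n) * exp (- L n \<xi>)) \<longlonglongrightarrow> exp (\<i> * complex_of_real (s * (b \<bullet> \<xi>)) - complex_of_real s * D)"
    proof -
      have e: "iexp (\<xi> \<bullet> x n) * exp (- L n \<xi>) = exp (\<i> * complex_of_real (s * (b \<bullet> \<xi>)) - complex_of_real s * ((LINT y|\<nu>. indicator (away n) y *\<^sub>R (1 - iexp (\<xi> \<bullet> y))) + \<i> * complex_of_real (\<xi> \<bullet> d n)))" for n
        unfolding mult_exp_exp L_def trunc
        by (rule arg_cong[where f=exp]) (simp add: x_def inner_diff_right inner_commute algebra_simps)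
      show ?thesis unfolding e by (intro tendsto_intros d[of \<xi>, folded D_def])
    qed
    ultimately have "(\<lambda>n. iexp (\<xi> \<bullet> x n) * (charf (J\<mu> n) \<xi> - exp (- L n \<xi>)) + iexp (\<xi> \<bullet> x n) * exp (- L n \<xi>)) \<longlonglongrightarrow> 0 + exp (\<i> * complex_of_real (s * (b \<bullet> \<xi>)) - complex_of_real s * D)"
      by (rule tendsto_add)
    then have "(\<lambda>n. charf (G\<mu> n) \<xi> * (iexp (\<xi> \<bullet> x n) * charf (J\<mu> n) \<xi>)) \<longlonglongrightarrow> complex_of_real (exp (- s * ((A *v \<xi>) \<bullet> \<xi>) / 2)) * exp (\<i> * complex_of_real (s * (b \<bullet> \<xi>)) - complex_of_real s * D)"
      by (intro tendsto_intros G\<mu>) (simp add: algebra_simps)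
    also have "complex_of_real (exp (- s * ((A *v \<xi>) \<bullet> \<xi>) / 2)) * exp (\<i> * complex_of_real (s * (b \<bullet> \<xi>)) - complex_of_real s * D) = charf \<mu> \<xi>"
      unfolding c\<mu> levy_exponent_def D_def[symmetric] exp_of_real[symmetric] mult_exp_exp
      by (rule arg_cong[where f=exp]) (simp add: algebra_simps)
    finally show "(\<lambda>n. charf (M n) \<xi>) \<longlonglongrightarrow> charf \<mu> \<xi>" by (simp only: cM mult.left_commute)
  qed (fact \<mu> \<rho>)+
qed

subsection \<open>Products along a chain of increments\<close>

text \<open>A small ball as test set turns overlaps into probabilities. If x lies deep inside U, the
  overlap of the translated small ball with U is full; on the other side it vanishes unless x lies
  within \<delta> j of the ball of radius r. In the limit a closed ball remains.\<close>

lemma law_dominated_open_le: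
  fixes \<mu> \<rho> :: "'a::euclidean_space measure"
  assumes d: "law_dominated \<mu> \<rho>" and U: "open U" "emeasure lborel U < \<top>" and r: "symball U = ball 0 r" "0 \<le> r"
  shows "emeasure \<mu> U \<le> emeasure \<rho> (cball 0 r)"
proof -
  interpret m: prob_space \<mu> using d by (simp add: law_dominated_def)
  interpret r: prob_space \<rho> using d by (simp add: law_dominated_def)
  have s[measurable_cong]: "sets \<mu> = sets borel" "sets \<rho> = sets borel" using d by (auto simp: law_dominated_def)
  have [measurable]: "U \<in> sets borel" using U by simp
  define \<delta> where "\<delta> j = 1 / real (Suc j)" for j
  have \<delta>: "0 < \<delta> j" for j by (simp add: \<delta>_def)
  \<comment> \<open>The points of U whose distance to the complement is at least \<delta> j.\<close>
  define V where "V j = {x. ball x (\<delta> j) \<subseteq> U}" for j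
  have "- V j = (\<Union>y\<in>-U. ball y (\<delta> j))" for j by (auto simp: V_def dist_commute)
  then have "closed (V j)" for j unfolding closed_def by (simp add: open_UN)
  then have [measurable]: "V j \<in> sets borel" for j by simp
  have dmono: "\<delta> j \<le> \<delta> i" if "i \<le> j" for i j using that by (simp add: \<delta>_def frac_le)
  have incV: "V i \<subseteq> V j" if "i \<le> j" for i j
    using subset_ball[OF dmono[OF that]] unfolding V_def by blast
  have UV: "(\<Union>j. V j) = U"
  proof (intro equalityI subsetI)
    fix x assume "x \<in> (\<Union>j. V j)"
    then obtain j where "ball x (\<delta> j) \<subseteq> U" by (auto simp: V_def)
    then show "x \<in> U" using \<delta>[of j] by (meson centre_in_ball subsetD)
  next
    fix x assume "x \<in> U"
    then obtain e where e: "0 < e" "ball x e \<subseteq> U" using U(1) by (meson open_contains_ball)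
    obtain j where "1 / real (Suc j) < e" using nat_approx_posE[OF e(1)] by auto
    then have "ball x (\<delta> j) \<subseteq> U" using e(2) subset_ball[of "\<delta> j" e x] by (auto simp: \<delta>_def)
    then show "x \<in> (\<Union>j. V j)" by (auto simp: V_def)
  qed
  have key: "emeasure \<mu> (V j) \<le> emeasure \<rho> (ball 0 (r + \<delta> j))" for j
  proof -
    define b where "b = emeasure lborel (ball (0::'a) (\<delta> j))"
    have b: "b < \<top>" "b \<noteq> 0"
      using \<delta>[of j] emeasure_lborel_ball_finite[of "0::'a" "\<delta> j"] emeasure_ball_less_iff[where 'a='a, of 0 "\<delta> j"] by (auto simp: b_def)
    have "b * emeasure \<mu> (V j) = (\<integral>\<^sup>+x. b * indicator (V j) x \<partial>\<mu>)"
      by (subst nn_integral_cmult_indicator) (auto simp: s)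
    also have "\<dots> \<le> (\<integral>\<^sup>+x. shifted_overlap (ball 0 (\<delta> j)) U x \<partial>\<mu>)"
    proof (rule nn_integral_mono)
      fix x
      show "b * indicator (V j) x \<le> shifted_overlap (ball 0 (\<delta> j)) U x"
      proof (cases "x \<in> V j")
        case True
        have "b = (\<integral>\<^sup>+y. indicator (ball 0 (\<delta> j)) y \<partial>(lborel :: 'a measure))" by (simp add: b_def)
        also have "\<dots> \<le> shifted_overlap (ball 0 (\<delta> j)) U x"
          unfolding shifted_overlap_def
        proof (rule nn_integral_mono)
          fix y
          have "x + y \<in> ball x (\<delta> j)" if "y \<in> ball 0 (\<delta> j)" using that by (simp add: dist_norm)
          then have "x + y \<in> U" if "y \<in> ball 0 (\<delta> j)" using that True by (auto simp: V_def)
          then show "indicator (ball 0 (\<delta> j)) y \<le> (indicator (ball 0 (\<delta> j)) y * indicator U (x + y) :: ennreal)"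
            by (auto simp: indicator_def)
        qed
        finally show ?thesis using True by simp
      qed simp
    qed
    also have "\<dots> \<le> (\<integral>\<^sup>+x. shifted_overlap (symball (ball 0 (\<delta> j))) (symball U) x \<partial>\<rho>)"
      using d b U by (auto simp: law_dominated_def riesz_le_measure_def b_def)
    also have "\<dots> \<le> (\<integral>\<^sup>+x. b * indicator (ball 0 (r + \<delta> j)) x \<partial>\<rho>)"
    proof (rule nn_integral_mono)
      fix x
      have sb: "symball (ball 0 (\<delta> j)) = (ball 0 (\<delta> j) :: 'a set)" using \<delta>[of j] by (simp add: symball_ball less_imp_le)
      show "shifted_overlap (symball (ball 0 (\<delta> j))) (symball U) x \<le> b * indicator (ball 0 (r + \<delta> j)) x"
      proof (cases "x \<in> ball 0 (r + \<delta> j)")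
        case True
        then show ?thesis using shifted_overlap_le[of "ball 0 (\<delta> j)" "symball U" x] by (simp add: sb b_def)
      next
        case False
        have "x + y \<notin> ball 0 r" if "y \<in> ball 0 (\<delta> j)" for y
          using norm_triangle_ineq4[of "x + y" y] that False by auto
        then have "shifted_overlap (ball 0 (\<delta> j)) (ball 0 r) x = (\<integral>\<^sup>+(y::'a). 0 \<partial>lborel)"
          unfolding shifted_overlap_def by (intro nn_integral_cong) (simp add: indicator_def)
        then show ?thesis by (simp add: sb r)
      qed
    qed
    also have "\<dots> = b * emeasure \<rho> (ball 0 (r + \<delta> j))"
      by (subst nn_integral_cmult_indicator) (auto simp: s)
    finally show ?thesis using b by (simp add: ennreal_mult_le_mult_iff)
  qed
  have sub: "(\<Inter>j. ball 0 (r + \<delta> j)) \<subseteq> cball (0::'a) r"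
  proof
    fix x :: 'a assume x: "x \<in> (\<Inter>j. ball 0 (r + \<delta> j))"
    show "x \<in> cball 0 r"
    proof (rule ccontr)
      assume "x \<notin> cball 0 r"
      then obtain j where "1 / real (Suc j) < norm x - r" using nat_approx_posE[of "norm x - r"] by auto
      moreover have "norm x < r + \<delta> j" using x by auto
      ultimately show False by (simp add: \<delta>_def)
    qed
  qed
  have "emeasure \<mu> U = (SUP j. emeasure \<mu> (V j))"
    unfolding UV[symmetric] by (rule SUP_emeasure_incseq[symmetric]) (auto simp: s incseq_def incV)
  \<comment> \<open>One family increases and the other decreases, so two different indices are
    compared at their maximum.\<close>
  also have "\<dots> \<le> (INF j. emeasure \<rho> (ball 0 (r + \<delta> j)))"
  proof (intro SUP_least INF_greatest)
    fix i j
    have "emeasure \<mu> (V i) \<le> emeasure \<mu> (V (max i j))" by (intro emeasure_mono incV) (auto simp: s)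
    also have "\<dots> \<le> emeasure \<rho> (ball 0 (r + \<delta> (max i j)))" by (rule key)
    also have "\<dots> \<le> emeasure \<rho> (ball 0 (r + \<delta> j))"
      using dmono[of j "max i j"] by (intro emeasure_mono subset_ball) (auto simp: s)
    finally show "emeasure \<mu> (V i) \<le> emeasure \<rho> (ball 0 (r + \<delta> j))" .
  qed
  also have "\<dots> = emeasure \<rho> (\<Inter>j. ball 0 (r + \<delta> j))"
    using dmono by (intro INF_emeasure_decseq) (auto simp: s decseq_def intro!: subset_ball)
  also have "\<dots> \<le> emeasure \<rho> (cball 0 r)" by (rule emeasure_mono[OF sub]) (simp add: s)
  finally show ?thesis .
qed

lemma emeasure_sphere_null:
  assumes ac: "absolutely_continuous lborel \<rho>" and "0 \<le> r" and that: "sets \<rho> = sets borel"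
  shows "emeasure \<rho> (cball (0::'a::euclidean_space) r) = emeasure \<rho> (ball 0 r)"
proof -
  have "emeasure lborel (cball (0::'a) r - ball 0 r) = emeasure lborel (cball (0::'a) r) - emeasure lborel (ball (0::'a) r)"
    using emeasure_lborel_ball_finite[of "0::'a" r] by (intro emeasure_Diff) auto
  also have "\<dots> = 0" using assms by (simp add: emeasure_ball emeasure_cball)
  finally have "cball (0::'a) r - ball 0 r \<in> null_sets lborel" by (auto simp: null_sets_def)
  then have n: "cball (0::'a) r - ball 0 r \<in> null_sets \<rho>" using ac by (auto simp: absolutely_continuous_def)
  have "emeasure \<rho> (ball 0 r \<union> (cball 0 r - ball 0 r)) = emeasure \<rho> (ball 0 r)"
    by (rule emeasure_Un_null_set[OF _ n]) (simp add: that)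
  moreover have "ball 0 r \<union> (cball (0::'a) r - ball 0 r) = cball 0 r" by auto
  ultimately show ?thesis by simp
qed

lemma sets_ball_emeasure_less:
  fixes c :: ennreal
  shows "{x::'a::euclidean_space. emeasure lborel (ball (0::'a) (norm x)) < c} \<in> sets borel"
proof -
  have "(\<lambda>x::'a. ennreal (unit_ball_vol (real DIM('a)) * norm x ^ DIM('a))) \<in> borel_measurable borel"
    by (intro measurable_compose[OF _ measurable_ennreal] borel_measurable_continuous_onI continuous_intros)
  then have "{x::'a. ennreal (unit_ball_vol (real DIM('a)) * norm x ^ DIM('a)) < c} \<in> sets borel"
    using borel_measurable_less[of _ borel "\<lambda>_. c"] by simp
  then show ?thesis by (simp only: emeasure_ball[OF norm_ge_zero])
qed

text \<open>Averaged overlaps give way to the mass of a single set: outer regularity reduces E to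
  open sets, and absolute continuity of \<rho> makes the bounding spheres null, so the closed balls
  that limits produce do no harm.\<close>

lemma law_dominated_emeasure_le:
  fixes \<mu> \<rho> :: "'a::euclidean_space measure"
  assumes d: "law_dominated \<mu> \<rho>" and ac: "absolutely_continuous lborel \<rho>" and E[measurable]: "E \<in> sets borel" and fE: "emeasure lborel E < \<top>"
  shows "emeasure \<mu> E \<le> emeasure \<rho> (symball E)"
proof -
  interpret r: prob_space \<rho> using d by (simp add: law_dominated_def)
  have s[measurable_cong]: "sets \<mu> = sets borel" "sets \<rho> = sets borel" using d by (auto simp: law_dominated_def)
  define \<delta> where "\<delta> j = 1 / real (Suc j)" for j
  have \<delta>: "0 < \<delta> j" for j by (simp add: \<delta>_def)
  \<comment> \<open>The ball whose volume exceeds that of E by \<delta> j, described by its volume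
    so that no radius is computed.\<close>
  define W where "W j = {x::'a. emeasure lborel (ball (0::'a) (norm x)) < emeasure lborel E + ennreal (\<delta> j)}" for j
  have Ws[measurable]: "W j \<in> sets borel" for j unfolding W_def by (rule sets_ball_emeasure_less)
  have le: "emeasure \<mu> E \<le> emeasure \<rho> (W j)" for j
  proof -
    have "E \<in> sets lebesgue" by simp
    then obtain U where U: "open U" "E \<subseteq> U" "emeasure lebesgue (U - E) < ennreal (\<delta> j)"
      using \<delta>[of j] by (rule sets_lebesgue_outer_open) (rule that)
    have Us[measurable]: "U \<in> sets borel" by (rule borel_open[OF U(1)])
    have "E \<union> (U - E) = U" using U by auto
    then have "emeasure lborel U = emeasure lborel E + emeasure lborel (U - E)"
      using plus_emeasure[of E lborel "U - E"] by simp
    also have lt: "\<dots> < emeasure lborel E + ennreal (\<delta> j)"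
      using U(3) fE by (simp add: ennreal_add_left_cancel_less)
    finally have lt: "emeasure lborel U < emeasure lborel E + ennreal (\<delta> j)" .
    also have "\<dots> < \<top>" using fE by simp
    finally have fU: "emeasure lborel U < \<top>" .
    then obtain r where r: "0 \<le> r" "symball U = ball 0 r" using symball_finite[of U] unfolding infinity_ennreal_def by metis
    have "emeasure \<mu> E \<le> emeasure \<mu> U" by (rule emeasure_mono[OF U(2)]) (simp only: s Us)
    also have "\<dots> \<le> emeasure \<rho> (cball 0 r)" by (rule law_dominated_open_le[OF d U(1) fU r(2,1)])
    also have "\<dots> = emeasure \<rho> (symball U)" unfolding r by (rule emeasure_sphere_null[OF ac r(1) s(2)])
    also have "\<dots> \<le> emeasure \<rho> (W j)"
    proof (rule emeasure_mono)
      show "symball U \<subseteq> W j" unfolding W_def symball_def using lt by (intro Collect_mono impI) (rule less_trans)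
    qed (simp only: s Ws)
    finally show ?thesis .
  qed
  obtain r where r: "0 \<le> r" "symball E = ball 0 r" "emeasure lborel (ball (0::'a) r) = emeasure lborel E" using symball_finite[of E] fE unfolding infinity_ennreal_def by metis
  have sub: "(\<Inter>j. W j) \<subseteq> cball 0 r"
  proof
    fix x :: 'a assume x: "x \<in> (\<Inter>j. W j)"
    have "emeasure lborel (ball (0::'a) (norm x)) \<le> emeasure lborel E"
    proof (rule ennreal_le_epsilon)
      fix e :: real assume "0 < e"
      then obtain j where "\<delta> j < e" using nat_approx_posE[of e] by (auto simp: \<delta>_def)
      then have "emeasure lborel E + ennreal (\<delta> j) \<le> emeasure lborel E + ennreal e" by (intro add_left_mono ennreal_leI) auto
      moreover have "emeasure lborel (ball (0::'a) (norm x)) < emeasure lborel E + ennreal (\<delta> j)" using x by (auto simp: W_def)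
      ultimately show "emeasure lborel (ball (0::'a) (norm x)) \<le> emeasure lborel E + ennreal e" by (rule order.trans[OF less_imp_le, rotated])
    qed
    then have "\<not> emeasure lborel (ball (0::'a) r) < emeasure lborel (ball (0::'a) (norm x))" by (simp add: r(3) not_less)
    then show "x \<in> cball 0 r" using emeasure_ball_less_iff[where 'a='a, OF r(1), of "norm x"] by simp
  qed
  have cb: "cball (0::'a) r \<in> sets \<rho>" unfolding s(2) by (rule borel_closed[OF closed_cball])
  have "emeasure \<mu> E \<le> (INF j. emeasure \<rho> (W j))" by (intro INF_greatest le)
  also have "\<dots> = emeasure \<rho> (\<Inter>j. W j)"
  proof (rule INF_emeasure_decseq)
    have dm: "emeasure lborel E + ennreal (\<delta> j) \<le> emeasure lborel E + ennreal (\<delta> i)" if "i \<le> j" for i j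
      using that by (intro add_left_mono ennreal_leI) (simp add: \<delta>_def frac_le)
    show "decseq W" unfolding decseq_def W_def
      by (intro allI impI Collect_mono) (erule less_le_trans, erule dm)
  qed (use Ws in \<open>auto simp: s\<close>)
  also have "\<dots> \<le> emeasure \<rho> (cball 0 r)" by (rule emeasure_mono[OF sub cb])
  also have "\<dots> = emeasure \<rho> (symball E)" unfolding r(2) by (rule emeasure_sphere_null[OF ac r(1) s(2)])
  finally show ?thesis .
qed

text \<open>The first increment starts from the single point z instead of being averaged over a set,
  so \<open>dominated_convolution\<close> does not apply. The inequality for masses of sets says
  that the density of \<mu>, translated by z, is dominated by that of \<rho>, and the integral
  becomes a product of two dominated functions.\<close>

lemma law_dominated_density_product:
  fixes \<mu> \<rho> :: "'a::euclidean_space measure"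
  assumes d: "law_dominated \<mu> \<rho>" and ac: "absolutely_continuous lborel \<rho>" and H: "dominated H H'"
  shows "(\<integral>\<^sup>+x. H (z + x) \<partial>\<mu>) \<le> (\<integral>\<^sup>+x. H' x \<partial>\<rho>)"
proof -
  interpret m: prob_space \<mu> using d by (simp add: law_dominated_def)
  interpret r: prob_space \<rho> using d by (simp add: law_dominated_def)
  have s[measurable_cong]: "sets \<mu> = sets borel" "sets \<rho> = sets borel" using d by (auto simp: law_dominated_def)
  have [measurable]: "H \<in> borel_measurable borel" "H' \<in> borel_measurable borel" using H by (auto simp: dominated_def)
  \<comment> \<open>\<mu> inherits a density from \<rho>: the ball belonging to a null set is
    empty.\<close>
  have ac': "absolutely_continuous lborel \<mu>"
    unfolding absolutely_continuous_def
  proof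
    fix N assume N: "N \<in> null_sets (lborel :: 'a measure)"
    then have "symball N = {}" by (auto simp: symball_def)
    moreover have "N \<in> sets borel" "emeasure lborel N < \<top>" using N by (auto simp: null_sets_def)
    ultimately have "emeasure \<mu> N \<le> 0" using law_dominated_emeasure_le[OF d ac, of N] by simp
    then show "N \<in> null_sets \<mu>" using N by (auto simp: null_sets_def s)
  qed
  define p where "p = RN_deriv lborel \<mu>"
  define q where "q = RN_deriv lborel \<rho>"
  have \<mu>: "\<mu> = density lborel p" unfolding p_def by (rule sigma_finite_measure.density_RN_deriv[OF sigma_finite_lborel, symmetric]) (auto simp: ac' s)
  have \<rho>: "\<rho> = density lborel q" unfolding q_def by (rule sigma_finite_measure.density_RN_deriv[OF sigma_finite_lborel, symmetric]) (auto simp: ac s)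
  have [measurable]: "p \<in> borel_measurable borel" "q \<in> borel_measurable borel" unfolding p_def q_def by simp_all
  have "dominated (\<lambda>x. p (x - z)) q"
    unfolding dominated_def
  proof (intro conjI)
    have q: "(\<integral>\<^sup>+x. indicator E x * q x \<partial>lborel) = emeasure \<rho> E" if "E \<in> sets borel" for E
      using that unfolding \<rho> by (subst emeasure_density) (auto simp: mult.commute)
    show "prec (\<lambda>x. p (x - z)) q"
      unfolding prec_def
    proof (intro ballI impI)
      fix E :: "'a set" assume [measurable]: "E \<in> sets borel" and fE: "emeasure lborel E < \<top>"
      define E' where "E' = {x. z + x \<in> E}"
      have [measurable]: "E' \<in> sets borel" unfolding E'_def by measurable
      have "emeasure lborel E' = (\<integral>\<^sup>+x. indicator E (z + x) \<partial>lborel)"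
        by (subst nn_integral_indicator[symmetric]) (simp, intro nn_integral_cong, simp add: E'_def indicator_def)
      then have eE: "emeasure lborel E' = emeasure lborel E" by (simp add: nn_integral_translate)
      have "(\<integral>\<^sup>+x. indicator E x * p (x - z) \<partial>lborel) = (\<integral>\<^sup>+x. indicator E (z + x) * p (z + x - z) \<partial>lborel)"
        by (rule nn_integral_translate[symmetric]) measurable
      also have "\<dots> = (\<integral>\<^sup>+x. p x * indicator E' x \<partial>lborel)"
        by (intro nn_integral_cong) (simp add: E'_def indicator_def)
      also have "\<dots> = emeasure \<mu> E'" unfolding \<mu> by (subst emeasure_density) auto
      also have "\<dots> \<le> emeasure \<rho> (symball E')" using fE eE by (intro law_dominated_emeasure_le[OF d ac]) auto
      also have "\<dots> = emeasure \<rho> (symball E)" using symball_cong[OF eE] by simp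
      finally show "(\<integral>\<^sup>+x. indicator E x * p (x - z) \<partial>lborel) \<le> (\<integral>\<^sup>+x. indicator (symball E) x * q x \<partial>lborel)"
        by (simp add: q)
    qed
    show "prec q q" unfolding prec_def using law_dominated_emeasure_le[OF law_dominated_refl[OF d] ac] by (simp add: q)
    show "(\<integral>\<^sup>+x. q x \<partial>lborel) < \<top>" using q[of UNIV] r.emeasure_space_1 sets_eq_imp_space_eq[OF s(2)] by simp
  qed measurable
  from dominated_product[OF this H]
  have le: "(\<integral>\<^sup>+x. p (x - z) * H x \<partial>lborel) \<le> (\<integral>\<^sup>+x. q x * H' x \<partial>lborel)" .
  have "(\<integral>\<^sup>+x. H (z + x) \<partial>\<mu>) = (\<integral>\<^sup>+x. p (z + x - z) * H (z + x) \<partial>lborel)"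
    unfolding \<mu> by (subst nn_integral_density) auto
  also have "\<dots> = (\<integral>\<^sup>+x. p (x - z) * H x \<partial>lborel)" by (rule nn_integral_translate) measurable
  also note le
  also have "(\<integral>\<^sup>+x. q x * H' x \<partial>lborel) = (\<integral>\<^sup>+x. H' x \<partial>\<rho>)" unfolding \<rho> by (subst nn_integral_density) auto
  finally show ?thesis .
qed

text \<open>The constant function 1 is dominated by itself in the sense of \<open>prec\<close>, and
  multiplying it by f and g gives the claim.\<close>

lemma dominated_rearr:
  assumes "is_rearr f g" and fin: "(\<integral>\<^sup>+x. f x \<partial>lborel) < \<top>"
  shows "dominated f g"
proof -
  have "prec (\<lambda>x. f x * 1) (\<lambda>x. g x * 1)" "prec (\<lambda>x. g x * 1) (\<lambda>x. g x * 1)"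
    by (intro prec_mult assms is_rearr_refl[OF assms(1)]; simp add: prec_def)+
  then show ?thesis using assms nn_integral_rearr[OF assms(1)] by (simp add: dominated_def is_rearr_def)
qed

text \<open>The recursion peels off the last increment and absorbs it, with the factor at the
  preceding position, into the terminal function H. Increment \<open>L j\<close> leads from position
  j to position j + 1, so factors are numbered from 1 and \<open>L 0\<close> starts at z.\<close>

primrec chain :: "(nat \<Rightarrow> 'a::euclidean_space measure) \<Rightarrow> (nat \<Rightarrow> 'a \<Rightarrow> ennreal) \<Rightarrow> nat \<Rightarrow> ('a \<Rightarrow> ennreal) \<Rightarrow> 'a \<Rightarrow> ennreal" where
  "chain L f 0 H z = (\<integral>\<^sup>+x. H (z + x) \<partial>L 0)"
| "chain L f (Suc k) H z = chain L f k (\<lambda>y. f (Suc k) y * (\<integral>\<^sup>+x. H (y + x) \<partial>L (Suc k))) z"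

text \<open>Domination of the terminal function is the invariant: convolution with an increment and
  multiplication by a factor both keep it. At the end only the first increment is left, which also
  replaces the start z by 0.\<close>

lemma chain_le:
  assumes L: "\<And>j. j \<le> k \<Longrightarrow> law_dominated (L j) (L' j)" and ac: "absolutely_continuous lborel (L' 0)"
    and f: "\<And>i. i \<in> {1..k} \<Longrightarrow> is_rearr (f i) (g i)" "\<And>i x. i \<in> {1..k} \<Longrightarrow> f i x \<le> ennreal c" "0 \<le> c"
    and H: "dominated H H'"
  shows "chain L f k H z \<le> chain L' g k H' 0"
  using L f H
proof (induction k arbitrary: H H')
  case 0
  then show ?case using law_dominated_density_product[OF _ ac, of "L 0" H H' z] by simp
next
  case (Suc k)
  have d: "law_dominated (L (Suc k)) (L' (Suc k))" using Suc.prems(1)[of "Suc k"] by simp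
  have "dominated (\<lambda>y. \<integral>\<^sup>+x. H (y + x) \<partial>L (Suc k)) (\<lambda>y. \<integral>\<^sup>+x. H' (y + x) \<partial>L' (Suc k))"
    using d by (intro dominated_convolution Suc.prems) (auto simp: law_dominated_def)
  then have "dominated (\<lambda>y. f (Suc k) y * (\<integral>\<^sup>+x. H (y + x) \<partial>L (Suc k))) (\<lambda>y. g (Suc k) y * (\<integral>\<^sup>+x. H' (y + x) \<partial>L' (Suc k)))"
    using Suc.prems(2)[of "Suc k"] Suc.prems(3)[of "Suc k"] Suc.prems(4) by (intro dominated_mult) auto
  then show ?case using Suc.prems by (auto intro!: Suc.IH)
qed

text \<open>Fubini with the last coordinate first: the earlier factors do not depend on it, and
  integrating it out produces the terminal function of the recursion.\<close>

lemma chain_PiM: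
  fixes L :: "nat \<Rightarrow> 'a::euclidean_space measure"
  assumes L: "\<And>j. prob_space (L j)" and s[measurable_cong]: "\<And>j. sets (L j) = sets borel"
    and f: "\<And>i. i \<in> {1..k} \<Longrightarrow> f i \<in> borel_measurable borel" and H: "H \<in> borel_measurable borel"
  shows "(\<integral>\<^sup>+\<omega>. (\<Prod>i=1..k. f i (z + (\<Sum>j<i. \<omega> j))) * H (z + (\<Sum>j<Suc k. \<omega> j)) \<partial>PiM {..<Suc k} L) = chain L f k H z"
  using f H
proof (induction k arbitrary: H)
  case 0
  interpret product_sigma_finite L
    by (intro product_sigma_finite.intro prob_space_imp_sigma_finite L)
  have [measurable]: "H \<in> borel_measurable borel" by (rule 0)
  have "{..<Suc 0} = insert 0 ({} :: nat set)" by auto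
  then show ?case using product_nn_integral_singleton[of "\<lambda>x. H (z + x)" 0] by simp
next
  case (Suc k)
  interpret product_sigma_finite L
    by (intro product_sigma_finite.intro prob_space_imp_sigma_finite L)
  interpret LS: prob_space "L (Suc k)" by (rule L)
  have Hm[measurable]: "H \<in> borel_measurable borel" by (rule Suc.prems)
  have fm: "f i \<in> borel_measurable borel" if "i \<in> {1..Suc k}" for i using Suc.prems(1) that by blast
  have [measurable]: "f (Suc k) \<in> borel_measurable borel" by (rule fm) simp
  have comp: "(\<lambda>\<omega>. z + (\<Sum>j<i. \<omega> j)) \<in> borel_measurable (PiM {..<n} L)" if "i \<le> n" for i n
    using that by (intro borel_measurable_add borel_measurable_const borel_measurable_sum) (auto intro!: measurable_component_singleton simp: measurable_cong_sets[OF refl s[symmetric]])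
  have prodm: "(\<lambda>\<omega>. \<Prod>i=1..m. f i (z + (\<Sum>j<i. \<omega> j))) \<in> borel_measurable (PiM {..<n} L)" if "m \<le> n" "m \<le> Suc k" for m n
    using that by (intro borel_measurable_prod_ennreal measurable_compose[OF comp fm]) auto
  have ins': "PiM {..<Suc (Suc k)} L = PiM (insert (Suc k) {..<Suc k}) L"
    by (rule arg_cong[where f="\<lambda>I. PiM I L"]) auto
  have meas: "(\<lambda>\<omega>. (\<Prod>i=1..Suc k. f i (z + (\<Sum>j<i. \<omega> j))) * H (z + (\<Sum>j<Suc (Suc k). \<omega> j))) \<in> borel_measurable (PiM {..<Suc (Suc k)} L)"
    by (intro borel_measurable_times_ennreal prodm measurable_compose[OF comp Hm]) auto
  have "(\<integral>\<^sup>+\<omega>. (\<Prod>i=1..Suc k. f i (z + (\<Sum>j<i. \<omega> j))) * H (z + (\<Sum>j<Suc (Suc k). \<omega> j)) \<partial>PiM {..<Suc (Suc k)} L)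
    = (\<integral>\<^sup>+\<omega>. (\<integral>\<^sup>+y. (\<Prod>i=1..Suc k. f i (z + (\<Sum>j<i. (fun_upd \<omega> (Suc k) y) j))) * H (z + (\<Sum>j<Suc (Suc k). (fun_upd \<omega> (Suc k) y) j)) \<partial>L (Suc k)) \<partial>PiM {..<Suc k} L)"
    by (subst ins', subst product_nn_integral_insert[OF _ _ meas[unfolded ins']]) auto
  also have "\<dots> = (\<integral>\<^sup>+\<omega>. (\<Prod>i=1..k. f i (z + (\<Sum>j<i. \<omega> j))) * (f (Suc k) (z + (\<Sum>j<Suc k. \<omega> j)) * (\<integral>\<^sup>+y. H ((z + (\<Sum>j<Suc k. \<omega> j)) + y) \<partial>L (Suc k))) \<partial>PiM {..<Suc k} L)"
  proof (rule nn_integral_cong)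
    fix \<omega> :: "nat \<Rightarrow> 'a"
    have eq: "(\<Sum>j<i. (fun_upd \<omega> (Suc k) y) j) = (\<Sum>j<i. \<omega> j)" if "i \<le> Suc k" for i y
      using that by (intro sum.cong) auto
    have "(\<integral>\<^sup>+y. (\<Prod>i=1..Suc k. f i (z + (\<Sum>j<i. (fun_upd \<omega> (Suc k) y) j))) * H (z + (\<Sum>j<Suc (Suc k). (fun_upd \<omega> (Suc k) y) j)) \<partial>L (Suc k))
       = (\<integral>\<^sup>+y. (\<Prod>i=1..Suc k. f i (z + (\<Sum>j<i. \<omega> j))) * H ((z + (\<Sum>j<Suc k. \<omega> j)) + y) \<partial>L (Suc k))"
      using eq[of "Suc k"] by (intro nn_integral_cong arg_cong2[where f="(*)"] prod.cong refl) (simp_all add: eq add.assoc)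
    also have "\<dots> = (\<Prod>i=1..Suc k. f i (z + (\<Sum>j<i. \<omega> j))) * (\<integral>\<^sup>+y. H ((z + (\<Sum>j<Suc k. \<omega> j)) + y) \<partial>L (Suc k))"
      by (rule nn_integral_cmult) measurable
    also have "(\<Prod>i=1..Suc k. f i (z + (\<Sum>j<i. \<omega> j))) = (\<Prod>i=1..k. f i (z + (\<Sum>j<i. \<omega> j))) * f (Suc k) (z + (\<Sum>j<Suc k. \<omega> j))"
      by simp
    finally show "(\<integral>\<^sup>+y. (\<Prod>i=1..Suc k. f i (z + (\<Sum>j<i. (fun_upd \<omega> (Suc k) y) j))) * H (z + (\<Sum>j<Suc (Suc k). (fun_upd \<omega> (Suc k) y) j)) \<partial>L (Suc k))
      = (\<Prod>i=1..k. f i (z + (\<Sum>j<i. \<omega> j))) * (f (Suc k) (z + (\<Sum>j<Suc k. \<omega> j)) * (\<integral>\<^sup>+y. H ((z + (\<Sum>j<Suc k. \<omega> j)) + y) \<partial>L (Suc k)))"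
      by (simp only: mult.assoc)
  qed
  also have "\<dots> = chain L f (Suc k) H z"
    using Suc.IH[of "\<lambda>y. f (Suc k) y * (\<integral>\<^sup>+x. H (y + x) \<partial>L (Suc k))"] fm by simp
  finally show ?case .
qed

subsection \<open>The symmetric decreasing rearrangement\<close>

lemma emeasure_level_AE:
  fixes f f' :: "'a::euclidean_space \<Rightarrow> ennreal"
  assumes [measurable]: "f' \<in> borel_measurable borel" and f: "f \<in> borel_measurable lebesgue" and ae: "AE x in lebesgue. f x = f' x"
  shows "emeasure lebesgue {x. t < f x} = emeasure lborel {x. t < f' x}"
proof -
  have 1: "{x. t < f x} \<in> sets lebesgue"
    using measurable_sets[OF f, OF borel_open[OF open_greaterThan[of t]]] by (simp add: vimage_def)
  have [measurable]: "{x. t < f' x} \<in> sets borel" by measurable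
  have "emeasure lebesgue {x. t < f x} = emeasure lebesgue {x. t < f' x}"
    by (rule emeasure_eq_AE) (use ae 1 in \<open>auto elim: eventually_mono\<close>)
  then show ?thesis by simp
qed

text \<open>A superlevel set is closed under passing to smaller norms and open by the one-sided
  limit, hence a centred ball; equimeasurability fixes its volume. The resulting criterion mentions
  f only, which gives uniqueness.\<close>

lemma is_sdr_iff_level:
  fixes f g :: "real ^ 'n \<Rightarrow> ennreal"
  assumes g: "is_symm_decr_rearrangement f g"
  shows "t < g x \<longleftrightarrow> emeasure lborel (ball (0 :: real ^ 'n) (norm x)) < emeasure lebesgue {x. t < f x}"
proof -
  note G = g[unfolded is_symm_decr_rearrangement_def]
  have dec: "g x \<le> g y" if "norm y \<le> norm x" for x y using G[THEN conjunct2, THEN conjunct1] that by blast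
  have lim: "(g \<longlongrightarrow> g y) (filtercomap norm (at_right (norm y)))" for y
    by (rule G[THEN conjunct2, THEN conjunct2, THEN conjunct1, THEN spec])
  have eq: "emeasure lebesgue {x. t < f x} = emeasure lebesgue {x. t < g x}"
    by (rule G[THEN conjunct2, THEN conjunct2, THEN conjunct2, THEN spec])
  \<comment> \<open>The limit from larger norms passes a strict inequality on to points slightly
    further out.\<close>
  have further: "\<exists>y. norm x < norm y \<and> t < g y" if "t < g x" for x
  proof -
    have "eventually (\<lambda>y. t < g y) (filtercomap norm (at_right (norm x)))" using lim[of x] that by (rule order_tendstoD)
    then obtain P where P: "eventually P (at_right (norm x))" "\<And>y. P (norm y) \<Longrightarrow> t < g y" by (auto simp: eventually_filtercomap)
    obtain b where b: "norm x < b" "\<And>r. norm x < r \<Longrightarrow> r < b \<Longrightarrow> P r" using P(1) by (auto simp: eventually_at_right_field)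
    obtain r where r: "norm x < r" "r < b" using dense[OF b(1)] by blast
    obtain y :: "real ^ 'n" where "norm y = r" using vector_choose_size[of r] r norm_ge_zero[of x] by (metis less_imp_le order_trans)
    then show ?thesis using P(2) b(2) r by blast
  qed
  have op: "open {x. t < g x}"
  proof (rule openI)
    fix x assume "x \<in> {x. t < g x}"
    then obtain y where y: "norm x < norm y" "t < g y" using further by blast
    have "ball x (norm y - norm x) \<subseteq> {x. t < g x}"
    proof
      fix w assume "w \<in> ball x (norm y - norm x)"
      then have "norm w \<le> norm y" using norm_triangle_sub[of w x] by (simp add: dist_norm norm_minus_commute)
      then show "w \<in> {x. t < g x}" using dec[of w y] y(2) by (auto intro: less_le_trans)
    qed
    then show "\<exists>e>0. ball x e \<subseteq> {x. t < g x}" using y by (intro exI[of _ "norm y - norm x"] conjI) simp_all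
  qed
  have [measurable]: "{x. t < g x} \<in> sets borel" using op by simp
  have eq': "emeasure lebesgue {x. t < f x} = emeasure lborel {x. t < g x}" unfolding eq by simp
  show ?thesis unfolding eq'
  proof
    assume "t < g x"
    then obtain y where y: "norm x < norm y" "t < g y" using further by blast
    have "ball 0 (norm y) \<subseteq> {x. t < g x}" using dec[of _ y] y(2) by (auto intro: less_le_trans)
    then have "emeasure lborel (ball (0 :: real ^ 'n) (norm y)) \<le> emeasure lborel {x. t < g x}" by (intro emeasure_mono) auto
    moreover have "emeasure lborel (ball (0 :: real ^ 'n) (norm x)) < emeasure lborel (ball (0 :: real ^ 'n) (norm y))"
      using y(1) by (simp add: emeasure_ball_less_iff)
    ultimately show "emeasure lborel (ball (0 :: real ^ 'n) (norm x)) < emeasure lborel {x. t < g x}" by simp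
  next
    assume *: "emeasure lborel (ball (0 :: real ^ 'n) (norm x)) < emeasure lborel {x. t < g x}"
    show "t < g x"
    proof (rule ccontr)
      assume n: "\<not> t < g x"
      have "{x. t < g x} \<subseteq> ball 0 (norm x)"
      proof
        fix w assume w: "w \<in> {x. t < g x}"
        show "w \<in> ball 0 (norm x)"
        proof (rule ccontr)
          assume "w \<notin> ball 0 (norm x)"
          then have "g w \<le> g x" by (intro dec) auto
          then show False using w n by auto
        qed
      qed
      then have "emeasure lborel {x. t < g x} \<le> emeasure lborel (ball (0 :: real ^ 'n) (norm x))" by (intro emeasure_mono) auto
      then show False using * by simp
    qed
  qed
qed

text \<open>Existence: superlevel sets of \<open>rearr_fun\<close> are open balls or the whole
  space, so a strict lower bound persists on slightly larger norms, and monotonicity gives the upper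
  bound. A Borel version suffices because volumes ignore null sets.\<close>

lemma is_sdr_rearr_fun:
  fixes f f' :: "real ^ 'n \<Rightarrow> ennreal"
  assumes f'[measurable]: "f' \<in> borel_measurable borel" and f: "f \<in> borel_measurable lebesgue" and ae: "AE x in lebesgue. f x = f' x"
  shows "is_symm_decr_rearrangement f (rearr_fun f')"
proof -
  define g where "g = rearr_fun f'"
  have [measurable]: "g \<in> borel_measurable borel" by (simp add: g_def)
  have lev: "level g t = symball (level f' t)" if "0 \<le> t" for t using that by (simp add: g_def level_rearr_fun)
  have lt: "t < g x \<longleftrightarrow> x \<in> symball {x. t < f' x}" for t x
  proof (cases t)
    case (real r)
    then show ?thesis using lev[of r] by (auto simp: level_def)
  qed (simp add: symball_def)
  have dec: "g x \<le> g y" if "norm y \<le> norm x" for x y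
  proof (rule ennreal_le_levels)
    fix t :: real assume "0 \<le> t" "ennreal t < g x"
    then have "x \<in> symball {x. ennreal t < f' x}" by (simp add: lt)
    moreover have "emeasure lborel (ball (0 :: real ^ 'n) (norm y)) \<le> emeasure lborel (ball (0 :: real ^ 'n) (norm x))"
      using that by (intro emeasure_mono subset_ball) auto
    ultimately show "ennreal t < g y" by (auto simp: lt symball_def)
  qed
  show ?thesis
    unfolding is_symm_decr_rearrangement_def g_def[symmetric]
  proof (intro conjI allI impI)
    show "g x = g y" if "norm x = norm y" for x y using dec[of x y] dec[of y x] that by simp
    show "g x \<le> g y" if "norm y \<le> norm x" for x y using dec that by blast
    show "emeasure lebesgue {x. t < f x} = emeasure lebesgue {x. t < g x}" for t
    proof -
      have [measurable]: "{x. t < g x} \<in> sets borel" by measurable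
      have "{x. t < g x} = symball {x. t < f' x}" using lt by blast
      then show ?thesis by (simp add: emeasure_level_AE[OF f' f ae])
    qed
    fix y
    show "(g \<longlongrightarrow> g y) (filtercomap norm (at_right (norm y)))"
    proof (rule order_tendstoI)
      fix a assume "a < g y"
      then have y: "y \<in> symball {x. a < f' x}" by (simp add: lt)
      obtain e where e: "0 < e" "\<And>x. norm x < norm y + e \<Longrightarrow> x \<in> symball {x. a < f' x}"
      proof (cases "emeasure lborel {x. a < f' x} < \<infinity>")
        case True
        then obtain r where r: "symball {x. a < f' x} = ball 0 r" by (rule symball_finite)
        show thesis
        proof (rule that)
          show "0 < r - norm y" using y r by simp
          show "x \<in> symball {x. a < f' x}" if "norm x < norm y + (r - norm y)" for x using that r by simp
        qed
      next
        case False
        then have "symball {x. a < f' x} = UNIV" by (intro symball_infinite) (simp add: less_top[symmetric])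
        then show thesis by (intro that[of 1]) simp_all
      qed
      then have "a < g x" if "norm x < norm y + e" for x using that by (simp add: lt)
      then show "eventually (\<lambda>x. a < g x) (filtercomap norm (at_right (norm y)))"
        unfolding eventually_filtercomap using e(1)
        by (intro exI[of _ "\<lambda>r. norm y < r \<and> r < norm y + e"]) (auto simp: eventually_at_right_field intro!: exI[of _ "norm y + e"])
    next
      fix a assume "g y < a"
      then have "a > g x" if "norm y < norm x" for x using dec[of y x] that by (auto intro: le_less_trans)
      then show "eventually (\<lambda>x. g x < a) (filtercomap norm (at_right (norm y)))"
        unfolding eventually_filtercomap
        by (intro exI[of _ "\<lambda>r. norm y < r"]) (auto simp: eventually_at_right_field intro!: exI[of _ "norm y + 1"])
    qed
  qed
qed

lemma symm_decr_rearrangement_eq: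
  fixes f f' :: "real ^ 'n \<Rightarrow> ennreal"
  assumes "f' \<in> borel_measurable borel" "f \<in> borel_measurable lebesgue" "AE x in lebesgue. f x = f' x"
  shows "symm_decr_rearrangement f = rearr_fun f'"
  unfolding symm_decr_rearrangement_def
proof (rule the_equality)
  show r: "is_symm_decr_rearrangement f (rearr_fun f')" by (rule is_sdr_rearr_fun[OF assms])
  fix g assume g: "is_symm_decr_rearrangement f g"
  have "t < g x \<longleftrightarrow> t < rearr_fun f' x" for t x using is_sdr_iff_level[OF g] is_sdr_iff_level[OF r] by simp
  then show "g = rearr_fun f'" by (intro ext) (meson antisym not_less order.irrefl)
qed

lemma prod_mono_ennreal:
  fixes f g :: "'i \<Rightarrow> ennreal"
  shows "(\<And>i. i \<in> I \<Longrightarrow> f i \<le> g i) \<Longrightarrow> prod f I \<le> prod g I"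
  by (induction I rule: infinite_finite_induct) (auto intro!: mult_mono)

text \<open>Two independent indices are replaced by their maximum, by monotonicity of both
  factors.\<close>

lemma SUP_prod_ennreal:
  fixes F :: "nat \<Rightarrow> 'i \<Rightarrow> ennreal"
  assumes "finite I" "\<And>i. i \<in> I \<Longrightarrow> incseq (\<lambda>n. F n i)"
  shows "(\<Prod>i\<in>I. SUP n. F n i) = (SUP n. \<Prod>i\<in>I. F n i)"
  using assms
proof (induction I rule: finite_induct)
  case (insert j I)
  have inc: "incseq (\<lambda>n. \<Prod>i\<in>I. F n i)" using insert.prems by (auto simp: incseq_def intro!: prod_mono_ennreal)
  have incj: "incseq (\<lambda>n. F n j)" using insert.prems by simp
  have "(SUP n. F n j) * (SUP n. \<Prod>i\<in>I. F n i) = (SUP n. F n j * (\<Prod>i\<in>I. F n i))"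
  proof (rule antisym)
    show "(SUP n. F n j) * (SUP n. \<Prod>i\<in>I. F n i) \<le> (SUP n. F n j * (\<Prod>i\<in>I. F n i))"
      unfolding SUP_mult_left_ennreal unfolding SUP_mult_right_ennreal
    proof (intro SUP_least)
      fix a c
      have "F c j * (\<Prod>i\<in>I. F a i) \<le> F (max a c) j * (\<Prod>i\<in>I. F (max a c) i)"
        using inc incj by (intro mult_mono) (auto simp: incseq_def)
      also have "\<dots> \<le> (SUP n. F n j * (\<Prod>i\<in>I. F n i))" by (rule SUP_upper) simp
      finally show "F c j * (\<Prod>i\<in>I. F a i) \<le> (SUP n. F n j * (\<Prod>i\<in>I. F n i))" .
    qed
  qed (intro SUP_least mult_mono SUP_upper; simp)
  then show ?case using insert by simp
qed simp

subsection \<open>Increments of a Levy process\<close>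

definition increment_law :: "'w measure \<Rightarrow> (real \<Rightarrow> 'w \<Rightarrow> 'a::euclidean_space) \<Rightarrow> (nat \<Rightarrow> real) \<Rightarrow> nat \<Rightarrow> 'a measure" where
  "increment_law M X \<tau> j = distr M borel (\<lambda>\<omega>. X (\<tau> (Suc j)) \<omega> - X (\<tau> j) \<omega>)"

lemma sets_increment_law [simp]: "sets (increment_law M X \<tau> j) = sets borel"
  by (simp add: increment_law_def)

lemma levy_process_measurable:
  "levy_process_with_triple P X b A \<nu> \<Longrightarrow> 0 \<le> s \<Longrightarrow> X s \<in> borel_measurable (P z)"
  by (simp add: levy_process_with_triple_def levy_process_def)

lemma levy_process_prob_space: "levy_process_with_triple P X b A \<nu> \<Longrightarrow> prob_space (P z)"
  by (simp add: levy_process_with_triple_def levy_process_def)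

lemma levy_process_start: "levy_process_with_triple P X b A \<nu> \<Longrightarrow> AE \<omega> in P z. X 0 \<omega> = z"
  by (simp add: levy_process_with_triple_def levy_process_def)

context
  fixes P :: "real ^ 'n \<Rightarrow> 'w measure" and X :: "real \<Rightarrow> 'w \<Rightarrow> real ^ 'n" and b A \<nu>
    and \<tau> :: "nat \<Rightarrow> real"
  assumes X: "levy_process_with_triple P X b A \<nu>"
    and \<tau>: "\<tau> 0 = 0" "\<And>i. \<tau> i \<le> \<tau> (Suc i)"
begin

lemma times_nonneg: "0 \<le> \<tau> i"
  using lift_Suc_mono_le[of \<tau> 0 i] \<tau> by simp

lemma measurable_times [measurable]: "X (\<tau> i) \<in> borel_measurable (P z)"
  by (rule levy_process_measurable[OF X times_nonneg])

lemma prob_space_increment_law: "prob_space (increment_law (P z) X \<tau> j)"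
  unfolding increment_law_def by (intro prob_space.prob_space_distr levy_process_prob_space[OF X]) measurable

text \<open>Stationarity reduces the increment to \<open>X u - X 0\<close>; subtracting the almost
  sure start z cancels the phase in the characteristic function at time u. The law is therefore
  independent of z.\<close>

lemma charf_increment_law:
  "charf (increment_law (P z) X \<tau> j) \<xi> = exp (- complex_of_real (\<tau> (Suc j) - \<tau> j) * levy_exponent b A \<nu> \<xi>)"
proof -
  define u where "u = \<tau> (Suc j) - \<tau> j"
  have u: "0 \<le> u" using \<tau>(2)[of j] by (simp add: u_def)
  have [measurable]: "X u \<in> borel_measurable (P z)" "X 0 \<in> borel_measurable (P z)"
    by (rule levy_process_measurable[OF X], simp add: u)+
  have "distr (P z) borel (\<lambda>\<omega>. X (\<tau> j + u) \<omega> - X (\<tau> j) \<omega>) = distr (P z) borel (\<lambda>\<omega>. X u \<omega> - X 0 \<omega>)"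
    using X u times_nonneg[of j] by (simp add: levy_process_with_triple_def levy_process_def)
  then have "charf (increment_law (P z) X \<tau> j) \<xi> = (LINT x|distr (P z) borel (\<lambda>\<omega>. X u \<omega> - X 0 \<omega>). iexp (\<xi> \<bullet> x))"
    by (simp add: increment_law_def charf_def u_def)
  also have "\<dots> = (LINT \<omega>|P z. iexp (\<xi> \<bullet> (X u \<omega> - X 0 \<omega>)))" by (rule integral_distr) measurable
  also have "\<dots> = (LINT \<omega>|P z. iexp (\<xi> \<bullet> X u \<omega>) * iexp (- (\<xi> \<bullet> z)))"
  proof (rule integral_cong_AE)
    show "AE \<omega> in P z. iexp (\<xi> \<bullet> (X u \<omega> - X 0 \<omega>)) = iexp (\<xi> \<bullet> X u \<omega>) * iexp (- (\<xi> \<bullet> z))"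
      using levy_process_start[OF X, of z] by eventually_elim (simp add: inner_diff_right exp_add[symmetric] algebra_simps)
  qed measurable
  also have "\<dots> = (LINT \<omega>|P z. iexp (\<xi> \<bullet> X u \<omega>)) * iexp (- (\<xi> \<bullet> z))" by simp
  also have "(LINT \<omega>|P z. iexp (\<xi> \<bullet> X u \<omega>)) = exp (- complex_of_real u * levy_exponent b A \<nu> \<xi> + \<i> * complex_of_real (\<xi> \<bullet> z))"
    using X u by (simp add: levy_process_with_triple_def)
  finally show ?thesis by (simp add: exp_add[symmetric] u_def)
qed

text \<open>Positions are z plus partial sums of independent increments, so the joint law of the
  increments is a product measure. The last of the functions serves as the terminal
  function.\<close>

lemma levy_product_eq_chain:
  assumes f: "\<And>i. i \<in> {1..Suc k} \<Longrightarrow> f i \<in> borel_measurable borel"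
  shows "(\<integral>\<^sup>+\<omega>. (\<Prod>i=1..Suc k. f i (X (\<tau> i) \<omega>)) \<partial>P z) = chain (increment_law (P z) X \<tau>) f k (f (Suc k)) z"
proof -
  interpret prob_space "P z" by (rule levy_process_prob_space[OF X])
  let ?D = "\<lambda>j \<omega>. X (\<tau> (Suc j)) \<omega> - X (\<tau> j) \<omega>"
  let ?G = "\<lambda>\<omega>'. (\<Prod>i=1..k. f i (z + (\<Sum>j<i. \<omega>' j))) * f (Suc k) (z + (\<Sum>j<Suc k. \<omega>' j))"
  let ?R = "\<lambda>\<omega>. \<lambda>j\<in>{..<Suc k}. ?D j \<omega>"
  have "indep_vars (\<lambda>_. borel) ?D {..<Suc k}"
    using X \<tau> unfolding levy_process_with_triple_def levy_process_def by simp
  then have eq: "distr (P z) (PiM {..<Suc k} (\<lambda>_. borel)) ?R = PiM {..<Suc k} (increment_law (P z) X \<tau>)"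
    by (subst (asm) indep_vars_iff_distr_eq_PiM') (auto simp: increment_law_def[abs_def] lessThan_empty_iff)
  have comp: "(\<lambda>\<omega>. z + (\<Sum>j<i. \<omega> j)) \<in> borel_measurable (PiM {..<Suc k} (\<lambda>_. borel))" if "i \<le> Suc k" for i
    using that by (intro borel_measurable_add borel_measurable_const borel_measurable_sum) (auto intro!: measurable_component_singleton)
  have G: "?G \<in> borel_measurable (PiM {..<Suc k} (\<lambda>_. borel))"
    by (intro borel_measurable_times_ennreal borel_measurable_prod_ennreal measurable_compose[OF comp f]) auto
  have R: "?R \<in> measurable (P z) (PiM {..<Suc k} (\<lambda>_. borel))" by measurable
  have "(\<integral>\<^sup>+\<omega>. (\<Prod>i=1..Suc k. f i (X (\<tau> i) \<omega>)) \<partial>P z) = (\<integral>\<^sup>+\<omega>. ?G (?R \<omega>) \<partial>P z)"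
  proof (rule nn_integral_cong_AE)
    show "AE \<omega> in P z. (\<Prod>i=1..Suc k. f i (X (\<tau> i) \<omega>)) = ?G (?R \<omega>)"
      using levy_process_start[OF X, of z]
    proof eventually_elim
      case (elim \<omega>)
      have tel: "z + (\<Sum>j<i. ?R \<omega> j) = X (\<tau> i) \<omega>" if "i \<le> Suc k" for i
      proof -
        have "(\<Sum>j<i. ?R \<omega> j) = (\<Sum>j<i. X (\<tau> (Suc j)) \<omega> - X (\<tau> j) \<omega>)" using that by (intro sum.cong) auto
        also have "\<dots> = X (\<tau> i) \<omega> - X (\<tau> 0) \<omega>" by (rule sum_lessThan_telescope)
        finally show ?thesis using elim \<tau> by simp
      qed
      have p: "(\<Prod>i=1..k. f i (z + (\<Sum>j<i. ?R \<omega> j))) = (\<Prod>i=1..k. f i (X (\<tau> i) \<omega>))"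
      proof (rule prod.cong[OF refl])
        fix i assume "i \<in> {1..k}"
        then have "i \<le> Suc k" by simp
        then show "f i (z + (\<Sum>j<i. ?R \<omega> j)) = f i (X (\<tau> i) \<omega>)" by (simp only: tel)
      qed
      have "(\<Prod>i=1..Suc k. f i (X (\<tau> i) \<omega>)) = (\<Prod>i=1..k. f i (X (\<tau> i) \<omega>)) * f (Suc k) (X (\<tau> (Suc k)) \<omega>)" by simp
      then show ?case by (simp only: p tel order_refl)
    qed
  qed
  also have "\<dots> = (\<integral>\<^sup>+\<omega>'. ?G \<omega>' \<partial>distr (P z) (PiM {..<Suc k} (\<lambda>_. borel)) ?R)"
    by (rule nn_integral_distr[OF R, symmetric]) (simp only: measurable_distr_eq1 G)
  also have "\<dots> = chain (increment_law (P z) X \<tau>) f k (f (Suc k)) z"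
    unfolding eq using f by (intro chain_PiM prob_space_increment_law) auto
  finally show ?thesis .
qed

end

context
  fixes P :: "real ^ 'n \<Rightarrow> 'w measure" and X :: "real \<Rightarrow> 'w \<Rightarrow> real ^ 'n" and b A \<nu>
    and Q :: "real ^ 'n \<Rightarrow> 'v measure" and Y :: "real \<Rightarrow> 'v \<Rightarrow> real ^ 'n" and \<nu>' \<phi> \<psi>
    and t :: "nat \<Rightarrow> real" and m :: nat
  assumes X: "levy_process_with_triple P X b A \<nu>"
    and Y: "levy_process_with_triple Q Y 0 (symm_matrix A) \<nu>'"
    and \<nu>: "\<nu> = density lborel \<phi>" "\<nu>' = density lborel \<psi>" and \<phi>: "is_rearr \<phi> \<psi>"
    and acY: "\<And>s. 0 < s \<Longrightarrow> absolutely_continuous lborel (distr (Q 0) borel (Y s))"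
    and m: "1 \<le> m" and t: "0 < t 1" "\<And>i. i \<in> {1..<m} \<Longrightarrow> t i \<le> t (Suc i)"
begin

lemma levy_product_le_bounded:
  assumes f: "\<And>i. i \<in> {1..m} \<Longrightarrow> is_rearr (f i) (g i)"
    and bd: "\<And>i x. i \<in> {1..m} \<Longrightarrow> f i x \<le> ennreal c" "0 \<le> c" and fin: "(\<integral>\<^sup>+x. f m x \<partial>lborel) < \<top>"
  shows "(\<integral>\<^sup>+\<omega>. (\<Prod>i=1..m. f i (X (t i) \<omega>)) \<partial>P z) \<le> (\<integral>\<^sup>+\<omega>. (\<Prod>i=1..m. g i (Y (t i) \<omega>)) \<partial>Q 0)"
proof -
  obtain k where k: "m = Suc k" using m by (cases m) auto
  \<comment> \<open>The lemmas on increments ask for a monotone sequence of times over all indices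
    that starts at 0. Time 0 is put in front and the last time is repeated for ever, which adds only
    increments of length zero.\<close>
  define \<tau> where "\<tau> i = (if i = 0 then 0 else t (min i m))" for i
  have \<tau>: "\<tau> 0 = 0" "\<tau> i \<le> \<tau> (Suc i)" for i
  proof -
    show "\<tau> 0 = 0" by (simp add: \<tau>_def)
    have "0 \<le> t (min 1 m)" using t(1) m by (simp add: min_def)
    moreover have "t i \<le> t (Suc i)" if "i \<noteq> 0" "i < m" using t(2)[of i] that by simp
    ultimately show "\<tau> i \<le> \<tau> (Suc i)" using m by (cases "i < m") (auto simp: \<tau>_def min_def)
  qed
  have \<tau>t: "\<tau> i = t i" if "i \<in> {1..m}" for i using that by (auto simp: \<tau>_def min_def)
  define L where "L = increment_law (P z) X \<tau>"
  define L' where "L' = increment_law (Q 0) Y \<tau>"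
  have dL: "law_dominated (L j) (L' j)" for j
    unfolding L_def L'_def
  proof (rule law_dominated_levy[OF _ _ \<nu> \<phi>])
    show "levy_triple b A \<nu>" "levy_triple 0 (symm_matrix A) \<nu>'" using X Y by (auto simp: levy_process_with_triple_def)
    show "0 \<le> \<tau> (Suc j) - \<tau> j" using \<tau>(2)[of j] by simp
  qed (simp_all add: prob_space_increment_law[OF X \<tau>] prob_space_increment_law[OF Y \<tau>] charf_increment_law[OF X \<tau>] charf_increment_law[OF Y \<tau>])
  \<comment> \<open>Only the first increment has to have a density, and it does because
    \<open>t 1\<close> is positive. Later times may coincide, where the increment is a point
    mass.\<close>
  have "L' 0 = distr (Q 0) borel (Y (t 1))"
    unfolding L'_def increment_law_def
  proof (rule distr_cong_AE[OF refl refl])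
    have [simp]: "\<tau> (Suc 0) = t 1" using \<tau>t[of 1] m by simp
    show "AE \<omega> in Q 0. Y (\<tau> (Suc 0)) \<omega> - Y (\<tau> 0) \<omega> = Y (t 1) \<omega>"
      using levy_process_start[OF Y, of 0] by eventually_elim (simp add: \<tau>)
    show "(\<lambda>\<omega>. Y (\<tau> (Suc 0)) \<omega> - Y (\<tau> 0) \<omega>) \<in> borel_measurable (Q 0)"
      using measurable_times[OF Y \<tau>, of _ 0] by (intro borel_measurable_diff)
    show "Y (t 1) \<in> borel_measurable (Q 0)" using t(1) by (intro levy_process_measurable[OF Y]) simp
  qed
  then have ac: "absolutely_continuous lborel (L' 0)" using acY[OF t(1)] by simp
  have fb: "f i \<in> borel_measurable borel" "g i \<in> borel_measurable borel" if "i \<in> {1..m}" for i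
    using f[OF that] by (auto simp: is_rearr_def)
  have "(\<integral>\<^sup>+\<omega>. (\<Prod>i=1..m. f i (X (t i) \<omega>)) \<partial>P z) = (\<integral>\<^sup>+\<omega>. (\<Prod>i=1..Suc k. f i (X (\<tau> i) \<omega>)) \<partial>P z)"
    unfolding k[symmetric] by (intro nn_integral_cong prod.cong refl) (simp add: \<tau>t)
  also have "\<dots> = chain L f k (f m) z"
    unfolding L_def k by (rule levy_product_eq_chain[OF X \<tau>]) (simp add: fb k)
  also have "\<dots> \<le> chain L' g k (g m) 0"
  proof (rule chain_le)
    show "law_dominated (L j) (L' j)" for j by (rule dL)
    show "absolutely_continuous lborel (L' 0)" "0 \<le> c" by (rule ac bd)+
    show "is_rearr (f i) (g i)" if "i \<in> {1..k}" for i using that k by (intro f) simp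
    show "f i x \<le> ennreal c" if "i \<in> {1..k}" for i x using that k by (intro bd) simp
    show "dominated (f m) (g m)" using m by (intro dominated_rearr f fin) simp
  qed
  also have "\<dots> = (\<integral>\<^sup>+\<omega>. (\<Prod>i=1..Suc k. g i (Y (\<tau> i) \<omega>)) \<partial>Q 0)"
    unfolding L'_def k by (rule levy_product_eq_chain[OF Y \<tau>, symmetric]) (simp add: fb k)
  also have "\<dots> = (\<integral>\<^sup>+\<omega>. (\<Prod>i=1..m. g i (Y (t i) \<omega>)) \<partial>Q 0)"
    unfolding k[symmetric] by (intro nn_integral_cong prod.cong refl) (simp add: \<tau>t)
  finally show ?thesis .
qed

text \<open>Truncation in height and in space gives the bounded and integrable functions needed for
  domination. Rearrangement is monotone, so the right side need not be followed through the
  limit.\<close>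

lemma levy_product_le:
  assumes f: "\<And>i. i \<in> {1..m} \<Longrightarrow> is_rearr (f i) (g i)"
  shows "(\<integral>\<^sup>+\<omega>. (\<Prod>i=1..m. f i (X (t i) \<omega>)) \<partial>P z) \<le> (\<integral>\<^sup>+\<omega>. (\<Prod>i=1..m. g i (Y (t i) \<omega>)) \<partial>Q 0)"
proof -
  define F where "F n i x = min (f i x) (of_nat n) * indicator (ball 0 (real n)) x" for n :: nat and i and x :: "real ^ 'n"
  have fb: "f i \<in> borel_measurable borel" if "i \<in> {1..m}" for i using f[OF that] by (auto simp: is_rearr_def)
  have Fb: "F n i \<in> borel_measurable borel" if "i \<in> {1..m}" for i n
  proof -
    have [measurable]: "f i \<in> borel_measurable borel" by (rule fb[OF that])
    show ?thesis unfolding F_def by measurable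
  qed
  have tn: "0 \<le> t i" if "i \<in> {1..m}" for i
  proof -
    have "i \<le> m \<Longrightarrow> 0 < t i" if "1 \<le> i" using that
    proof (induction i rule: dec_induct)
      case (step i)
      then show ?case using t(2)[of i] by simp
    qed (use t in simp)
    then show ?thesis using that by simp
  qed
  have le: "(\<integral>\<^sup>+\<omega>. (\<Prod>i=1..m. F n i (X (t i) \<omega>)) \<partial>P z) \<le> (\<integral>\<^sup>+\<omega>. (\<Prod>i=1..m. g i (Y (t i) \<omega>)) \<partial>Q 0)" for n
  proof -
    have "(\<integral>\<^sup>+\<omega>. (\<Prod>i=1..m. F n i (X (t i) \<omega>)) \<partial>P z) \<le> (\<integral>\<^sup>+\<omega>. (\<Prod>i=1..m. rearr_fun (F n i) (Y (t i) \<omega>)) \<partial>Q 0)"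
    proof (rule levy_product_le_bounded)
      show "is_rearr (F n i) (rearr_fun (F n i))" if "i \<in> {1..m}" for i by (rule is_rearr_rearr_fun[OF Fb[OF that]])
      show "F n i x \<le> ennreal (real n)" for i x by (auto simp: F_def indicator_def ennreal_of_nat_eq_real_of_nat)
      have "(\<integral>\<^sup>+x. F n m x \<partial>lborel) \<le> (\<integral>\<^sup>+x. of_nat n * indicator (ball 0 (real n)) x \<partial>(lborel :: (real ^ 'n) measure))"
        by (rule nn_integral_mono) (auto simp: F_def indicator_def)
      also have "\<dots> = of_nat n * emeasure lborel (ball (0 :: real ^ 'n) (real n))" by (simp add: nn_integral_cmult)
      also have "\<dots> < \<top>" using emeasure_lborel_ball_finite[of "0 :: real ^ 'n" "real n"] by (simp add: ennreal_mult_less_top of_nat_less_top)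
      finally show "(\<integral>\<^sup>+x. F n m x \<partial>lborel) < \<top>" .
    qed simp
    also have "\<dots> \<le> (\<integral>\<^sup>+\<omega>. (\<Prod>i=1..m. g i (Y (t i) \<omega>)) \<partial>Q 0)"
    proof (intro nn_integral_mono prod_mono_ennreal)
      fix i \<omega> assume i: "i \<in> {1..m}"
      show "rearr_fun (F n i) (Y (t i) \<omega>) \<le> g i (Y (t i) \<omega>)"
        by (rule is_rearr_mono[OF is_rearr_rearr_fun[OF Fb[OF i]] f[OF i]]) (auto simp: F_def indicator_def)
    qed
    finally show ?thesis .
  qed
  have incF: "F n i x \<le> F n' i x" if "n \<le> n'" for n n' i x
    unfolding F_def by (intro mult_mono min.mono) (use that in \<open>auto simp: indicator_def\<close>)
  have SUPF: "(SUP n. F n i x) = f i x" for i x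
  proof (rule LIMSEQ_unique[OF LIMSEQ_SUP])
    show "incseq (\<lambda>n. F n i x)" using incF by (simp add: incseq_def)
    obtain N where N: "norm x < real N" using reals_Archimedean2 by blast
    have "(\<lambda>n. min (f i x) (of_nat n)) \<longlonglongrightarrow> min (f i x) \<top>"
      by (intro tendsto_min tendsto_const of_nat_tendsto_top_ennreal)
    moreover have "eventually (\<lambda>n. min (f i x) (of_nat n) = F n i x) sequentially"
      using eventually_ge_at_top[of N] by eventually_elim (use N in \<open>auto simp: F_def indicator_def\<close>)
    ultimately show "(\<lambda>n. F n i x) \<longlonglongrightarrow> f i x" by (simp add: tendsto_cong)
  qed
  have "(\<integral>\<^sup>+\<omega>. (\<Prod>i=1..m. f i (X (t i) \<omega>)) \<partial>P z) = (\<integral>\<^sup>+\<omega>. (SUP n. \<Prod>i=1..m. F n i (X (t i) \<omega>)) \<partial>P z)"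
  proof (rule nn_integral_cong)
    fix \<omega>
    have "(\<Prod>i=1..m. f i (X (t i) \<omega>)) = (\<Prod>i=1..m. SUP n. F n i (X (t i) \<omega>))" by (simp add: SUPF)
    also have "\<dots> = (SUP n. \<Prod>i=1..m. F n i (X (t i) \<omega>))" by (rule SUP_prod_ennreal) (simp_all add: incseq_def incF)
    finally show "(\<Prod>i=1..m. f i (X (t i) \<omega>)) = (SUP n. \<Prod>i=1..m. F n i (X (t i) \<omega>))" .
  qed
  also have "\<dots> = (SUP n. \<integral>\<^sup>+\<omega>. (\<Prod>i=1..m. F n i (X (t i) \<omega>)) \<partial>P z)"
  proof (rule nn_integral_monotone_convergence_SUP)
    show "incseq (\<lambda>n \<omega>. \<Prod>i=1..m. F n i (X (t i) \<omega>))"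
      by (intro monoI le_funI prod_mono_ennreal incF)
    show "(\<lambda>\<omega>. \<Prod>i=1..m. F n i (X (t i) \<omega>)) \<in> borel_measurable (P z)" for n
      by (intro borel_measurable_prod_ennreal measurable_compose[OF levy_process_measurable[OF X] Fb] tn) auto
  qed
  also have "\<dots> \<le> (\<integral>\<^sup>+\<omega>. (\<Prod>i=1..m. g i (Y (t i) \<omega>)) \<partial>Q 0)" by (intro SUP_least le)
  finally show ?thesis .
qed

end

text \<open>At positive times the law is absolutely continuous, and f may be exchanged for a Borel
  version. At time 0 the process sits at one point, so the original values \<open>f i z\<close> have
  to stay.\<close>

lemma levy_product_split:
  assumes X: "levy_process_with_triple P X b A \<nu>" and ac: "\<And>s. 0 < s \<Longrightarrow> absolutely_continuous lborel (distr (P z) borel (X s))"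
    and k: "k \<le> m" "\<And>i. i \<in> {1..k} \<Longrightarrow> t i = 0" "\<And>i. i \<in> {Suc k..m} \<Longrightarrow> 0 < t i"
    and f': "\<And>i. i \<in> {1..m} \<Longrightarrow> f' i \<in> borel_measurable borel" "\<And>i. i \<in> {1..m} \<Longrightarrow> AE x in lborel. f i x = f' i x"
  shows "(\<integral>\<^sup>+\<omega>. (\<Prod>i=1..m. f i (X (t i) \<omega>)) \<partial>P z)
    = (\<Prod>i=1..k. f i z) * (\<integral>\<^sup>+\<omega>. (\<Prod>i=1..m-k. f' (i + k) (X (t (i + k)) \<omega>)) \<partial>P z)"
proof -
  have Xm: "X (t i) \<in> borel_measurable (P z)" if "i \<in> {Suc k..m}" for i
    using k(3)[OF that] by (intro levy_process_measurable[OF X]) simp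
  have "AE \<omega> in P z. \<forall>i\<in>{Suc k..m}. f i (X (t i) \<omega>) = f' i (X (t i) \<omega>)"
  proof (rule AE_finite_allI)
    fix i assume i: "i \<in> {Suc k..m}"
    then have "AE x in lborel. f i x = f' i x" by (intro f') simp
    then have "AE x in distr (P z) borel (X (t i)). f i x = f' i x"
      by (rule absolutely_continuous_AE[rotated 2]) (simp_all add: ac k(3)[OF i])
    then show "AE \<omega> in P z. f i (X (t i) \<omega>) = f' i (X (t i) \<omega>)" by (rule AE_distrD[OF Xm[OF i]])
  qed simp
  with levy_process_start[OF X, of z]
  have "AE \<omega> in P z. (\<Prod>i=1..m. f i (X (t i) \<omega>)) = (\<Prod>i=1..k. f i z) * (\<Prod>i=1..m-k. f' (i + k) (X (t (i + k)) \<omega>))"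
  proof eventually_elim
    case (elim \<omega>)
    have "(\<Prod>i=1..m. f i (X (t i) \<omega>)) = (\<Prod>i=1..k. f i (X (t i) \<omega>)) * (\<Prod>i=k+1..m. f i (X (t i) \<omega>))"
      using prod.ub_add_nat[of 1 k "\<lambda>i. f i (X (t i) \<omega>)" "m - k"] k(1) by simp
    also have "(\<Prod>i=1..k. f i (X (t i) \<omega>)) = (\<Prod>i=1..k. f i z)"
      by (rule prod.cong) (simp_all add: k(2) elim(1))
    also have "(\<Prod>i=k+1..m. f i (X (t i) \<omega>)) = (\<Prod>i=1+k..(m-k)+k. f' i (X (t i) \<omega>))"
      by (rule prod.cong) (use k(1) elim(2) in auto)
    also have "\<dots> = (\<Prod>i=1..m-k. f' (i + k) (X (t (i + k)) \<omega>))" by (rule prod.shift_bounds_cl_nat_ivl)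
    finally show ?case .
  qed
  then have "(\<integral>\<^sup>+\<omega>. (\<Prod>i=1..m. f i (X (t i) \<omega>)) \<partial>P z)
    = (\<integral>\<^sup>+\<omega>. (\<Prod>i=1..k. f i z) * (\<Prod>i=1..m-k. f' (i + k) (X (t (i + k)) \<omega>)) \<partial>P z)"
    by (rule nn_integral_cong_AE)
  also have "\<dots> = (\<Prod>i=1..k. f i z) * (\<integral>\<^sup>+\<omega>. (\<Prod>i=1..m-k. f' (i + k) (X (t (i + k)) \<omega>)) \<partial>P z)"
    by (intro nn_integral_cmult borel_measurable_prod_ennreal measurable_compose[OF Xm f'(1)]) auto
  finally show ?thesis .
qed

text \<open>The times are nonnegative and nondecreasing, so the zeros come first; k counts them, and
  k = 0 when there are none.\<close>

lemma zero_times_initial: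
  fixes t :: "nat \<Rightarrow> real"
  assumes "0 \<le> t 1" "\<And>i. i \<in> {1..<m} \<Longrightarrow> t i \<le> t (Suc i)"
  obtains k where "k \<le> m" "\<And>i. i \<in> {1..k} \<Longrightarrow> t i = 0" "\<And>i. i \<in> {Suc k..m} \<Longrightarrow> 0 < t i"
proof -
  have mono: "t i \<le> t j" if "1 \<le> i" "i \<le> j" "j \<le> m" for i j
    using that(2,1,3)
  proof (induction j rule: dec_induct)
    case (step j)
    then show ?case using assms(2)[of j] by simp
  qed simp
  define S where "S = {i \<in> {1..m}. t i = 0}"
  define k where "k = Max (insert 0 S)"
  have S: "finite S" by (simp add: S_def)
  have "k \<in> insert 0 S" unfolding k_def by (rule Max_in) (simp_all add: S)
  have ge: "i \<le> k" if "i \<in> S" for i unfolding k_def using that S by (intro Max_ge) auto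
  have nn: "0 \<le> t i" if "i \<in> {1..m}" for i using mono[of 1 i] assms(1) that by simp
  show ?thesis
  proof (rule that)
    show "k \<le> m" using \<open>k \<in> insert 0 S\<close> by (auto simp: S_def)
    show "t i = 0" if "i \<in> {1..k}" for i
      using \<open>k \<in> insert 0 S\<close> that mono[of i k] nn[of i] by (auto simp: S_def)
    show "0 < t i" if "i \<in> {Suc k..m}" for i
      using ge[of i] nn[of i] that by (fastforce simp: S_def)
  qed
qed

text \<open>At time 0 the left side contains the value \<open>f i z\<close>, which can be altered
  without changing the rearrangement, and the right side contains the rearrangement at 0, the
  essential supremum. The first part therefore compares these values at the zero times, a condition
  that is empty when all times are positive; the second part records that it holds for almost every
  start.\<close>

theorem theorem1p2:
  fixes P :: "real ^ 'n \<Rightarrow> 'w measure" and X :: "real \<Rightarrow> 'w \<Rightarrow> real ^ 'n"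
    and Q :: "real ^ 'n \<Rightarrow> 'v measure" and Y :: "real \<Rightarrow> 'v \<Rightarrow> real ^ 'n"
    and b :: "real ^ 'n" and A :: "real ^ 'n ^ 'n" and \<nu> :: "(real ^ 'n) measure"
    and p p_star :: "real \<Rightarrow> real ^ 'n \<Rightarrow> real ^ 'n \<Rightarrow> ennreal"
    and f :: "nat \<Rightarrow> real ^ 'n \<Rightarrow> ennreal" and t :: "nat \<Rightarrow> real" and m :: nat
  assumes "levy_process_with_triple P X b A \<nu>"
    and "absolutely_continuous lborel \<nu>"
    and "is_symmetrization Q Y A \<nu>"
    and "\<And>s x. 0 < s \<Longrightarrow> distributed (P x) lborel (X s) (p s x)"
    and "\<And>s x. 0 < s \<Longrightarrow> distributed (Q x) lborel (Y s) (p_star s x)"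
    and "1 \<le> m"
    and "\<And>i. i \<in> {1..m} \<Longrightarrow> f i \<in> borel_measurable lebesgue"
    and "0 \<le> t 1"
    and "\<And>i. i \<in> {1..<m} \<Longrightarrow> t i \<le> t (Suc i)"
  shows "(\<forall>z. (\<forall>i\<in>{1..m}. t i = 0 \<longrightarrow> f i z \<le> symm_decr_rearrangement (f i) 0) \<longrightarrow>
            (\<integral>\<^sup>+ \<omega>. (\<Prod>i=1..m. f i (X (t i) \<omega>)) \<partial>P z)
              \<le> (\<integral>\<^sup>+ \<omega>. (\<Prod>i=1..m. symm_decr_rearrangement (f i) (Y (t i) \<omega>)) \<partial>Q 0)) \<and>
         (AE z in lebesgue.
            (\<integral>\<^sup>+ \<omega>. (\<Prod>i=1..m. f i (X (t i) \<omega>)) \<partial>P z)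
              \<le> (\<integral>\<^sup>+ \<omega>. (\<Prod>i=1..m. symm_decr_rearrangement (f i) (Y (t i) \<omega>)) \<partial>Q 0))"
proof -
  note X = assms(1)
  have Y: "levy_process_with_triple Q Y 0 (symm_matrix A) (symm_levy_measure \<nu>)" using assms(3) by (simp add: is_symmetrization_def)
  define \<phi> where "\<phi> = RN_deriv lborel \<nu>"
  have \<phi>m: "\<phi> \<in> borel_measurable borel" by (simp add: \<phi>_def)
  have "sets \<nu> = sets borel" using X by (simp add: levy_process_with_triple_def levy_triple_def)
  then have \<nu>: "\<nu> = density lborel \<phi>"
    unfolding \<phi>_def by (intro sigma_finite_measure.density_RN_deriv[OF sigma_finite_lborel, symmetric] assms(2)) simp
  have "symm_decr_rearrangement \<phi> = rearr_fun \<phi>"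
    by (rule symm_decr_rearrangement_eq[OF \<phi>m]) (simp_all add: measurable_completion \<phi>m)
  then have \<nu>': "symm_levy_measure \<nu> = density lborel (rearr_fun \<phi>)" by (simp add: symm_levy_measure_def \<phi>_def)
  have ac: "absolutely_continuous lborel (distr M borel Z)" if "distributed M lborel Z q" for M q and Z :: "_ \<Rightarrow> real ^ 'n"
  proof -
    have "distr M borel Z = distr M lborel Z" by (rule distr_cong) simp_all
    then show ?thesis using that by (simp add: distributed_def absolutely_continuousI_density)
  qed
  have "\<exists>f'. f' \<in> borel_measurable borel \<and> (AE x in lborel. f i x = f' x)" if "i \<in> {1..m}" for i
    using completion_ex_borel_measurable[OF assms(7)[OF that]] by auto
  then obtain f' where f': "\<And>i. i \<in> {1..m} \<Longrightarrow> f' i \<in> borel_measurable borel" "\<And>i. i \<in> {1..m} \<Longrightarrow> AE x in lborel. f i x = f' i x"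
    by metis
  let ?g = "\<lambda>i. symm_decr_rearrangement (f i)"
  have g: "?g i = rearr_fun (f' i)" "is_symm_decr_rearrangement (f i) (?g i)" if "i \<in> {1..m}" for i
    using symm_decr_rearrangement_eq[OF f'(1)[OF that] assms(7)[OF that] AE_completion[OF f'(2)[OF that]]]
      is_sdr_rearr_fun[OF f'(1)[OF that] assms(7)[OF that] AE_completion[OF f'(2)[OF that]]] by simp_all
  have gm: "?g i \<in> borel_measurable borel" if "i \<in> {1..m}" for i
    unfolding g(1)[OF that] by (rule rearr_fun_measurable[OF f'(1)[OF that]])
  obtain k where k: "k \<le> m" "\<And>i. i \<in> {1..k} \<Longrightarrow> t i = 0" "\<And>i. i \<in> {Suc k..m} \<Longrightarrow> 0 < t i"
    by (rule zero_times_initial[OF assms(8,9)]) (assumption | rule that)+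
  have main: "(\<integral>\<^sup>+\<omega>. (\<Prod>i=1..m. f i (X (t i) \<omega>)) \<partial>P z) \<le> (\<integral>\<^sup>+\<omega>. (\<Prod>i=1..m. ?g i (Y (t i) \<omega>)) \<partial>Q 0)"
    if start: "\<forall>i\<in>{1..m}. t i = 0 \<longrightarrow> f i z \<le> ?g i 0" for z
  proof -
    \<comment> \<open>The positive times, renumbered from 1. If there are none, both integrands are
      empty products and both integrals equal 1.\<close>
    have later: "(\<integral>\<^sup>+\<omega>. (\<Prod>i=1..m-k. f' (i + k) (X (t (i + k)) \<omega>)) \<partial>P z)
        \<le> (\<integral>\<^sup>+\<omega>. (\<Prod>i=1..m-k. ?g (i + k) (Y (t (i + k)) \<omega>)) \<partial>Q 0)"
    proof (cases "k = m")
      case True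
      then show ?thesis
        using prob_space.emeasure_space_1[OF levy_process_prob_space[OF X, of z]] prob_space.emeasure_space_1[OF levy_process_prob_space[OF Y, of 0]]
        by simp
    next
      case False
      show ?thesis
      proof (rule levy_product_le[OF X Y \<nu> \<nu>' is_rearr_rearr_fun[OF \<phi>m] ac[OF assms(5)], where t = "\<lambda>i. t (i + k)"])
        show "1 \<le> m - k" "0 < t (1 + k)" using False k(1) by (auto intro!: k(3))
        show "t (i + k) \<le> t (Suc i + k)" if "i \<in> {1..<m - k}" for i using assms(9)[of "i + k"] that by (simp add: less_diff_conv)
        show "is_rearr (f' (i + k)) (?g (i + k))" if "i \<in> {1..m - k}" for i
          using that k(1) by (subst g) (auto intro!: is_rearr_rearr_fun f')
      qed
    qed
    have "(\<integral>\<^sup>+\<omega>. (\<Prod>i=1..m. f i (X (t i) \<omega>)) \<partial>P z)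
      = (\<Prod>i=1..k. f i z) * (\<integral>\<^sup>+\<omega>. (\<Prod>i=1..m-k. f' (i + k) (X (t (i + k)) \<omega>)) \<partial>P z)"
      by (rule levy_product_split[OF X ac[OF assms(4)] k f'])
    also have "\<dots> \<le> (\<Prod>i=1..k. ?g i 0) * (\<integral>\<^sup>+\<omega>. (\<Prod>i=1..m-k. ?g (i + k) (Y (t (i + k)) \<omega>)) \<partial>Q 0)"
      using start k(1,2) by (intro mult_mono prod_mono_ennreal later) auto
    also have "\<dots> = (\<integral>\<^sup>+\<omega>. (\<Prod>i=1..m. ?g i (Y (t i) \<omega>)) \<partial>Q 0)"
      by (rule levy_product_split[OF Y ac[OF assms(5)] k gm, symmetric]) simp_all
    finally show ?thesis .
  qed
  have "AE z in lebesgue. \<forall>i\<in>{1..m}. f i z \<le> ?g i 0"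
  proof (rule AE_finite_allI)
    fix i assume i: "i \<in> {1..m}"
    note G = g(2)[OF i, unfolded is_symm_decr_rearrangement_def]
    have dec: "?g i x \<le> ?g i 0" for x
      using G[THEN conjunct2, THEN conjunct1, THEN spec, THEN spec, of 0 x] by simp
    \<comment> \<open>Equimeasurability at the height \<open>?g i 0\<close>: the rearrangement never
      exceeds its value at the origin, so \<open>f i\<close> does so only on a null set.\<close>
    have "emeasure lebesgue {x. ?g i 0 < f i x} = emeasure lebesgue {x. ?g i 0 < ?g i x}"
      by (rule G[THEN conjunct2, THEN conjunct2, THEN conjunct2, THEN spec])
    also have "{x. ?g i 0 < ?g i x} = {}" using dec by (auto simp: not_less)
    finally have z: "emeasure lebesgue {x. ?g i 0 < f i x} = 0" by simp
    moreover have "{x. ?g i 0 < f i x} \<in> sets lebesgue"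
      using measurable_sets[OF assms(7)[OF i] borel_open[OF open_greaterThan[of "?g i 0"]]] by (simp add: vimage_def)
    ultimately have "{x. ?g i 0 < f i x} \<in> null_sets lebesgue" by (simp add: null_sets_def)
    then show "AE z in lebesgue. f i z \<le> ?g i 0" by (rule AE_I') (auto simp: not_le)
  qed simp
  then have "AE z in lebesgue. (\<integral>\<^sup>+\<omega>. (\<Prod>i=1..m. f i (X (t i) \<omega>)) \<partial>P z) \<le> (\<integral>\<^sup>+\<omega>. (\<Prod>i=1..m. ?g i (Y (t i) \<omega>)) \<partial>Q 0)"
    by eventually_elim (rule main, simp)
  moreover have "\<forall>z. (\<forall>i\<in>{1..m}. t i = 0 \<longrightarrow> f i z \<le> ?g i 0) \<longrightarrow>
      (\<integral>\<^sup>+\<omega>. (\<Prod>i=1..m. f i (X (t i) \<omega>)) \<partial>P z) \<le> (\<integral>\<^sup>+\<omega>. (\<Prod>i=1..m. ?g i (Y (t i) \<omega>)) \<partial>Q 0)"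
    by (intro allI impI main)
  ultimately show ?thesis by (intro conjI)
qed

end
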